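(* Let $0<\beta_*<1/3$, and let $(T_n)_{n\ge 1}$, $T_n=T_{\alpha_n}$, be an admissible sequence of intermittent maps, i.e. $0\le\alpha_n\le\beta_*$ for all $n\ge1$. Let $\mu$ be a Borel probability measure on $[0,1]$ whose density (with respect to Lebesgue measure) belongs to $\mathcal{C}_*(\beta_* )$, let $d\ge 1$ and let $f:[0,1]\to\mathbb{R}^d$ be Lipschitz continuous. Let $h:\mathbb{R}^d\to\mathbb{R}$ be any three times differentiable function with $\max_{k=1,2,3}\|D^kh\|_\infty<\infty$. Then there is a constant $C>0$, independent of $N$, such that for every integer $N\ge2$ for which $\Sigma_N$ is positive definite, $$|\mu(h(W))-\Phi_{\Sigma_N}(h)|\le C N^{\beta_*-\frac12}(\log N)^{\frac1{\beta_*}},$$ where $W=W(N)$.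
   Context: For $\alpha\in[0,1)$, $T_\alpha:[0,1]\to[0,1]$ is defined by $T_\alpha(x)=x(1+2^\alpha x^\alpha)$ for $x\in[0,1/2)$ and $T_\alpha(x)=2x-1$ for $x\in[1/2,1]$ (for $\alpha=0$ this is the angle-doubling map). Let $m$ be Lebesgue measure on $[0,1]$. For $\alpha\in(0,1)$, $$\mathcal{C}_*(\alpha)=\{g\in C((0,1])\cap L^1(m): g\ge0,\ g\text{ decreasing},\ x^{\alpha+1}g\text{ increasing},\ g(x)\le 2^\alpha(2+\alpha)x^{-\alpha}m(g)\}$$ (monotonicity non-strict, $m(g)=\int g\,dm$). Write $\mu(g)=\int g\,d\mu$, $\widetilde T_n=T_n\circ\cdots\circ T_1$, $\widetilde T_0=\mathrm{id}$, and $$W=W(N)=\frac1{\sqrt N}\sum_{i=0}^{N-1}\bigl(f\circ\widetilde T_i-\mu(f\circ\widetilde T_i)\bigr),\qquad \Sigma_N=\mu(W\otimes W),$$ where $(v\otimes w)_{\alpha\beta}=v_\alpha w_\beta$. $\Phi_{\Sigma}(h)$ denotes the expectation of $h$ with respect to the centered normal distribution $\mathcal{N}(0,\Sigma)$ on $\mathbb{R}^d$. $\|D^kh\|_\infty$ is the maximum of the sup-norms of all partial derivatives of $h$ of order $k$. *)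

theory Defs
  imports "HOL-Probability.Probability"
begin

section \<open>Intermittent maps and their compositions\<close>

text \<open>The maps are total functions on the reals; only their values on the invariant
  interval [0,1] matter. For \<open>\<alpha> = 0\<close> and \<open>x = 0\<close> the convention \<open>0 powr 0 = 0\<close> is harmless
  because of the factor \<open>x\<close>.\<close>

definition intermittent_map :: "real \<Rightarrow> real \<Rightarrow> real" where
  "intermittent_map \<alpha> x =
     (if x < 1/2 then x * (1 + 2 powr \<alpha> * x powr \<alpha>) else 2 * x - 1)"

text \<open>The value \<open>\<alpha> 0\<close> is never used: the sequence of maps is indexed from 1.\<close>

definition admissible :: "real \<Rightarrow> (nat \<Rightarrow> real) \<Rightarrow> bool" where
  "admissible \<beta> \<alpha> \<longleftrightarrow> (\<forall>n\<ge>1. 0 \<le> \<alpha> n \<and> \<alpha> n \<le> \<beta>)"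

primrec composed_map :: "(nat \<Rightarrow> real) \<Rightarrow> nat \<Rightarrow> real \<Rightarrow> real" where
  "composed_map \<alpha> 0 = id"
| "composed_map \<alpha> (Suc n) = intermittent_map (\<alpha> (Suc n)) \<circ> composed_map \<alpha> n"


section \<open>The cone of densities\<close>

definition leb01 :: "real measure" where
  "leb01 = restrict_space lborel {0..1}"

text \<open>The value of \<open>g\<close> at 0 is arbitrary; it does not affect any integral.\<close>

definition C_star :: "real \<Rightarrow> (real \<Rightarrow> real) set" where
  "C_star \<alpha> = {g. continuous_on {0<..1} g \<and> integrable leb01 g
      \<and> (\<forall>x\<in>{0<..1}. 0 \<le> g x)
      \<and> antimono_on {0<..1} g
      \<and> mono_on {0<..1} (\<lambda>x. x powr (\<alpha> + 1) * g x)
      \<and> (\<forall>x\<in>{0<..1}. g x \<le> 2 powr \<alpha> * (2 + \<alpha>) * x powr (-\<alpha>) * (LINT y|leb01. g y))}"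


section \<open>Normalized centered Birkhoff sums and their covariance\<close>

definition W_sum ::
  "(nat \<Rightarrow> real) \<Rightarrow> real measure \<Rightarrow> (real \<Rightarrow> real ^ 'd) \<Rightarrow> nat \<Rightarrow> real \<Rightarrow> real ^ 'd" where
  "W_sum \<alpha> \<mu> f N x = (1 / sqrt (real N)) *\<^sub>R
     (\<Sum>i<N. f (composed_map \<alpha> i x) - (LINT y|\<mu>. f (composed_map \<alpha> i y)))"

definition outer :: "real ^ 'd \<Rightarrow> real ^ 'd \<Rightarrow> real ^ 'd ^ 'd" where
  "outer v w = (\<chi> a b. v $ a * w $ b)"

definition Sigma_mat ::
  "(nat \<Rightarrow> real) \<Rightarrow> real measure \<Rightarrow> (real \<Rightarrow> real ^ 'd) \<Rightarrow> nat \<Rightarrow> real ^ 'd ^ 'd" where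
  "Sigma_mat \<alpha> \<mu> f N = (LINT x|\<mu>. outer (W_sum \<alpha> \<mu> f N x) (W_sum \<alpha> \<mu> f N x))"

definition positive_definite :: "real ^ 'd ^ 'd \<Rightarrow> bool" where
  "positive_definite A \<longleftrightarrow> transpose A = A \<and> (\<forall>v. v \<noteq> 0 \<longrightarrow> 0 < v \<bullet> (A *v v))"


section \<open>The centered multivariate normal distribution\<close>

text \<open>Given by its density, hence only meaningful for positive definite \<open>S\<close>.\<close>

definition centered_normal :: "real ^ 'd ^ 'd \<Rightarrow> (real ^ 'd) measure" where
  "centered_normal S = density lborel (\<lambda>x. ennreal
     (exp (- (x \<bullet> (matrix_inv S *v x)) / 2) / sqrt ((2 * pi) ^ CARD('d) * det S)))"

definition Phi :: "real ^ 'd ^ 'd \<Rightarrow> (real ^ 'd \<Rightarrow> real) \<Rightarrow> real" where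
  "Phi S h = (LINT x|centered_normal S. h x)"


section \<open>Differentiability and norms of derivatives of test functions\<close>

text \<open>Three-fold Frechet differentiability; the third derivative need not be continuous.\<close>

definition three_times_differentiable :: "(real ^ 'd \<Rightarrow> real) \<Rightarrow> bool" where
  "three_times_differentiable h \<longleftrightarrow>
     (\<exists>(h1 :: real ^ 'd \<Rightarrow> ((real ^ 'd) \<Rightarrow>\<^sub>L real))
       (h2 :: real ^ 'd \<Rightarrow> ((real ^ 'd) \<Rightarrow>\<^sub>L ((real ^ 'd) \<Rightarrow>\<^sub>L real)))
       (h3 :: real ^ 'd \<Rightarrow> ((real ^ 'd) \<Rightarrow>\<^sub>L ((real ^ 'd) \<Rightarrow>\<^sub>L ((real ^ 'd) \<Rightarrow>\<^sub>L real)))).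
       \<forall>x. (h has_derivative blinfun_apply (h1 x)) (at x)
         \<and> (h1 has_derivative blinfun_apply (h2 x)) (at x)
         \<and> (h2 has_derivative blinfun_apply (h3 x)) (at x))"

definition partial :: "'d \<Rightarrow> (real ^ 'd \<Rightarrow> real) \<Rightarrow> real ^ 'd \<Rightarrow> real" where
  "partial i h x = deriv (\<lambda>t. h (x + t *\<^sub>R axis i 1)) 0"

primrec partials :: "'d list \<Rightarrow> (real ^ 'd \<Rightarrow> real) \<Rightarrow> real ^ 'd \<Rightarrow> real" where
  "partials [] h = h"
| "partials (i # is) h = partial i (partials is h)"

definition D_norm :: "nat \<Rightarrow> (real ^ 'd \<Rightarrow> real) \<Rightarrow> ereal" where
  "D_norm k h = (MAX is\<in>{is :: 'd list. length is = k}. SUP x. ereal \<bar>partials is h x\<bar>)"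

end

theory Submission
  imports Defs
begin

text \<open>Densities evolve inside a cone of decreasing functions \<open>r\<close> on \<open>(0,1]\<close> for which
  \<open>x powr (1 + \<beta>) * r x\<close> increases and \<open>r x \<le> A * x powr (- \<beta>)\<close>. After a waiting time, a fixed
  fraction of the mass can be split off as a constant density while the remainder stays in the
  cone. Two densities of equal mass therefore merge at the rate \<open>n powr (1 - 1/\<beta>)\<close>, and for
  \<open>\<beta> < 1/3\<close> even the square root of this rate is summable. A Lipschitz function times a cone element
  is a difference of cone elements, so \<open>X i\<close> and \<open>X i * X j\<close> decorrelate from the future at the
  same rate, where \<open>X i\<close> are the centred observables along the orbit.

  The normal approximation replaces \<open>X 0, X 1, ...\<close> one at a time by independent Gaussian vectors;
  the terms not yet replaced are functions of the future. Taylor's formula produces the covariances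
  of \<open>X i\<close> with itself and with later terms, which need not form a positive semidefinite matrix. The
  Gaussian vectors have instead the covariance \<open>V i\<close> of the reverse martingale differences of the
  sequence. The discrepancy is a discrete derivative in \<open>i\<close> and becomes negligible after summation
  by parts. The total error is \<open>O(N powr (- 1/2))\<close>, better than claimed.\<close>

section \<open>Transfer operators\<close>

locale neutral_exponent =
  fixes \<beta> :: real
  assumes beta_pos: "0 < \<beta>" and beta_less_1: "\<beta> < 1"
begin

definition lbr :: "real \<Rightarrow> real \<Rightarrow> real" where
  "lbr \<alpha> x = x * (1 + 2 powr \<alpha> * x powr \<alpha>)"

definition dlbr :: "real \<Rightarrow> real \<Rightarrow> real" where
  "dlbr \<alpha> x = (if \<alpha> = 0 then 2 else 1 + (1 + \<alpha>) * (2 powr \<alpha> * x powr \<alpha>))"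

lemma lbr_0: "lbr 0 x = 2 * x"
  by (cases "x = 0") (auto simp: lbr_def)

lemma lbr_zero [simp]: "lbr \<alpha> 0 = 0"
  by (simp add: lbr_def)

lemma lbr_half [simp]: "lbr \<alpha> (1/2) = 1"
  by (simp add: lbr_def powr_mult [symmetric])

lemma dlbr_pos_eq: "x > 0 \<Longrightarrow> dlbr \<alpha> x = 1 + (1 + \<alpha>) * (2 * x) powr \<alpha>"
  by (auto simp: dlbr_def powr_mult)

lemma lbr_pos_eq: "x > 0 \<Longrightarrow> lbr \<alpha> x = x * (1 + (2 * x) powr \<alpha>)"
  by (auto simp: lbr_def powr_mult)

lemma dlbr_ge_1: "0 \<le> \<alpha> \<Longrightarrow> 1 \<le> dlbr \<alpha> x"
  by (auto simp: dlbr_def)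

lemma DERIV_lbr:
  assumes "0 \<le> \<alpha>" "0 \<le> x"
  shows "(lbr \<alpha> has_real_derivative dlbr \<alpha> x) (at x)"
proof (cases "\<alpha> = 0")
  case True
  have "lbr 0 = (\<lambda>x. 2 * x)" by (auto simp: lbr_0)
  then show ?thesis using True by (auto simp: dlbr_def intro!: derivative_eq_intros)
next
  case False
  then have a: "\<alpha> > 0" using assms by simp
  show ?thesis
  proof (cases "x = 0")
    case True
    have "((\<lambda>h. 1 + 2 powr \<alpha> * \<bar>h\<bar> powr \<alpha>) \<longlongrightarrow> 1 + 2 powr \<alpha> * 0) (at (0::real))"
      using a by (intro tendsto_intros tendsto_rabs_zero_iff[THEN iffD2] tendsto_zero_powrI) (auto intro!: tendsto_eq_intros)
    moreover have "\<bar>h\<bar> powr \<alpha> = h powr \<alpha>" for h :: real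
      by (auto simp: powr_def abs_if ln_minus)
    ultimately have "((\<lambda>h. 1 + 2 powr \<alpha> * h powr \<alpha>) \<longlongrightarrow> 1) (at (0::real))" by simp
    then have "((\<lambda>h. (lbr \<alpha> (0 + h) - lbr \<alpha> 0) / h) \<longlongrightarrow> 1) (at (0::real))"
      by (rule Lim_transform_eventually) (auto simp: eventually_at_filter lbr_def)
    then show ?thesis using True False by (simp add: DERIV_def dlbr_def)
  next
    case False
    then have x: "x > 0" using assms by simp
    have "((\<lambda>x. x * (1 + 2 powr \<alpha> * x powr \<alpha>)) has_real_derivative dlbr \<alpha> x) (at x)"
      unfolding dlbr_def using x a
      by (auto intro!: derivative_eq_intros simp: powr_diff field_simps)
    then show ?thesis by (simp add: lbr_def[abs_def])
  qed
qed

lemma continuous_on_dlbr: "0 \<le> \<alpha> \<Longrightarrow> continuous_on {0..1/2} (dlbr \<alpha>)"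
  unfolding dlbr_def[abs_def] by (cases "\<alpha> = 0") (auto intro!: continuous_intros continuous_on_powr')

lemma continuous_on_lbr: "0 \<le> \<alpha> \<Longrightarrow> continuous_on {0..1/2} (lbr \<alpha>)"
  using DERIV_lbr by (intro continuous_at_imp_continuous_on ballI) (auto intro: DERIV_isCont)

lemma lbr_strict_mono:
  assumes "0 \<le> \<alpha>" "0 \<le> x" "x < y"
  shows "lbr \<alpha> x < lbr \<alpha> y"
proof (rule DERIV_pos_imp_increasing[OF assms(3)])
  fix t assume "x \<le> t" "t \<le> y"
  then show "\<exists>d. (lbr \<alpha> has_real_derivative d) (at t) \<and> 0 < d"
    using DERIV_lbr[of \<alpha> t] dlbr_ge_1[of \<alpha> t] assms by (intro exI[of _ "dlbr \<alpha> t"]) auto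
qed

lemma inj_on_lbr: "0 \<le> \<alpha> \<Longrightarrow> inj_on (lbr \<alpha>) {0..1/2}"
  by (rule linorder_inj_onI) (use lbr_strict_mono in force)+

lemma lbr_image: 
  assumes "0 \<le> \<alpha>" shows "lbr \<alpha> ` {0..1/2} = {0..1}"
proof -
  have "lbr \<alpha> x \<in> {0..1}" if "x \<in> {0..1/2}" for x
  proof -
    have "0 \<le> lbr \<alpha> x" using lbr_strict_mono[OF assms, of 0 x] that by (cases "x = 0") auto
    moreover have "lbr \<alpha> x \<le> 1"
    proof (cases "x = 1/2")
      case True then show ?thesis by (simp only: lbr_half)
    next
      case False then show ?thesis using lbr_strict_mono[OF assms, of x "1/2"] that lbr_half[of \<alpha>] by auto
    qed
    ultimately show ?thesis by simp
  qed
  moreover have "\<exists>x\<in>{0..1/2}. lbr \<alpha> x = y" if "y \<in> {0..1}" for y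
    using IVT'[of "lbr \<alpha>" 0 y "1/2"] that continuous_on_lbr[OF assms] by auto
  ultimately show ?thesis by blast
qed

definition linv :: "real \<Rightarrow> real \<Rightarrow> real" where
  "linv \<alpha> y = (if y \<in> {0..1} then the_inv_into {0..1/2} (lbr \<alpha>) y else 0)"

lemma linv_lbr: "0 \<le> \<alpha> \<Longrightarrow> x \<in> {0..1/2} \<Longrightarrow> linv \<alpha> (lbr \<alpha> x) = x"
  using lbr_image[of \<alpha>] inj_on_lbr[of \<alpha>] by (auto simp: linv_def the_inv_into_f_f)

lemma lbr_linv: "0 \<le> \<alpha> \<Longrightarrow> y \<in> {0..1} \<Longrightarrow> lbr \<alpha> (linv \<alpha> y) = y"
  using lbr_image[of \<alpha>] inj_on_lbr[of \<alpha>] by (auto simp: linv_def f_the_inv_into_f)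

lemma linv_in: "0 \<le> \<alpha> \<Longrightarrow> y \<in> {0..1} \<Longrightarrow> linv \<alpha> y \<in> {0..1/2}"
  using lbr_image[of \<alpha>] the_inv_into_into[OF inj_on_lbr, of \<alpha> y "{0..1/2}"] by (simp add: linv_def)

lemma linv_bounds:
  assumes "0 \<le> \<alpha>" "0 < y" "y \<le> 1"
  shows "0 < linv \<alpha> y" "linv \<alpha> y \<le> 1/2"
  using linv_in[of \<alpha> y] lbr_linv[of \<alpha> y] assms by (cases "linv \<alpha> y = 0"; force)+

lemma linv_mono:
  assumes "0 \<le> \<alpha>" "0 \<le> x" "x \<le> y" "y \<le> 1"
  shows "linv \<alpha> x \<le> linv \<alpha> y"
proof (rule ccontr)
  assume "\<not> ?thesis"
  then have "lbr \<alpha> (linv \<alpha> y) < lbr \<alpha> (linv \<alpha> x)"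
    using assms linv_in[of \<alpha> y] by (intro lbr_strict_mono) auto
  then show False using assms by (simp add: lbr_linv)
qed

lemma linv_measurable [measurable]:
  assumes "0 \<le> \<alpha>" shows "linv \<alpha> \<in> borel_measurable borel"
proof -
  have "mono_on {0..1} (linv \<alpha>)" using assms by (auto intro!: mono_onI linv_mono)
  then have "linv \<alpha> \<in> borel_measurable (restrict_space borel {0..1})"
    by (rule borel_measurable_mono_on_fnc)
  then have "(\<lambda>y. if y \<in> {0..1} then linv \<alpha> y else 0) \<in> borel_measurable borel"
    by (subst measurable_If_restrict_space_iff) (auto simp del: atLeastAtMost_iff)
  moreover have "(\<lambda>y. if y \<in> {0..1} then linv \<alpha> y else 0) = linv \<alpha>"
    by (auto simp: linv_def)
  ultimately show ?thesis by simp
qed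

lemma dlbr_measurable [measurable]: "dlbr \<alpha> \<in> borel_measurable borel"
  unfolding dlbr_def[abs_def] by measurable

lemma lbr_measurable [measurable]: "lbr \<alpha> \<in> borel_measurable borel"
  unfolding lbr_def[abs_def] by measurable

definition lpush :: "real \<Rightarrow> (real \<Rightarrow> real) \<Rightarrow> real \<Rightarrow> real" where
  "lpush \<alpha> g y = (if 0 < y \<and> y \<le> 1 then g (linv \<alpha> y) / dlbr \<alpha> (linv \<alpha> y) else 0)"

definition rpush :: "(real \<Rightarrow> real) \<Rightarrow> real \<Rightarrow> real" where
  "rpush g y = (if 0 < y \<and> y \<le> 1 then g ((1 + y) / 2) / 2 else 0)"

definition transfer :: "real \<Rightarrow> (real \<Rightarrow> real) \<Rightarrow> real \<Rightarrow> real" where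
  "transfer \<alpha> g y = lpush \<alpha> g y + rpush g y"

lemma lpush_measurable [measurable]:
  assumes [measurable]: "g \<in> borel_measurable borel" and "0 \<le> \<alpha>"
  shows "lpush \<alpha> g \<in> borel_measurable borel"
  using assms(2) unfolding lpush_def[abs_def] by measurable

lemma rpush_measurable [measurable]:
  assumes [measurable]: "g \<in> borel_measurable borel"
  shows "rpush g \<in> borel_measurable borel"
  unfolding rpush_def[abs_def] by measurable

lemma transfer_measurable [measurable]:
  assumes [measurable]: "g \<in> borel_measurable borel" and "0 \<le> \<alpha>"
  shows "transfer \<alpha> g \<in> borel_measurable borel"
  using assms(2) unfolding transfer_def[abs_def] by measurable

lemma intermittent_measurable [measurable]: "intermittent_map \<alpha> \<in> borel_measurable borel"
  unfolding intermittent_map_def[abs_def] by measurable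

lemma nn_integral_lpush:
  assumes a: "0 \<le> \<alpha>" and [measurable]: "g \<in> borel_measurable borel" "v \<in> borel_measurable borel"
    and nn: "\<And>x. 0 \<le> g x" "\<And>x. 0 \<le> v x"
  shows "(\<integral>\<^sup>+y. v y * lpush \<alpha> g y \<partial>lborel) = (\<integral>\<^sup>+x. v (lbr \<alpha> x) * (g x * indicator {0<..1/2} x) \<partial>lborel)"
proof -
  let ?f = "\<lambda>y. v y * (g (linv \<alpha> y) / dlbr \<alpha> (linv \<alpha> y))"
  note [measurable] = linv_measurable[OF a]
  have "(\<integral>\<^sup>+y. v y * lpush \<alpha> g y \<partial>lborel) = (\<integral>\<^sup>+y. ennreal (?f y * indicator {lbr \<alpha> 0..lbr \<alpha> (1/2)} y) \<partial>lborel)"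
    by (intro nn_integral_cong_AE AE_I[where N="{0}"])
      (auto simp: lpush_def indicator_def split: if_splits)
  also have "\<dots> = (\<integral>\<^sup>+x. ennreal (?f (lbr \<alpha> x) * dlbr \<alpha> x * indicator {0..1/2} x) \<partial>lborel)"
  proof (rule nn_integral_substitution)
    show "0 \<le> dlbr \<alpha> x" for x using dlbr_ge_1[OF a, of x] by simp
  qed (use a in \<open>auto intro: DERIV_lbr continuous_on_dlbr simp: set_borel_measurable_def\<close>)
  also have "\<dots> = (\<integral>\<^sup>+x. v (lbr \<alpha> x) * (g x * indicator {0<..1/2} x) \<partial>lborel)"
  proof (intro nn_integral_cong_AE AE_I[where N="{0}"])
    have "dlbr \<alpha> x \<noteq> 0" for x using dlbr_ge_1[OF a, of x] by linarith
    then show "{x\<in>space lborel. ennreal (?f (lbr \<alpha> x) * dlbr \<alpha> x * indicator {0..1/2} x) \<noteq> ennreal (v (lbr \<alpha> x) * (g x * indicator {0<..1/2} x))} \<subseteq> {0}"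
      using a nn by (auto simp: indicator_def linv_lbr split: if_splits)
  qed auto
  finally show ?thesis .
qed

lemma nn_integral_rpush:
  assumes [measurable]: "g \<in> borel_measurable borel" "v \<in> borel_measurable borel"
    and nn: "\<And>x. 0 \<le> g x" "\<And>x. 0 \<le> v x"
  shows "(\<integral>\<^sup>+y. v y * rpush g y \<partial>lborel) = (\<integral>\<^sup>+x. v (2 * x - 1) * (g x * indicator {1/2<..1} x) \<partial>lborel)"
proof -
  have "(\<integral>\<^sup>+x. ennreal (v (2 * x - 1) * (g x * indicator {1/2<..1} x)) \<partial>lborel)
    = ennreal \<bar>1/2\<bar> * (\<integral>\<^sup>+y. ennreal (v (2 * (1/2 + 1/2 * y) - 1) * (g (1/2 + 1/2 * y) * indicator {1/2<..1} (1/2 + 1/2 * y))) \<partial>lborel)"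
    by (rule nn_integral_real_affine) auto
  also have "\<dots> = (\<integral>\<^sup>+y. ennreal (\<bar>1/2\<bar> * (v (2 * (1/2 + 1/2 * y) - 1) * (g (1/2 + 1/2 * y) * indicator {1/2<..1} (1/2 + 1/2 * y)))) \<partial>lborel)"
    by (subst nn_integral_cmult[symmetric], measurable) (intro nn_integral_cong ennreal_mult'[symmetric], simp)
  also have "\<dots> = (\<integral>\<^sup>+y. v y * rpush g y \<partial>lborel)"
    by (intro nn_integral_cong) (auto simp: rpush_def indicator_def add_divide_distrib)
  finally show ?thesis by simp
qed

lemma lpush_nonneg: "0 \<le> \<alpha> \<Longrightarrow> (\<And>x. 0 \<le> g x) \<Longrightarrow> 0 \<le> lpush \<alpha> g y"
  using dlbr_ge_1[of \<alpha> "linv \<alpha> y"] by (auto simp: lpush_def)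

lemma rpush_nonneg: "(\<And>x. 0 \<le> g x) \<Longrightarrow> 0 \<le> rpush g y"
  by (auto simp: rpush_def)

lemma transfer_nonneg: "0 \<le> \<alpha> \<Longrightarrow> (\<And>x. 0 \<le> g x) \<Longrightarrow> 0 \<le> transfer \<alpha> g y"
  by (simp add: transfer_def lpush_nonneg rpush_nonneg)

lemma nn_integral_transfer:
  assumes a: "0 \<le> \<alpha>" and [measurable]: "g \<in> borel_measurable borel" "v \<in> borel_measurable borel"
    and nn: "\<And>x. 0 \<le> g x" "\<And>x. 0 \<le> v x" and supp: "\<And>x. x \<notin> {0<..1} \<Longrightarrow> g x = 0"
  shows "(\<integral>\<^sup>+y. v y * transfer \<alpha> g y \<partial>lborel) = (\<integral>\<^sup>+x. v (intermittent_map \<alpha> x) * g x \<partial>lborel)"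
proof -
  note [measurable] = lpush_measurable[OF _ a]
  have "(\<integral>\<^sup>+y. v y * transfer \<alpha> g y \<partial>lborel)
    = (\<integral>\<^sup>+y. ennreal (v y * lpush \<alpha> g y) + ennreal (v y * rpush g y) \<partial>lborel)"
    by (intro nn_integral_cong) (simp add: transfer_def algebra_simps nn lpush_nonneg rpush_nonneg a)
  also have "\<dots> = (\<integral>\<^sup>+y. ennreal (v y * lpush \<alpha> g y) \<partial>lborel) + (\<integral>\<^sup>+y. ennreal (v y * rpush g y) \<partial>lborel)"
    by (rule nn_integral_add) auto
  also have "\<dots> = (\<integral>\<^sup>+x. ennreal (v (lbr \<alpha> x) * (g x * indicator {0<..1/2} x)) \<partial>lborel)
      + (\<integral>\<^sup>+x. ennreal (v (2 * x - 1) * (g x * indicator {1/2<..1} x)) \<partial>lborel)"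
    using nn_integral_lpush[OF a, of g v] nn_integral_rpush[of g v] nn by simp
  also have "\<dots> = (\<integral>\<^sup>+x. ennreal (v (lbr \<alpha> x) * (g x * indicator {0<..1/2} x))
      + ennreal (v (2 * x - 1) * (g x * indicator {1/2<..1} x)) \<partial>lborel)"
    by (rule nn_integral_add[symmetric]) auto
  also have "\<dots> = (\<integral>\<^sup>+x. v (intermittent_map \<alpha> x) * g x \<partial>lborel)"
  proof (intro nn_integral_cong_AE AE_I[where N="{1/2}"])
    show "{x\<in>space lborel. \<not> ennreal (v (lbr \<alpha> x) * (g x * indicator {0<..1/2} x))
      + ennreal (v (2 * x - 1) * (g x * indicator {1/2<..1} x)) = ennreal (v (intermittent_map \<alpha> x) * g x)} \<subseteq> {1/2}"
      using supp by (auto simp: indicator_def intermittent_map_def lbr_def)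
  qed auto
  finally show ?thesis .
qed

lemma transfer_distr:
  assumes a: "0 \<le> \<alpha>" and [measurable]: "g \<in> borel_measurable borel"
    and nn: "\<And>x. 0 \<le> g x" and supp: "\<And>x. x \<notin> {0<..1} \<Longrightarrow> g x = 0"
  shows "distr (density lborel g) borel (intermittent_map \<alpha>) = density lborel (transfer \<alpha> g)"
proof (rule measure_eqI)
  fix A assume "A \<in> sets (distr (density lborel g) borel (intermittent_map \<alpha>))"
  then have [measurable]: "A \<in> sets borel" by simp
  note [measurable] = transfer_measurable[OF _ a]
  have "emeasure (distr (density lborel g) borel (intermittent_map \<alpha>)) A
     = (\<integral>\<^sup>+x. g x * indicator (intermittent_map \<alpha> -` A) x \<partial>lborel)"
    using measurable_sets_borel[OF intermittent_measurable, of A \<alpha>]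
    by (subst emeasure_distr) (auto simp: emeasure_density ennreal_mult' nn intro!: nn_integral_cong split: split_indicator)
  also have "\<dots> = (\<integral>\<^sup>+x. ennreal (indicator A (intermittent_map \<alpha> x) * g x) \<partial>lborel)"
    by (intro nn_integral_cong) (auto simp: indicator_def)
  also have "\<dots> = (\<integral>\<^sup>+y. ennreal (indicator A y * transfer \<alpha> g y) \<partial>lborel)"
    by (subst nn_integral_transfer[OF a]) (auto simp: nn supp)
  also have "\<dots> = emeasure (density lborel (transfer \<alpha> g)) A"
    by (subst emeasure_density) (auto intro!: nn_integral_cong simp: indicator_def)
  finally show "emeasure (distr (density lborel g) borel (intermittent_map \<alpha>)) A
    = emeasure (density lborel (transfer \<alpha> g)) A" .
qed simp

lemma lpush_diff: "lpush \<alpha> (\<lambda>x. g x - k x) y = lpush \<alpha> g y - lpush \<alpha> k y"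
  by (simp add: lpush_def diff_divide_distrib)

lemma rpush_diff: "rpush (\<lambda>x. g x - k x) y = rpush g y - rpush k y"
  by (simp add: rpush_def diff_divide_distrib)

lemma transfer_diff: "transfer \<alpha> (\<lambda>x. g x - k x) y = transfer \<alpha> g y - transfer \<alpha> k y"
  by (simp add: transfer_def lpush_diff rpush_diff)

lemma integral_transfer_nonneg:
  assumes a: "0 \<le> \<alpha>" and [measurable]: "g \<in> borel_measurable borel" "v \<in> borel_measurable borel"
    and nn: "\<And>x. 0 \<le> g x" and supp: "\<And>x. x \<notin> {0<..1} \<Longrightarrow> g x = 0"
  shows "integrable lborel (\<lambda>y. v y * transfer \<alpha> g y) \<longleftrightarrow> integrable lborel (\<lambda>x. v (intermittent_map \<alpha> x) * g x)"
    and "(\<integral>y. v y * transfer \<alpha> g y \<partial>lborel) = (\<integral>x. v (intermittent_map \<alpha> x) * g x \<partial>lborel)"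
proof -
  note [measurable] = transfer_measurable[OF _ a]
  have D: "distr (density lborel g) borel (intermittent_map \<alpha>) = density lborel (transfer \<alpha> g)"
    by (rule transfer_distr) (use assms in auto)
  have "integrable lborel (\<lambda>y. v y * transfer \<alpha> g y) \<longleftrightarrow> integrable (density lborel (transfer \<alpha> g)) v"
    by (subst integrable_density) (auto simp: mult.commute transfer_nonneg[OF a nn])
  also have "\<dots> \<longleftrightarrow> integrable (density lborel g) (\<lambda>x. v (intermittent_map \<alpha> x))"
    unfolding D[symmetric] by (subst integrable_distr_eq) auto
  also have "\<dots> \<longleftrightarrow> integrable lborel (\<lambda>x. v (intermittent_map \<alpha> x) * g x)"
    by (subst integrable_density) (auto simp: mult.commute nn)
  finally show "integrable lborel (\<lambda>y. v y * transfer \<alpha> g y) \<longleftrightarrow> integrable lborel (\<lambda>x. v (intermittent_map \<alpha> x) * g x)" .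
  have "(\<integral>y. v y * transfer \<alpha> g y \<partial>lborel) = integral\<^sup>L (density lborel (transfer \<alpha> g)) v"
    by (subst integral_density) (auto simp: mult.commute transfer_nonneg[OF a nn])
  also have "\<dots> = integral\<^sup>L (density lborel g) (\<lambda>x. v (intermittent_map \<alpha> x))"
    unfolding D[symmetric] by (subst integral_distr) auto
  also have "\<dots> = (\<integral>x. v (intermittent_map \<alpha> x) * g x \<partial>lborel)"
    by (subst integral_density) (auto simp: mult.commute nn)
  finally show "(\<integral>y. v y * transfer \<alpha> g y \<partial>lborel) = (\<integral>x. v (intermittent_map \<alpha> x) * g x \<partial>lborel)" .
qed

lemma integral_transfer:
  assumes a: "0 \<le> \<alpha>" and [measurable]: "v \<in> borel_measurable borel"
    and gi: "integrable lborel g" and v: "\<And>x. \<bar>v x\<bar> \<le> c"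
    and supp: "\<And>x. x \<notin> {0<..1} \<Longrightarrow> g x = 0"
  shows "integrable lborel (\<lambda>y. v y * transfer \<alpha> g y)"
    and "(\<integral>y. v y * transfer \<alpha> g y \<partial>lborel) = (\<integral>x. v (intermittent_map \<alpha> x) * g x \<partial>lborel)"
proof -
  have [measurable]: "g \<in> borel_measurable borel" using gi by auto
  define p where "p x = max 0 (g x)" for x
  define n where "n x = max 0 (- g x)" for x
  have pi: "integrable lborel p" and ni: "integrable lborel n"
    using gi by (auto simp: p_def[abs_def] n_def[abs_def])
  have g: "g x = p x - n x" for x by (auto simp: p_def n_def)
  then have g': "g = (\<lambda>x. p x - n x)" by auto
  have [measurable]: "p \<in> borel_measurable borel" "n \<in> borel_measurable borel"
    using pi ni by auto
  have s: "p x = 0" "n x = 0" if "x \<notin> {0<..1}" for x using supp[OF that] by (auto simp: p_def n_def)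
  have nn: "0 \<le> p x" "0 \<le> n x" for x by (auto simp: p_def n_def)
  have I: "integrable lborel (\<lambda>x. v (intermittent_map \<alpha> x) * k x)" if "integrable lborel k" for k
    by (rule Bochner_Integration.integrable_bound[OF integrable_mult_right[OF that, of c]])
       (use that v in \<open>auto simp: abs_mult intro!: AE_I2 mult_right_mono intro: order_trans[OF _ abs_ge_self]\<close>)
  note P = integral_transfer_nonneg[OF a, of p v] and N = integral_transfer_nonneg[OF a, of n v]
  have Pi: "integrable lborel (\<lambda>y. v y * transfer \<alpha> p y)" and Ni: "integrable lborel (\<lambda>y. v y * transfer \<alpha> n y)"
    using P(1) N(1) I[OF pi] I[OF ni] nn s by auto
  have T: "v y * transfer \<alpha> g y = v y * transfer \<alpha> p y - v y * transfer \<alpha> n y" for y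
    unfolding g' by (simp add: transfer_diff algebra_simps)
  show "integrable lborel (\<lambda>y. v y * transfer \<alpha> g y)" unfolding T using Pi Ni by auto
  have "(\<integral>y. v y * transfer \<alpha> g y \<partial>lborel) = (\<integral>x. v (intermittent_map \<alpha> x) * p x \<partial>lborel) - (\<integral>x. v (intermittent_map \<alpha> x) * n x \<partial>lborel)"
    unfolding T using Pi Ni P(2) N(2) nn s by simp
  also have "\<dots> = (\<integral>x. v (intermittent_map \<alpha> x) * g x \<partial>lborel)"
    using I[OF pi] I[OF ni] by (subst Bochner_Integration.integral_diff[symmetric]) (auto simp: g algebra_simps)
  finally show "(\<integral>y. v y * transfer \<alpha> g y \<partial>lborel) = (\<integral>x. v (intermittent_map \<alpha> x) * g x \<partial>lborel)" .
qed

lemma transfer_supp: "x \<notin> {0<..1} \<Longrightarrow> transfer \<alpha> g x = 0"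
  by (auto simp: transfer_def lpush_def rpush_def)

lemma transfer_abs_le: "0 \<le> \<alpha> \<Longrightarrow> \<bar>transfer \<alpha> g y\<bar> \<le> transfer \<alpha> (\<lambda>x. \<bar>g x\<bar>) y"
  using dlbr_ge_1[of \<alpha> "linv \<alpha> y"]
  by (auto simp: transfer_def lpush_def rpush_def abs_divide intro!: order_trans[OF abs_triangle_ineq])

lemma integrable_transfer:
  assumes "0 \<le> \<alpha>" "integrable lborel g" "\<And>x. x \<notin> {0<..1} \<Longrightarrow> g x = 0"
  shows "integrable lborel (transfer \<alpha> g)"
    and "(\<integral>y. transfer \<alpha> g y \<partial>lborel) = (\<integral>x. g x \<partial>lborel)"
    and "(\<integral>y. \<bar>transfer \<alpha> g y\<bar> \<partial>lborel) \<le> (\<integral>x. \<bar>g x\<bar> \<partial>lborel)"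
proof -
  show 1: "integrable lborel (transfer \<alpha> g)"
    using integral_transfer(1)[OF assms(1) _ assms(2), of "\<lambda>_. 1" 1] assms(3) by simp
  show "(\<integral>y. transfer \<alpha> g y \<partial>lborel) = (\<integral>x. g x \<partial>lborel)"
    using integral_transfer(2)[OF assms(1) _ assms(2), of "\<lambda>_. 1" 1] assms(3) by simp
  have i: "integrable lborel (\<lambda>x. \<bar>g x\<bar>)" using assms by auto
  have "(\<integral>y. \<bar>transfer \<alpha> g y\<bar> \<partial>lborel) \<le> (\<integral>y. transfer \<alpha> (\<lambda>x. \<bar>g x\<bar>) y \<partial>lborel)"
    using 1 integral_transfer(1)[OF assms(1) _ i, of "\<lambda>_. 1" 1] assms
    by (intro integral_mono transfer_abs_le) auto
  also have "\<dots> = (\<integral>x. \<bar>g x\<bar> \<partial>lborel)"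
    using integral_transfer(2)[OF assms(1) _ i, of "\<lambda>_. 1" 1] assms(3) by simp
  finally show "(\<integral>y. \<bar>transfer \<alpha> g y\<bar> \<partial>lborel) \<le> (\<integral>x. \<bar>g x\<bar> \<partial>lborel)" .
qed

section \<open>An invariant cone of densities\<close>

lemma bernoulli_upper: 
  fixes u :: real
  assumes "0 \<le> u" shows "(1 + u) powr \<beta> \<le> 1 + \<beta> * u"
  using Youngs_inequality_0[of \<beta> "1 - \<beta>" "1 + u" 1] beta_pos beta_less_1 assms by (simp add: algebra_simps)

lemma bernoulli_upper_inverse: 
  fixes u :: real
  assumes "0 \<le> u" "u \<le> 1" shows "(1 + u) powr (-\<beta>) \<le> 1 - \<beta> * u / 2"
proof -
  have "(1 + u) powr (-\<beta>) = (1 / (1 + u)) powr \<beta>"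
    using assms by (simp add: powr_minus powr_divide inverse_eq_divide)
  also have "\<dots> \<le> \<beta> * (1 / (1 + u)) + (1 - \<beta>)"
    using Youngs_inequality_0[of \<beta> "1 - \<beta>" "1 / (1 + u)" 1] beta_pos beta_less_1 assms by simp
  also have "\<dots> = 1 - \<beta> * (u / (1 + u))" using assms by (simp add: field_simps)
  also have "\<dots> \<le> 1 - \<beta> * (u / 2)"
    using assms beta_pos by (intro diff_left_mono mult_left_mono divide_left_mono) auto
  finally show ?thesis by simp
qed

lemma bernoulli_lower: 
  fixes t :: real
  assumes "0 \<le> t" shows "1 + (1 + \<beta>) * t \<le> (1 + t) powr (1 + \<beta>)"
proof -
  have "((1 + t) powr (1 + \<beta>)) powr (1 / (1 + \<beta>)) * 1 powr (\<beta> / (1 + \<beta>))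
     \<le> 1 / (1 + \<beta>) * (1 + t) powr (1 + \<beta>) + \<beta> / (1 + \<beta>) * 1"
    by (rule Youngs_inequality_0) (use beta_pos assms in \<open>auto simp: divide_simps\<close>)
  moreover have "((1 + t) powr (1 + \<beta>)) powr (1 / (1 + \<beta>)) = 1 + t"
    using beta_pos assms by (simp add: powr_powr)
  ultimately have "(1 + t) \<le> 1 / (1 + \<beta>) * (1 + t) powr (1 + \<beta>) + \<beta> / (1 + \<beta>)" by simp
  then have "(1 + t) * (1 + \<beta>) \<le> (1 / (1 + \<beta>) * (1 + t) powr (1 + \<beta>) + \<beta> / (1 + \<beta>)) * (1 + \<beta>)"
    using beta_pos by (intro mult_right_mono) auto
  also have "\<dots> = (1 + t) powr (1 + \<beta>) + \<beta>" using beta_pos by (simp add: distrib_right)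
  finally show ?thesis by (simp add: algebra_simps)
qed

definition B :: real where "B = 6 / (1 - \<beta>)"

lemma B_pos: "0 < B" using beta_less_1 by (simp add: B_def)
lemma B_ge_1: "1 \<le> B" using beta_less_1 beta_pos by (simp add: B_def)

lemma powr_ratio_ge_1:
  assumes "0 \<le> \<alpha>" "\<alpha> \<le> \<beta>" "0 < x" "x \<le> 1/2"
  shows "1 \<le> x powr (-\<beta>) * (2 * x) powr \<alpha>"
proof -
  have "1 \<le> 2 powr \<beta>" using beta_pos by (intro ge_one_powr_ge_zero) auto
  also have "\<dots> = x powr (-\<beta>) * (2 * x) powr \<beta>"
    using assms by (simp add: powr_mult powr_minus field_simps)
  also have "\<dots> \<le> x powr (-\<beta>) * (2 * x) powr \<alpha>"
    using assms by (intro mult_left_mono powr_mono') auto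
  finally show ?thesis .
qed

lemma two_x_powr:
  fixes x :: real
  assumes "0 \<le> \<alpha>" "0 < x" "x \<le> 1/2" shows "0 < (2 * x) powr \<alpha>" "(2 * x) powr \<alpha> \<le> 1"
  using assms by (auto intro!: powr_le1)

lemma lbr_powr_minus:
  assumes "0 < x"
  shows "lbr \<alpha> x powr (-\<beta>) = x powr (-\<beta>) * (1 + (2 * x) powr \<alpha>) powr (-\<beta>)"
  using assms by (simp add: lbr_pos_eq powr_mult)

lemma tail_inequality:
  assumes a: "0 \<le> \<alpha>" "\<alpha> \<le> \<beta>" and x: "0 < x" "x \<le> 1/2"
  shows "x powr (-\<beta>) / dlbr \<alpha> x + 1 / B \<le> lbr \<alpha> x powr (-\<beta>)"
proof -
  define u where "u = (2 * x) powr \<alpha>"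
  have u: "0 < u" "u \<le> 1" using two_x_powr[OF a(1) x] by (auto simp: u_def)
  have p: "0 < 1 + \<beta> * u" "0 < 1 + (1 + \<alpha>) * u" using u a beta_pos by (auto intro!: add_pos_nonneg)
  have "(1 - \<beta>) * u / 6 \<le> (1 + \<alpha> - \<beta>) * u / ((1 + \<beta> * u) * (1 + (1 + \<alpha>) * u))"
  proof (rule frac_le)
    have "(1 + \<beta> * u) * (1 + (1 + \<alpha>) * u) \<le> 2 * 3"
    proof (rule mult_mono)
      show "1 + \<beta> * u \<le> 2" using mult_mono[of \<beta> 1 u 1] u beta_less_1 by simp
      show "1 + (1 + \<alpha>) * u \<le> 3" using mult_mono[of "1 + \<alpha>" 2 u 1] u a beta_less_1 by simp
    qed (use u a beta_pos in auto)
    then show "(1 + \<beta> * u) * (1 + (1 + \<alpha>) * u) \<le> 6" by simp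
  qed (use p u a beta_pos beta_less_1 in \<open>auto intro!: mult_right_mono mult_pos_pos[OF p]\<close>)
  also have "\<dots> = 1 / (1 + \<beta> * u) - 1 / (1 + (1 + \<alpha>) * u)"
  proof -
    have "1 + \<beta> * u \<noteq> 0" "1 + (1 + \<alpha>) * u \<noteq> 0" using p by linarith+
    then show ?thesis by (simp add: divide_simps) (simp add: algebra_simps)
  qed
  also have "1 / (1 + \<beta> * u) \<le> (1 + u) powr (-\<beta>)"
    using bernoulli_upper[of u] u by (simp add: powr_minus inverse_eq_divide frac_le)
  finally have *: "(1 - \<beta>) * u / 6 + 1 / dlbr \<alpha> x \<le> (1 + u) powr (-\<beta>)"
    using x by (simp add: dlbr_pos_eq u_def)
  have "1 / B = (1 - \<beta>) / 6 * 1" by (simp add: B_def)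
  also have "\<dots> \<le> (1 - \<beta>) / 6 * (x powr (-\<beta>) * u)"
    using powr_ratio_ge_1[OF a x] beta_less_1 unfolding u_def by (intro mult_left_mono) auto
  finally have "x powr (-\<beta>) / dlbr \<alpha> x + 1 / B \<le> x powr (-\<beta>) * ((1 - \<beta>) * u / 6 + 1 / dlbr \<alpha> x)"
    by (simp add: algebra_simps)
  also have "\<dots> \<le> x powr (-\<beta>) * (1 + u) powr (-\<beta>)" using * by (intro mult_left_mono) auto
  finally show ?thesis using lbr_powr_minus[of x \<alpha>] x by (simp add: u_def)
qed

lemma escape_inequality:
  assumes a: "0 \<le> \<alpha>" "\<alpha> \<le> \<beta>" and x: "0 < x" "x \<le> 1/2"
  shows "lbr \<alpha> x powr (-\<beta>) + \<beta> / 2 \<le> x powr (-\<beta>)"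
proof -
  define u where "u = (2 * x) powr \<alpha>"
  have u: "0 < u" "u \<le> 1" using two_x_powr[OF a(1) x] by (auto simp: u_def)
  have "lbr \<alpha> x powr (-\<beta>) \<le> x powr (-\<beta>) * (1 - \<beta> * u / 2)"
    using bernoulli_upper_inverse[of u] u x lbr_powr_minus[of x \<alpha>] by (simp add: u_def)
  also have "\<dots> = x powr (-\<beta>) - \<beta> / 2 * (x powr (-\<beta>) * u)" by (simp add: algebra_simps)
  also have "\<dots> \<le> x powr (-\<beta>) - \<beta> / 2 * 1"
    using powr_ratio_ge_1[OF a x] beta_pos unfolding u_def by (intro diff_left_mono mult_left_mono) auto
  finally show ?thesis by simp
qed

lemma distortion_mono:
  assumes "0 \<le> \<alpha>" "\<alpha> \<le> \<beta>" "0 \<le> u" "u \<le> w"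
  shows "(1 + u) powr (1 + \<beta>) / (1 + (1 + \<alpha>) * u) \<le> (1 + w) powr (1 + \<beta>) / (1 + (1 + \<alpha>) * w)"
proof -
  define t where "t = (w - u) / (1 + u)"
  have t: "0 \<le> t" "1 + t = (1 + w) / (1 + u)" using assms by (auto simp: t_def field_simps)
  have p: "0 < 1 + (1 + \<alpha>) * u" "0 < 1 + (1 + \<alpha>) * w" using assms by (auto intro!: add_pos_nonneg)
  have "(1 + \<alpha>) * (1 + u) \<le> (1 + \<beta>) * (1 + (1 + \<alpha>) * u)"
  proof -
    have "(1 + \<alpha>) * (1 + u) \<le> (1 + \<alpha>) * (1 + (1 + \<alpha>) * u)"
      using assms by (intro mult_left_mono) (auto simp: algebra_simps)
    also have "\<dots> \<le> (1 + \<beta>) * (1 + (1 + \<alpha>) * u)" using assms p by (intro mult_right_mono) auto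
    finally show ?thesis .
  qed
  then have "(1 + \<alpha>) / (1 + (1 + \<alpha>) * u) \<le> (1 + \<beta>) / (1 + u)"
    using p assms by (simp add: divide_simps mult.commute)
  then have "(1 + \<alpha>) / (1 + (1 + \<alpha>) * u) * (w - u) \<le> (1 + \<beta>) / (1 + u) * (w - u)"
    using assms by (intro mult_right_mono) auto
  then have "(1 + (1 + \<alpha>) * w) / (1 + (1 + \<alpha>) * u) \<le> 1 + (1 + \<beta>) * t"
    using p by (simp add: t_def field_simps)
  also have "\<dots> \<le> (1 + t) powr (1 + \<beta>)" by (rule bernoulli_lower[OF t(1)])
  also have "\<dots> = (1 + w) powr (1 + \<beta>) / (1 + u) powr (1 + \<beta>)" using assms t by (simp add: powr_divide)
  finally show ?thesis using p assms by (simp add: divide_simps mult.commute)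
qed

lemma right_mono:
  assumes "0 < y" "y \<le> w" "w \<le> 1"
  shows "(2 * y / (1 + y)) powr (1 + \<beta>) - y powr (1 + \<beta>) / 2 \<le> (2 * w / (1 + w)) powr (1 + \<beta>) - w powr (1 + \<beta>) / 2"
proof (rule DERIV_nonneg_imp_nondecreasing[OF assms(2)])
  fix t assume "y \<le> t" "t \<le> w"
  then have t: "0 < t" "t \<le> 1" using assms by auto
  define d where "d = (1 + \<beta>) * (2 * t / (1 + t)) powr \<beta> * (2 / (1 + t)^2) - (1 + \<beta>) * t powr \<beta> / 2"
  have "((\<lambda>t. (2 * t / (1 + t)) powr (1 + \<beta>) - t powr (1 + \<beta>) / 2) has_real_derivative d) (at t)"
    unfolding d_def using t
    by (auto intro!: derivative_eq_intros simp: power2_eq_square divide_simps) (auto simp: algebra_simps)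
  moreover have "0 \<le> d"
  proof -
    have "t powr \<beta> \<le> (2 * t / (1 + t)) powr \<beta>"
      using t beta_pos mult_mono[of t 1 t 1] by (intro powr_mono2) (auto simp: field_simps)
    moreover have "1 / 2 \<le> 2 / (1 + t)^2"
      using t power_mono[of "1 + t" 2 2] by (simp add: field_simps)
    ultimately have "t powr \<beta> * (1 / 2) \<le> (2 * t / (1 + t)) powr \<beta> * (2 / (1 + t)^2)"
      by (intro mult_mono) auto
    then have "(1 + \<beta>) * (t powr \<beta> * (1 / 2)) \<le> (1 + \<beta>) * ((2 * t / (1 + t)) powr \<beta> * (2 / (1 + t)^2))"
      using beta_pos by (intro mult_left_mono) auto
    then show ?thesis by (simp add: d_def mult.assoc)
  qed
  ultimately show "\<exists>d. ((\<lambda>t. (2 * t / (1 + t)) powr (1 + \<beta>) - t powr (1 + \<beta>) / 2) has_real_derivative d) (at t) \<and> 0 \<le> d"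
    by blast
qed

definition cone :: "real \<Rightarrow> (real \<Rightarrow> real) set" where
  "cone A = {r. r \<in> borel_measurable borel \<and> (\<forall>x. 0 \<le> r x) \<and> (\<forall>x. x \<notin> {0<..1} \<longrightarrow> r x = 0)
    \<and> (\<forall>x y. 0 < x \<longrightarrow> x \<le> y \<longrightarrow> y \<le> 1 \<longrightarrow> r y \<le> r x)
    \<and> (\<forall>x y. 0 < x \<longrightarrow> x \<le> y \<longrightarrow> y \<le> 1 \<longrightarrow> x powr (1 + \<beta>) * r x \<le> y powr (1 + \<beta>) * r y)
    \<and> (\<forall>x. 0 < x \<longrightarrow> x \<le> 1 \<longrightarrow> r x \<le> A * x powr (-\<beta>))
    \<and> integrable lborel r \<and> B * (\<integral>x. r x \<partial>lborel) \<le> A}"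

lemma coneD:
  assumes "r \<in> cone A"
  shows "r \<in> borel_measurable borel" "0 \<le> r x" "x \<notin> {0<..1} \<Longrightarrow> r x = 0"
    "0 < x \<Longrightarrow> x \<le> y \<Longrightarrow> y \<le> 1 \<Longrightarrow> r y \<le> r x"
    "0 < x \<Longrightarrow> x \<le> y \<Longrightarrow> y \<le> 1 \<Longrightarrow> x powr (1 + \<beta>) * r x \<le> y powr (1 + \<beta>) * r y"
    "0 < x \<Longrightarrow> x \<le> 1 \<Longrightarrow> r x \<le> A * x powr (-\<beta>)"
    "integrable lborel r" "B * (\<integral>x. r x \<partial>lborel) \<le> A"
  using assms by (auto simp: cone_def)

lemma coneI:
  assumes "r \<in> borel_measurable borel" "\<And>x. 0 \<le> r x" "\<And>x. x \<notin> {0<..1} \<Longrightarrow> r x = 0"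
    "\<And>x y. 0 < x \<Longrightarrow> x \<le> y \<Longrightarrow> y \<le> 1 \<Longrightarrow> r y \<le> r x"
    "\<And>x y. 0 < x \<Longrightarrow> x \<le> y \<Longrightarrow> y \<le> 1 \<Longrightarrow> x powr (1 + \<beta>) * r x \<le> y powr (1 + \<beta>) * r y"
    "\<And>x. 0 < x \<Longrightarrow> x \<le> 1 \<Longrightarrow> r x \<le> A * x powr (-\<beta>)"
    "integrable lborel r" "B * (\<integral>x. r x \<partial>lborel) \<le> A"
  shows "r \<in> cone A"
  using assms unfolding cone_def by blast

lemma cone_mass_nonneg: "r \<in> cone A \<Longrightarrow> 0 \<le> (\<integral>x. r x \<partial>lborel)"
  by (simp add: coneD(2))

lemma cone_nonneg: "r \<in> cone A \<Longrightarrow> 0 \<le> A"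
  using coneD(8)[of r A] cone_mass_nonneg[of r A] B_pos by (meson mult_nonneg_nonneg less_imp_le order_trans)

lemma cone_pointwise:
  assumes r: "r \<in> cone A" and x: "0 < x" "x \<le> 1"
  shows "x * r x \<le> (\<integral>t. r t \<partial>lborel)"
proof -
  have "x * r x = (\<integral>t. r x * indicator {0<..x} t \<partial>lborel)" using x by simp
  also have "\<dots> \<le> (\<integral>t. r t \<partial>lborel)"
  proof (rule integral_mono)
    show "integrable lborel (\<lambda>t. r x * indicator {0<..x} t)"
      by (rule integrable_mult_right) (use x in \<open>auto simp: integrable_indicator_iff\<close>)
    show "r x * indicator {0<..x} t \<le> r t" for t
      using coneD(2)[OF r] coneD(4)[OF r, of t x] x by (auto simp: indicator_def)
  qed (rule coneD[OF r])
  finally show ?thesis .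
qed

lemma rpush_le_mass:
  assumes r: "r \<in> cone A" and y: "0 < y" "y \<le> 1"
  shows "rpush r y \<le> (\<integral>t. r t \<partial>lborel)"
proof -
  have "1 / 2 * r ((1 + y) / 2) \<le> (1 + y) / 2 * r ((1 + y) / 2)"
    using y coneD(2)[OF r] by (intro mult_right_mono) auto
  also have "\<dots> \<le> (\<integral>t. r t \<partial>lborel)" using y by (intro cone_pointwise[OF r]) auto
  finally show ?thesis using y by (simp add: rpush_def)
qed

lemma dlbr_mono:
  assumes "0 \<le> \<alpha>" "0 < x" "x \<le> y" shows "dlbr \<alpha> x \<le> dlbr \<alpha> y"
proof -
  have "(2 * x) powr \<alpha> \<le> (2 * y) powr \<alpha>" using assms by (intro powr_mono2) auto
  then show ?thesis using assms by (auto simp: dlbr_pos_eq intro!: mult_left_mono)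
qed

theorem transfer_subtract_cone:
  assumes a: "0 \<le> \<alpha>" "\<alpha> \<le> \<beta>" and r: "r \<in> cone A" and d: "0 \<le> \<delta>" "\<delta> \<le> r 1 / 16"
  shows "(\<lambda>y. transfer \<alpha> r y - \<delta> * indicator {0<..1} y) \<in> cone A"
proof (rule coneI)
  note [measurable] = coneD(1)[OF r] transfer_measurable[OF _ a(1)]
  note li = linv_bounds[OF a(1)]
  show "(\<lambda>y. transfer \<alpha> r y - \<delta> * indicator {0<..1} y) \<in> borel_measurable borel" by measurable
  show "transfer \<alpha> r y - \<delta> * indicator {0<..1} y = 0" if "y \<notin> {0<..1}" for y
    using that transfer_supp by simp
  have half: "r 1 \<le> r ((1 + y) / 2)" if "0 < y" "y \<le> 1" for y
    using coneD(4)[OF r, of "(1 + y) / 2" 1] that by simp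
  show "0 \<le> transfer \<alpha> r y - \<delta> * indicator {0<..1} y" for y
    using half[of y] lpush_nonneg[OF a(1), of r y] transfer_supp[of y \<alpha> r] d coneD(2)[OF r]
    by (cases "y \<in> {0<..1}") (auto simp: transfer_def rpush_def)
  show "transfer \<alpha> r y - \<delta> * indicator {0<..1} y \<le> transfer \<alpha> r x - \<delta> * indicator {0<..1} x"
    if xy: "0 < x" "x \<le> y" "y \<le> 1" for x y
  proof -
    have lm: "linv \<alpha> x \<le> linv \<alpha> y" using xy by (intro linv_mono[OF a(1)]) auto
    have "r (linv \<alpha> y) / dlbr \<alpha> (linv \<alpha> y) \<le> r (linv \<alpha> x) / dlbr \<alpha> (linv \<alpha> x)"
    proof (rule frac_le)
      show "r (linv \<alpha> y) \<le> r (linv \<alpha> x)" using li[of x] li[of y] xy lm by (intro coneD(4)[OF r]) auto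
      show "dlbr \<alpha> (linv \<alpha> x) \<le> dlbr \<alpha> (linv \<alpha> y)" using li[of x] xy lm by (intro dlbr_mono[OF a(1)]) auto
      show "0 < dlbr \<alpha> (linv \<alpha> x)" using dlbr_ge_1[OF a(1)] by (rule less_le_trans[rotated]) simp
    qed (rule coneD[OF r])
    moreover have "r ((1 + y) / 2) \<le> r ((1 + x) / 2)" using xy by (intro coneD(4)[OF r]) auto
    ultimately show ?thesis using xy by (simp add: transfer_def lpush_def rpush_def)
  qed
  show "x powr (1 + \<beta>) * (transfer \<alpha> r x - \<delta> * indicator {0<..1} x)
      \<le> y powr (1 + \<beta>) * (transfer \<alpha> r y - \<delta> * indicator {0<..1} y)"
    if xy: "0 < x" "x \<le> y" "y \<le> 1" for x y
  proof -
    let ?a = "1 + \<beta>"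
    have lm: "linv \<alpha> x \<le> linv \<alpha> y" using xy by (intro linv_mono[OF a(1)]) auto
    have L: "t powr ?a * lpush \<alpha> r t = (linv \<alpha> t powr ?a * r (linv \<alpha> t)) *
       ((1 + (2 * linv \<alpha> t) powr \<alpha>) powr ?a / (1 + (1 + \<alpha>) * (2 * linv \<alpha> t) powr \<alpha>))" if t: "0 < t" "t \<le> 1" for t
    proof -
      define z where "z = linv \<alpha> t"
      have z: "0 < z" "z \<le> 1/2" using li[OF t] by (auto simp: z_def)
      have "t powr ?a = (z * (1 + (2 * z) powr \<alpha>)) powr ?a"
        using lbr_linv[OF a(1), of t] t z by (simp add: z_def lbr_pos_eq)
      also have "\<dots> = z powr ?a * (1 + (2 * z) powr \<alpha>) powr ?a" using z by (simp add: powr_mult)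
      finally show ?thesis using t z by (simp add: lpush_def dlbr_pos_eq flip: z_def)
    qed
    have "x powr ?a * lpush \<alpha> r x \<le> y powr ?a * lpush \<alpha> r y"
      unfolding L[OF xy(1) order_trans[OF xy(2,3)]] L[OF less_le_trans[OF xy(1,2)] xy(3)]
    proof (rule mult_mono)
      show "linv \<alpha> x powr ?a * r (linv \<alpha> x) \<le> linv \<alpha> y powr ?a * r (linv \<alpha> y)"
        using li[of x] li[of y] xy lm by (intro coneD(5)[OF r]) auto
      have "(2 * linv \<alpha> x) powr \<alpha> \<le> (2 * linv \<alpha> y) powr \<alpha>"
        using li[of x] xy lm a by (intro powr_mono2) auto
      then show "(1 + (2 * linv \<alpha> x) powr \<alpha>) powr (1 + \<beta>) / (1 + (1 + \<alpha>) * (2 * linv \<alpha> x) powr \<alpha>)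
        \<le> (1 + (2 * linv \<alpha> y) powr \<alpha>) powr (1 + \<beta>) / (1 + (1 + \<alpha>) * (2 * linv \<alpha> y) powr \<alpha>)"
        by (intro distortion_mono a) auto
    qed (use a coneD(2)[OF r] in auto)
    moreover have "x powr ?a * (rpush r x - \<delta>) \<le> y powr ?a * (rpush r y - \<delta>)"
    proof -
      define R where "R t = ((1 + t) / 2) powr ?a * r ((1 + t) / 2)" for t
      define p where "p t = (2 * t / (1 + t)) powr ?a" for t
      have E: "t powr ?a * rpush r t = p t * R t / 2" if t: "0 < t" "t \<le> 1" for t
      proof -
        have "p t * ((1 + t) / 2) powr ?a = t powr ?a"
        proof -
          have "2 * t / (1 + t) * ((1 + t) / 2) = t" using t by simp
          then show ?thesis unfolding p_def using t by (simp only: powr_mult[symmetric])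
        qed
        then show ?thesis using t by (simp add: R_def rpush_def)
      qed
      have Rm: "R x \<le> R y" unfolding R_def using xy by (intro coneD(5)[OF r]) auto
      have "1 / 4 * r 1 \<le> R x"
      proof -
        have "(1/2::real) powr 2 \<le> (1/2) powr ?a" using beta_less_1 by (intro powr_mono') auto
        also have "\<dots> \<le> ((1 + x) / 2) powr ?a" using xy beta_pos by (intro powr_mono2) auto
        finally have "1 / 4 \<le> ((1 + x) / 2) powr ?a" by (simp add: power2_eq_square)
        then show ?thesis unfolding R_def using half[of x] xy coneD(2)[OF r, of 1] by (intro mult_mono) auto
      qed
      then have dR: "\<delta> \<le> R x / 4" using d by simp
      have pd: "y powr ?a / 2 - x powr ?a / 2 \<le> p y - p x" using right_mono[OF xy] by (simp add: p_def)
      have xa: "0 \<le> y powr ?a - x powr ?a" using xy beta_pos powr_mono2[of ?a x y] by simp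
      have "\<delta> * (y powr ?a - x powr ?a) \<le> R x / 4 * (y powr ?a - x powr ?a)"
        using dR xa by (rule mult_right_mono)
      also have "\<dots> = R x / 2 * (y powr ?a / 2 - x powr ?a / 2)" by (simp add: algebra_simps)
      also have "\<dots> \<le> R x / 2 * (p y - p x)"
        using pd dR d by (intro mult_left_mono) auto
      also have "\<dots> \<le> p y * R y / 2 - p x * R x / 2"
      proof -
        have "p y * R x \<le> p y * R y" using Rm by (intro mult_left_mono) (auto simp: p_def)
        then show ?thesis by (simp add: field_simps)
      qed
      finally show ?thesis using E[of x] E[of y] xy by (simp add: algebra_simps)
    qed
    ultimately show ?thesis using xy by (simp add: transfer_def algebra_simps)
  qed
  have int: "integrable lborel (transfer \<alpha> r)" "(\<integral>y. transfer \<alpha> r y \<partial>lborel) = (\<integral>x. r x \<partial>lborel)"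
    using integrable_transfer[OF a(1) coneD(7)[OF r] coneD(3)[OF r]] by auto
  have ind: "integrable lborel (\<lambda>y. \<delta> * indicator {0<..1::real} y)"
    by (rule integrable_mult_right) (auto simp: integrable_indicator_iff)
  show "integrable lborel (\<lambda>y. transfer \<alpha> r y - \<delta> * indicator {0<..1} y)" using int ind by auto
  have mass: "(\<integral>y. transfer \<alpha> r y - \<delta> * indicator {0<..1} y \<partial>lborel) = (\<integral>x. r x \<partial>lborel) - \<delta>"
    using int ind by simp
  show "B * (\<integral>y. transfer \<alpha> r y - \<delta> * indicator {0<..1} y \<partial>lborel) \<le> A"
  proof -
    have "0 \<le> B * \<delta>" using d B_pos by simp
    then show ?thesis using coneD(8)[OF r] by (simp add: right_diff_distrib mass)
  qed
  show "transfer \<alpha> r y - \<delta> * indicator {0<..1} y \<le> A * y powr (-\<beta>)" if y: "0 < y" "y \<le> 1" for y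
  proof -
    have "lpush \<alpha> r y \<le> A * linv \<alpha> y powr (-\<beta>) / dlbr \<alpha> (linv \<alpha> y)"
      using y li[OF y] coneD(6)[OF r, of "linv \<alpha> y"] dlbr_ge_1[OF a(1), of "linv \<alpha> y"]
      by (auto simp: lpush_def intro!: divide_right_mono)
    moreover have "rpush r y \<le> (\<integral>x. r x \<partial>lborel)" by (rule rpush_le_mass[OF r y])
    moreover have "(\<integral>x. r x \<partial>lborel) \<le> A / B" using coneD(8)[OF r] B_pos by (simp add: field_simps)
    ultimately have "transfer \<alpha> r y \<le> A * (linv \<alpha> y powr (-\<beta>) / dlbr \<alpha> (linv \<alpha> y) + 1 / B)"
      by (simp add: transfer_def algebra_simps)
    also have "\<dots> \<le> A * (y powr (-\<beta>))"
      using tail_inequality[OF a li[OF y]] lbr_linv[OF a(1), of y] y cone_nonneg[OF r] by (intro mult_left_mono) auto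
    finally show ?thesis using d by (auto simp: indicator_def)
  qed
qed

lemma transfer_cone:
  assumes "0 \<le> \<alpha>" "\<alpha> \<le> \<beta>" "r \<in> cone A" shows "transfer \<alpha> r \<in> cone A"
  using transfer_subtract_cone[OF assms, of 0] coneD(2)[OF assms(3), of 1] by simp

section \<open>Loss of memory\<close>

primrec lpush_iter :: "(nat \<Rightarrow> real) \<Rightarrow> nat \<Rightarrow> (real \<Rightarrow> real) \<Rightarrow> real \<Rightarrow> real" where
  "lpush_iter \<alpha> 0 g = g"
| "lpush_iter \<alpha> (Suc n) g = lpush (\<alpha> (Suc n)) (lpush_iter \<alpha> n g)"

primrec transfer_iter :: "(nat \<Rightarrow> real) \<Rightarrow> nat \<Rightarrow> (real \<Rightarrow> real) \<Rightarrow> real \<Rightarrow> real" where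
  "transfer_iter \<alpha> 0 g = g"
| "transfer_iter \<alpha> (Suc n) g = transfer (\<alpha> (Suc n)) (transfer_iter \<alpha> n g)"

lemma admissibleD: "admissible \<beta> \<alpha> \<Longrightarrow> 0 \<le> \<alpha> (Suc n)" "admissible \<beta> \<alpha> \<Longrightarrow> \<alpha> (Suc n) \<le> \<beta>"
  by (auto simp: admissible_def)

lemma admissible_shift: "admissible \<beta> \<alpha> \<Longrightarrow> admissible \<beta> (\<lambda>n. \<alpha> (m + n))"
  by (auto simp: admissible_def)

lemma transfer_iter_add:
  "transfer_iter \<alpha> (m + n) g = transfer_iter (\<lambda>k. \<alpha> (m + k)) n (transfer_iter \<alpha> m g)"
  by (induction n) auto

lemma composed_map_add:
  "composed_map \<alpha> (m + n) x = composed_map (\<lambda>k. \<alpha> (m + k)) n (composed_map \<alpha> m x)"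
  by (induction n) auto

lemma composed_map_measurable [measurable]: "composed_map \<alpha> n \<in> borel_measurable borel"
proof (induction n)
  case 0 show ?case by (simp add: id_def)
next
  case (Suc n)
  show ?case unfolding composed_map.simps by (rule measurable_comp[OF Suc intermittent_measurable])
qed

lemma transfer_iter_cone: "admissible \<beta> \<alpha> \<Longrightarrow> r \<in> cone A \<Longrightarrow> transfer_iter \<alpha> n r \<in> cone A"
  by (induction n) (auto intro!: transfer_cone admissibleD)

lemma transfer_iter_diff: "transfer_iter \<alpha> n (\<lambda>x. g x - k x) y = transfer_iter \<alpha> n g y - transfer_iter \<alpha> n k y"
proof (induction n arbitrary: y)
  case (Suc n)
  have "transfer_iter \<alpha> n (\<lambda>x. g x - k x) = (\<lambda>y. transfer_iter \<alpha> n g y - transfer_iter \<alpha> n k y)"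
    using Suc by auto
  then show ?case by (simp add: transfer_diff)
qed simp

lemma transfer_iter_supp:
  "(\<And>x. x \<notin> {0<..1} \<Longrightarrow> g x = 0) \<Longrightarrow> x \<notin> {0<..1} \<Longrightarrow> transfer_iter \<alpha> n g x = 0"
  by (cases n) (auto simp: transfer_supp)

lemma integrable_transfer_iter:
  assumes "admissible \<beta> \<alpha>" "integrable lborel g" "\<And>x. x \<notin> {0<..1} \<Longrightarrow> g x = 0"
  shows "integrable lborel (transfer_iter \<alpha> n g)
    \<and> (\<integral>y. transfer_iter \<alpha> n g y \<partial>lborel) = (\<integral>x. g x \<partial>lborel)
    \<and> (\<integral>y. \<bar>transfer_iter \<alpha> n g y\<bar> \<partial>lborel) \<le> (\<integral>x. \<bar>g x\<bar> \<partial>lborel)"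
proof (induction n)
  case 0 then show ?case using assms by auto
next
  case (Suc n)
  have s: "\<And>x. x \<notin> {0<..1} \<Longrightarrow> transfer_iter \<alpha> n g x = 0" by (rule transfer_iter_supp[OF assms(3)])
  show ?case
    using integrable_transfer[OF admissibleD(1)[OF assms(1), of n], of "transfer_iter \<alpha> n g"] Suc s by auto
qed

lemma integral_transfer_iter:
  assumes adm: "admissible \<beta> \<alpha>" and "v \<in> borel_measurable borel"
    and gi: "integrable lborel g" and "\<And>x. \<bar>v x\<bar> \<le> c"
    and supp: "\<And>x. x \<notin> {0<..1} \<Longrightarrow> g x = 0"
  shows "(\<integral>y. v y * transfer_iter \<alpha> n g y \<partial>lborel) = (\<integral>x. v (composed_map \<alpha> n x) * g x \<partial>lborel)"
  using assms(2,4)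
proof (induction n arbitrary: v)
  case (Suc n)
  note [measurable] = Suc.prems(1)
  have "(\<integral>y. v y * transfer_iter \<alpha> (Suc n) g y \<partial>lborel)
     = (\<integral>y. v (intermittent_map (\<alpha> (Suc n)) y) * transfer_iter \<alpha> n g y \<partial>lborel)"
    unfolding transfer_iter.simps
    by (rule integral_transfer(2)) (use Suc.prems integrable_transfer_iter[OF adm gi supp] transfer_iter_supp[OF supp] admissibleD[OF adm] in auto)
  also have "\<dots> = (\<integral>x. v (intermittent_map (\<alpha> (Suc n)) (composed_map \<alpha> n x)) * g x \<partial>lborel)"
    by (rule Suc.IH) (use Suc.prems in auto)
  finally show ?case by simp
qed simp

text \<open>A bound, uniform over admissible sequences, for the points that stay in the left branch for
  \<open>k\<close> steps.\<close>

definition xi :: "nat \<Rightarrow> real" where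
  "xi k = (1 + \<beta> / 2 * k) powr (-1 / \<beta>)"

lemma xi_pos: "0 < xi k"
proof -
  have "0 < 1 + \<beta> / 2 * real k" using beta_pos by (intro add_pos_nonneg) auto
  then have "1 + \<beta> / 2 * real k \<noteq> 0" by linarith
  then show ?thesis unfolding xi_def by (simp only: powr_gt_zero) simp
qed

lemma xi_escape:
  assumes "0 \<le> \<alpha>" "\<alpha> \<le> \<beta>" "0 < x" "x \<le> 1/2" "lbr \<alpha> x \<le> xi k"
  shows "x \<le> xi (Suc k)"
proof -
  have p: "0 < 1 + \<beta> / 2 * real k" "0 < 1 + \<beta> / 2 * real (Suc k)" using beta_pos by (auto intro!: add_pos_nonneg)
  have l: "0 < lbr \<alpha> x" using assms by (auto simp: lbr_def intro!: mult_pos_pos add_pos_nonneg)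
  have "(q powr (-1 / \<beta>)) powr (-\<beta>) = q" if "0 < q" for q :: real
    using that beta_pos by (simp add: powr_powr)
  then have "1 + \<beta> / 2 * real k = xi k powr (-\<beta>)"
    using p(1) unfolding xi_def by metis
  also have "\<dots> \<le> lbr \<alpha> x powr (-\<beta>)"
    using assms l beta_pos by (intro powr_mono2') auto
  finally have "1 + \<beta> / 2 * real (Suc k) \<le> x powr (-\<beta>)"
    using escape_inequality[OF assms(1-4)] by (simp add: field_simps)
  then have "(x powr (-\<beta>)) powr (-1 / \<beta>) \<le> (1 + \<beta> / 2 * real (Suc k)) powr (-1 / \<beta>)"
    using p beta_pos by (intro powr_mono2') auto
  then show ?thesis using assms beta_pos by (simp add: xi_def powr_powr)
qed

lemma lpush_iter_measurable:
  "admissible \<beta> \<alpha> \<Longrightarrow> g \<in> borel_measurable borel \<Longrightarrow> lpush_iter \<alpha> n g \<in> borel_measurable borel"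
  by (induction n) (auto intro!: lpush_measurable admissibleD(1))

lemma lpush_iter_nonneg: 
  assumes "admissible \<beta> \<alpha>" "\<And>x. 0 \<le> g x" shows "0 \<le> lpush_iter \<alpha> n g x"
proof (induction n arbitrary: x)
  case (Suc n) show ?case
    unfolding lpush_iter.simps by (rule lpush_nonneg[OF admissibleD(1)[OF assms(1)] Suc])
qed (use assms in simp)

lemma nn_integral_lpush_iter:
  assumes adm: "admissible \<beta> \<alpha>" and [measurable]: "g \<in> borel_measurable borel" and nn: "\<And>x. 0 \<le> g x"
  shows "(\<integral>\<^sup>+y. indicator {0<..xi k} y * lpush_iter \<alpha> n g y \<partial>lborel)
    \<le> (\<integral>\<^sup>+x. indicator {0<..xi (k + n)} x * g x \<partial>lborel)"
proof (induction n arbitrary: k)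
  case (Suc n)
  let ?a = "\<alpha> (Suc n)" and ?G = "lpush_iter \<alpha> n g"
  note a = admissibleD[OF adm, of n]
  have [measurable]: "?G \<in> borel_measurable borel" by (rule lpush_iter_measurable[OF adm]) simp
  have Gn: "0 \<le> ?G x" for x by (rule lpush_iter_nonneg[OF adm nn])
  have "(\<integral>\<^sup>+y. ennreal (indicator {0<..xi k} y * lpush_iter \<alpha> (Suc n) g y) \<partial>lborel)
    = (\<integral>\<^sup>+x. ennreal (indicator {0<..xi k} (lbr ?a x) * (?G x * indicator {0<..1/2} x)) \<partial>lborel)"
    unfolding lpush_iter.simps by (rule nn_integral_lpush[OF a(1)]) (auto simp: Gn)
  also have "\<dots> \<le> (\<integral>\<^sup>+x. ennreal (indicator {0<..xi (Suc k)} x * ?G x) \<partial>lborel)"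
    using xi_escape[OF a] Gn by (intro nn_integral_mono ennreal_leI) (auto simp: indicator_def)
  also have "\<dots> \<le> (\<integral>\<^sup>+x. ennreal (indicator {0<..xi (Suc k + n)} x * g x) \<partial>lborel)"
    by (rule Suc.IH)
  finally show ?case by simp
qed simp

lemma nn_integral_powr_near_0:
  assumes "0 \<le> c" "0 \<le> A"
  shows "(\<integral>\<^sup>+x. ennreal (A * x powr (-\<beta>) * indicator {0<..c} x) \<partial>lborel) = ennreal (A * c powr (1 - \<beta>) / (1 - \<beta>))"
proof -
  have "((\<lambda>x. x powr (-\<beta>)) has_integral (c powr (-\<beta> + 1) / (-\<beta> + 1))) {0..c}"
    using beta_less_1 assms by (intro has_integral_powr_from_0) auto
  then have "((\<lambda>x. A * x powr (-\<beta>)) has_integral (A * (c powr (-\<beta> + 1) / (-\<beta> + 1)))) {0..c}"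
    by (rule has_integral_mult_right)
  then have "(\<integral>\<^sup>+x. ennreal (A * x powr (-\<beta>)) * indicator {0..c} x \<partial>lborel) = ennreal (A * (c powr (-\<beta> + 1) / (-\<beta> + 1)))"
    by (intro nn_integral_has_integral_lebesgue') (use assms in auto)
  also have "(\<integral>\<^sup>+x. ennreal (A * x powr (-\<beta>)) * indicator {0..c} x \<partial>lborel) = (\<integral>\<^sup>+x. ennreal (A * x powr (-\<beta>) * indicator {0<..c} x) \<partial>lborel)"
    by (intro nn_integral_cong) (auto simp: indicator_def)
  finally show ?thesis by (simp add: algebra_simps)
qed

text \<open>Splits a pushed forward density into the part that never left the left branch and the rest,
  whose tail is controlled by its mass alone.\<close>

lemma transfer_iter_split:
  assumes adm: "admissible \<beta> \<alpha>" and r: "r \<in> cone A" and y: "0 < y" "y \<le> 1"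
  shows "transfer_iter \<alpha> n r y \<le> lpush_iter \<alpha> n r y + B * (\<integral>x. r x \<partial>lborel) * y powr (-\<beta>)"
  using y
proof (induction n arbitrary: y)
  case 0 then show ?case using B_pos cone_mass_nonneg[OF r] by simp
next
  case (Suc n)
  let ?a = "\<alpha> (Suc n)" and ?m = "\<integral>x. r x \<partial>lborel" and ?P = "transfer_iter \<alpha> n r" and ?z = "linv (\<alpha> (Suc n)) y"
  note a = admissibleD[OF adm, of n]
  have z: "0 < ?z" "?z \<le> 1/2" using linv_bounds[OF a(1)] Suc.prems by auto
  have "lpush ?a ?P y \<le> (lpush_iter \<alpha> n r ?z + B * ?m * ?z powr (-\<beta>)) / dlbr ?a ?z"
    using Suc.IH[of ?z] z Suc.prems dlbr_ge_1[OF a(1), of ?z] by (auto simp: lpush_def intro!: divide_right_mono)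
  also have "\<dots> = lpush_iter \<alpha> (Suc n) r y + B * ?m * (?z powr (-\<beta>) / dlbr ?a ?z)"
    using Suc.prems by (simp add: lpush_def add_divide_distrib)
  finally have 1: "lpush ?a ?P y \<le> lpush_iter \<alpha> (Suc n) r y + B * ?m * (?z powr (-\<beta>) / dlbr ?a ?z)" .
  have 2: "rpush ?P y \<le> ?m"
    using rpush_le_mass[OF transfer_iter_cone[OF adm r, of n] Suc.prems] integrable_transfer_iter[OF adm coneD(7)[OF r] coneD(3)[OF r], of n] by simp
  have "transfer_iter \<alpha> (Suc n) r y \<le> lpush_iter \<alpha> (Suc n) r y + B * ?m * (?z powr (-\<beta>) / dlbr ?a ?z + 1 / B)"
    using 1 2 B_pos by (simp add: transfer_def algebra_simps)
  also have "B * ?m * (?z powr (-\<beta>) / dlbr ?a ?z + 1 / B) \<le> B * ?m * y powr (-\<beta>)"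
    using tail_inequality[OF a z] lbr_linv[OF a(1), of y] Suc.prems B_pos cone_mass_nonneg[OF r]
    by (intro mult_left_mono) auto
  finally show ?case by simp
qed

definition kappa :: real where "kappa = ((1 - \<beta>) / (4 * B)) powr (1 / (1 - \<beta>))"

lemma kappa_pos: "0 < kappa" using beta_less_1 B_pos by (simp add: kappa_def)

lemma kappa_le_1: "kappa \<le> 1"
  unfolding kappa_def using beta_pos beta_less_1 B_ge_1 by (intro powr_le1) (auto simp: field_simps)

lemma transfer_iter_lower_bound:
  assumes adm: "admissible \<beta> \<alpha>" and r: "r \<in> cone A"
    and n: "A * xi n powr (1 - \<beta>) / (1 - \<beta>) \<le> (\<integral>x. r x \<partial>lborel) / 4"
  shows "kappa powr (1 + \<beta>) * (\<integral>x. r x \<partial>lborel) / 2 \<le> transfer_iter \<alpha> n r 1"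
proof -
  let ?P = "transfer_iter \<alpha> n r" and ?L = "lpush_iter \<alpha> n r"
  define m where "m = (\<integral>x. r x \<partial>lborel)"
  have m0: "0 \<le> m" unfolding m_def by (rule cone_mass_nonneg[OF r])
  have P: "?P \<in> cone A" by (rule transfer_iter_cone[OF adm r])
  note [measurable] = coneD(1)[OF r] coneD(1)[OF P] lpush_iter_measurable[OF adm coneD(1)[OF r]]
  have Ln: "0 \<le> ?L x" for x by (rule lpush_iter_nonneg[OF adm coneD(2)[OF r]])
  have xi0: "xi 0 = 1" by (simp add: xi_def)
  have "ennreal m = (\<integral>\<^sup>+y. ennreal (?P y) \<partial>lborel)"
    using integrable_transfer_iter[OF adm coneD(7)[OF r] coneD(3)[OF r], of n] coneD(2)[OF P]
    by (subst nn_integral_eq_integral) (auto simp: m_def)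
  also have "\<dots> \<le> (\<integral>\<^sup>+y. ennreal (indicator {0<..xi 0} y * ?L y)
      + (ennreal (B * m * y powr (-\<beta>) * indicator {0<..kappa} y) + ennreal (?P kappa * indicator {kappa<..1} y)) \<partial>lborel)"
  proof (intro nn_integral_mono)
    fix y
    consider "y \<notin> {0<..1}" | "0 < y" "y \<le> kappa" | "kappa < y" "y \<le> 1"
      unfolding greaterThanAtMost_iff by linarith
    then show "ennreal (?P y) \<le> ennreal (indicator {0<..xi 0} y * ?L y)
      + (ennreal (B * m * y powr (-\<beta>) * indicator {0<..kappa} y) + ennreal (?P kappa * indicator {kappa<..1} y))"
    proof cases
      case 1 then show ?thesis using coneD(3)[OF P, of y] by simp
    next
      case 2
      then have "?P y \<le> ?L y + B * m * y powr (-\<beta>)"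
        using transfer_iter_split[OF adm r, of y n] kappa_le_1 by (auto simp: m_def)
      then have "ennreal (?P y) \<le> ennreal (?L y + B * m * y powr (-\<beta>))" by (rule ennreal_leI)
      also have "\<dots> = ennreal (?L y) + ennreal (B * m * y powr (-\<beta>))"
        using Ln B_pos m0 by (intro ennreal_plus) auto
      finally show ?thesis using 2 kappa_le_1 by (simp add: xi0)
    next
      case 3
      then have "?P y \<le> ?P kappa" using coneD(4)[OF P, of kappa y] kappa_pos by simp
      then have "ennreal (?P y) \<le> 0 + (0 + ennreal (?P kappa * indicator {kappa<..1} y))"
        using 3 by (simp add: ennreal_leI)
      also have "\<dots> \<le> ennreal (indicator {0<..xi 0} y * ?L y)
        + (ennreal (B * m * y powr (-\<beta>) * indicator {0<..kappa} y) + ennreal (?P kappa * indicator {kappa<..1} y))"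
        by (intro add_mono zero_le order_refl)
      finally show ?thesis .
    qed
  qed
  also have "\<dots> = (\<integral>\<^sup>+y. ennreal (indicator {0<..xi 0} y * ?L y) \<partial>lborel)
      + ((\<integral>\<^sup>+y. ennreal (B * m * y powr (-\<beta>) * indicator {0<..kappa} y) \<partial>lborel)
        + (\<integral>\<^sup>+y. ennreal (?P kappa * indicator {kappa<..1} y) \<partial>lborel))"
    by (rule trans[OF nn_integral_add arg_cong2[where f="(+)", OF refl nn_integral_add]]; measurable)
  also have "\<dots> \<le> ennreal (m / 4) + (ennreal (m / 4) + ennreal (?P kappa))"
  proof (intro add_mono)
    have "(\<integral>\<^sup>+y. ennreal (indicator {0<..xi 0} y * ?L y) \<partial>lborel) \<le> (\<integral>\<^sup>+x. ennreal (indicator {0<..xi n} x * r x) \<partial>lborel)"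
      using nn_integral_lpush_iter[OF adm coneD(1)[OF r] coneD(2)[OF r], of 0 n] by simp
    also have "\<dots> \<le> (\<integral>\<^sup>+x. ennreal (A * x powr (-\<beta>) * indicator {0<..xi n} x) \<partial>lborel)"
    proof (intro nn_integral_mono ennreal_leI)
      fix x
      show "indicator {0<..xi n} x * r x \<le> A * x powr (-\<beta>) * indicator {0<..xi n} x"
        using coneD(6)[OF r, of x] coneD(3)[OF r, of x] cone_nonneg[OF r]
        by (cases "x \<in> {0<..1}") (auto simp: indicator_def)
    qed
    also have "\<dots> = ennreal (A * xi n powr (1 - \<beta>) / (1 - \<beta>))"
      by (rule nn_integral_powr_near_0) (use xi_pos[of n] cone_nonneg[OF r] in auto)
    also have "\<dots> \<le> ennreal (m / 4)" using n by (intro ennreal_leI) (simp add: m_def)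
    finally show "(\<integral>\<^sup>+y. ennreal (indicator {0<..xi 0} y * ?L y) \<partial>lborel) \<le> ennreal (m / 4)" .
    have "kappa powr (1 - \<beta>) = (1 - \<beta>) / (4 * B)"
      using beta_less_1 B_pos by (simp add: kappa_def powr_powr)
    moreover have "B * m * (b / (4 * B)) / b = m / 4" if "b \<noteq> 0" for b using that B_pos by simp
    ultimately have "B * m * kappa powr (1 - \<beta>) / (1 - \<beta>) = m / 4" using beta_less_1 by simp
    then show "(\<integral>\<^sup>+y. ennreal (B * m * y powr (-\<beta>) * indicator {0<..kappa} y) \<partial>lborel) \<le> ennreal (m / 4)"
      by (subst nn_integral_powr_near_0) (use kappa_pos B_pos m0 in auto)
    have "(\<integral>\<^sup>+y. ennreal (?P kappa * indicator {kappa<..1} y) \<partial>lborel) = ennreal (?P kappa) * ennreal (1 - kappa)"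
      using kappa_le_1 coneD(2)[OF P]
      by (simp add: ennreal_mult' ennreal_indicator nn_integral_cmult_indicator)
    also have "\<dots> \<le> ennreal (?P kappa) * 1" using kappa_pos by (intro mult_left_mono) auto
    finally show "(\<integral>\<^sup>+y. ennreal (?P kappa * indicator {kappa<..1} y) \<partial>lborel) \<le> ennreal (?P kappa)" by simp
  qed
  also have "\<dots> = ennreal (m / 4 + (m / 4 + ?P kappa))"
  proof -
    have "0 \<le> m / 4" "0 \<le> ?P kappa" "0 \<le> m / 4 + ?P kappa" using m0 coneD(2)[OF P, of kappa] by auto
    then show ?thesis by (simp only: ennreal_plus)
  qed
  finally have "m \<le> m / 4 + (m / 4 + ?P kappa)"
    using m0 coneD(2)[OF P, of kappa] by (subst (asm) ennreal_le_iff) auto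
  then have "m / 2 \<le> ?P kappa" by simp
  then have "kappa powr (1 + \<beta>) * (m / 2) \<le> kappa powr (1 + \<beta>) * ?P kappa" by (intro mult_left_mono) auto
  also have "\<dots> \<le> 1 powr (1 + \<beta>) * ?P 1"
    using kappa_pos kappa_le_1 by (intro coneD(5)[OF P]) auto
  finally show ?thesis by (simp add: m_def)
qed

definition eta :: real where "eta = kappa powr (1 + \<beta>) / 32"

lemma eta_pos: "0 < eta" using kappa_pos by (simp add: eta_def)
lemma eta_less_1: "eta < 1"
  using powr_le1[of "1 + \<beta>" kappa] kappa_pos kappa_le_1 beta_pos by (simp add: eta_def)

lemma regeneration_round:
  assumes adm: "admissible \<beta> \<alpha>" and r: "r \<in> cone A" "(\<integral>x. r x \<partial>lborel) = m"
    and n: "A * xi n powr (1 - \<beta>) / (1 - \<beta>) \<le> m / 4"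
  shows "(\<lambda>y. transfer_iter \<alpha> (Suc n) r y - eta * m * indicator {0<..1} y) \<in> cone A"
    and "(\<integral>y. transfer_iter \<alpha> (Suc n) r y - eta * m * indicator {0<..1} y \<partial>lborel) = (1 - eta) * m"
proof -
  have "eta * m \<le> transfer_iter \<alpha> n r 1 / 16"
    using transfer_iter_lower_bound[OF adm r(1), of n] n r(2) by (simp add: eta_def mult.commute)
  moreover have "0 \<le> eta * m" using eta_pos cone_mass_nonneg[OF r(1)] r(2) by simp
  ultimately show "(\<lambda>y. transfer_iter \<alpha> (Suc n) r y - eta * m * indicator {0<..1} y) \<in> cone A"
    using transfer_subtract_cone[OF admissibleD[OF adm, of n] transfer_iter_cone[OF adm r(1)]] by simp
  have "integrable lborel (\<lambda>y. eta * m * indicator {0<..1::real} y)"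
    by (rule integrable_mult_right) (auto simp: integrable_indicator_iff)
  then show "(\<integral>y. transfer_iter \<alpha> (Suc n) r y - eta * m * indicator {0<..1} y \<partial>lborel) = (1 - eta) * m"
    using integrable_transfer_iter[OF adm coneD(7)[OF r(1)] coneD(3)[OF r(1)], of "Suc n"] r(2)
    by (subst Bochner_Integration.integral_diff) (auto simp: algebra_simps)
qed

definition rate :: real where "rate = 1 / \<beta> - 1"

lemma rate_pos: "0 < rate" using beta_pos beta_less_1 by (simp add: rate_def)

lemma xi_mass_bound:
  assumes "0 < D" "D \<le> \<beta> / 2 * real n"
  shows "xi n powr (1 - \<beta>) \<le> D powr (- rate)"
proof -
  have "xi n powr (1 - \<beta>) = (1 + \<beta> / 2 * real n) powr (- rate)"
    using beta_pos by (simp add: xi_def powr_powr rate_def field_simps)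
  also have "\<dots> \<le> D powr (- rate)"
    using assms rate_pos by (intro powr_mono2') auto
  finally show ?thesis .
qed

definition growth :: real where "growth = (1 - eta) powr (- 1 / rate)"

lemma growth_gt_1: "1 < growth"
proof -
  have "growth = (1 / (1 - eta)) powr (1 / rate)"
    using eta_less_1 by (simp add: growth_def powr_divide powr_minus_divide)
  moreover have "1 < (1 / (1 - eta)) powr (1 / rate)"
    using eta_pos eta_less_1 rate_pos by (intro gr_one_powr) auto
  ultimately show ?thesis by simp
qed

lemma growth_powr_rate: "(growth ^ k) powr (- rate) = (1 - eta) ^ k"
proof -
  have "growth powr (- rate) = 1 - eta"
    using eta_less_1 rate_pos by (simp add: growth_def powr_powr)
  then have "(growth powr (- rate)) ^ k = (1 - eta) ^ k" by simp
  then show ?thesis using growth_gt_1 by (simp add: powr_power mult.commute flip: powr_realpow)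
     (simp add: powr_powr mult.commute)
qed

definition wait_scale :: real where "wait_scale = ((1 - \<beta>) / (4 * B)) powr (- 1 / rate)"

text \<open>The mass left after \<open>k\<close> rounds is proportional to \<open>(1 - eta) ^ k\<close> while the cone parameter
  \<open>A\<close> stays the same, so the waiting times grow geometrically.\<close>

definition wait :: "nat \<Rightarrow> nat" where
  "wait k = nat \<lceil>2 / \<beta> * (wait_scale * growth ^ Suc k)\<rceil>"

lemma wait_scale_pos: "0 < wait_scale"
  using beta_less_1 B_pos by (simp add: wait_scale_def)

lemma wait_sufficient:
  "xi (wait k) powr (1 - \<beta>) / (1 - \<beta>) \<le> (1 - eta) ^ Suc k / (4 * B)"
proof -
  have "xi (wait k) powr (1 - \<beta>) \<le> (wait_scale * growth ^ Suc k) powr (- rate)"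
  proof (rule xi_mass_bound)
    show "0 < wait_scale * growth ^ Suc k" using wait_scale_pos growth_gt_1 by (intro mult_pos_pos zero_less_power) auto
    have "2 / \<beta> * (wait_scale * growth ^ Suc k) \<le> real (wait k)"
      unfolding wait_def by (rule real_nat_ceiling_ge)
    then have "\<beta> / 2 * (2 / \<beta> * (wait_scale * growth ^ Suc k)) \<le> \<beta> / 2 * real (wait k)"
      using beta_pos by (intro mult_left_mono) auto
    then show "wait_scale * growth ^ Suc k \<le> \<beta> / 2 * real (wait k)" using beta_pos by simp
  qed
  also have "\<dots> = wait_scale powr (- rate) * (growth ^ Suc k) powr (- rate)"
    using wait_scale_pos growth_gt_1 by (intro powr_mult) 
  also have "\<dots> = (1 - \<beta>) / (4 * B) * (1 - eta) ^ Suc k"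
    unfolding growth_powr_rate using beta_less_1 B_pos rate_pos by (simp add: wait_scale_def powr_powr)
  finally have "xi (wait k) powr (1 - \<beta>) / (1 - \<beta>) \<le> (1 - \<beta>) / (4 * B) * (1 - eta) ^ Suc k / (1 - \<beta>)"
    using beta_less_1 by (intro divide_right_mono) auto
  then show ?thesis using beta_less_1 by simp
qed

definition wait_total :: "nat \<Rightarrow> nat" where "wait_total k = (\<Sum>j<k. Suc (wait j))"

definition wait_const :: real where "wait_const = (2 / \<beta> * wait_scale * growth + 2) / (growth - 1)"

lemma wait_const_pos: "0 < wait_const"
  using wait_scale_pos growth_gt_1 beta_pos by (auto simp: wait_const_def intro!: divide_pos_pos add_pos_pos mult_pos_pos)

lemma wait_total_le: "real (wait_total k) \<le> wait_const * growth ^ k"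
proof -
  have "real (wait_total k) = (\<Sum>j<k. 1 + real (wait j))" by (simp add: wait_total_def)
  also have "\<dots> \<le> (\<Sum>j<k. (2 / \<beta> * wait_scale * growth + 2) * growth ^ j)"
  proof (rule sum_mono)
    fix j
    have nn: "0 \<le> 2 / \<beta> * (wait_scale * growth ^ Suc j)"
      using wait_scale_pos growth_gt_1 beta_pos by (intro mult_nonneg_nonneg zero_le_power) auto
    have "real (wait j) \<le> 2 / \<beta> * (wait_scale * growth ^ Suc j) + 1"
      unfolding wait_def using nn by (simp only: real_nat_ceiling_ge of_nat_nat zero_le_ceiling) linarith
    moreover have "1 \<le> growth ^ j" using growth_gt_1 by (intro one_le_power) simp
    ultimately show "1 + real (wait j) \<le> (2 / \<beta> * wait_scale * growth + 2) * growth ^ j"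
      by (simp add: algebra_simps)
  qed
  also have "\<dots> = (2 / \<beta> * wait_scale * growth + 2) * ((growth ^ k - 1) / (growth - 1))"
    using growth_gt_1 by (subst sum_distrib_left[symmetric], subst geometric_sum) auto
  also have "\<dots> \<le> (2 / \<beta> * wait_scale * growth + 2) * (growth ^ k / (growth - 1))"
    using growth_gt_1 wait_scale_pos beta_pos by (intro mult_left_mono divide_right_mono add_nonneg_nonneg) auto
  finally show ?thesis by (simp add: wait_const_def)
qed

lemma coupling_representation:
  assumes "admissible \<beta> \<alpha>" "r1 \<in> cone A" "r2 \<in> cone A" "(\<integral>x. r1 x \<partial>lborel) = (\<integral>x. r2 x \<partial>lborel)" "wait_total k \<le> n"
  shows "\<exists>s1\<in>cone A. \<exists>s2\<in>cone A. (\<integral>x. s1 x \<partial>lborel) = (\<integral>x. s2 x \<partial>lborel)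
    \<and> (\<integral>x. s1 x \<partial>lborel) \<le> A / B * (1 - eta) ^ k
    \<and> (\<forall>x. transfer_iter \<alpha> n r1 x - transfer_iter \<alpha> n r2 x = s1 x - s2 x)"
  using assms(5)
proof (induction k arbitrary: n)
  case 0
  have i: "(\<integral>x. transfer_iter \<alpha> n r1 x \<partial>lborel) = (\<integral>x. r1 x \<partial>lborel)" "(\<integral>x. transfer_iter \<alpha> n r2 x \<partial>lborel) = (\<integral>x. r2 x \<partial>lborel)"
    using integrable_transfer_iter[OF assms(1) coneD(7)[OF assms(2)] coneD(3)[OF assms(2)], of n]
      integrable_transfer_iter[OF assms(1) coneD(7)[OF assms(3)] coneD(3)[OF assms(3)], of n] by auto
  have "(\<integral>x. r1 x \<partial>lborel) \<le> A / B" using coneD(8)[OF assms(2)] B_pos by (simp add: field_simps)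
  then show ?case using i assms by (intro bexI[of _ "transfer_iter \<alpha> n r1"] bexI[of _ "transfer_iter \<alpha> n r2"]) (auto intro: transfer_iter_cone)
next
  case (Suc k)
  define p where "p = n - Suc (wait k)"
  have n: "n = p + Suc (wait k)" and p: "wait_total k \<le> p" using Suc.prems by (auto simp: p_def wait_total_def)
  obtain s1 s2 where s: "s1 \<in> cone A" "s2 \<in> cone A" "(\<integral>x. s1 x \<partial>lborel) = (\<integral>x. s2 x \<partial>lborel)"
    "(\<integral>x. s1 x \<partial>lborel) \<le> A / B * (1 - eta) ^ k"
    "\<And>x. transfer_iter \<alpha> p r1 x - transfer_iter \<alpha> p r2 x = s1 x - s2 x"
    using Suc.IH[OF p] by blast
  define m where "m = (\<integral>x. s1 x \<partial>lborel)"
  define \<alpha>' where "\<alpha>' = (\<lambda>j. \<alpha> (p + j))"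
  have adm: "admissible \<beta> \<alpha>'" unfolding \<alpha>'_def by (rule admissible_shift[OF assms(1)])
  have eq: "transfer_iter \<alpha> n r1 x - transfer_iter \<alpha> n r2 x
      = transfer_iter \<alpha>' (Suc (wait k)) s1 x - transfer_iter \<alpha>' (Suc (wait k)) s2 x" for x
  proof -
    have "transfer_iter \<alpha> n r1 x - transfer_iter \<alpha> n r2 x
      = transfer_iter \<alpha>' (Suc (wait k)) (\<lambda>x. transfer_iter \<alpha> p r1 x - transfer_iter \<alpha> p r2 x) x"
      unfolding n transfer_iter_add transfer_iter_diff \<alpha>'_def ..
    also have "\<dots> = transfer_iter \<alpha>' (Suc (wait k)) (\<lambda>x. s1 x - s2 x) x" unfolding s(5) ..
    finally show ?thesis by (simp only: transfer_iter_diff)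
  qed
  show ?case
  proof (cases "m \<le> A / B * (1 - eta) ^ Suc k")
    case True
    have i: "(\<integral>x. transfer_iter \<alpha>' (Suc (wait k)) s1 x \<partial>lborel) = (\<integral>x. s1 x \<partial>lborel)"
      "(\<integral>x. transfer_iter \<alpha>' (Suc (wait k)) s2 x \<partial>lborel) = (\<integral>x. s2 x \<partial>lborel)"
      using integrable_transfer_iter[OF adm coneD(7)[OF s(1)] coneD(3)[OF s(1)], of "Suc (wait k)"]
        integrable_transfer_iter[OF adm coneD(7)[OF s(2)] coneD(3)[OF s(2)], of "Suc (wait k)"] by auto
    show ?thesis
      using True i eq s(3) transfer_iter_cone[OF adm s(1), of "Suc (wait k)"] transfer_iter_cone[OF adm s(2), of "Suc (wait k)"]
      unfolding m_def
      by (intro bexI[of _ "transfer_iter \<alpha>' (Suc (wait k)) s1"] bexI[of _ "transfer_iter \<alpha>' (Suc (wait k)) s2"])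
         (auto simp del: transfer_iter.simps)
  next
    case False
    have "A * xi (wait k) powr (1 - \<beta>) / (1 - \<beta>) \<le> A * ((1 - eta) ^ Suc k / (4 * B))"
      using mult_left_mono[OF wait_sufficient[of k] cone_nonneg[OF s(1)]] by simp
    also have "\<dots> \<le> m / 4" using False by simp
    finally have w: "A * xi (wait k) powr (1 - \<beta>) / (1 - \<beta>) \<le> m / 4" .
    have m2: "(\<integral>x. s2 x \<partial>lborel) = m" using s(3) by (simp add: m_def)
    note R1 = regeneration_round[OF adm s(1) m_def[symmetric] w] and R2 = regeneration_round[OF adm s(2) m2 w]
    have "(1 - eta) * m \<le> (1 - eta) * (A / B * (1 - eta) ^ k)"
      using s(4) eta_less_1 by (intro mult_left_mono) (auto simp: m_def)
    moreover have "(1 - eta) * (A / B * (1 - eta) ^ k) = A / B * (1 - eta) ^ Suc k" by simp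
    ultimately have "(\<integral>y. transfer_iter \<alpha>' (Suc (wait k)) s1 y - eta * m * indicator {0<..1} y \<partial>lborel) \<le> A / B * (1 - eta) ^ Suc k"
      unfolding R1(2) by (simp add: ac_simps)
    then show ?thesis
      using R1 R2 by (intro bexI[OF _ R1(1)] bexI[OF _ R2(1)] conjI) (simp_all only: eq, simp)
  qed
qed

definition loss_const :: real where
  "loss_const = 2 / B * max 1 ((wait_const * growth) powr rate)"

lemma loss_const_pos: "0 < loss_const" using B_pos by (simp add: loss_const_def)

theorem memory_loss:
  assumes adm: "admissible \<beta> \<alpha>" and r: "r1 \<in> cone A" "r2 \<in> cone A" "(\<integral>x. r1 x \<partial>lborel) = (\<integral>x. r2 x \<partial>lborel)"
    and n: "0 < n"
  shows "(\<integral>x. \<bar>transfer_iter \<alpha> n r1 x - transfer_iter \<alpha> n r2 x\<bar> \<partial>lborel) \<le> loss_const * A * real n powr (- rate)"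
proof -
  have A: "0 \<le> A" by (rule cone_nonneg[OF r(1)])
  have step: "(\<integral>x. \<bar>transfer_iter \<alpha> n r1 x - transfer_iter \<alpha> n r2 x\<bar> \<partial>lborel) \<le> 2 * A / B * (1 - eta) ^ k"
    if k: "wait_total k \<le> n" for k
  proof -
    obtain s1 s2 where s: "s1 \<in> cone A" "s2 \<in> cone A" "(\<integral>x. s1 x \<partial>lborel) = (\<integral>x. s2 x \<partial>lborel)"
      "(\<integral>x. s1 x \<partial>lborel) \<le> A / B * (1 - eta) ^ k"
      "\<And>x. transfer_iter \<alpha> n r1 x - transfer_iter \<alpha> n r2 x = s1 x - s2 x"
      using coupling_representation[OF adm r k] by blast
    have "(\<integral>x. \<bar>s1 x - s2 x\<bar> \<partial>lborel) \<le> (\<integral>x. s1 x + s2 x \<partial>lborel)"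
    proof (rule integral_mono)
      show "\<bar>s1 x - s2 x\<bar> \<le> s1 x + s2 x" for x using coneD(2)[OF s(1), of x] coneD(2)[OF s(2), of x] by simp
    qed (use coneD(7)[OF s(1)] coneD(7)[OF s(2)] in auto)
    also have "\<dots> = 2 * (\<integral>x. s1 x \<partial>lborel)" using coneD(7)[OF s(1)] coneD(7)[OF s(2)] s(3) by simp
    finally show ?thesis using s(4,5) by simp
  qed
  show ?thesis
  proof (cases "real n < wait_const * growth")
    case True
    have "1 \<le> (wait_const * growth / real n) powr rate"
      using True n rate_pos by (intro ge_one_powr_ge_zero) auto
    also have "\<dots> = (wait_const * growth) powr rate * real n powr (- rate)"
      using n by (simp add: powr_divide powr_minus field_simps)
    finally have "2 * A / B * 1 \<le> 2 * A / B * ((wait_const * growth) powr rate * real n powr (- rate))"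
      using A B_pos by (intro mult_left_mono) auto
    also have "\<dots> = 2 / B * (wait_const * growth) powr rate * (A * real n powr (- rate))" by simp
    also have "\<dots> \<le> loss_const * (A * real n powr (- rate))"
      unfolding loss_const_def using A B_pos by (intro mult_right_mono mult_left_mono) auto
    finally show ?thesis using step[of 0] by (simp add: wait_total_def)
  next
    case False
    obtain k where k: "wait_const * growth ^ k \<le> real n" "real n < wait_const * growth ^ Suc k"
    proof -
      have "\<exists>k. real n < wait_const * growth ^ k"
      proof -
        obtain k where "real n / wait_const < growth ^ k" using real_arch_pow[OF growth_gt_1] by blast
        then show ?thesis using wait_const_pos by (auto simp: field_simps)
      qed
      then have L: "real n < wait_const * growth ^ (LEAST k. real n < wait_const * growth ^ k)" by (rule LeastI_ex)
      moreover have "(LEAST k. real n < wait_const * growth ^ k) \<noteq> 0"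
      proof
        assume "(LEAST k. real n < wait_const * growth ^ k) = 0"
        then have "real n < wait_const * 1" using L by simp
        also have "\<dots> \<le> wait_const * growth" using wait_const_pos growth_gt_1 by (intro mult_left_mono) auto
        finally show False using False by simp
      qed
      then obtain k where "(LEAST k. real n < wait_const * growth ^ k) = Suc k" using not0_implies_Suc by blast
      moreover from this have "\<not> real n < wait_const * growth ^ k" by (intro not_less_Least) simp
      ultimately show ?thesis using that[of k] by auto
    qed
    have "wait_total k \<le> n" using wait_total_le[of k] k(1) by linarith
    note step[OF this]
    also have "2 * A / B * (1 - eta) ^ k \<le> 2 * A / B * ((wait_const * growth) powr rate * real n powr (- rate))"
    proof (rule mult_left_mono)
      have "(1 - eta) ^ k = (growth ^ k) powr (- rate)" by (simp add: growth_powr_rate)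
      also have "\<dots> \<le> (real n / (wait_const * growth)) powr (- rate)"
        using k wait_const_pos growth_gt_1 n rate_pos by (intro powr_mono2') (auto simp: field_simps)
      also have "\<dots> = (wait_const * growth) powr rate * real n powr (- rate)"
        using n wait_const_pos growth_gt_1 by (simp add: powr_divide powr_minus field_simps)
      finally show "(1 - eta) ^ k \<le> (wait_const * growth) powr rate * real n powr (- rate)" .
    qed (use A B_pos in auto)
    also have "\<dots> = 2 / B * (wait_const * growth) powr rate * (A * real n powr (- rate))" by simp
    also have "\<dots> \<le> loss_const * (A * real n powr (- rate))"
      unfolding loss_const_def using A B_pos by (intro mult_right_mono mult_left_mono) auto
    finally show ?thesis by simp
  qed
qed

section \<open>Decorrelation\<close>

lemma cone_add:
  assumes r: "r \<in> cone A" and s: "s \<in> cone A'"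
  shows "(\<lambda>x. r x + s x) \<in> cone (A + A')"
proof (rule coneI)
  show "B * (\<integral>x. r x + s x \<partial>lborel) \<le> A + A'"
    using coneD(7,8)[OF r] coneD(7,8)[OF s] by (simp add: distrib_left)
qed (use coneD[OF r] coneD[OF s] in \<open>auto simp: distrib_left distrib_right intro!: add_mono\<close>)

lemma cone_scale:
  assumes r: "r \<in> cone A" and c: "0 \<le> c"
  shows "(\<lambda>x. c * r x) \<in> cone (c * A)"
proof (rule coneI)
  show "B * (\<integral>x. c * r x \<partial>lborel) \<le> c * A"
    using mult_left_mono[OF coneD(8)[OF r] c] by (simp add: ac_simps)
  show "x powr (1 + \<beta>) * (c * r x) \<le> y powr (1 + \<beta>) * (c * r y)" if "0 < x" "x \<le> y" "y \<le> 1" for x y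
    using mult_left_mono[OF coneD(5)[OF r that] c] by (simp add: ac_simps)
  show "c * r x \<le> c * A * x powr (- \<beta>)" if "0 < x" "x \<le> 1" for x
    using mult_left_mono[OF coneD(6)[OF r that] c] by (simp add: ac_simps)
qed (use coneD[OF r] c in \<open>auto intro!: mult_left_mono\<close>)

lemma cone_mono:
  assumes r: "r \<in> cone A" and "A \<le> A'" shows "r \<in> cone A'"
proof (rule coneI)
  show "r x \<le> A' * x powr (- \<beta>)" if "0 < x" "x \<le> 1" for x
    using coneD(6)[OF r that] assms(2) by (meson mult_right_mono order_trans powr_ge_zero)
qed (use coneD[OF r] assms(2) in auto)

lemma powr_diff_ge:
  assumes "0 < x" "x \<le> y" "y \<le> (1::real)"
  shows "x * (y - x) \<le> y powr (1 + \<beta>) - x powr (1 + \<beta>)"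
proof -
  have "x powr 1 \<le> x powr \<beta>" using assms beta_less_1 by (intro powr_mono') auto
  then have "x * (y - x) \<le> x powr \<beta> * (y - x)" using assms by (intro mult_right_mono) auto
  also have "\<dots> = y * x powr \<beta> - x powr (1 + \<beta>)" using assms by (simp add: powr_add algebra_simps)
  also have "\<dots> \<le> y * y powr \<beta> - x powr (1 + \<beta>)"
    using assms beta_pos by (intro diff_right_mono mult_left_mono powr_mono2) auto
  finally show ?thesis using assms by (simp add: powr_add)
qed

text \<open>The added constant supplies the slack in the increasing condition that the
  decreasing factor \<open>\<phi>\<close> uses up.\<close>

lemma cone_multiply_decreasing:
  assumes r: "r \<in> cone A" and [measurable]: "\<phi> \<in> borel_measurable borel"
    and bd: "\<And>x. 0 < x \<Longrightarrow> x \<le> 1 \<Longrightarrow> 0 \<le> \<phi> x \<and> \<phi> x \<le> M"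
    and dec: "\<And>x y. 0 < x \<Longrightarrow> x \<le> y \<Longrightarrow> y \<le> 1 \<Longrightarrow> \<phi> y \<le> \<phi> x \<and> \<phi> x - \<phi> y \<le> K * (y - x)"
    and K: "0 \<le> K"
  shows "(\<lambda>x. \<phi> x * r x + K * A * indicator {0<..1} x) \<in> cone ((M + B * K) * A)"
proof (rule coneI)
  note [measurable] = coneD(1)[OF r]
  have A: "0 \<le> A" by (rule cone_nonneg[OF r])
  have M: "0 \<le> M" using bd[of 1] by simp
  have le: "\<phi> x * r x \<le> M * r x" for x
    using bd[of x] coneD(2,3)[OF r, of x] by (cases "x \<in> {0<..1}") (auto intro!: mult_right_mono)
  have nn: "0 \<le> \<phi> x * r x" for x
    using bd[of x] coneD(2,3)[OF r, of x] by (cases "x \<in> {0<..1}") auto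
  show "(\<lambda>x. \<phi> x * r x + K * A * indicator {0<..1} x) \<in> borel_measurable borel" by measurable
  show "0 \<le> \<phi> x * r x + K * A * indicator {0<..1} x" for x using nn[of x] K A by simp
  show "\<phi> x * r x + K * A * indicator {0<..1} x = 0" if "x \<notin> {0<..1}" for x
    using coneD(3)[OF r that] that by simp
  show "\<phi> y * r y + K * A * indicator {0<..1} y \<le> \<phi> x * r x + K * A * indicator {0<..1} x"
    if xy: "0 < x" "x \<le> y" "y \<le> 1" for x y
    using xy mult_mono[of "\<phi> y" "\<phi> x" "r y" "r x"] dec[OF xy] coneD(4)[OF r xy] coneD(2)[OF r] bd[of x] by simp
  show "x powr (1 + \<beta>) * (\<phi> x * r x + K * A * indicator {0<..1} x)
     \<le> y powr (1 + \<beta>) * (\<phi> y * r y + K * A * indicator {0<..1} y)" if xy: "0 < x" "x \<le> y" "y \<le> 1" for x y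
  proof -
    let ?a = "1 + \<beta>"
    have "x powr ?a * r x \<le> x powr ?a * (A * x powr (-\<beta>))"
      using coneD(6)[OF r, of x] xy by (intro mult_left_mono) auto
    also have "\<dots> = A * x" using xy by (simp add: powr_add powr_minus)
    finally have R: "x powr ?a * r x \<le> A * x" .
    have "(x powr ?a * r x) * (\<phi> x - \<phi> y) \<le> (A * x) * (K * (y - x))"
      by (rule mult_mono[OF R]) (use dec[OF xy] A xy in auto)
    also have "\<dots> \<le> K * A * (y powr ?a - x powr ?a)"
      using mult_left_mono[OF powr_diff_ge[OF xy], of "K * A"] K A by (simp add: ac_simps)
    finally have "(x powr ?a * r x) * \<phi> x + K * A * x powr ?a \<le> (x powr ?a * r x) * \<phi> y + K * A * y powr ?a"
      by (simp add: algebra_simps)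
    also have "\<dots> \<le> (y powr ?a * r y) * \<phi> y + K * A * y powr ?a"
      using coneD(5)[OF r xy] bd[of y] xy by (intro add_right_mono mult_right_mono) auto
    finally show ?thesis using xy by (simp add: algebra_simps)
  qed
  show "\<phi> x * r x + K * A * indicator {0<..1} x \<le> (M + B * K) * A * x powr (- \<beta>)" if x: "0 < x" "x \<le> 1" for x
  proof -
    have "1 \<le> x powr (-\<beta>)" using x beta_pos powr_mono'[of "-\<beta>" 0 x] by simp
    then have "1 * 1 \<le> B * x powr (-\<beta>)" using B_ge_1 by (intro mult_mono) auto
    then have "K * A * 1 \<le> K * A * (B * x powr (-\<beta>))" using K A by (intro mult_left_mono) auto
    moreover have "\<phi> x * r x \<le> M * (A * x powr (-\<beta>))"
      using le[of x] mult_left_mono[OF coneD(6)[OF r x] M] by linarith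
    ultimately show ?thesis using x by (simp add: algebra_simps)
  qed
  have i1: "integrable lborel (\<lambda>x. \<phi> x * r x)"
    by (rule Bochner_Integration.integrable_bound[OF integrable_mult_right[OF coneD(7)[OF r], of M]])
       (use le nn in \<open>auto intro!: AE_I2 intro: order_trans[OF _ abs_ge_self]\<close>)
  have i2: "integrable lborel (\<lambda>x. K * A * indicator {0<..1::real} x)"
    by (rule integrable_mult_right) (auto simp: integrable_indicator_iff)
  show "integrable lborel (\<lambda>x. \<phi> x * r x + K * A * indicator {0<..1} x)" using i1 i2 by auto
  have "(\<integral>x. \<phi> x * r x + K * A * indicator {0<..1} x \<partial>lborel) = (\<integral>x. \<phi> x * r x \<partial>lborel) + K * A"
    using i1 i2 by simp
  also have "(\<integral>x. \<phi> x * r x \<partial>lborel) \<le> (\<integral>x. M * r x \<partial>lborel)"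
    using i1 coneD(7)[OF r] le by (intro integral_mono) auto
  finally have "(\<integral>x. \<phi> x * r x + K * A * indicator {0<..1} x \<partial>lborel) \<le> M * (\<integral>x. r x \<partial>lborel) + K * A" by simp
  then have "B * (\<integral>x. \<phi> x * r x + K * A * indicator {0<..1} x \<partial>lborel) \<le> B * (M * (\<integral>x. r x \<partial>lborel) + K * A)"
    using B_pos by (intro mult_left_mono) auto
  also have "\<dots> = M * (B * (\<integral>x. r x \<partial>lborel)) + B * K * A" by (simp add: algebra_simps)
  also have "\<dots> \<le> M * A + B * K * A" using coneD(8)[OF r] M by (intro add_right_mono mult_left_mono) auto
  finally show "B * (\<integral>x. \<phi> x * r x + K * A * indicator {0<..1} x \<partial>lborel) \<le> (M + B * K) * A"
    by (simp add: algebra_simps)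
qed

definition observable :: "real \<Rightarrow> real \<Rightarrow> (real \<Rightarrow> real) \<Rightarrow> bool" where
  "observable F L u \<longleftrightarrow> u \<in> borel_measurable borel \<and> (\<forall>x. \<bar>u x\<bar> \<le> F)
     \<and> (\<forall>x\<in>{0<..1}. \<forall>y\<in>{0<..1}. \<bar>u x - u y\<bar> \<le> L * \<bar>x - y\<bar>) \<and> 0 \<le> L"

definition mult_const :: "real \<Rightarrow> real \<Rightarrow> real" where
  "mult_const F L = (2 * F + L) + B * (2 * L)"

lemma observable_nonneg: "observable F L u \<Longrightarrow> 0 \<le> F"
  unfolding observable_def by (meson abs_ge_zero order_trans)

lemma cone_multiply:
  assumes r: "r \<in> cone A" and u: "observable F L u"
  obtains r1 r2 where "r1 \<in> cone (mult_const F L * A)" "r2 \<in> cone (mult_const F L * A)"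
    "\<And>x. u x * r x = r1 x - r2 x"
proof -
  have [measurable]: "u \<in> borel_measurable borel" and F: "\<And>x. \<bar>u x\<bar> \<le> F" and L: "0 \<le> L"
    and lip: "\<And>x y. x \<in> {0<..1} \<Longrightarrow> y \<in> {0<..1} \<Longrightarrow> \<bar>u x - u y\<bar> \<le> L * \<bar>x - y\<bar>"
    using u by (auto simp: observable_def)
  have F0: "0 \<le> F" by (rule observable_nonneg[OF u])
  have u2: "u x \<le> F" "- F \<le> u x" for x using F[of x] by linarith+
  have "(\<lambda>x. (u x + F + L * (1 - x)) * r x + 2 * L * A * indicator {0<..1} x) \<in> cone (mult_const F L * A)"
    unfolding mult_const_def
  proof (rule cone_multiply_decreasing[OF r])
    show "0 \<le> u x + F + L * (1 - x) \<and> u x + F + L * (1 - x) \<le> 2 * F + L" if "0 < x" "x \<le> 1" for x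
      using u2[of x] that L mult_left_mono[of "1 - x" 1 L] mult_nonneg_nonneg[of L "1 - x"] by auto
    show "u y + F + L * (1 - y) \<le> u x + F + L * (1 - x) \<and> u x + F + L * (1 - x) - (u y + F + L * (1 - y)) \<le> 2 * L * (y - x)"
      if "0 < x" "x \<le> y" "y \<le> 1" for x y
      using lip[of x y] that by (auto simp: abs_le_iff algebra_simps)
  qed (use L in auto)
  moreover have "(\<lambda>x. (F + L * (1 - x)) * r x + 2 * L * A * indicator {0<..1} x) \<in> cone (mult_const F L * A)"
    unfolding mult_const_def
  proof (rule cone_multiply_decreasing[OF r])
    show "0 \<le> F + L * (1 - x) \<and> F + L * (1 - x) \<le> 2 * F + L" if "0 < x" "x \<le> 1" for x
      using F0 that L mult_left_mono[of "1 - x" 1 L] mult_nonneg_nonneg[of L "1 - x"] by auto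
    show "F + L * (1 - y) \<le> F + L * (1 - x) \<and> F + L * (1 - x) - (F + L * (1 - y)) \<le> 2 * L * (y - x)"
      if "0 < x" "x \<le> y" "y \<le> 1" for x y
      using that L mult_left_mono[of x y L] by (auto simp: algebra_simps)
  qed (use L in auto)
  ultimately show ?thesis by (rule that) (simp add: algebra_simps)
qed

lemma integrable_bounded_mult:
  fixes v :: "real \<Rightarrow> real"
  assumes "integrable lborel g" and [measurable]: "v \<in> borel_measurable borel" and "\<And>x. \<bar>v x\<bar> \<le> c"
  shows "integrable lborel (\<lambda>x. v x * g x)"
  by (rule Bochner_Integration.integrable_bound[OF integrable_mult_right[OF assms(1), of c]])
     (use assms in \<open>auto simp: abs_mult intro!: AE_I2 mult_right_mono intro: order_trans[OF _ abs_ge_self]\<close>)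

lemma integral_bounded_mult_le:
  fixes v :: "real \<Rightarrow> real"
  assumes "integrable lborel g" and [measurable]: "v \<in> borel_measurable borel" and "\<And>x. \<bar>v x\<bar> \<le> 1"
  shows "\<bar>\<integral>x. v x * g x \<partial>lborel\<bar> \<le> (\<integral>x. \<bar>g x\<bar> \<partial>lborel)"
proof -
  have "\<bar>\<integral>x. v x * g x \<partial>lborel\<bar> \<le> (\<integral>x. \<bar>v x * g x\<bar> \<partial>lborel)" by (rule integral_abs_bound)
  also have "\<dots> \<le> (\<integral>x. \<bar>g x\<bar> \<partial>lborel)"
  proof (rule integral_mono)
    show "integrable lborel (\<lambda>x. \<bar>v x * g x\<bar>)"
      by (rule integrable_abs[OF integrable_bounded_mult[OF assms]])
  qed (use assms in \<open>auto simp: abs_mult intro!: mult_left_le_one_le\<close>)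
  finally show ?thesis .
qed

lemma cone_difference_decorrelation:
  assumes adm: "admissible \<beta> \<alpha>" and r: "r1 \<in> cone A" "r2 \<in> cone A" "(\<integral>x. r1 x - r2 x \<partial>lborel) = 0"
    and n: "0 < n" and [measurable]: "v \<in> borel_measurable borel" and v: "\<And>x. \<bar>v x\<bar> \<le> 1"
  shows "\<bar>\<integral>x. v (composed_map \<alpha> n x) * (r1 x - r2 x) \<partial>lborel\<bar> \<le> loss_const * A * real n powr (- rate)"
proof -
  have i: "integrable lborel (\<lambda>x. r1 x - r2 x)" using coneD(7)[OF r(1)] coneD(7)[OF r(2)] by auto
  have s: "r1 x - r2 x = 0" if "x \<notin> {0<..1}" for x using coneD(3)[OF r(1) that] coneD(3)[OF r(2) that] by simp
  have m: "(\<integral>x. r1 x \<partial>lborel) = (\<integral>x. r2 x \<partial>lborel)" using r(3) coneD(7)[OF r(1)] coneD(7)[OF r(2)] by simp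
  have "(\<integral>x. v (composed_map \<alpha> n x) * (r1 x - r2 x) \<partial>lborel) = (\<integral>y. v y * transfer_iter \<alpha> n (\<lambda>x. r1 x - r2 x) y \<partial>lborel)"
    using integral_transfer_iter[OF adm _ i v s, where n=n] by simp
  also have "\<bar>\<dots>\<bar> \<le> (\<integral>y. \<bar>transfer_iter \<alpha> n (\<lambda>x. r1 x - r2 x) y\<bar> \<partial>lborel)"
    using integrable_transfer_iter[OF adm i s, where n=n] v by (intro integral_bounded_mult_le) auto
  also have "\<dots> \<le> loss_const * A * real n powr (- rate)"
    unfolding transfer_iter_diff by (rule memory_loss[OF adm r(1,2) m n])
  finally show ?thesis .
qed

lemma decorrelation_one:
  assumes adm: "admissible \<beta> \<alpha>" and r: "r \<in> cone A" and u: "observable F L u" "(\<integral>x. u x * r x \<partial>lborel) = 0"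
    and n: "0 < n" and v: "v \<in> borel_measurable borel" "\<And>x. \<bar>v x\<bar> \<le> 1"
  shows "\<bar>\<integral>x. v (composed_map \<alpha> n x) * (u x * r x) \<partial>lborel\<bar> \<le> loss_const * (mult_const F L * A) * real n powr (- rate)"
proof -
  obtain r1 r2 where "r1 \<in> cone (mult_const F L * A)" "r2 \<in> cone (mult_const F L * A)" "\<And>x. u x * r x = r1 x - r2 x"
    using cone_multiply[OF r u(1)] by blast
  then show ?thesis using cone_difference_decorrelation[OF adm _ _ _ n v] u(2) by simp
qed

lemma decorrelation_two:
  assumes adm: "admissible \<beta> \<alpha>" and r: "r \<in> cone A" "(\<integral>x. r x \<partial>lborel) = 1"
    and u: "observable F L u" and w: "observable F L w"
    and n: "0 < n" and v: "v \<in> borel_measurable borel" "\<And>x. \<bar>v x\<bar> \<le> 1"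
    and c: "c = (\<integral>x. u x * w (composed_map \<alpha> j x) * r x \<partial>lborel)"
  shows "\<bar>\<integral>x. v (composed_map \<alpha> (j + n) x) * ((u x * w (composed_map \<alpha> j x) - c) * r x) \<partial>lborel\<bar>
    \<le> loss_const * ((2 * (mult_const F L)\<^sup>2 + F\<^sup>2) * A) * real n powr (- rate)"
proof -
  let ?C = "mult_const F L" and ?\<alpha> = "\<lambda>k. \<alpha> (j + k)"
  have [measurable]: "v \<in> borel_measurable borel" "u \<in> borel_measurable borel" "w \<in> borel_measurable borel"
    and uF: "\<And>x. \<bar>u x\<bar> \<le> F" and wF: "\<And>x. \<bar>w x\<bar> \<le> F"
    using u w v by (auto simp: observable_def)
  have F0: "0 \<le> F" by (rule observable_nonneg[OF u])
  have A0: "0 \<le> A" by (rule cone_nonneg[OF r(1)])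
  have adm': "admissible \<beta> ?\<alpha>" by (rule admissible_shift[OF adm])
  obtain r1 r2 where r12: "r1 \<in> cone (?C * A)" "r2 \<in> cone (?C * A)" "\<And>x. u x * r x = r1 x - r2 x"
    using cone_multiply[OF r(1) u] by blast
  define s1 where "s1 = transfer_iter \<alpha> j r1"
  define s2 where "s2 = transfer_iter \<alpha> j r2"
  define rj where "rj = transfer_iter \<alpha> j r"
  have s: "s1 \<in> cone (?C * A)" "s2 \<in> cone (?C * A)" and rj: "rj \<in> cone A"
    unfolding s1_def s2_def rj_def using r12 r by (auto intro: transfer_iter_cone[OF adm])
  have rj1: "(\<integral>x. rj x \<partial>lborel) = 1"
    unfolding rj_def using integrable_transfer_iter[OF adm coneD(7)[OF r(1)] coneD(3)[OF r(1)], of j] r(2) by auto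
  obtain p1 q1 where pq1: "p1 \<in> cone (?C * (?C * A))" "q1 \<in> cone (?C * (?C * A))" "\<And>x. w x * s1 x = p1 x - q1 x"
    using cone_multiply[OF s(1) w] by blast
  obtain p2 q2 where pq2: "p2 \<in> cone (?C * (?C * A))" "q2 \<in> cone (?C * (?C * A))" "\<And>x. w x * s2 x = p2 x - q2 x"
    using cone_multiply[OF s(2) w] by blast
  have iu: "integrable lborel (\<lambda>x. u x * r x)"
    using coneD(7)[OF r12(1)] coneD(7)[OF r12(2)] unfolding r12(3) by auto
  have su: "u x * r x = 0" if "x \<notin> {0<..1}" for x using coneD(3)[OF r(1) that] by simp
  have P: "transfer_iter \<alpha> j (\<lambda>x. u x * r x) y = s1 y - s2 y" for y
    unfolding r12(3) transfer_iter_diff s1_def s2_def ..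
  have step: "(\<integral>x. k (composed_map \<alpha> j x) * (u x * r x) \<partial>lborel) = (\<integral>y. k y * (s1 y - s2 y) \<partial>lborel)"
    if "k \<in> borel_measurable borel" "\<And>x. \<bar>k x\<bar> \<le> F" for k
    using integral_transfer_iter[OF adm that(1) iu that(2) su, where n=j] by (simp add: P)
  have step': "(\<integral>x. k (composed_map \<alpha> j x) * r x \<partial>lborel) = (\<integral>y. k y * rj y \<partial>lborel)"
    if "k \<in> borel_measurable borel" "\<And>x. \<bar>k x\<bar> \<le> 1" for k
    using integral_transfer_iter[OF adm that(1) coneD(7)[OF r(1)] that(2) coneD(3)[OF r(1)], where n=j] by (simp add: rj_def)
  define cp where "cp = max 0 c"
  define cm where "cm = max 0 (- c)"
  have cc: "c = cp - cm" "0 \<le> cp" "0 \<le> cm" by (auto simp: cp_def cm_def)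
  have c_le: "\<bar>c\<bar> \<le> F\<^sup>2"
  proof -
    have "\<bar>c\<bar> \<le> (\<integral>x. \<bar>u x * w (composed_map \<alpha> j x) * r x\<bar> \<partial>lborel)" unfolding c by (rule integral_abs_bound)
    also have "\<dots> \<le> (\<integral>x. F\<^sup>2 * r x \<partial>lborel)"
    proof (rule integral_mono)
      show b: "\<bar>u x * w (composed_map \<alpha> j x) * r x\<bar> \<le> F\<^sup>2 * r x" for x
        using mult_mono[OF uF[of x] wF[of "composed_map \<alpha> j x"] F0 abs_ge_zero] coneD(2)[OF r(1), of x]
        by (auto simp: abs_mult power2_eq_square intro!: mult_right_mono)
      show "integrable lborel (\<lambda>x. F\<^sup>2 * r x)" using coneD(7)[OF r(1)] by auto
      show "integrable lborel (\<lambda>x. \<bar>u x * w (composed_map \<alpha> j x) * r x\<bar>)"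
        by (rule Bochner_Integration.integrable_bound[OF \<open>integrable lborel (\<lambda>x. F\<^sup>2 * r x)\<close>])
           (use coneD(1)[OF r(1)] b in \<open>auto intro: order_trans[OF _ abs_ge_self]\<close>)
    qed
    finally show ?thesis using r(2) by simp
  qed
  have "cp + cm = \<bar>c\<bar>" by (auto simp: cp_def cm_def)
  then have cpm: "cp \<le> F\<^sup>2" "cm \<le> F\<^sup>2" using c_le cc by linarith+
  define P1 where "P1 x = p1 x + q2 x + cm * rj x" for x
  define P2 where "P2 x = q1 x + p2 x + cp * rj x" for x
  have le: "?C * (?C * A) + ?C * (?C * A) + d * A \<le> (2 * ?C\<^sup>2 + F\<^sup>2) * A" if "d \<le> F\<^sup>2" for d
    using mult_right_mono[OF that A0] by (simp add: power2_eq_square algebra_simps)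
  have P12: "P1 \<in> cone ((2 * ?C\<^sup>2 + F\<^sup>2) * A)" "P2 \<in> cone ((2 * ?C\<^sup>2 + F\<^sup>2) * A)"
    unfolding P1_def P2_def
    using cone_mono[OF cone_add[OF cone_add[OF pq1(1) pq2(2)] cone_scale[OF rj cc(3)]] le[OF cpm(2)]]
      cone_mono[OF cone_add[OF cone_add[OF pq1(2) pq2(1)] cone_scale[OF rj cc(2)]] le[OF cpm(1)]] by auto
  have D: "P1 x - P2 x = w x * (s1 x - s2 x) - c * rj x" for x
    unfolding P1_def P2_def right_diff_distrib pq1(3) pq2(3) cc(1) by (simp add: algebra_simps)
  have isd: "integrable lborel (\<lambda>x. s1 x - s2 x)" using coneD(7)[OF s(1)] coneD(7)[OF s(2)] by auto
  have iws: "integrable lborel (\<lambda>x. w x * (s1 x - s2 x))"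
    by (rule integrable_bounded_mult[OF isd _ wF]) simp
  have "c = (\<integral>x. w (composed_map \<alpha> j x) * (u x * r x) \<partial>lborel)" unfolding c by (simp add: ac_simps)
  then have c': "c = (\<integral>x. w x * (s1 x - s2 x) \<partial>lborel)" using step[of w] wF by simp
  have zero: "(\<integral>x. P1 x - P2 x \<partial>lborel) = 0"
    unfolding D using iws coneD(7)[OF rj] rj1 c' by simp
  let ?v = "\<lambda>x. v (composed_map ?\<alpha> n x)"
  have vm: "?v \<in> borel_measurable borel" by measurable
  have ir: "integrable lborel (\<lambda>x. v (composed_map \<alpha> (j + n) x) * r x)"
    by (rule integrable_bounded_mult[OF coneD(7)[OF r(1)] _ v(2)]) measurable
  have "(\<integral>x. v (composed_map \<alpha> (j + n) x) * ((u x * w (composed_map \<alpha> j x) - c) * r x) \<partial>lborel)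
    = (\<integral>x. v (composed_map \<alpha> (j + n) x) * w (composed_map \<alpha> j x) * (u x * r x) - c * (v (composed_map \<alpha> (j + n) x) * r x) \<partial>lborel)"
    by (simp add: algebra_simps)
  also have "\<dots> = (\<integral>x. v (composed_map \<alpha> (j + n) x) * w (composed_map \<alpha> j x) * (u x * r x) \<partial>lborel) - c * (\<integral>x. v (composed_map \<alpha> (j + n) x) * r x \<partial>lborel)"
    by (subst Bochner_Integration.integral_diff)
      (use ir mult_mono[OF v(2) wF] F0 in \<open>auto intro!: integrable_bounded_mult[OF iu, where c=F] simp: abs_mult\<close>)
  also have "\<dots> = (\<integral>x. ?v x * w x * (s1 x - s2 x) \<partial>lborel) - c * (\<integral>x. ?v x * rj x \<partial>lborel)"
  proof -
    have b: "\<bar>?v x * w x\<bar> \<le> F" for x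
      using mult_mono[OF v(2)[of "composed_map ?\<alpha> n x"] wF[of x]] by (simp add: abs_mult)
    have 1: "(\<integral>x. v (composed_map \<alpha> (j + n) x) * w (composed_map \<alpha> j x) * (u x * r x) \<partial>lborel) = (\<integral>x. ?v x * w x * (s1 x - s2 x) \<partial>lborel)"
      using step[of "\<lambda>x. ?v x * w x", OF _ b] vm by (simp add: composed_map_add)
    have 2: "(\<integral>x. v (composed_map \<alpha> (j + n) x) * r x \<partial>lborel) = (\<integral>x. ?v x * rj x \<partial>lborel)"
      using step'[of ?v, OF vm v(2)] by (simp add: composed_map_add)
    show ?thesis unfolding 1 2 ..
  qed
  also have "\<dots> = (\<integral>x. ?v x * (P1 x - P2 x) \<partial>lborel)"
    unfolding D right_diff_distrib[of "?v _" "_ * (_ - _)"]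
    by (subst Bochner_Integration.integral_diff)
       (use integrable_bounded_mult[OF iws vm v(2)] integrable_bounded_mult[OF coneD(7)[OF rj] vm v(2)] in \<open>auto simp: ac_simps\<close>)
  finally show ?thesis
    using cone_difference_decorrelation[OF adm' P12 zero n v] by simp
qed

lemma C_star_cone:
  assumes g: "g \<in> C_star \<beta>" and [measurable]: "g' \<in> borel_measurable borel"
    and g': "\<And>x. x \<in> {0<..1} \<Longrightarrow> g' x = g x" "\<And>x. x \<notin> {0<..1} \<Longrightarrow> g' x = 0"
    and i: "integrable lborel g'"
  shows "\<exists>A. g' \<in> cone A"
proof -
  define a where "a = 2 powr \<beta> * (2 + \<beta>) * (LINT y|leb01. g y)"
  define A where "A = max a (B * (\<integral>x. g' x \<partial>lborel))"
  have "g' \<in> cone A"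
  proof (rule coneI)
    show "g' x \<le> A * x powr (- \<beta>)" if x: "0 < x" "x \<le> 1" for x
    proof -
      have "g' x \<le> a * x powr (- \<beta>)" using g g'(1)[of x] x by (auto simp: C_star_def a_def ac_simps)
      also have "\<dots> \<le> A * x powr (- \<beta>)" by (intro mult_right_mono) (auto simp: A_def)
      finally show ?thesis .
    qed
    show "0 \<le> g' x" for x using g g' by (cases "x \<in> {0<..1}") (auto simp: C_star_def)
    show "g' y \<le> g' x" if "0 < x" "x \<le> y" "y \<le> 1" for x y
      using g g'(1)[of x] g'(1)[of y] that by (auto simp: C_star_def monotone_on_def)
    show "x powr (1 + \<beta>) * g' x \<le> y powr (1 + \<beta>) * g' y" if "0 < x" "x \<le> y" "y \<le> 1" for x y
      using g g'(1)[of x] g'(1)[of y] that by (auto simp: C_star_def monotone_on_def add.commute)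
  qed (use g' i in \<open>auto simp: A_def\<close>)
  then show ?thesis by blast
qed

end

section \<open>Gaussian integration by parts\<close>

lemma nn_integral_lborel_shear:
  fixes F :: "real ^ 'd \<Rightarrow> ennreal"
  assumes [measurable]: "F \<in> borel_measurable borel" and mn: "m \<noteq> n"
  shows "(\<integral>\<^sup>+v. F (\<chi> i. if i = m then v $ m + v $ n else v $ i) \<partial>lborel) = (\<integral>\<^sup>+v. F v \<partial>lborel)"
proof -
  let ?a = "axis m (1::real) :: real ^ 'd" and ?b = "axis n (1::real) :: real ^ 'd"
  let ?I = "Basis - {?a}"
  let ?sh = "\<lambda>v. v + (v \<bullet> ?b) *\<^sub>R ?a"
  let ?s = "\<lambda>f :: real ^ 'd \<Rightarrow> real. \<Sum>b\<in>Basis. f b *\<^sub>R b"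
  interpret product_sigma_finite "\<lambda>_ :: real ^ 'd. lborel :: real measure" ..
  have aB: "?a \<in> Basis" "?b \<in> Basis" by (auto simp: axis_in_Basis_iff)
  have ab: "?b \<noteq> ?a" using mn by (auto simp: axis_eq_axis)
  have ins: "insert ?a ?I = (Basis :: (real ^ 'd) set)" using aB by auto
  have sh: "(\<chi> i. if i = m then v $ m + v $ n else v $ i) = ?sh v" for v
  proof -
    have vb: "v \<bullet> ?b = v $ n" by (simp add: inner_axis)
    show ?thesis unfolding vb using mn by (auto simp: vec_eq_iff axis_def)
  qed
  have s_upd: "?s (x(?a := y)) = y *\<^sub>R ?a + (\<Sum>b\<in>?I. x b *\<^sub>R b)" for x y
    using aB by (subst sum.remove[of _ ?a]) auto
  have s_inner: "?s f \<bullet> ?b = f ?b" for f using aB by simp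
  have main: "(\<integral>\<^sup>+v. G v \<partial>lborel) = (\<integral>\<^sup>+x. (\<integral>\<^sup>+y. G (?s (x(?a := y))) \<partial>lborel) \<partial>Pi\<^sub>M ?I (\<lambda>_. lborel))"
    if [measurable]: "G \<in> borel_measurable borel" for G :: "real ^ 'd \<Rightarrow> ennreal"
  proof -
    have "(\<integral>\<^sup>+v. G v \<partial>lborel) = (\<integral>\<^sup>+f. G (?s f) \<partial>Pi\<^sub>M (insert ?a ?I) (\<lambda>_. lborel))"
      unfolding ins by (subst lborel_eq, subst nn_integral_distr) auto
    also have "\<dots> = (\<integral>\<^sup>+x. (\<integral>\<^sup>+y. G (?s (x(?a := y))) \<partial>lborel) \<partial>Pi\<^sub>M ?I (\<lambda>_. lborel))"
      by (rule product_nn_integral_insert) (auto simp: ins)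
    finally show ?thesis .
  qed
  have "(\<integral>\<^sup>+v. F (?sh v) \<partial>lborel) = (\<integral>\<^sup>+x. (\<integral>\<^sup>+y. F (?sh (?s (x(?a := y)))) \<partial>lborel) \<partial>Pi\<^sub>M ?I (\<lambda>_. lborel))"
    by (rule main) measurable
  also have "\<dots> = (\<integral>\<^sup>+x. (\<integral>\<^sup>+y. F (?s (x(?a := y))) \<partial>lborel) \<partial>Pi\<^sub>M ?I (\<lambda>_. lborel))"
  proof (rule nn_integral_cong)
    fix x :: "real ^ 'd \<Rightarrow> real"
    have "(\<integral>\<^sup>+y. F (?s (x(?a := y))) \<partial>lborel) = (\<integral>\<^sup>+y. F (?s (x(?a := x ?b + 1 * y))) \<partial>lborel)"
      by (subst nn_integral_real_affine[where c=1 and t="x ?b"]) (auto simp: s_upd)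
    also have "\<dots> = (\<integral>\<^sup>+y. F (?sh (?s (x(?a := y)))) \<partial>lborel)"
    proof (intro nn_integral_cong arg_cong[of _ _ F])
      fix y
      have ib: "?s (x(?a := y)) \<bullet> ?b = x ?b" using s_inner[of "x(?a := y)"] ab by simp
      show "?s (x(?a := x ?b + 1 * y)) = ?sh (?s (x(?a := y)))"
        unfolding ib unfolding s_upd by (simp add: algebra_simps)
    qed
    finally show "(\<integral>\<^sup>+y. F (?sh (?s (x(?a := y)))) \<partial>lborel) = (\<integral>\<^sup>+y. F (?s (x(?a := y))) \<partial>lborel)" by simp
  qed
  also have "\<dots> = (\<integral>\<^sup>+v. F v \<partial>lborel)" by (rule main[symmetric]) simp
  finally show ?thesis unfolding sh .
qed

lemma prod_Basis_cart: "(\<Prod>b\<in>(Basis :: (real ^ 'd) set). G b) = (\<Prod>i\<in>UNIV. G (axis i 1))"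
proof -
  have B: "(Basis :: (real ^ 'd) set) = range (\<lambda>i. axis i 1)" by (auto simp: Basis_vec_def)
  have inj: "inj (\<lambda>i. axis i (1::real) :: real ^ 'd)" by (auto intro!: injI simp: axis_eq_axis)
  show ?thesis unfolding B by (subst prod.reindex[OF inj]) (simp add: o_def)
qed

lemma lborel_distr_permute_coords:
  fixes p :: "'d::finite \<Rightarrow> 'd"
  assumes p: "p permutes UNIV"
  shows "distr lborel borel (\<lambda>v :: real ^ 'd. \<chi> i. v $ p i) = lborel"
proof (rule lborel_eqI[symmetric])
  fix l u :: "real ^ 'd" assume le: "\<And>b. b \<in> Basis \<Longrightarrow> l \<bullet> b \<le> u \<bullet> b"
  let ?q = "inv p" and ?h = "\<lambda>v :: real ^ 'd. \<chi> i. v $ p i"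
  have q: "?q permutes UNIV" using p by (rule permutes_inv)
  have inv: "p (?q i) = i" "?q (p i) = i" for i using permutes_inverses[OF p] by auto
  have [measurable]: "?h \<in> borel \<rightarrow>\<^sub>M borel"
    by (intro borel_measurable_continuous_onI continuous_intros)
  have eq: "?h -` box l u = box (\<chi> i. l $ ?q i) (\<chi> i. u $ ?q i)"
    by (auto simp: mem_box_cart) (metis inv)+
  have le': "l $ i \<le> u $ i" for i using le[of "axis i 1"] by (simp add: inner_axis axis_in_Basis_iff)
  have "emeasure (distr lborel borel ?h) (box l u) = emeasure lborel (box (\<chi> i. l $ ?q i) (\<chi> i. u $ ?q i))"
    by (subst emeasure_distr) (auto simp: eq)
  also have "\<dots> = (\<Prod>b\<in>Basis. ((\<chi> i. u $ ?q i) - (\<chi> i. l $ ?q i)) \<bullet> b)"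
    using le' by (subst emeasure_lborel_box) (auto simp: Basis_vec_def inner_axis)
  also have "\<dots> = (\<Prod>i\<in>UNIV. (u - l) $ ?q i)" by (simp add: prod_Basis_cart inner_axis)
  also have "\<dots> = (\<Prod>i\<in>UNIV. (u - l) $ i)" using prod.permute[OF q, of "\<lambda>i. (u - l) $ i"] by (simp add: o_def)
  also have "\<dots> = (\<Prod>b\<in>Basis. (u - l) \<bullet> b)" by (simp add: prod_Basis_cart inner_axis)
  finally show "emeasure (distr lborel borel ?h) (box l u) = (\<Prod>b\<in>Basis. (u - l) \<bullet> b)" .
qed simp

text \<open>The library's linear change of variables is restricted to well-ordered index types.\<close>

lemma nn_integral_lborel_linear:
  fixes f :: "real ^ 'd \<Rightarrow> real ^ 'd"
  assumes "linear f" and "det (matrix f) \<noteq> 0" and "F \<in> borel_measurable borel"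
  shows "(\<integral>\<^sup>+x. F x \<partial>lborel) = ennreal \<bar>det (matrix f)\<bar> * (\<integral>\<^sup>+x. F (f x) \<partial>lborel)"
proof -
  have lin_meas: "g \<in> borel_measurable borel" if "linear g" for g :: "real ^ 'd \<Rightarrow> real ^ 'd"
    using that by (intro borel_measurable_continuous_onI linear_continuous_on) (simp add: linear_conv_bounded_linear)
  define P where "P f \<longleftrightarrow> (det (matrix f) \<noteq> 0 \<longrightarrow> (\<forall>F\<in>borel_measurable borel. (\<integral>\<^sup>+x. F x \<partial>lborel) = ennreal \<bar>det (matrix f)\<bar> * (\<integral>\<^sup>+x. F (f x) \<partial>lborel)))"
    for f :: "real ^ 'd \<Rightarrow> real ^ 'd"
  have PD: "(\<integral>\<^sup>+x. F x \<partial>lborel) = ennreal \<bar>det (matrix k)\<bar> * (\<integral>\<^sup>+x. F (k x) \<partial>lborel)"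
    if "P k" "det (matrix k) \<noteq> 0" "F \<in> borel_measurable borel" for k F
    by (rule that(1)[unfolded P_def, rule_format, OF that(2,3)])
  have "P f"
    using assms(1)
  proof (rule induct_linear_elementary)
    fix f g :: "real ^ 'd \<Rightarrow> real ^ 'd"
    assume l: "linear f" "linear g" and P: "P f" "P g"
    show "P (f \<circ> g)"
      unfolding P_def
    proof (intro impI ballI)
      fix F :: "real ^ 'd \<Rightarrow> ennreal" assume nz: "det (matrix (f \<circ> g)) \<noteq> 0" and [measurable]: "F \<in> borel_measurable borel"
      have d3: "det (matrix (f \<circ> g)) = det (matrix f) * det (matrix g)"
        by (subst matrix_compose[OF l(2,1)]) (rule det_mul)
      have d: "det (matrix f) \<noteq> 0" "det (matrix g) \<noteq> 0" using nz unfolding d3 by auto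
      have [measurable]: "f \<in> borel_measurable borel" by (rule lin_meas[OF l(1)])
      have "(\<integral>\<^sup>+x. F x \<partial>lborel) = ennreal \<bar>det (matrix f)\<bar> * (\<integral>\<^sup>+x. F (f x) \<partial>lborel)" by (rule PD[OF P(1) d(1)]) measurable
      also have "(\<integral>\<^sup>+x. F (f x) \<partial>lborel) = ennreal \<bar>det (matrix g)\<bar> * (\<integral>\<^sup>+x. F (f (g x)) \<partial>lborel)"
        by (rule PD[OF P(2) d(2)]) measurable
      finally show "(\<integral>\<^sup>+x. F x \<partial>lborel) = ennreal \<bar>det (matrix (f \<circ> g))\<bar> * (\<integral>\<^sup>+x. F ((f \<circ> g) x) \<partial>lborel)"
        unfolding d3 by (simp add: abs_mult ennreal_mult' mult.assoc)
    qed
  next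
    fix f :: "real ^ 'd \<Rightarrow> real ^ 'd" and i assume l: "linear f" and z: "\<And>x. f x $ i = 0"
    have "row i (matrix f) = 0" using z by (simp add: row_def matrix_def vec_eq_iff)
    then show "P f" using det_zero_row(1) by (auto simp: P_def)
  next
    fix c :: "'d \<Rightarrow> real"
    let ?h = "\<lambda>x :: real ^ 'd. \<chi> i. c i * x $ i"
    have det: "det (matrix ?h) = prod c UNIV" by (simp add: axis_def matrix_def det_diagonal)
    show "P ?h"
      unfolding P_def
    proof (intro impI ballI)
      fix F :: "real ^ 'd \<Rightarrow> ennreal" assume d: "det (matrix ?h) \<noteq> 0" and [measurable]: "F \<in> borel_measurable borel"
      define c' where "c' b = (\<Sum>i\<in>UNIV. c i * b $ i)" for b :: "real ^ 'd"
      have c': "c' (axis i 1) = c i" for i by (simp add: c'_def axis_def if_distrib cong: if_cong)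
      have nz: "c' b \<noteq> 0" if b: "b \<in> Basis" for b using d det b by (auto simp: Basis_vec_def c')
      have h: "?h x = 0 + (\<Sum>j\<in>Basis. (c' j * (x \<bullet> j)) *\<^sub>R j)" for x
      proof -
        have "(\<Sum>j\<in>Basis. (c' j * (x \<bullet> j)) *\<^sub>R j) \<bullet> axis i 1 = c i * x $ i" for i
          by (subst inner_sum_left_Basis) (auto simp: axis_in_Basis_iff c' inner_axis)
        then show ?thesis by (simp add: vec_eq_iff inner_axis)
      qed
      have [measurable]: "?h \<in> borel_measurable borel"
        by (intro borel_measurable_continuous_onI continuous_intros)
      have "(\<integral>\<^sup>+x. F x \<partial>lborel) = (\<integral>\<^sup>+x. F x \<partial>density (distr lborel borel ?h) (\<lambda>_. (\<Prod>j\<in>Basis. \<bar>c' j\<bar>)))"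
        by (rule arg_cong[of _ _ "\<lambda>M. \<integral>\<^sup>+x. F x \<partial>M"])
           (unfold h, rule lborel_affine_euclidean[where t=0 and c=c', OF nz])
      also have "\<dots> = ennreal \<bar>det (matrix ?h)\<bar> * (\<integral>\<^sup>+x. F (?h x) \<partial>lborel)"
        by (subst nn_integral_density) (auto simp: nn_integral_cmult nn_integral_distr prod_Basis_cart c' det abs_prod)
      finally show "(\<integral>\<^sup>+x. F x \<partial>lborel) = ennreal \<bar>det (matrix ?h)\<bar> * (\<integral>\<^sup>+x. F (?h x) \<partial>lborel)" .
    qed
  next
    fix m n :: 'd assume "m \<noteq> n"
    let ?p = "Transposition.transpose m n"
    let ?h = "\<lambda>x :: real ^ 'd. \<chi> i. x $ ?p i"
    have p: "?p permutes UNIV" by (rule permutes_swap_id) auto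
    have "matrix ?h = (\<chi> i. mat 1 $ ?p i)" by (auto simp: matrix_def mat_def axis_def vec_eq_iff)
    then have det: "\<bar>det (matrix ?h)\<bar> = 1"
      using det_permute_rows[OF p, of "mat 1 :: real ^ 'd ^ 'd"] by (simp add: sign_def)
    have hm: "?h \<in> borel_measurable borel" by (intro borel_measurable_continuous_onI continuous_intros)
    show "P ?h"
      unfolding P_def det
    proof (intro impI ballI)
      fix F :: "real ^ 'd \<Rightarrow> ennreal" assume [measurable]: "F \<in> borel_measurable borel"
      have "(\<integral>\<^sup>+x. F x \<partial>lborel) = (\<integral>\<^sup>+x. F x \<partial>distr lborel borel ?h)"
        unfolding lborel_distr_permute_coords[OF p] ..
      also have "\<dots> = (\<integral>\<^sup>+x. F (?h x) \<partial>lborel)" by (rule nn_integral_distr) (use hm in auto)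
      finally show "(\<integral>\<^sup>+x. F x \<partial>lborel) = ennreal 1 * (\<integral>\<^sup>+x. F (?h x) \<partial>lborel)" by simp
    qed
  next
    fix m n :: 'd assume mn: "m \<noteq> n"
    let ?h = "\<lambda>x :: real ^ 'd. \<chi> i. if i = m then x $ m + x $ n else x $ i"
    have "matrix ?h = (\<chi> k. if k = m then row m (mat 1) + 1 *s row n (mat 1) else row k (mat 1))"
      by (auto simp: matrix_def mat_def axis_def vec_eq_iff row_def)
    then have "det (matrix ?h) = 1" using det_row_operation[OF mn, of "mat 1 :: real ^ 'd ^ 'd" 1] by simp
    then show "P ?h" using nn_integral_lborel_shear[OF _ mn] by (simp add: P_def)
  qed
  then show ?thesis by (rule PD) (use assms in auto)
qed

lemma inner_cart_sum: "(x :: real ^ 'd) \<bullet> y = (\<Sum>i\<in>UNIV. x $ i * y $ i)"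
  by (simp add: inner_vec_def)

lemma norm_cart_square: "(norm (x :: real ^ 'd))\<^sup>2 = (\<Sum>i\<in>UNIV. (x $ i)\<^sup>2)"
  unfolding power2_norm_eq_inner inner_cart_sum by (simp add: power2_eq_square)

lemma nn_integral_gaussian:
  assumes s: "0 < \<sigma>"
  shows "(\<integral>\<^sup>+x. ennreal (exp (- (norm (x :: real ^ 'd))\<^sup>2 / (2 * \<sigma>\<^sup>2))) \<partial>lborel) = ennreal (sqrt (2 * pi * \<sigma>\<^sup>2) ^ CARD('d))"
proof -
  have one: "(\<integral>\<^sup>+t. ennreal (exp (- t\<^sup>2 / (2 * \<sigma>\<^sup>2))) \<partial>lborel) = ennreal (sqrt (2 * pi * \<sigma>\<^sup>2))"
  proof -
    interpret N: prob_space "density lborel (\<lambda>x. ennreal (normal_density 0 \<sigma> x))"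
      by (rule prob_space_normal_density[OF s])
    have "1 = emeasure (density lborel (\<lambda>x. ennreal (normal_density 0 \<sigma> x))) UNIV"
      using N.emeasure_space_1 by simp
    also have "\<dots> = (\<integral>\<^sup>+t. ennreal (normal_density 0 \<sigma> t) \<partial>lborel)"
      by (subst emeasure_density) auto
    finally have "(\<integral>\<^sup>+t. ennreal (normal_density 0 \<sigma> t) \<partial>lborel) = 1" ..
    moreover have "(\<integral>\<^sup>+t. ennreal (exp (- t\<^sup>2 / (2 * \<sigma>\<^sup>2))) \<partial>lborel)
      = (\<integral>\<^sup>+t. ennreal (sqrt (2 * pi * \<sigma>\<^sup>2)) * ennreal (normal_density 0 \<sigma> t) \<partial>lborel)"
      using s by (intro nn_integral_cong) (simp add: normal_density_def ennreal_mult'[symmetric])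
    ultimately show ?thesis by (simp add: nn_integral_cmult)
  qed
  have "(\<integral>\<^sup>+x. ennreal (exp (- (norm (x :: real ^ 'd))\<^sup>2 / (2 * \<sigma>\<^sup>2))) \<partial>lborel)
    = (\<integral>\<^sup>+(x :: real ^ 'd). (\<Prod>b\<in>Basis. ennreal (exp (- (x \<bullet> b)\<^sup>2 / (2 * \<sigma>\<^sup>2)))) \<partial>lborel)"
  proof (rule nn_integral_cong)
    fix x :: "real ^ 'd"
    have "- (norm x)\<^sup>2 / (2 * \<sigma>\<^sup>2) = (\<Sum>i\<in>UNIV. - (x $ i)\<^sup>2 / (2 * \<sigma>\<^sup>2))"
      by (simp add: norm_cart_square sum_negf sum_divide_distrib)
    then show "ennreal (exp (- (norm x)\<^sup>2 / (2 * \<sigma>\<^sup>2))) = (\<Prod>b\<in>Basis. ennreal (exp (- (x \<bullet> b)\<^sup>2 / (2 * \<sigma>\<^sup>2))))"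
      by (simp add: prod_ennreal exp_sum prod_Basis_cart inner_axis)
  qed
  also have "\<dots> = (\<Prod>b\<in>(Basis :: (real ^ 'd) set). (\<integral>\<^sup>+t. ennreal (exp (- t\<^sup>2 / (2 * \<sigma>\<^sup>2))) \<partial>lborel))"
    by (rule nn_integral_lborel_prod) auto
  also have "\<dots> = ennreal (sqrt (2 * pi * \<sigma>\<^sup>2) ^ CARD('d))"
    unfolding one by (simp add: ennreal_power)
  finally show ?thesis .
qed

definition gauss_density :: "real ^ 'd \<Rightarrow> real" where
  "gauss_density x = exp (- (norm x)\<^sup>2 / 2) / sqrt (2 * pi) ^ CARD('d)"

definition std_normal :: "(real ^ 'd) measure" where
  "std_normal = density lborel (\<lambda>x. ennreal (gauss_density x))"

lemma gauss_density_pos: "0 < gauss_density x" by (simp add: gauss_density_def)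

lemma gauss_density_measurable [measurable]: "gauss_density \<in> borel_measurable borel"
  unfolding gauss_density_def[abs_def] by measurable

lemma sets_std_normal [simp, measurable_cong]: "sets std_normal = sets borel"
  by (simp add: std_normal_def)

lemma space_std_normal [simp]: "space std_normal = UNIV"
  by (simp add: std_normal_def)

lemma prob_space_std_normal: "prob_space (std_normal :: (real ^ 'd) measure)"
proof
  have "emeasure (std_normal :: (real ^ 'd) measure) UNIV = (\<integral>\<^sup>+x. ennreal (gauss_density (x :: real ^ 'd)) \<partial>lborel)"
    unfolding std_normal_def by (subst emeasure_density) auto
  also have "\<dots> = (\<integral>\<^sup>+(x :: real ^ 'd). ennreal (1 / sqrt (2 * pi) ^ CARD('d)) * ennreal (exp (- (norm x)\<^sup>2 / (2 * 1\<^sup>2))) \<partial>lborel)"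
    by (intro nn_integral_cong) (simp add: gauss_density_def ennreal_mult'[symmetric])
  also have "\<dots> = 1"
    by (subst nn_integral_cmult, measurable) (simp add: nn_integral_gaussian[of 1, simplified] ennreal_mult'[symmetric])
  finally show "emeasure (std_normal :: (real ^ 'd) measure) (space std_normal) = 1" by simp
qed

lemma integrable_norm_power4_gauss: "integrable lborel (\<lambda>x :: real ^ 'd. (1 + norm x ^ 4) * gauss_density x)"
proof -
  have i: "integrable lborel (\<lambda>x :: real ^ 'd. exp (- (norm x)\<^sup>2 / (2 * (sqrt 2)\<^sup>2)))"
    by (rule integrableI_nonneg) (use nn_integral_gaussian[of "sqrt 2", where 'd='d] in auto)
  show ?thesis
  proof (rule Bochner_Integration.integrable_bound[OF integrable_mult_right[OF i, of 33]])
    show "AE x in lborel. norm ((1 + norm x ^ 4) * gauss_density x) \<le> norm (33 * exp (- (norm (x :: real ^ 'd))\<^sup>2 / (2 * (sqrt 2)\<^sup>2)))"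
    proof (rule AE_I2)
      fix x :: "real ^ 'd"
      define s where "s = (norm x)\<^sup>2 / 4"
      have s: "0 \<le> s" by (simp add: s_def)
      have "1 + s + s\<^sup>2 / 2 \<le> exp s" using exp_lower_Taylor_quadratic[OF s] .
      then have "s\<^sup>2 / 2 \<le> exp s" "1 \<le> exp s" using s zero_le_power2[of s] by linarith+
      then have "1 + 16 * s\<^sup>2 \<le> 33 * exp s" by linarith
      moreover have "norm x ^ 4 = 16 * s\<^sup>2" by (simp add: s_def power2_eq_square power4_eq_xxxx)
      ultimately have le: "1 + norm x ^ 4 \<le> 33 * exp s" by simp
      have "1 \<le> sqrt (2 * pi) ^ CARD('d)" using pi_ge_two by (intro one_le_power) (auto intro!: real_le_rsqrt)
      then have "gauss_density x \<le> exp (- (norm x)\<^sup>2 / 2)"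
        unfolding gauss_density_def by (simp add: divide_le_eq mult_le_cancel_left1)
      then have "(1 + norm x ^ 4) * gauss_density x \<le> (33 * exp s) * exp (- (norm x)\<^sup>2 / 2)"
        using le gauss_density_pos[of x] by (intro mult_mono) auto
      also have "\<dots> = 33 * exp (- (norm x)\<^sup>2 / (2 * (sqrt 2)\<^sup>2))"
        by (simp add: s_def mult_exp_exp)
      finally show "norm ((1 + norm x ^ 4) * gauss_density x) \<le> norm (33 * exp (- (norm x)\<^sup>2 / (2 * (sqrt 2)\<^sup>2)))"
        using gauss_density_pos[of x] by (simp add: abs_mult)
    qed
  qed measurable
qed

lemma power_le_1_plus_power4:
  fixes t :: real
  assumes "0 \<le> t" "k \<le> 4" shows "t ^ k \<le> 1 + t ^ 4"
proof (cases "t \<le> 1")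
  case True
  then show ?thesis using power_le_one[of t k] zero_le_power[of t 4] assms by linarith
next
  case False
  then show ?thesis using power_increasing[of k 4 t] assms by linarith
qed

lemma integrable_gauss_growth:
  fixes u :: "real ^ 'd \<Rightarrow> real"
  assumes [measurable]: "u \<in> borel_measurable borel" and u: "\<And>x. \<bar>u x\<bar> \<le> C * (1 + norm x ^ 4)"
  shows "integrable lborel (\<lambda>x. u x * gauss_density x)" "integrable std_normal u"
proof -
  show i: "integrable lborel (\<lambda>x. u x * gauss_density x)"
  proof (rule Bochner_Integration.integrable_bound[OF integrable_mult_right[OF integrable_norm_power4_gauss, of C]])
    show "AE x in lborel. norm (u x * gauss_density x) \<le> norm (C * ((1 + norm x ^ 4) * gauss_density x))"
    proof (rule AE_I2)
      fix x
      have "\<bar>u x\<bar> * gauss_density x \<le> (C * (1 + norm x ^ 4)) * gauss_density x"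
        using u[of x] gauss_density_pos[of x] by (intro mult_right_mono) auto
      also have "\<dots> \<le> \<bar>C * ((1 + norm x ^ 4) * gauss_density x)\<bar>" unfolding mult.assoc by (rule abs_ge_self)
      finally show "norm (u x * gauss_density x) \<le> norm (C * ((1 + norm x ^ 4) * gauss_density x))"
        using gauss_density_pos[of x] by (simp only: real_norm_def abs_mult abs_of_pos)
    qed
  qed measurable
  then show "integrable std_normal u"
    unfolding std_normal_def using gauss_density_pos
    by (subst integrable_density) (auto simp: mult.commute intro!: AE_I2 less_imp_le)
qed

lemma integral_std_normal:
  fixes u :: "real ^ 'd \<Rightarrow> real"
  assumes "u \<in> borel_measurable borel"
  shows "(\<integral>x. u x \<partial>std_normal) = (\<integral>x. u x * gauss_density x \<partial>lborel)"
  unfolding std_normal_def using assms gauss_density_pos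
  by (subst integral_density) (auto simp: mult.commute intro!: AE_I2 less_imp_le)

lemma integral_directional_derivative_zero:
  fixes G g :: "'a::euclidean_space \<Rightarrow> real"
  assumes G: "integrable lborel G" and g: "integrable lborel g" and cont: "continuous_on UNIV g"
    and D: "\<And>x. ((\<lambda>t. G (x + t *\<^sub>R e)) has_real_derivative g x) (at 0)"
  shows "(\<integral>x. g x \<partial>lborel) = 0"
proof -
  have gm [measurable]: "g \<in> borel_measurable borel" using g by auto
  have D': "((\<lambda>t. G (x + t *\<^sub>R e)) has_real_derivative g (x + t *\<^sub>R e)) (at t)" for x t
  proof -
    have "((\<lambda>s. G ((x + t *\<^sub>R e) + s *\<^sub>R e)) has_real_derivative g (x + t *\<^sub>R e)) (at 0)" by (rule D)
    then have "((\<lambda>s. G (x + (s + t) *\<^sub>R e)) has_real_derivative g (x + t *\<^sub>R e)) (at 0)"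
      by (simp add: algebra_simps)
    then show ?thesis using DERIV_shift[of "\<lambda>s. G (x + s *\<^sub>R e)" _ 0 t] by simp
  qed
  have FTC: "(\<integral>t. g (x + t *\<^sub>R e) * indicator {0..1} t \<partial>lborel) = G (x + 1 *\<^sub>R e) - G (x + 0 *\<^sub>R e)" for x
  proof (rule integral_FTC_Icc_real)
    show "isCont (\<lambda>t. g (x + t *\<^sub>R e)) t" for t
    proof -
      have "continuous_on UNIV (\<lambda>t. g (x + t *\<^sub>R e))"
        by (rule continuous_on_compose2[OF cont]) (auto intro!: continuous_intros)
      then show ?thesis by (simp add: continuous_on_eq_continuous_at)
    qed
  qed (use D' in auto)
  have shift: "integrable lborel (\<lambda>x. k (x + v))" "(\<integral>x. k (x + v) \<partial>lborel) = (\<integral>x. k x \<partial>lborel)"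
    if k: "integrable lborel k" for k :: "'a \<Rightarrow> real" and v
  proof -
    have [measurable]: "k \<in> borel_measurable borel" using k by auto
    have "integrable (distr lborel borel ((+) v)) k" unfolding lborel_distr_plus by (rule k)
    then show "integrable lborel (\<lambda>x. k (x + v))" by (subst (asm) integrable_distr_eq) (auto simp: add.commute)
    have "(\<integral>x. k x \<partial>lborel) = (\<integral>x. k x \<partial>distr lborel borel ((+) v))" unfolding lborel_distr_plus ..
    also have "\<dots> = (\<integral>x. k (x + v) \<partial>lborel)" by (subst integral_distr) (auto simp: add.commute)
    finally show "(\<integral>x. k (x + v) \<partial>lborel) = (\<integral>x. k x \<partial>lborel)" ..
  qed
  let ?f = "\<lambda>(t, x). g (x + t *\<^sub>R e) * indicator {0..1} t"
  have int: "integrable (lborel \<Otimes>\<^sub>M lborel) ?f"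
  proof (rule lborel_pair.Fubini_integrable)
    have "(\<integral>x. norm (?f (t, x)) \<partial>lborel) = (\<integral>x. \<bar>g x\<bar> \<partial>lborel) * indicator {0..1} t" for t
      using shift(2)[OF integrable_abs[OF g], of "t *\<^sub>R e"] by (simp add: abs_mult)
    then show "integrable lborel (\<lambda>t. \<integral>x. norm (?f (t, x)) \<partial>lborel)"
      by (simp add: integrable_mult_right integrable_indicator_iff)
    show "AE t in lborel. integrable lborel (\<lambda>x. ?f (t, x))"
      using shift(1)[OF g] by auto
  qed measurable
  have "(\<integral>t. (\<integral>x. ?f (t, x) \<partial>lborel) \<partial>lborel) = (\<integral>t. (\<integral>x. g x \<partial>lborel) * indicator {0..1::real} t \<partial>lborel)"
    using shift(2)[OF g] by simp
  also have "\<dots> = (\<integral>x. g x \<partial>lborel)" by simp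
  finally have 1: "(\<integral>t. (\<integral>x. ?f (t, x) \<partial>lborel) \<partial>lborel) = (\<integral>x. g x \<partial>lborel)" .
  have "(\<integral>x. (\<integral>t. ?f (t, x) \<partial>lborel) \<partial>lborel) = (\<integral>x. G (x + e) - G x \<partial>lborel)"
    using FTC by simp
  also have "\<dots> = 0" using shift[OF G, of e] G by simp
  finally have "(\<integral>x. (\<integral>t. ?f (t, x) \<partial>lborel) \<partial>lborel) = 0" .
  moreover have "(\<integral>x. (\<integral>t. ?f (t, x) \<partial>lborel) \<partial>lborel) = (\<integral>t. (\<integral>x. ?f (t, x) \<partial>lborel) \<partial>lborel)"
    using lborel_pair.Fubini_integral[of "\<lambda>t x. ?f (t, x)"] int by simp
  ultimately show ?thesis using 1 by simp
qed

definition C11 :: "real \<Rightarrow> (real ^ 'd \<Rightarrow> real) \<Rightarrow> ('d \<Rightarrow> real ^ 'd \<Rightarrow> real) \<Rightarrow> bool" where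
  "C11 M F dF \<longleftrightarrow> 0 \<le> M \<and> (\<forall>x v. \<bar>F (x + v) - F x\<bar> \<le> M * norm v)
    \<and> (\<forall>x v. \<bar>F (x + v) - F x - (\<Sum>a\<in>UNIV. dF a x * v $ a)\<bar> \<le> M * (norm v)\<^sup>2)
    \<and> (\<forall>a x. \<bar>dF a x\<bar> \<le> M) \<and> (\<forall>a x v. \<bar>dF a (x + v) - dF a x\<bar> \<le> M * norm v)"

lemma C11D:
  assumes "C11 M F dF"
  shows "0 \<le> M" "\<bar>F (x + v) - F x\<bar> \<le> M * norm v"
    "\<bar>F (x + v) - F x - (\<Sum>a\<in>UNIV. dF a x * v $ a)\<bar> \<le> M * (norm v)\<^sup>2"
    "\<bar>dF a x\<bar> \<le> M" "\<bar>dF a (x + v) - dF a x\<bar> \<le> M * norm v"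
  using assms by (auto simp: C11_def)

lemma lipschitz_continuous_cart:
  fixes F :: "real ^ 'd \<Rightarrow> real"
  assumes "\<And>x v. \<bar>F (x + v) - F x\<bar> \<le> M * norm v" "0 \<le> M"
  shows "continuous_on UNIV F"
proof (rule lipschitz_on_continuous_on)
  show "M-lipschitz_on UNIV F"
  proof (rule lipschitz_onI)
    show "dist (F x) (F y) \<le> M * dist x y" for x y
      using assms(1)[of y "x - y"] by (simp add: dist_norm)
  qed fact
qed

lemma C11_continuous:
  assumes "C11 M F dF" shows "continuous_on UNIV F" "continuous_on UNIV (dF a)"
proof -
  show "continuous_on UNIV F" by (rule lipschitz_continuous_cart[OF C11D(2)[OF assms] C11D(1)[OF assms]])
  show "continuous_on UNIV (dF a)" by (rule lipschitz_continuous_cart[OF C11D(5)[OF assms] C11D(1)[OF assms]])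
qed

lemma C11_measurable:
  assumes "C11 M F dF" shows "F \<in> borel_measurable borel" "dF a \<in> borel_measurable borel"
  using C11_continuous[OF assms] by (auto intro: borel_measurable_continuous_onI)

lemma C11_growth: 
  assumes "C11 M F dF" shows "\<bar>F x\<bar> \<le> \<bar>F 0\<bar> + M * norm x"
  using C11D(2)[OF assms, of 0 x] by simp

lemma C11_directional_derivative:
  assumes F: "C11 M F dF"
  shows "((\<lambda>t. F (x + t *\<^sub>R axis a 1)) has_real_derivative dF a x) (at 0)"
proof -
  have "((\<lambda>h. (F (x + h *\<^sub>R axis a 1) - F x) / h - dF a x) \<longlongrightarrow> 0) (at 0)"
  proof (rule tendsto_0_le[where K=1])
    show "((\<lambda>h. M * \<bar>h\<bar>) \<longlongrightarrow> 0) (at (0::real))" by (auto intro!: tendsto_eq_intros)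
    show "\<forall>\<^sub>F h in at 0. norm ((F (x + h *\<^sub>R axis a 1) - F x) / h - dF a x) \<le> norm (M * \<bar>h\<bar>) * 1"
    proof (intro eventually_at_filter[THEN iffD2] always_eventually allI impI)
      fix h :: real assume "h \<noteq> 0"
      have "(\<Sum>b\<in>UNIV. dF b x * (h *\<^sub>R axis a 1) $ b) = h * dF a x"
        by (simp add: axis_def if_distrib cong: if_cong)
      then have "\<bar>F (x + h *\<^sub>R axis a 1) - F x - h * dF a x\<bar> \<le> M * h\<^sup>2"
        using C11D(3)[OF F, of x "h *\<^sub>R axis a 1"] by simp
      then have "\<bar>F (x + h *\<^sub>R axis a 1) - F x - h * dF a x\<bar> / \<bar>h\<bar> \<le> M * h\<^sup>2 / \<bar>h\<bar>" by (intro divide_right_mono) auto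
      also have "\<dots> = M * \<bar>h\<bar>" using \<open>h \<noteq> 0\<close> by (simp add: power2_eq_square abs_if)
      finally show "norm ((F (x + h *\<^sub>R axis a 1) - F x) / h - dF a x) \<le> norm (M * \<bar>h\<bar>) * 1"
        using \<open>h \<noteq> 0\<close> C11D(1)[OF F] by (simp add: diff_divide_distrib abs_mult flip: abs_divide)
    qed
  qed
  then show ?thesis by (simp add: DERIV_def LIM_zero_iff)
qed

lemma std_normal_stein:
  fixes F :: "real ^ 'd \<Rightarrow> real"
  assumes F: "C11 M F dF"
  shows "(\<integral>x. x $ a * F x \<partial>std_normal) = (\<integral>x. dF a x \<partial>std_normal)"
proof -
  note [measurable] = C11_measurable[OF F]
  have M: "0 \<le> M" by (rule C11D(1)[OF F])
  have comp [measurable]: "(\<lambda>x :: real ^ 'd. x $ a) \<in> borel_measurable borel"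
    by (intro borel_measurable_continuous_onI continuous_intros)
  have xa: "\<bar>x $ a\<bar> \<le> norm x" for x :: "real ^ 'd" by (rule component_le_norm_cart)
  have iF: "integrable lborel (\<lambda>x. F x * gauss_density x)"
  proof (rule integrable_gauss_growth(1)[where C="\<bar>F 0\<bar> + M"])
    fix x :: "real ^ 'd"
    have "M * norm x \<le> M * (1 + norm x ^ 4)" using power_le_1_plus_power4[of "norm x" 1] M by (intro mult_left_mono) auto
    moreover have "\<bar>F 0\<bar> * 1 \<le> \<bar>F 0\<bar> * (1 + norm x ^ 4)" by (intro mult_left_mono) auto
    ultimately show "\<bar>F x\<bar> \<le> (\<bar>F 0\<bar> + M) * (1 + norm x ^ 4)"
      using C11_growth[OF F, of x] unfolding distrib_right by linarith
  qed measurable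
  have ixF: "integrable lborel (\<lambda>x. (x $ a * F x) * gauss_density x)"
  proof (rule integrable_gauss_growth(1)[where C="\<bar>F 0\<bar> + M"])
    fix x :: "real ^ 'd"
    have "\<bar>x $ a * F x\<bar> \<le> norm x * (\<bar>F 0\<bar> + M * norm x)"
      unfolding abs_mult using C11_growth[OF F, of x] xa M by (intro mult_mono) auto
    also have "\<dots> = \<bar>F 0\<bar> * norm x + M * (norm x)\<^sup>2" by (simp add: power2_eq_square algebra_simps)
    also have "\<dots> \<le> \<bar>F 0\<bar> * (1 + norm x ^ 4) + M * (1 + norm x ^ 4)"
      using power_le_1_plus_power4[of "norm x" 1] power_le_1_plus_power4[of "norm x" 2] M
      by (intro add_mono mult_left_mono) auto
    finally show "\<bar>x $ a * F x\<bar> \<le> (\<bar>F 0\<bar> + M) * (1 + norm x ^ 4)" by (simp add: algebra_simps)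
  qed measurable
  have idF: "integrable lborel (\<lambda>x. dF a x * gauss_density x)"
  proof (rule integrable_gauss_growth(1)[where C=M])
    show "\<bar>dF a x\<bar> \<le> M * (1 + norm x ^ 4)" for x
      using C11D(4)[OF F, of a x] M mult_left_mono[of 1 "1 + norm x ^ 4" M] by simp
  qed measurable
  have "(\<integral>x. dF a x * gauss_density x - (x $ a * F x) * gauss_density x \<partial>lborel) = 0"
  proof (rule integral_directional_derivative_zero[OF iF])
    have "continuous_on UNIV (\<lambda>x :: real ^ 'd. gauss_density x)"
      unfolding gauss_density_def by (intro continuous_intros) auto
    then show "continuous_on UNIV (\<lambda>x. dF a x * gauss_density x - x $ a * F x * gauss_density x)"
      using C11_continuous[OF F] by (intro continuous_intros) auto
    show "((\<lambda>t. F (x + t *\<^sub>R axis a 1) * gauss_density (x + t *\<^sub>R axis a 1)) has_real_derivative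
         dF a x * gauss_density x - x $ a * F x * gauss_density x) (at 0)" for x
    proof -
      have n: "(norm (x + t *\<^sub>R axis a 1))\<^sup>2 = (norm x)\<^sup>2 + 2 * t * x $ a + t\<^sup>2" for t
        unfolding power2_norm_eq_inner by (simp add: inner_simps inner_axis inner_axis' power2_eq_square algebra_simps)
      have "((\<lambda>t. gauss_density (x + t *\<^sub>R axis a 1)) has_real_derivative - x $ a * gauss_density x) (at 0)"
        unfolding gauss_density_def n by (auto intro!: derivative_eq_intros)
      from DERIV_mult[OF C11_directional_derivative[OF F, of x a] this] show ?thesis
        by (simp add: algebra_simps)
    qed
  qed (use ixF idF in auto)
  then show ?thesis using ixF idF by (simp add: integral_std_normal)
qed

text \<open>For the centred normal distribution with covariance \<open>S\<close> this is integration by parts, the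
  only property of Gaussian measures used in the comparison. Singular \<open>S\<close> is allowed.\<close>

definition stein :: "real ^ 'd ^ 'd \<Rightarrow> (real ^ 'd) measure \<Rightarrow> bool" where
  "stein S Q \<longleftrightarrow> prob_space Q \<and> sets Q = sets borel \<and> integrable Q (\<lambda>x. norm x ^ 3)
    \<and> (\<forall>M F dF a. C11 M F dF \<longrightarrow> (\<integral>x. x $ a * F x \<partial>Q) = (\<Sum>b\<in>UNIV. S $ a $ b * (\<integral>x. dF b x \<partial>Q)))"

lemma steinD:
  assumes "stein S Q"
  shows "prob_space Q" "sets Q = sets borel" "integrable Q (\<lambda>x. norm x ^ 3)"
    "C11 M F dF \<Longrightarrow> (\<integral>x. x $ a * F x \<partial>Q) = (\<Sum>b\<in>UNIV. S $ a $ b * (\<integral>x. dF b x \<partial>Q))"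
  using assms by (auto simp: stein_def)

lemma power_le_1_plus_power3:
  fixes t :: real
  assumes "0 \<le> t" "k \<le> 3" shows "t ^ k \<le> 1 + t ^ 3"
proof (cases "t \<le> 1")
  case True
  then show ?thesis using power_le_one[of t k] zero_le_power[of t 3] assms by linarith
next
  case False
  then show ?thesis using power_increasing[of k 3 t] assms by linarith
qed

lemma integrable_cubic_growth:
  fixes u :: "real ^ 'd \<Rightarrow> real"
  assumes "finite_measure Q" and sets: "sets Q = sets borel" and i: "integrable Q (\<lambda>x. norm x ^ 3)"
    and u: "u \<in> borel_measurable borel" and b: "\<And>x. \<bar>u x\<bar> \<le> C * (1 + norm x ^ 3)"
  shows "integrable Q u"
proof -
  interpret finite_measure Q by fact
  have "integrable Q (\<lambda>x. C * (1 + norm x ^ 3))" using i by auto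
  then show ?thesis
  proof (rule Bochner_Integration.integrable_bound)
    show "u \<in> borel_measurable Q" using u sets by (simp cong: measurable_cong_sets)
    show "AE x in Q. norm (u x) \<le> norm (C * (1 + norm x ^ 3))"
      using b by (auto intro!: AE_I2 intro: order_trans[OF _ abs_ge_self])
  qed
qed

lemma component_measurable [measurable]: "(\<lambda>x :: real ^ 'd. x $ a) \<in> borel_measurable borel"
  by (intro borel_measurable_continuous_onI continuous_intros)

definition frob :: "real ^ 'd ^ 'd \<Rightarrow> real" where
  "frob B = sqrt (\<Sum>i\<in>UNIV. \<Sum>j\<in>UNIV. (B $ i $ j)\<^sup>2)"

lemma frob_nonneg: "0 \<le> frob B" by (simp add: frob_def sum_nonneg)

lemma norm_matrix_le_frob: "norm (B *v x) \<le> frob B * norm (x :: real ^ 'd)"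
proof -
  have "(norm (B *v x))\<^sup>2 = (\<Sum>i\<in>UNIV. (\<Sum>j\<in>UNIV. B $ i $ j * x $ j)\<^sup>2)"
    by (simp add: norm_cart_square matrix_vector_mult_def)
  also have "\<dots> \<le> (\<Sum>i\<in>UNIV. (\<Sum>j\<in>UNIV. (B $ i $ j)\<^sup>2) * (\<Sum>j\<in>UNIV. (x $ j)\<^sup>2))"
    by (intro sum_mono Cauchy_Schwarz_ineq_sum)
  also have "\<dots> = (frob B * norm x)\<^sup>2"
    by (simp add: frob_def power_mult_distrib norm_cart_square sum_distrib_right sum_nonneg)
  finally show ?thesis by (rule power2_le_imp_le) (simp add: frob_nonneg)
qed

lemma frob_square: "(frob B)\<^sup>2 = (\<Sum>i\<in>UNIV. (B ** transpose B) $ i $ i)"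
  by (simp add: frob_def sum_nonneg matrix_matrix_mult_def transpose_def power2_eq_square)

lemma matrix_apply_measurable [measurable]: "(*v) (B :: real ^ 'd ^ 'd) \<in> borel_measurable borel"
  by (intro borel_measurable_continuous_onI linear_continuous_on) (simp add: matrix_vector_mul_bounded_linear)

lemma C11_linear:
  fixes B :: "real ^ 'd ^ 'd"
  assumes F: "C11 M F dF"
  shows "\<exists>M'. C11 M' (\<lambda>y. F (B *v y)) (\<lambda>c y. \<Sum>b\<in>UNIV. B $ b $ c * dF b (B *v y))"
proof -
  define K where "K = (\<Sum>c\<in>UNIV. \<Sum>b\<in>UNIV. \<bar>B $ b $ c\<bar>)"
  define L where "L = frob B"
  have K0: "0 \<le> K" and L0: "0 \<le> L" and M0: "0 \<le> M"
    using C11D(1)[OF F] by (auto simp: K_def L_def frob_nonneg sum_nonneg)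
  have BL: "norm (B *v v) \<le> L * norm v" for v unfolding L_def by (rule norm_matrix_le_frob)
  have Kc: "(\<Sum>b\<in>UNIV. \<bar>B $ b $ c\<bar>) \<le> K" for c
    unfolding K_def by (rule member_le_sum) (auto intro: sum_nonneg)
  let ?M = "M * L + M * L\<^sup>2 + K * M + K * M * L"
  have parts: "0 \<le> M * L" "0 \<le> M * L\<^sup>2" "0 \<le> K * M" "0 \<le> K * M * L" using K0 L0 M0 by auto
  have "C11 ?M (\<lambda>y. F (B *v y)) (\<lambda>c y. \<Sum>b\<in>UNIV. B $ b $ c * dF b (B *v y))"
    unfolding C11_def
  proof (intro conjI allI)
    show "0 \<le> ?M" using parts by simp
    fix x v :: "real ^ 'd" and c
    have up: "p \<le> ?M * t" if "p \<le> k * t" "k \<le> ?M" "0 \<le> t" for p k t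
      using that mult_right_mono[of k ?M t] by linarith
    have "\<bar>F (B *v (x + v)) - F (B *v x)\<bar> \<le> M * norm (B *v v)"
      unfolding matrix_vector_right_distrib by (rule C11D(2)[OF F])
    also have "\<dots> \<le> M * (L * norm v)" using BL M0 by (intro mult_left_mono) auto
    finally show "\<bar>F (B *v (x + v)) - F (B *v x)\<bar> \<le> ?M * norm v"
      by (intro up[of _ "M * L"]) (use parts in auto)
    have "(\<Sum>b\<in>UNIV. dF b (B *v x) * (B *v v) $ b) = (\<Sum>c\<in>UNIV. (\<Sum>b\<in>UNIV. B $ b $ c * dF b (B *v x)) * v $ c)"
      unfolding matrix_vector_mult_def by (simp add: sum_distrib_left sum_distrib_right, subst sum.swap) (simp add: ac_simps)
    then have "\<bar>F (B *v (x + v)) - F (B *v x) - (\<Sum>c\<in>UNIV. (\<Sum>b\<in>UNIV. B $ b $ c * dF b (B *v x)) * v $ c)\<bar> \<le> M * (norm (B *v v))\<^sup>2"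
      using C11D(3)[OF F, of "B *v x" "B *v v"] by (simp add: matrix_vector_right_distrib)
    also have "\<dots> \<le> M * (L * norm v)\<^sup>2" using BL M0 by (intro mult_left_mono power_mono) auto
    finally show "\<bar>F (B *v (x + v)) - F (B *v x) - (\<Sum>c\<in>UNIV. (\<Sum>b\<in>UNIV. B $ b $ c * dF b (B *v x)) * v $ c)\<bar> \<le> ?M * (norm v)\<^sup>2"
      by (intro up[of _ "M * L\<^sup>2"]) (use parts in \<open>auto simp: power_mult_distrib ac_simps\<close>)
    have "\<bar>\<Sum>b\<in>UNIV. B $ b $ c * dF b (B *v x)\<bar> \<le> (\<Sum>b\<in>UNIV. \<bar>B $ b $ c\<bar> * M)"
      by (rule order_trans[OF sum_abs]) (auto simp: abs_mult intro!: sum_mono mult_left_mono C11D(4)[OF F])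
    also have "\<dots> \<le> K * M" unfolding sum_distrib_right[symmetric] using Kc M0 by (intro mult_right_mono) auto
    finally show "\<bar>\<Sum>b\<in>UNIV. B $ b $ c * dF b (B *v x)\<bar> \<le> ?M" using parts by linarith
    have "\<bar>(\<Sum>b\<in>UNIV. B $ b $ c * dF b (B *v (x + v))) - (\<Sum>b\<in>UNIV. B $ b $ c * dF b (B *v x))\<bar>
       = \<bar>\<Sum>b\<in>UNIV. B $ b $ c * (dF b (B *v x + B *v v) - dF b (B *v x))\<bar>"
      by (simp add: matrix_vector_right_distrib right_diff_distrib sum_subtractf)
    also have "\<dots> \<le> (\<Sum>b\<in>UNIV. \<bar>B $ b $ c\<bar> * (M * (L * norm v)))"
    proof (rule order_trans[OF sum_abs], rule sum_mono)
      fix b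
      have "\<bar>dF b (B *v x + B *v v) - dF b (B *v x)\<bar> \<le> M * (L * norm v)"
        using C11D(5)[OF F, of b "B *v x" "B *v v"] mult_left_mono[OF BL[of v] M0] by linarith
      then show "\<bar>B $ b $ c * (dF b (B *v x + B *v v) - dF b (B *v x))\<bar> \<le> \<bar>B $ b $ c\<bar> * (M * (L * norm v))"
        unfolding abs_mult by (rule mult_left_mono) auto
    qed
    also have "\<dots> \<le> K * (M * (L * norm v))"
      unfolding sum_distrib_right[symmetric] using Kc M0 L0 by (intro mult_right_mono) auto
    finally show "\<bar>(\<Sum>b\<in>UNIV. B $ b $ c * dF b (B *v (x + v))) - (\<Sum>b\<in>UNIV. B $ b $ c * dF b (B *v x))\<bar> \<le> ?M * norm v"
      by (intro up[of _ "K * M * L"]) (use parts in auto)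
  qed
  then show ?thesis by blast
qed

definition gauss_third_moment :: "'d::finite itself \<Rightarrow> real" where
  "gauss_third_moment _ = (\<integral>x. norm (x :: real ^ 'd) ^ 3 \<partial>std_normal)"

lemma integrable_std_normal_cube: "integrable std_normal (\<lambda>x :: real ^ 'd. norm x ^ 3)"
  by (rule integrable_gauss_growth(2)[where C=1]) (auto intro: power_le_1_plus_power4)

lemma stein_linear:
  fixes B :: "real ^ 'd ^ 'd"
  shows "stein (B ** transpose B) (distr std_normal borel ((*v) B))" (is "stein _ ?Q")
    and "(\<integral>x. norm x ^ 3 \<partial>distr std_normal borel ((*v) B)) \<le> frob B ^ 3 * gauss_third_moment TYPE('d)"
proof -
  interpret N: prob_space "std_normal :: (real ^ 'd) measure" by (rule prob_space_std_normal)
  have Bm: "(*v) B \<in> std_normal \<rightarrow>\<^sub>M borel" by measurable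
  have le: "norm (B *v x) ^ 3 \<le> frob B ^ 3 * norm x ^ 3" for x
    using power_mono[OF norm_matrix_le_frob[of B x], of 3] by (simp add: power_mult_distrib)
  have i: "integrable std_normal (\<lambda>x. norm (B *v x) ^ 3)"
    by (rule Bochner_Integration.integrable_bound[OF integrable_mult_right[OF integrable_std_normal_cube, of "frob B ^ 3"]])
       (use le in \<open>auto intro!: AE_I2 simp: abs_mult frob_nonneg\<close>)
  show "(\<integral>x. norm x ^ 3 \<partial>?Q) \<le> frob B ^ 3 * gauss_third_moment TYPE('d)"
  proof -
    have "(\<integral>x. norm x ^ 3 \<partial>?Q) = (\<integral>x. norm (B *v x) ^ 3 \<partial>std_normal)"
      by (subst integral_distr[OF Bm]) auto
    also have "\<dots> \<le> (\<integral>x. frob B ^ 3 * norm (x :: real ^ 'd) ^ 3 \<partial>std_normal)"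
      using i le integrable_std_normal_cube by (intro integral_mono) auto
    finally show ?thesis by (simp add: gauss_third_moment_def)
  qed
  show "stein (B ** transpose B) ?Q"
    unfolding stein_def
  proof (intro conjI allI impI)
    show "prob_space ?Q" by (rule N.prob_space_distr[OF Bm])
    show "integrable ?Q (\<lambda>x. norm x ^ 3)" using i by (subst integrable_distr_eq[OF Bm]) auto
    fix M F dF a assume F: "C11 M F (dF :: 'd \<Rightarrow> real ^ 'd \<Rightarrow> real)"
    note Fm [measurable] = C11_measurable[OF F]
    obtain M' where C: "C11 M' (\<lambda>y. F (B *v y)) (\<lambda>c y. \<Sum>b\<in>UNIV. B $ b $ c * dF b (B *v y))"
      using C11_linear[OF F] by blast
    have Fg: "integrable std_normal (\<lambda>y. y $ c * F (B *v y))" for c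
    proof (rule integrable_gauss_growth(2)[where C="\<bar>F 0\<bar> + M'"])
      show "(\<lambda>y. y $ c * F (B *v y)) \<in> borel_measurable borel" by measurable
      fix x :: "real ^ 'd"
      have "\<bar>x $ c * F (B *v x)\<bar> \<le> norm x * (\<bar>F 0\<bar> + M' * norm x)"
        unfolding abs_mult using C11_growth[OF C, of x] C11D(1)[OF C] component_le_norm_cart[of x c] by (intro mult_mono) auto
      also have "\<dots> = \<bar>F 0\<bar> * norm x + M' * (norm x)\<^sup>2" by (simp add: power2_eq_square algebra_simps)
      also have "\<dots> \<le> \<bar>F 0\<bar> * (1 + norm x ^ 4) + M' * (1 + norm x ^ 4)"
        using power_le_1_plus_power4[of "norm x" 1] power_le_1_plus_power4[of "norm x" 2] C11D(1)[OF C]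
        by (intro add_mono mult_left_mono) auto
      finally show "\<bar>x $ c * F (B *v x)\<bar> \<le> (\<bar>F 0\<bar> + M') * (1 + norm x ^ 4)" by (simp add: algebra_simps)
    qed
    have dFi: "integrable std_normal (\<lambda>y. dF b (B *v y))" for b
      by (rule N.integrable_const_bound[where B=M]) (use C11D(4)[OF F] in auto)
    have "(\<integral>x. x $ a * F x \<partial>?Q) = (\<integral>y. (B *v y) $ a * F (B *v y) \<partial>std_normal)"
      by (subst integral_distr[OF Bm]) auto
    also have "\<dots> = (\<integral>y. (\<Sum>c\<in>UNIV. B $ a $ c * (y $ c * F (B *v y))) \<partial>std_normal)"
      by (simp add: matrix_vector_mult_def sum_distrib_right mult.assoc)
    also have "\<dots> = (\<Sum>c\<in>UNIV. B $ a $ c * (\<integral>y. y $ c * F (B *v y) \<partial>std_normal))"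
      using Fg by simp
    also have "\<dots> = (\<Sum>c\<in>UNIV. B $ a $ c * (\<Sum>b\<in>UNIV. B $ b $ c * (\<integral>y. dF b (B *v y) \<partial>std_normal)))"
      using std_normal_stein[OF C] dFi by simp
    also have "\<dots> = (\<Sum>b\<in>UNIV. (B ** transpose B) $ a $ b * (\<integral>y. dF b (B *v y) \<partial>std_normal))"
      unfolding matrix_matrix_mult_def transpose_def
      by (simp add: sum_distrib_left sum_distrib_right, subst sum.swap) (simp add: ac_simps)
    also have "\<dots> = (\<Sum>b\<in>UNIV. (B ** transpose B) $ a $ b * (\<integral>x. dF b x \<partial>?Q))"
      by (subst integral_distr[OF Bm]) auto
    finally show "(\<integral>x. x $ a * F x \<partial>?Q) = (\<Sum>b\<in>UNIV. (B ** transpose B) $ a $ b * (\<integral>x. dF b x \<partial>?Q))" .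
  qed simp
qed

lemma positive_definite_basis:
  fixes P :: "real ^ 'd ^ 'd"
  assumes sym: "transpose P = P" and pd: "\<And>v. v \<noteq> 0 \<Longrightarrow> 0 < v \<bullet> (P *v v)"
  shows "\<exists>u :: 'd \<Rightarrow> real ^ 'd. \<forall>i\<in>I. \<forall>j\<in>I. u i \<bullet> (P *v u j) = (if i = j then 1 else 0)"
proof -
  have "finite I" by simp
  then show ?thesis
  proof (induction rule: finite_induct)
  case empty then show ?case by simp
next
  case (insert k I)
  then obtain u where u: "\<forall>i\<in>I. \<forall>j\<in>I. u i \<bullet> (P *v u j) = (if i = j then 1 else 0)" by blast
  let ?S = "(\<lambda>i. P *v u i) ` I"
  have "dim ?S \<le> card ?S" by (rule dim_le_card') simp
  also have "\<dots> \<le> card I" by (rule card_image_le) simp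
  also have "\<dots> < card (UNIV :: 'd set)" using insert by (intro psubset_card_mono) auto
  finally have "dim ?S < DIM(real ^ 'd)" by simp
  then obtain w where w: "w \<noteq> 0" "\<And>y. y \<in> span ?S \<Longrightarrow> orthogonal w y"
    using orthogonal_to_subspace_exists by blast
  define c where "c = w \<bullet> (P *v w)"
  have c: "0 < c" unfolding c_def by (rule pd[OF w(1)])
  define w' where "w' = (1 / sqrt c) *\<^sub>R w"
  have swap: "x \<bullet> (P *v y) = y \<bullet> (P *v x)" for x y
    using dot_lmul_matrix[of x P y] sym by (metis inner_commute transpose_matrix_vector)
  have wi: "w' \<bullet> (P *v u i) = 0" if "i \<in> I" for i
    using w(2)[of "P *v u i"] that by (auto simp: w'_def orthogonal_def intro: span_base)
  have wi': "u i \<bullet> (P *v w') = 0" if "i \<in> I" for i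
    by (rule trans[OF swap wi[OF that]])
  have ww: "w' \<bullet> (P *v w') = 1"
    using c by (simp add: w'_def matrix_vector_mult_scaleR flip: c_def)
  have "\<forall>i\<in>insert k I. \<forall>j\<in>insert k I. (u(k := w')) i \<bullet> (P *v (u(k := w')) j) = (if i = j then 1 else 0)"
    using u wi wi' ww insert(2) by auto
  then show ?case by blast
qed
qed

lemma positive_definite_factor:
  fixes S :: "real ^ 'd ^ 'd"
  assumes S: "positive_definite S"
  obtains B where "B ** transpose B = S" "det B \<noteq> 0" "transpose B ** matrix_inv S ** B = mat 1"
proof -
  have sym: "transpose S = S" and pd: "\<And>v. v \<noteq> 0 \<Longrightarrow> 0 < v \<bullet> (S *v v)"
    using S by (auto simp: positive_definite_def)
  obtain u :: "'d \<Rightarrow> real ^ 'd" where u: "\<And>i j. u i \<bullet> (S *v u j) = (if i = j then 1 else 0)"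
    using positive_definite_basis[OF sym pd, of UNIV] by auto
  define U where "U = (\<chi> i. u i)"
  have U1: "U ** S ** transpose U = mat 1"
  proof -
    have "(U ** S ** transpose U) $ i $ j = u i \<bullet> (S *v u j)" for i j
      unfolding matrix_mul_assoc[symmetric]
      by (simp add: U_def matrix_matrix_mult_def transpose_def inner_cart_sum matrix_vector_mult_def)
    then show ?thesis using u by (simp add: vec_eq_iff mat_def)
  qed
  have "det U * det S * det U = 1"
    using arg_cong[OF U1, of det] by (simp add: det_mul det_transpose)
  then have dU: "det U \<noteq> 0" and dS: "det S \<noteq> 0" by auto
  obtain B where B: "U ** B = mat 1" "B ** U = mat 1"
    using dU invertible_det_nz[of U] by (auto simp: invertible_def)
  have "B ** (U ** S ** transpose U) ** transpose B = (B ** U) ** S ** (transpose U ** transpose B)"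
    by (simp add: matrix_mul_assoc)
  also have "transpose U ** transpose B = mat 1" using B(2) by (metis matrix_transpose_mul transpose_mat)
  finally have BS: "B ** transpose B = S" unfolding U1 B by simp
  have dB: "det B \<noteq> 0" using arg_cong[OF B(1), of det] by (auto simp: det_mul)
  have iS: "S ** matrix_inv S = mat 1" "matrix_inv S ** S = mat 1"
  proof -
    have "\<exists>A'. S ** A' = mat 1 \<and> A' ** S = mat 1" using dS invertible_det_nz[of S] by (simp add: invertible_def)
    then have "S ** matrix_inv S = mat 1 \<and> matrix_inv S ** S = mat 1" unfolding matrix_inv_def by (rule someI_ex)
    then show "S ** matrix_inv S = mat 1" "matrix_inv S ** S = mat 1" by auto
  qed
  have "transpose B ** matrix_inv S ** B = (U ** B) ** transpose B ** matrix_inv S ** B ** (U ** B)" using B by simp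
  also have "\<dots> = U ** ((B ** transpose B) ** matrix_inv S) ** (B ** U) ** B" by (simp add: matrix_mul_assoc)
  also have "\<dots> = mat 1" unfolding BS iS B by (simp add: B)
  finally show ?thesis using that BS dB by blast
qed

lemma centered_normal_eq:
  fixes B :: "real ^ 'd ^ 'd"
  assumes B: "B ** transpose B = S" "det B \<noteq> 0" "transpose B ** matrix_inv S ** B = mat 1"
  shows "centered_normal S = distr std_normal borel ((*v) B)"
proof (rule measure_eqI)
  fix X assume "X \<in> sets (centered_normal S)"
  then have X [measurable]: "X \<in> sets borel" by (simp add: centered_normal_def)
  define p where "p x = exp (- (x \<bullet> (matrix_inv S *v x)) / 2) / sqrt ((2 * pi) ^ CARD('d) * det S)" for x :: "real ^ 'd"
  have pm [measurable]: "p \<in> borel_measurable borel"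
    unfolding p_def[abs_def] by measurable
  have Bm: "(*v) B \<in> std_normal \<rightarrow>\<^sub>M borel" by measurable
  have dS: "det S = (det B)\<^sup>2" using arg_cong[OF B(1), of det] by (simp add: det_mul det_transpose power2_eq_square)
  have key: "\<bar>det B\<bar> * p (B *v y) = gauss_density y" for y
  proof -
    have "(B *v y) \<bullet> z = y \<bullet> (transpose B *v z)" for z
      by (metis dot_lmul_matrix inner_commute transpose_matrix_vector)
    then have "(B *v y) \<bullet> (matrix_inv S *v (B *v y)) = y \<bullet> ((transpose B ** matrix_inv S ** B) *v y)"
      by (simp only: matrix_vector_mul_assoc matrix_mul_assoc)
    then have "(B *v y) \<bullet> (matrix_inv S *v (B *v y)) = (norm y)\<^sup>2" by (simp add: B(3) power2_norm_eq_inner)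
    moreover have "sqrt ((2 * pi) ^ CARD('d) * det S) = sqrt (2 * pi) ^ CARD('d) * \<bar>det B\<bar>"
      unfolding dS real_sqrt_mult[of "(2 * pi) ^ CARD('d)" "(det B)\<^sup>2"] real_sqrt_power[of "2 * pi"] real_sqrt_abs ..
    ultimately show ?thesis using B(2) unfolding p_def gauss_density_def by simp
  qed
  have "emeasure (centered_normal S) X = (\<integral>\<^sup>+x. ennreal (p x) * indicator X x \<partial>lborel)"
    unfolding centered_normal_def p_def[symmetric] by (rule emeasure_density) (auto intro: X)
  also have "\<dots> = ennreal \<bar>det (matrix ((*v) B))\<bar> * (\<integral>\<^sup>+y. ennreal (p (B *v y)) * indicator X (B *v y) \<partial>lborel)"
    by (rule nn_integral_lborel_linear) (use B(2) in auto)
  also have "\<dots> = (\<integral>\<^sup>+y. ennreal \<bar>det B\<bar> * (ennreal (p (B *v y)) * indicator X (B *v y)) \<partial>lborel)"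
    by (subst nn_integral_cmult) auto
  also have "\<dots> = (\<integral>\<^sup>+y. ennreal (gauss_density y) * indicator ((*v) B -` X) y \<partial>lborel)"
    by (intro nn_integral_cong) (simp add: key[symmetric] ennreal_mult' mult.assoc indicator_def)
  also have "\<dots> = emeasure (distr std_normal borel ((*v) B)) X"
    using measurable_sets_borel[OF matrix_apply_measurable X, of B]
    by (subst emeasure_distr[OF Bm X]) (simp add: std_normal_def emeasure_density)
  finally show "emeasure (centered_normal S) X = emeasure (distr std_normal borel ((*v) B)) X" .
qed (simp add: centered_normal_def)

lemma stein_centered_normal:
  assumes "positive_definite S" shows "stein S (centered_normal S)"
proof -
  obtain B where B: "B ** transpose B = S" "det B \<noteq> 0" "transpose B ** matrix_inv S ** B = mat 1"
    using positive_definite_factor[OF assms] by blast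
  show ?thesis unfolding centered_normal_eq[OF B] using stein_linear(1)[of B] B(1) by simp
qed

lemma positive_definite_stein_exists:
  fixes S :: "real ^ 'd ^ 'd"
  assumes "positive_definite S"
  obtains Q where "stein S Q" "(\<integral>x. norm x ^ 3 \<partial>Q) \<le> sqrt (\<Sum>i\<in>UNIV. S $ i $ i) ^ 3 * gauss_third_moment TYPE('d)"
proof -
  obtain B where B: "B ** transpose B = S" "det B \<noteq> 0" "transpose B ** matrix_inv S ** B = mat 1"
    using positive_definite_factor[OF assms] by blast
  have "frob B = sqrt (\<Sum>i\<in>UNIV. S $ i $ i)"
    using real_sqrt_unique[OF frob_square frob_nonneg, of B] unfolding B(1) by simp
  note frob = this
  show ?thesis
  proof (rule that)
    show "stein S (distr std_normal borel ((*v) B))" using stein_linear(1)[of B] unfolding B(1) .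
    show "(\<integral>x. norm x ^ 3 \<partial>distr std_normal borel ((*v) B)) \<le> sqrt (\<Sum>i\<in>UNIV. S $ i $ i) ^ 3 * gauss_third_moment TYPE('d)"
      using stein_linear(2)[of B] unfolding frob .
  qed
qed

section \<open>Smooth test functions\<close>

lemma C11_affine:
  fixes F :: "real ^ 'd \<Rightarrow> real"
  assumes F: "C11 M F dF"
  shows "C11 (M * (\<bar>c\<bar> + c\<^sup>2)) (\<lambda>x. F (c *\<^sub>R x + w)) (\<lambda>b x. c * dF b (c *\<^sub>R x + w))"
  unfolding C11_def
proof (intro conjI allI)
  have M: "0 \<le> M" by (rule C11D(1)[OF F])
  have le: "M * \<bar>c\<bar> * t \<le> M * (\<bar>c\<bar> + c\<^sup>2) * t" "M * c\<^sup>2 * t \<le> M * (\<bar>c\<bar> + c\<^sup>2) * t" if "0 \<le> t" for t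
    using M that by (auto intro!: mult_right_mono mult_left_mono)
  show "0 \<le> M * (\<bar>c\<bar> + c\<^sup>2)" using M by simp
  fix x v :: "real ^ 'd" and a
  have e: "c *\<^sub>R (x + v) + w = (c *\<^sub>R x + w) + c *\<^sub>R v" by (simp add: scaleR_add_right)
  show "\<bar>F (c *\<^sub>R (x + v) + w) - F (c *\<^sub>R x + w)\<bar> \<le> M * (\<bar>c\<bar> + c\<^sup>2) * norm v"
    unfolding e using C11D(2)[OF F, of "c *\<^sub>R x + w" "c *\<^sub>R v"] le(1)[of "norm v"] by (simp add: mult.assoc)
  have "(\<Sum>b\<in>UNIV. dF b (c *\<^sub>R x + w) * (c *\<^sub>R v) $ b) = (\<Sum>b\<in>UNIV. c * dF b (c *\<^sub>R x + w) * v $ b)"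
    by (simp add: ac_simps)
  then show "\<bar>F (c *\<^sub>R (x + v) + w) - F (c *\<^sub>R x + w) - (\<Sum>b\<in>UNIV. c * dF b (c *\<^sub>R x + w) * v $ b)\<bar> \<le> M * (\<bar>c\<bar> + c\<^sup>2) * (norm v)\<^sup>2"
    unfolding e using C11D(3)[OF F, of "c *\<^sub>R x + w" "c *\<^sub>R v"] le(2)[of "(norm v)\<^sup>2"] by (simp add: power_mult_distrib mult.assoc)
  show "\<bar>c * dF a (c *\<^sub>R x + w)\<bar> \<le> M * (\<bar>c\<bar> + c\<^sup>2)"
    using mult_right_mono[OF C11D(4)[OF F, of a "c *\<^sub>R x + w"], of "\<bar>c\<bar>"] le(1)[of 1] by (simp add: abs_mult mult.commute)
  have "\<bar>c\<bar> * \<bar>dF a (c *\<^sub>R x + w + c *\<^sub>R v) - dF a (c *\<^sub>R x + w)\<bar> \<le> \<bar>c\<bar> * (M * norm (c *\<^sub>R v))"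
    by (intro mult_left_mono C11D(5)[OF F]) simp
  also have "\<dots> = M * c\<^sup>2 * norm v" by (simp add: power2_eq_square)
  finally show "\<bar>c * dF a (c *\<^sub>R (x + v) + w) - c * dF a (c *\<^sub>R x + w)\<bar> \<le> M * (\<bar>c\<bar> + c\<^sup>2) * norm v"
    unfolding e using le(2)[of "norm v"] by (simp add: abs_mult flip: right_diff_distrib)
qed

lemma integrable_pair_cubic:
  fixes u :: "(real ^ 'd) \<times> (real ^ 'd) \<Rightarrow> real"
  assumes Q1: "stein S1 Q1" and Q2: "stein S2 Q2"
    and u: "u \<in> borel_measurable (borel \<Otimes>\<^sub>M borel)"
    and b: "\<And>x y. \<bar>u (x, y)\<bar> \<le> C * (1 + norm x ^ 3 + norm y ^ 3)"
  shows "integrable (Q1 \<Otimes>\<^sub>M Q2) u"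
proof -
  interpret Q1: prob_space Q1 by (rule steinD[OF Q1])
  interpret Q2: prob_space Q2 by (rule steinD[OF Q2])
  interpret pair_prob_space Q1 Q2 ..
  note [measurable_cong] = steinD(2)[OF Q1] steinD(2)[OF Q2]
  have 1: "integrable (Q1 \<Otimes>\<^sub>M Q2) (\<lambda>p. norm (fst p) ^ 3)"
    by (rule Fubini_integrable) (use steinD(3)[OF Q1] in auto)
  have 2: "integrable (Q1 \<Otimes>\<^sub>M Q2) (\<lambda>p. norm (snd p) ^ 3)"
    by (rule Fubini_integrable) (use steinD(3)[OF Q2] in auto)
  have "integrable (Q1 \<Otimes>\<^sub>M Q2) (\<lambda>p. C * (1 + norm (fst p) ^ 3 + norm (snd p) ^ 3))" using 1 2 by auto
  then show ?thesis
  proof (rule Bochner_Integration.integrable_bound)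
    show "u \<in> borel_measurable (Q1 \<Otimes>\<^sub>M Q2)" using u by measurable
    show "AE p in Q1 \<Otimes>\<^sub>M Q2. norm (u p) \<le> norm (C * (1 + norm (fst p) ^ 3 + norm (snd p) ^ 3))"
      using b by (auto intro!: AE_I2 intro: order_trans[OF _ abs_ge_self] simp: split_beta)
  qed
qed

lemma cubic_bounds:
  fixes s t :: real
  assumes "0 \<le> s" "0 \<le> t"
  shows "s \<le> 1 + s ^ 3 + t ^ 3" "t \<le> 1 + s ^ 3 + t ^ 3" "s\<^sup>2 \<le> 1 + s ^ 3 + t ^ 3" "t\<^sup>2 \<le> 1 + s ^ 3 + t ^ 3" "s * t \<le> 1 + s ^ 3 + t ^ 3"
proof -
  have p: "s \<le> 1 + s ^ 3" "t \<le> 1 + t ^ 3" "s\<^sup>2 \<le> 1 + s ^ 3" "t\<^sup>2 \<le> 1 + t ^ 3" "0 \<le> s ^ 3" "0 \<le> t ^ 3"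
    using power_le_1_plus_power3[of s 1] power_le_1_plus_power3[of t 1] power_le_1_plus_power3[of s 2] power_le_1_plus_power3[of t 2] assms by auto
  then show "s \<le> 1 + s ^ 3 + t ^ 3" "t \<le> 1 + s ^ 3 + t ^ 3" "s\<^sup>2 \<le> 1 + s ^ 3 + t ^ 3" "t\<^sup>2 \<le> 1 + s ^ 3 + t ^ 3" by linarith+
  have "2 * (s * t) \<le> s\<^sup>2 + t\<^sup>2" using zero_le_power2[of "s - t"] by (simp add: power2_diff)
  then show "s * t \<le> 1 + s ^ 3 + t ^ 3" using p by linarith
qed

lemma stein_product_integrable:
  fixes F :: "real ^ 'd \<Rightarrow> real"
  assumes Q1: "stein S1 Q1" and Q2: "stein S2 Q2" and F: "C11 M F dF"
  shows "integrable (Q1 \<Otimes>\<^sub>M Q2) (\<lambda>p. fst p $ a * F (c *\<^sub>R fst p + d *\<^sub>R snd p))"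
    "integrable (Q1 \<Otimes>\<^sub>M Q2) (\<lambda>p. snd p $ a * F (c *\<^sub>R fst p + d *\<^sub>R snd p))"
    "integrable (Q1 \<Otimes>\<^sub>M Q2) (\<lambda>p. F (c *\<^sub>R fst p + d *\<^sub>R snd p))"
    "integrable (Q1 \<Otimes>\<^sub>M Q2) (\<lambda>p. dF a (c *\<^sub>R fst p + d *\<^sub>R snd p))"
proof -
  note [measurable] = C11_measurable[OF F]
  have M: "0 \<le> M" by (rule C11D(1)[OF F])
  have Fb: "\<bar>F (c *\<^sub>R x + d *\<^sub>R y)\<bar> \<le> \<bar>F 0\<bar> + M * (\<bar>c\<bar> * norm x + \<bar>d\<bar> * norm y)" for x y
    using C11_growth[OF F, of "c *\<^sub>R x + d *\<^sub>R y"] mult_left_mono[OF norm_triangle_ineq[of "c *\<^sub>R x" "d *\<^sub>R y"] M] by simp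
  let ?C = "\<bar>F 0\<bar> + M * \<bar>c\<bar> + M * \<bar>d\<bar>"
  have lin: "\<bar>F 0\<bar> * r + M * \<bar>c\<bar> * s + M * \<bar>d\<bar> * t \<le> ?C * T" if "r \<le> T" "s \<le> T" "t \<le> T" for r s t T
    unfolding distrib_right using that M by (intro add_mono mult_left_mono) auto
  show "integrable (Q1 \<Otimes>\<^sub>M Q2) (\<lambda>p. fst p $ a * F (c *\<^sub>R fst p + d *\<^sub>R snd p))"
  proof (rule integrable_pair_cubic[OF Q1 Q2, where C="?C"])
    fix x y :: "real ^ 'd"
    have "\<bar>x $ a * F (c *\<^sub>R x + d *\<^sub>R y)\<bar> \<le> norm x * (\<bar>F 0\<bar> + M * (\<bar>c\<bar> * norm x + \<bar>d\<bar> * norm y))"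
      unfolding abs_mult using Fb[of x y] M component_le_norm_cart[of x a] by (intro mult_mono) auto
    also have "\<dots> = \<bar>F 0\<bar> * norm x + M * \<bar>c\<bar> * (norm x)\<^sup>2 + M * \<bar>d\<bar> * (norm x * norm y)"
      by (simp add: power2_eq_square algebra_simps)
    also have "\<dots> \<le> ?C * (1 + norm x ^ 3 + norm y ^ 3)"
      by (rule lin) (use cubic_bounds[of "norm x" "norm y"] in auto)
    finally show "\<bar>fst (x, y) $ a * F (c *\<^sub>R fst (x, y) + d *\<^sub>R snd (x, y))\<bar> \<le> ?C * (1 + norm x ^ 3 + norm y ^ 3)" by simp
  qed measurable
  show "integrable (Q1 \<Otimes>\<^sub>M Q2) (\<lambda>p. snd p $ a * F (c *\<^sub>R fst p + d *\<^sub>R snd p))"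
  proof (rule integrable_pair_cubic[OF Q1 Q2, where C="?C"])
    fix x y :: "real ^ 'd"
    have "\<bar>y $ a * F (c *\<^sub>R x + d *\<^sub>R y)\<bar> \<le> norm y * (\<bar>F 0\<bar> + M * (\<bar>c\<bar> * norm x + \<bar>d\<bar> * norm y))"
      unfolding abs_mult using Fb[of x y] M component_le_norm_cart[of y a] by (intro mult_mono) auto
    also have "\<dots> = \<bar>F 0\<bar> * norm y + M * \<bar>c\<bar> * (norm x * norm y) + M * \<bar>d\<bar> * (norm y)\<^sup>2"
      by (simp add: power2_eq_square algebra_simps)
    also have "\<dots> \<le> ?C * (1 + norm x ^ 3 + norm y ^ 3)"
      by (rule lin) (use cubic_bounds[of "norm x" "norm y"] in auto)
    finally show "\<bar>snd (x, y) $ a * F (c *\<^sub>R fst (x, y) + d *\<^sub>R snd (x, y))\<bar> \<le> ?C * (1 + norm x ^ 3 + norm y ^ 3)" by simp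
  qed measurable
  show "integrable (Q1 \<Otimes>\<^sub>M Q2) (\<lambda>p. F (c *\<^sub>R fst p + d *\<^sub>R snd p))"
  proof (rule integrable_pair_cubic[OF Q1 Q2, where C="?C"])
    fix x y :: "real ^ 'd"
    have "\<bar>F (c *\<^sub>R x + d *\<^sub>R y)\<bar> \<le> \<bar>F 0\<bar> * 1 + M * \<bar>c\<bar> * norm x + M * \<bar>d\<bar> * norm y"
      using Fb[of x y] by (simp add: algebra_simps)
    also have "\<dots> \<le> ?C * (1 + norm x ^ 3 + norm y ^ 3)"
      by (rule lin) (use cubic_bounds[of "norm x" "norm y"] in auto)
    finally show "\<bar>F (c *\<^sub>R fst (x, y) + d *\<^sub>R snd (x, y))\<bar> \<le> ?C * (1 + norm x ^ 3 + norm y ^ 3)" by simp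
  qed measurable
  show "integrable (Q1 \<Otimes>\<^sub>M Q2) (\<lambda>p. dF a (c *\<^sub>R fst p + d *\<^sub>R snd p))"
  proof (rule integrable_pair_cubic[OF Q1 Q2, where C="M"])
    fix x y :: "real ^ 'd"
    show "\<bar>dF a (c *\<^sub>R fst (x, y) + d *\<^sub>R snd (x, y))\<bar> \<le> M * (1 + norm x ^ 3 + norm y ^ 3)"
      using C11D(4)[OF F] mult_left_mono[of 1 "1 + norm x ^ 3 + norm y ^ 3" M] M by (auto intro: order_trans)
  qed measurable
qed

lemma stein_product:
  fixes F :: "real ^ 'd \<Rightarrow> real"
  assumes Q1: "stein S1 Q1" and Q2: "stein S2 Q2" and F: "C11 M F dF"
  shows "(\<integral>p. fst p $ a * F (c *\<^sub>R fst p + d *\<^sub>R snd p) \<partial>(Q1 \<Otimes>\<^sub>M Q2))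
      = c * (\<Sum>b\<in>UNIV. S1 $ a $ b * (\<integral>p. dF b (c *\<^sub>R fst p + d *\<^sub>R snd p) \<partial>(Q1 \<Otimes>\<^sub>M Q2)))" (is ?A)
    and "(\<integral>p. snd p $ a * F (c *\<^sub>R fst p + d *\<^sub>R snd p) \<partial>(Q1 \<Otimes>\<^sub>M Q2))
      = d * (\<Sum>b\<in>UNIV. S2 $ a $ b * (\<integral>p. dF b (c *\<^sub>R fst p + d *\<^sub>R snd p) \<partial>(Q1 \<Otimes>\<^sub>M Q2)))" (is ?B)
proof -
  interpret Q1: prob_space Q1 by (rule steinD[OF Q1])
  interpret Q2: prob_space Q2 by (rule steinD[OF Q2])
  interpret pair_prob_space Q1 Q2 ..
  note I = stein_product_integrable[OF Q1 Q2 F, where c=c and d=d]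
  have swapI: "integrable (Q1 \<Otimes>\<^sub>M Q2) (\<lambda>(x, y). k x y)" "integrable (Q1 \<Otimes>\<^sub>M Q2) (\<lambda>p. k (fst p) (snd p))"
    if "integrable (Q1 \<Otimes>\<^sub>M Q2) (\<lambda>p. k (fst p) (snd p))" for k :: "real ^ 'd \<Rightarrow> real ^ 'd \<Rightarrow> real"
    using that by (simp_all add: case_prod_unfold)
  have fub1: "(\<integral>p. k (fst p) (snd p) \<partial>(Q1 \<Otimes>\<^sub>M Q2)) = (\<integral>x. (\<integral>y. k x y \<partial>Q2) \<partial>Q1)"
    "integrable Q1 (\<lambda>x. \<integral>y. k x y \<partial>Q2)"
    "(\<integral>p. k (fst p) (snd p) \<partial>(Q1 \<Otimes>\<^sub>M Q2)) = (\<integral>y. (\<integral>x. k x y \<partial>Q1) \<partial>Q2)"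
    "integrable Q2 (\<lambda>y. \<integral>x. k x y \<partial>Q1)"
    if "integrable (Q1 \<Otimes>\<^sub>M Q2) (\<lambda>p. k (fst p) (snd p))" for k :: "real ^ 'd \<Rightarrow> real ^ 'd \<Rightarrow> real"
    using integral_fst[OF swapI(1)[OF that]] integrable_fst[OF swapI(1)[OF that]]
      integral_snd[OF swapI(1)[OF that]] integrable_snd[OF swapI(1)[OF that]] by (simp_all add: case_prod_unfold)
  show ?A
  proof -
    have "(\<integral>p. fst p $ a * F (c *\<^sub>R fst p + d *\<^sub>R snd p) \<partial>(Q1 \<Otimes>\<^sub>M Q2)) = (\<integral>y. (\<integral>x. x $ a * F (c *\<^sub>R x + d *\<^sub>R y) \<partial>Q1) \<partial>Q2)"
      by (rule fub1(3)[OF I(1)])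
    also have "\<dots> = (\<integral>y. (\<Sum>b\<in>UNIV. S1 $ a $ b * (\<integral>x. c * dF b (c *\<^sub>R x + d *\<^sub>R y) \<partial>Q1)) \<partial>Q2)"
      by (simp only: steinD(4)[OF Q1 C11_affine[OF F]])
    also have "\<dots> = (\<integral>y. (\<Sum>b\<in>UNIV. (S1 $ a $ b * c) * (\<integral>x. dF b (c *\<^sub>R x + d *\<^sub>R y) \<partial>Q1)) \<partial>Q2)" by (simp add: mult.assoc)
    also have "\<dots> = (\<Sum>b\<in>UNIV. (S1 $ a $ b * c) * (\<integral>y. (\<integral>x. dF b (c *\<^sub>R x + d *\<^sub>R y) \<partial>Q1) \<partial>Q2))"
      using fub1(4)[OF I(4)] by simp
    also have "\<dots> = c * (\<Sum>b\<in>UNIV. S1 $ a $ b * (\<integral>p. dF b (c *\<^sub>R fst p + d *\<^sub>R snd p) \<partial>(Q1 \<Otimes>\<^sub>M Q2)))"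
      unfolding fub1(3)[OF I(4)] by (simp add: sum_distrib_left ac_simps)
    finally show ?thesis .
  qed
  show ?B
  proof -
    have "(\<integral>p. snd p $ a * F (c *\<^sub>R fst p + d *\<^sub>R snd p) \<partial>(Q1 \<Otimes>\<^sub>M Q2)) = (\<integral>x. (\<integral>y. y $ a * F (d *\<^sub>R y + c *\<^sub>R x) \<partial>Q2) \<partial>Q1)"
      using fub1(1)[OF I(2)] by (simp add: add.commute)
    also have "\<dots> = (\<integral>x. (\<Sum>b\<in>UNIV. S2 $ a $ b * (\<integral>y. d * dF b (d *\<^sub>R y + c *\<^sub>R x) \<partial>Q2)) \<partial>Q1)"
      by (simp only: steinD(4)[OF Q2 C11_affine[OF F]])
    also have "\<dots> = (\<integral>x. (\<Sum>b\<in>UNIV. (S2 $ a $ b * d) * (\<integral>y. dF b (c *\<^sub>R x + d *\<^sub>R y) \<partial>Q2)) \<partial>Q1)" by (simp add: mult.assoc add.commute)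
    also have "\<dots> = (\<Sum>b\<in>UNIV. (S2 $ a $ b * d) * (\<integral>x. (\<integral>y. dF b (c *\<^sub>R x + d *\<^sub>R y) \<partial>Q2) \<partial>Q1))"
      using fub1(2)[OF I(4)] by simp
    also have "\<dots> = d * (\<Sum>b\<in>UNIV. S2 $ a $ b * (\<integral>p. dF b (c *\<^sub>R fst p + d *\<^sub>R snd p) \<partial>(Q1 \<Otimes>\<^sub>M Q2)))"
      unfolding fub1(1)[OF I(4)] by (simp add: sum_distrib_left ac_simps)
    finally show ?thesis .
  qed
qed

definition convol :: "(real ^ 'd) measure \<Rightarrow> (real ^ 'd) measure \<Rightarrow> (real ^ 'd) measure" where
  "convol Q1 Q2 = distr (Q1 \<Otimes>\<^sub>M Q2) borel (\<lambda>p. fst p + snd p)"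

lemma stein_convol:
  fixes S1 S2 :: "real ^ 'd ^ 'd"
  assumes Q1: "stein S1 Q1" and Q2: "stein S2 Q2"
  shows "stein (S1 + S2) (convol Q1 Q2)"
  unfolding stein_def
proof (intro conjI allI impI)
  interpret Q1: prob_space Q1 by (rule steinD[OF Q1])
  interpret Q2: prob_space Q2 by (rule steinD[OF Q2])
  interpret pair_prob_space Q1 Q2 ..
  note [measurable_cong] = steinD(2)[OF Q1] steinD(2)[OF Q2]
  have m: "(\<lambda>p. fst p + snd p) \<in> Q1 \<Otimes>\<^sub>M Q2 \<rightarrow>\<^sub>M borel" by measurable
  show "prob_space (convol Q1 Q2)" unfolding convol_def by (rule prob_space_distr[OF m])
  show "sets (convol Q1 Q2) = sets borel" by (simp add: convol_def)
  have "integrable (Q1 \<Otimes>\<^sub>M Q2) (\<lambda>p. norm (fst p + snd p) ^ 3)"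
  proof (rule integrable_pair_cubic[OF Q1 Q2, where C=8])
    fix x y :: "real ^ 'd"
    have "norm (x + y) \<le> 2 * max (norm x) (norm y)" using norm_triangle_ineq[of x y] by simp
    then have "norm (x + y) ^ 3 \<le> (2 * max (norm x) (norm y)) ^ 3" by (intro power_mono) auto
    also have "\<dots> \<le> 8 * (norm x ^ 3 + norm y ^ 3)" by (auto simp: max_def power_mult_distrib)
    finally show "\<bar>norm (fst (x, y) + snd (x, y)) ^ 3\<bar> \<le> 8 * (1 + norm x ^ 3 + norm y ^ 3)" by simp
  qed measurable
  then show "integrable (convol Q1 Q2) (\<lambda>x. norm x ^ 3)"
    unfolding convol_def by (subst integrable_distr_eq[OF m]) auto
  fix M F dF a assume F: "C11 M F (dF :: 'd \<Rightarrow> real ^ 'd \<Rightarrow> real)"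
  note [measurable] = C11_measurable[OF F]
  note I = stein_product_integrable[OF Q1 Q2 F, where c=1 and d=1, simplified]
  note P = stein_product[OF Q1 Q2 F, where c=1 and d=1, simplified]
  have "(\<integral>x. x $ a * F x \<partial>convol Q1 Q2) = (\<integral>p. fst p $ a * F (fst p + snd p) + snd p $ a * F (fst p + snd p) \<partial>(Q1 \<Otimes>\<^sub>M Q2))"
    unfolding convol_def by (subst integral_distr[OF m]) (auto simp: algebra_simps)
  also have "\<dots> = (\<Sum>b\<in>UNIV. (S1 + S2) $ a $ b * (\<integral>p. dF b (fst p + snd p) \<partial>(Q1 \<Otimes>\<^sub>M Q2)))"
    using I P by (simp add: distrib_right sum.distrib)
  also have "\<dots> = (\<Sum>b\<in>UNIV. (S1 + S2) $ a $ b * (\<integral>x. dF b x \<partial>convol Q1 Q2))"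
    unfolding convol_def by (subst integral_distr[OF m]) auto
  finally show "(\<integral>x. x $ a * F x \<partial>convol Q1 Q2) = (\<Sum>b\<in>UNIV. (S1 + S2) $ a $ b * (\<integral>x. dF b x \<partial>convol Q1 Q2))" .
qed

lemma stein_return_0: "stein 0 (return borel (0 :: real ^ 'd))"
  unfolding stein_def
proof (intro conjI allI impI)
  show "prob_space (return borel (0 :: real ^ 'd))" by (rule prob_space_return) simp
  show "integrable (return borel (0 :: real ^ 'd)) (\<lambda>x. norm x ^ 3)"
    by (subst integrable_iff_bounded) (simp add: nn_integral_return)
  fix M F dF a assume F: "C11 M F (dF :: 'd \<Rightarrow> real ^ 'd \<Rightarrow> real)"
  note [measurable] = C11_measurable[OF F]
  show "(\<integral>x. x $ a * F x \<partial>return borel 0) = (\<Sum>b\<in>UNIV. 0 $ a $ b * (\<integral>x. dF b x \<partial>return borel 0))"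
    by (subst integral_return) auto
qed simp

definition C3 :: "real \<Rightarrow> (real ^ 'd \<Rightarrow> real) \<Rightarrow> ('d \<Rightarrow> real ^ 'd \<Rightarrow> real) \<Rightarrow> ('d \<Rightarrow> 'd \<Rightarrow> real ^ 'd \<Rightarrow> real) \<Rightarrow> bool" where
  "C3 M h G A \<longleftrightarrow> 0 \<le> M \<and> (\<forall>x v. \<bar>h (x + v) - h x\<bar> \<le> M * norm v)
    \<and> (\<forall>x v. \<bar>h (x + v) - h x - (\<Sum>a\<in>UNIV. G a x * v $ a) - (\<Sum>a\<in>UNIV. \<Sum>b\<in>UNIV. A a b x * (v $ a * v $ b)) / 2\<bar> \<le> M * norm v ^ 3)
    \<and> (\<forall>a. C11 M (G a) (A a)) \<and> (\<forall>a x. \<bar>G a x\<bar> \<le> M) \<and> (\<forall>a b x. A a b x = A b a x)"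

lemma C3D:
  assumes "C3 M h G A"
  shows "0 \<le> M" "\<bar>h (x + v) - h x\<bar> \<le> M * norm v"
    "\<bar>h (x + v) - h x - (\<Sum>a\<in>UNIV. G a x * v $ a) - (\<Sum>a\<in>UNIV. \<Sum>b\<in>UNIV. A a b x * (v $ a * v $ b)) / 2\<bar> \<le> M * norm v ^ 3"
    "C11 M (G a) (A a)" "\<bar>G a x\<bar> \<le> M" "A a b x = A b a x"
  using assms unfolding C3_def by blast+

lemma C3_C11:
  fixes h :: "real ^ 'd \<Rightarrow> real"
  assumes h: "C3 M h G A"
  shows "C11 (M * (1 + real CARD('d) + (real CARD('d))\<^sup>2)) h G"
proof -
  let ?d = "real CARD('d)" and ?M = "M * (1 + real CARD('d) + (real CARD('d))\<^sup>2)"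
  have M: "0 \<le> M" by (rule C3D(1)[OF h])
  have Mle: "M \<le> ?M" using mult_left_mono[of 1 "1 + ?d + ?d\<^sup>2" M] M by simp
  have up: "p \<le> ?M * t" if "p \<le> M * t" "0 \<le> t" for p t
    using that mult_right_mono[OF Mle that(2)] by linarith
  show ?thesis
    unfolding C11_def
  proof (intro conjI allI)
    show "0 \<le> ?M" using M by simp
    fix x v :: "real ^ 'd" and a
    show "\<bar>h (x + v) - h x\<bar> \<le> ?M * norm v" by (rule up[OF C3D(2)[OF h]]) simp
    show "\<bar>G a x\<bar> \<le> ?M" using C3D(5)[OF h, of a x] Mle by linarith
    show "\<bar>G a (x + v) - G a x\<bar> \<le> ?M * norm v" by (rule up[OF C11D(2)[OF C3D(4)[OF h]]]) simp
    let ?L = "\<Sum>a\<in>UNIV. G a x * v $ a" and ?Q = "\<Sum>a\<in>UNIV. \<Sum>b\<in>UNIV. A a b x * (v $ a * v $ b)"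
    show "\<bar>h (x + v) - h x - ?L\<bar> \<le> ?M * (norm v)\<^sup>2"
    proof (cases "norm v \<le> 1")
      case True
      have "\<bar>?Q\<bar> \<le> (\<Sum>a\<in>(UNIV :: 'd set). \<Sum>b\<in>(UNIV :: 'd set). M * (norm v * norm v))"
      proof (rule order_trans[OF sum_abs], rule sum_mono, rule order_trans[OF sum_abs], rule sum_mono)
        fix a b
        show "\<bar>A a b x * (v $ a * v $ b)\<bar> \<le> M * (norm v * norm v)"
          unfolding abs_mult using C11D(4)[OF C3D(4)[OF h]] M
          by (intro mult_mono component_le_norm_cart) auto
      qed
      then have "\<bar>?Q\<bar> \<le> ?d\<^sup>2 * (M * (norm v)\<^sup>2)" by (simp add: power2_eq_square ac_simps)
      moreover have "M * norm v ^ 3 \<le> M * (norm v)\<^sup>2"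
        using True M power_decreasing[of 2 3 "norm v"] by (intro mult_left_mono) auto
      moreover have "0 \<le> ?d\<^sup>2 * (M * (norm v)\<^sup>2)" "0 \<le> ?d * (M * (norm v)\<^sup>2)" using M by auto
      moreover have "?M * (norm v)\<^sup>2 = M * (norm v)\<^sup>2 + ?d * (M * (norm v)\<^sup>2) + ?d\<^sup>2 * (M * (norm v)\<^sup>2)" by (simp add: algebra_simps)
      ultimately show ?thesis using C3D(3)[OF h, of x v] by linarith
    next
      case False
      have "\<bar>?L\<bar> \<le> (\<Sum>a\<in>(UNIV :: 'd set). M * norm v)"
        by (rule order_trans[OF sum_abs], rule sum_mono)
          (auto simp: abs_mult intro!: mult_mono C3D(5)[OF h] component_le_norm_cart M)
      then have "\<bar>?L\<bar> \<le> ?d * (M * norm v)" by simp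
      then have "\<bar>h (x + v) - h x - ?L\<bar> \<le> M * norm v + ?d * (M * norm v)" using C3D(2)[OF h, of x v] by linarith
      also have "\<dots> \<le> M * (norm v)\<^sup>2 + ?d * (M * (norm v)\<^sup>2)"
        using False M self_le_power[of "norm v" 2] by (intro add_mono mult_left_mono) auto
      also have "\<dots> \<le> ?M * (norm v)\<^sup>2" using M by (simp add: algebra_simps)
      finally show ?thesis .
    qed
  qed
qed

text \<open>Interpolation along the rotation \<open>x sin t + y cos t\<close>, which avoids the singularities of the
  usual square root parametrisation at the endpoints.\<close>

lemma stein_comparison:
  fixes h :: "real ^ 'd \<Rightarrow> real"
  assumes Q1: "stein S1 Q1" and Q2: "stein S2 Q2" and h: "C3 M h G A"
  shows "\<bar>(\<integral>x. h x \<partial>Q1) - (\<integral>x. h x \<partial>Q2)\<bar> \<le> 2 * M * (\<Sum>a\<in>UNIV. \<Sum>b\<in>UNIV. \<bar>S1 $ a $ b - S2 $ a $ b\<bar>)"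
proof -
  interpret Q1: prob_space Q1 by (rule steinD[OF Q1])
  interpret Q2: prob_space Q2 by (rule steinD[OF Q2])
  interpret P: pair_prob_space Q1 Q2 ..
  note [measurable_cong] = steinD(2)[OF Q1] steinD(2)[OF Q2]
  let ?P = "Q1 \<Otimes>\<^sub>M Q2"
  define K where "K = M * (1 + real CARD('d) + (real CARD('d))\<^sup>2)"
  have hC: "C11 K h G" unfolding K_def by (rule C3_C11[OF h])
  have K: "0 \<le> K" by (rule C11D(1)[OF hC])
  have M: "0 \<le> M" by (rule C3D(1)[OF h])
  have Gm [measurable]: "G a \<in> borel_measurable borel" and Am [measurable]: "A a b \<in> borel_measurable borel" for a b
    using C11_measurable[OF C3D(4)[OF h]] by auto
  have hm [measurable]: "h \<in> borel_measurable borel" by (rule C11_measurable[OF hC])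
  define u where "u t p = sin t *\<^sub>R fst p + cos t *\<^sub>R snd p" for t and p :: "(real ^ 'd) \<times> (real ^ 'd)"
  define \<psi> where "\<psi> t = (\<integral>p. h (u t p) \<partial>?P)" for t
  define D where "D t = (\<integral>p. (\<Sum>a\<in>UNIV. G a (u t p) * (cos t * fst p $ a - sin t * snd p $ a)) \<partial>?P)" for t
  have hi: "integrable ?P (\<lambda>p. h (u t p))" for t
    unfolding u_def by (rule stein_product_integrable(3)[OF Q1 Q2 hC])
  have G1: "integrable ?P (\<lambda>p. fst p $ a * G a (u t p))" "integrable ?P (\<lambda>p. snd p $ a * G a (u t p))" for t a
    unfolding u_def using stein_product_integrable(1,2)[OF Q1 Q2 C3D(4)[OF h]] by auto
  have Dsum: "(\<lambda>p. \<Sum>a\<in>UNIV. G a (u t p) * (cos t * fst p $ a - sin t * snd p $ a))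
      = (\<lambda>p. \<Sum>a\<in>UNIV. cos t * (fst p $ a * G a (u t p)) - sin t * (snd p $ a * G a (u t p)))" for t
    by (simp add: algebra_simps)
  have Di: "integrable ?P (\<lambda>p. \<Sum>a\<in>UNIV. G a (u t p) * (cos t * fst p $ a - sin t * snd p $ a))" for t
    unfolding Dsum using G1 by auto
  have Dval: "D t = sin t * cos t * (\<Sum>a\<in>UNIV. \<Sum>b\<in>UNIV. (S1 $ a $ b - S2 $ a $ b) * (\<integral>p. A a b (u t p) \<partial>?P))" for t
  proof -
    have "D t = (\<Sum>a\<in>UNIV. cos t * (\<integral>p. fst p $ a * G a (u t p) \<partial>?P) - sin t * (\<integral>p. snd p $ a * G a (u t p) \<partial>?P))"
      unfolding D_def Dsum using G1 by simp
    also have "\<dots> = (\<Sum>a\<in>UNIV. cos t * (sin t * (\<Sum>b\<in>UNIV. S1 $ a $ b * (\<integral>p. A a b (u t p) \<partial>?P)))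
      - sin t * (cos t * (\<Sum>b\<in>UNIV. S2 $ a $ b * (\<integral>p. A a b (u t p) \<partial>?P))))"
      unfolding u_def stein_product[OF Q1 Q2 C3D(4)[OF h]] ..
    also have "\<dots> = sin t * cos t * (\<Sum>a\<in>UNIV. \<Sum>b\<in>UNIV. (S1 $ a $ b - S2 $ a $ b) * (\<integral>p. A a b (u t p) \<partial>?P))"
      by (simp add: sum_distrib_left left_diff_distrib sum_subtractf right_diff_distrib ac_simps)
    finally show ?thesis .
  qed
  define V where "V = (\<Sum>a\<in>UNIV. \<Sum>b\<in>UNIV. \<bar>S1 $ a $ b - S2 $ a $ b\<bar>)"
  have Dbound: "\<bar>D t\<bar> \<le> M * V" for t
  proof -
    have Ab: "\<bar>\<integral>p. A a b (u t p) \<partial>?P\<bar> \<le> M" for a b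
    proof -
      have "\<bar>\<integral>p. A a b (u t p) \<partial>?P\<bar> \<le> (\<integral>p. \<bar>A a b (u t p)\<bar> \<partial>?P)" by (rule integral_abs_bound)
      also have "\<dots> \<le> M"
      proof (rule P.integral_le_const)
        show "integrable ?P (\<lambda>p. \<bar>A a b (u t p)\<bar>)"
          unfolding u_def by (rule integrable_abs[OF stein_product_integrable(4)[OF Q1 Q2 C3D(4)[OF h]]])
        show "AE p in ?P. \<bar>A a b (u t p)\<bar> \<le> M" using C11D(4)[OF C3D(4)[OF h]] by auto
      qed
      finally show ?thesis .
    qed
    have "\<bar>D t\<bar> = \<bar>sin t * cos t\<bar> * \<bar>\<Sum>a\<in>UNIV. \<Sum>b\<in>UNIV. (S1 $ a $ b - S2 $ a $ b) * (\<integral>p. A a b (u t p) \<partial>?P)\<bar>"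
      unfolding Dval abs_mult ..
    also have "\<dots> \<le> 1 * (V * M)"
    proof (rule mult_mono)
      show "\<bar>sin t * cos t\<bar> \<le> 1" unfolding abs_mult using mult_mono[OF abs_sin_le_one[of t] abs_cos_le_one[of t]] by simp
      show "\<bar>\<Sum>a\<in>UNIV. \<Sum>b\<in>UNIV. (S1 $ a $ b - S2 $ a $ b) * (\<integral>p. A a b (u t p) \<partial>?P)\<bar> \<le> V * M"
        unfolding V_def sum_distrib_right
        by (rule order_trans[OF sum_abs], rule sum_mono, rule order_trans[OF sum_abs], rule sum_mono)
          (auto simp: abs_mult intro!: mult_left_mono Ab)
    qed auto
    finally show ?thesis by (simp add: mult.commute)
  qed
  define N where "N p = norm (fst p) + norm (snd p)" for p :: "(real ^ 'd) \<times> (real ^ 'd)"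
  have Ni: "integrable ?P (\<lambda>p. (N p)\<^sup>2)" "integrable ?P N"
  proof -
    show "integrable ?P N"
    proof (rule integrable_pair_cubic[OF Q1 Q2, where C=2])
      show "\<bar>N (x, y)\<bar> \<le> 2 * (1 + norm x ^ 3 + norm y ^ 3)" for x y
        using cubic_bounds[of "norm x" "norm y"] by (simp add: N_def)
    qed (unfold N_def[abs_def], measurable)
    show "integrable ?P (\<lambda>p. (N p)\<^sup>2)"
    proof (rule integrable_pair_cubic[OF Q1 Q2, where C=4])
      show "\<bar>(N (x, y))\<^sup>2\<bar> \<le> 4 * (1 + norm x ^ 3 + norm y ^ 3)" for x y
        using cubic_bounds[of "norm x" "norm y"] by (simp add: N_def power2_sum)
    qed (unfold N_def[abs_def], measurable)
  qed
  have trig: "\<bar>sin s - sin t - (s - t) * cos t\<bar> \<le> (s - t)\<^sup>2" "\<bar>cos s - cos t + (s - t) * sin t\<bar> \<le> (s - t)\<^sup>2"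
    "\<bar>sin s - sin t\<bar> \<le> \<bar>s - t\<bar>" "\<bar>cos s - cos t\<bar> \<le> \<bar>s - t\<bar>" for s t :: real
  proof -
    show s1: "\<bar>sin s - sin t\<bar> \<le> \<bar>s - t\<bar>" for s t :: real
      using field_differentiable_bound[of UNIV sin cos 1 s t] by (auto intro!: derivative_eq_intros simp: abs_cos_le_one)
    show c1: "\<bar>cos s - cos t\<bar> \<le> \<bar>s - t\<bar>" for s t :: real
      using field_differentiable_bound[of UNIV cos "\<lambda>x. - sin x" 1 s t] by (auto intro!: derivative_eq_intros simp: abs_sin_le_one)
    have seg: "\<bar>x - t\<bar> \<le> \<bar>s - t\<bar>" if "x \<in> closed_segment t s" for x
      using that by (auto simp: closed_segment_eq_real_ivl split: if_splits)
    have "norm ((sin s - s * cos t) - (sin t - t * cos t)) \<le> \<bar>s - t\<bar> * norm (s - t)"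
    proof (rule field_differentiable_bound[where S="closed_segment t s"])
      show "((\<lambda>x. sin x - x * cos t) has_field_derivative cos z - cos t) (at z within closed_segment t s)" for z
        by (auto intro!: derivative_eq_intros)
      show "norm (cos z - cos t) \<le> \<bar>s - t\<bar>" if "z \<in> closed_segment t s" for z
        using c1[of z t] seg[OF that] by simp
    qed auto
    then show "\<bar>sin s - sin t - (s - t) * cos t\<bar> \<le> (s - t)\<^sup>2" by (simp add: algebra_simps power2_eq_square)
    have "norm ((cos s + s * sin t) - (cos t + t * sin t)) \<le> \<bar>s - t\<bar> * norm (s - t)"
    proof (rule field_differentiable_bound[where S="closed_segment t s"])
      show "((\<lambda>x. cos x + x * sin t) has_field_derivative - sin z + sin t) (at z within closed_segment t s)" for z
        by (auto intro!: derivative_eq_intros)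
      show "norm (- sin z + sin t) \<le> \<bar>s - t\<bar>" if "z \<in> closed_segment t s" for z
        using s1[of z t] seg[OF that] by simp
    qed auto
    then show "\<bar>cos s - cos t + (s - t) * sin t\<bar> \<le> (s - t)\<^sup>2" by (simp add: algebra_simps power2_eq_square)
  qed
  define E where "E = (\<integral>p. K * (N p)\<^sup>2 + K * real CARD('d) * N p \<partial>?P)"
  have est: "\<bar>\<psi> s - \<psi> t - (s - t) * D t\<bar> \<le> E * (s - t)\<^sup>2" for s t
  proof -
    define g where "g p = h (u s p) - h (u t p) - (s - t) * (\<Sum>a\<in>UNIV. G a (u t p) * (cos t * fst p $ a - sin t * snd p $ a))" for p
    define c where "c p = (K * (N p)\<^sup>2 + K * real CARD('d) * N p) * (s - t)\<^sup>2" for p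
    have b: "\<bar>g p\<bar> \<le> c p" for p
    proof -
      define v where "v = u s p - u t p"
      have us: "u s p = u t p + v" by (simp add: v_def)
      have v: "v = (sin s - sin t) *\<^sub>R fst p + (cos s - cos t) *\<^sub>R snd p" by (simp add: v_def u_def algebra_simps)
      have "norm v \<le> \<bar>sin s - sin t\<bar> * norm (fst p) + \<bar>cos s - cos t\<bar> * norm (snd p)"
        unfolding v by (rule order_trans[OF norm_triangle_ineq]) simp
      also have "\<dots> \<le> \<bar>s - t\<bar> * N p" unfolding N_def distrib_left by (intro add_mono mult_right_mono trig) auto
      finally have "(norm v)\<^sup>2 \<le> (\<bar>s - t\<bar> * N p)\<^sup>2" by (intro power_mono) auto
      then have 1: "K * (norm v)\<^sup>2 \<le> K * (N p)\<^sup>2 * (s - t)\<^sup>2"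
        using mult_left_mono[OF _ K, of "(norm v)\<^sup>2" "(\<bar>s - t\<bar> * N p)\<^sup>2"] by (simp add: power_mult_distrib ac_simps)
      have comp: "\<bar>v $ a - (s - t) * (cos t * fst p $ a - sin t * snd p $ a)\<bar> \<le> (s - t)\<^sup>2 * N p" for a
      proof -
        have "v $ a - (s - t) * (cos t * fst p $ a - sin t * snd p $ a)
          = (sin s - sin t - (s - t) * cos t) * fst p $ a + (cos s - cos t + (s - t) * sin t) * snd p $ a"
          unfolding v by (simp add: algebra_simps)
        also have "\<bar>\<dots>\<bar> \<le> (s - t)\<^sup>2 * norm (fst p) + (s - t)\<^sup>2 * norm (snd p)"
          by (rule order_trans[OF abs_triangle_ineq])
            (unfold abs_mult, intro add_mono mult_mono trig component_le_norm_cart, auto)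
        finally show ?thesis by (simp add: N_def distrib_left)
      qed
      have "\<bar>(\<Sum>a\<in>UNIV. G a (u t p) * v $ a) - (s - t) * (\<Sum>a\<in>UNIV. G a (u t p) * (cos t * fst p $ a - sin t * snd p $ a))\<bar>
        = \<bar>\<Sum>a\<in>UNIV. G a (u t p) * (v $ a - (s - t) * (cos t * fst p $ a - sin t * snd p $ a))\<bar>"
        by (simp add: sum_distrib_left right_diff_distrib sum_subtractf ac_simps)
      also have "\<dots> \<le> (\<Sum>a\<in>(UNIV :: 'd set). K * ((s - t)\<^sup>2 * N p))"
        by (rule order_trans[OF sum_abs], rule sum_mono, unfold abs_mult)
           (intro mult_mono comp C11D(4)[OF hC] K, auto)
      finally have 2: "\<bar>(\<Sum>a\<in>UNIV. G a (u t p) * v $ a) - (s - t) * (\<Sum>a\<in>UNIV. G a (u t p) * (cos t * fst p $ a - sin t * snd p $ a))\<bar>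
        \<le> K * real CARD('d) * N p * (s - t)\<^sup>2" by (simp add: ac_simps)
      have 3: "\<bar>h (u s p) - h (u t p) - (\<Sum>a\<in>UNIV. G a (u t p) * v $ a)\<bar> \<le> K * (norm v)\<^sup>2"
        unfolding us by (rule C11D(3)[OF hC])
      show ?thesis using 1 2 3 unfolding g_def c_def distrib_right by linarith
    qed
    have gi: "integrable ?P g" unfolding g_def[abs_def] by (intro Bochner_Integration.integrable_diff hi integrable_mult_right Di)
    have ci: "integrable ?P c" unfolding c_def[abs_def]
      by (intro integrable_mult_left Bochner_Integration.integrable_add integrable_mult_right Ni)
    have "\<psi> s - \<psi> t - (s - t) * D t = (\<integral>p. g p \<partial>?P)" unfolding \<psi>_def D_def g_def using hi Di by simp
    also have "\<bar>\<dots>\<bar> \<le> (\<integral>p. \<bar>g p\<bar> \<partial>?P)" by (rule integral_abs_bound)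
    also have "\<dots> \<le> (\<integral>p. c p \<partial>?P)"
      by (rule integral_mono[OF integrable_abs[OF gi] ci]) (rule b)
    also have "\<dots> = E * (s - t)\<^sup>2" unfolding E_def c_def by simp
    finally show ?thesis .
  qed
  have deriv: "(\<psi> has_real_derivative D t) (at t)" for t
  proof -
    have "((\<lambda>s. (\<psi> s - \<psi> t) / (s - t) - D t) \<longlongrightarrow> 0) (at t)"
    proof (rule tendsto_0_le[where K=1])
      show "((\<lambda>s. E * \<bar>s - t\<bar>) \<longlongrightarrow> 0) (at t)" by (auto intro!: tendsto_eq_intros)
      show "\<forall>\<^sub>F s in at t. norm ((\<psi> s - \<psi> t) / (s - t) - D t) \<le> norm (E * \<bar>s - t\<bar>) * 1"
      proof (intro eventually_at_filter[THEN iffD2] always_eventually allI impI)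
        fix s assume "s \<noteq> t"
        then have "(\<psi> s - \<psi> t) / (s - t) - D t = (\<psi> s - \<psi> t - (s - t) * D t) / (s - t)" by (simp add: diff_divide_distrib)
        then have "norm ((\<psi> s - \<psi> t) / (s - t) - D t) \<le> E * (s - t)\<^sup>2 / \<bar>s - t\<bar>"
          using est[of s t] by (simp add: abs_divide divide_right_mono)
        also have "E * (s - t)\<^sup>2 / \<bar>s - t\<bar> = E * \<bar>s - t\<bar>"
        proof -
          have "E * (r * r) / r = E * r" for r by simp
          from this[of "\<bar>s - t\<bar>"] show ?thesis by (simp add: power2_eq_square)
        qed
        finally show "norm ((\<psi> s - \<psi> t) / (s - t) - D t) \<le> norm (E * \<bar>s - t\<bar>) * 1" by simp
      qed
    qed
    then show ?thesis by (simp add: has_field_derivative_iff LIM_zero_iff)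
  qed
  have "\<bar>\<psi> (pi / 2) - \<psi> 0\<bar> \<le> M * V * \<bar>pi / 2 - 0\<bar>"
    using field_differentiable_bound[of UNIV \<psi> D "M * V" "pi / 2" 0] deriv Dbound by (auto simp: has_field_derivative_at_within)
  also have "\<dots> \<le> M * V * 2" using M pi_less_4 by (intro mult_left_mono) (auto simp: V_def sum_nonneg)
  finally have "\<bar>\<psi> (pi / 2) - \<psi> 0\<bar> \<le> 2 * M * V" by simp
  moreover have "\<psi> (pi / 2) = (\<integral>x. h x \<partial>Q1)" "\<psi> 0 = (\<integral>x. h x \<partial>Q2)"
  proof -
    have i: "integrable ?P (\<lambda>(x, y). h x)" "integrable ?P (\<lambda>(x, y). h y)"
      using hi[of "pi / 2"] hi[of 0] by (simp_all add: u_def case_prod_unfold)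
    show "\<psi> (pi / 2) = (\<integral>x. h x \<partial>Q1)" using P.integral_fst[OF i(1)] by (simp add: \<psi>_def u_def case_prod_unfold Q2.prob_space)
    show "\<psi> 0 = (\<integral>x. h x \<partial>Q2)" using P.integral_fst[OF i(2)] by (simp add: \<psi>_def u_def case_prod_unfold Q1.prob_space)
  qed
  ultimately show ?thesis by (simp add: V_def)
qed

lemma (in prob_space) abs_integral_le:
  fixes u :: "'a \<Rightarrow> real"
  assumes "integrable M u" "\<And>z. \<bar>u z\<bar> \<le> c"
  shows "\<bar>\<integral>z. u z \<partial>M\<bar> \<le> c"
proof -
  have "\<bar>\<integral>z. u z \<partial>M\<bar> \<le> (\<integral>z. \<bar>u z\<bar> \<partial>M)" by (rule integral_abs_bound)
  also have "\<dots> \<le> c"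
    by (rule integral_le_const[OF integrable_abs[OF assms(1)]]) (use assms(2) in auto)
  finally show ?thesis .
qed

lemma C3_integrable:
  assumes Q: "stein S Q" and h: "C3 M h G A"
  shows "integrable Q (\<lambda>z. h (x + z))" "integrable Q (\<lambda>z. G a (x + z))" "integrable Q (\<lambda>z. A a b (x + z))"
proof -
  interpret prob_space Q by (rule steinD[OF Q])
  have M: "0 \<le> M" by (rule C3D(1)[OF h])
  have [measurable]: "h \<in> borel_measurable borel" by (rule C11_measurable[OF C3_C11[OF h]])
  have [measurable]: "G a \<in> borel_measurable borel" "A a b \<in> borel_measurable borel"
    using C11_measurable[OF C3D(4)[OF h]] by auto
  note [measurable_cong] = steinD(2)[OF Q]
  show "integrable Q (\<lambda>z. h (x + z))"
  proof (rule integrable_cubic_growth[OF finite_measure_axioms steinD(2,3)[OF Q], where C="\<bar>h x\<bar> + M"])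
    fix z
    have "\<bar>h (x + z)\<bar> \<le> \<bar>h x\<bar> * 1 + M * norm z" using C3D(2)[OF h, of x z] by simp
    also have "\<dots> \<le> \<bar>h x\<bar> * (1 + norm z ^ 3) + M * (1 + norm z ^ 3)"
      using power_le_1_plus_power3[of "norm z" 1] M by (intro add_mono mult_left_mono) auto
    finally show "\<bar>h (x + z)\<bar> \<le> (\<bar>h x\<bar> + M) * (1 + norm z ^ 3)" by (simp add: algebra_simps)
  qed measurable
  show "integrable Q (\<lambda>z. G a (x + z))"
    by (rule integrable_const_bound[where B=M]) (use C3D(5)[OF h] in auto)
  show "integrable Q (\<lambda>z. A a b (x + z))"
    by (rule integrable_const_bound[where B=M]) (use C11D(4)[OF C3D(4)[OF h]] in auto)
qed

lemma C3_average:
  fixes h :: "real ^ 'd \<Rightarrow> real"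
  assumes Q: "stein S Q" and h: "C3 M h G A"
  shows "C3 M (\<lambda>x. \<integral>z. h (x + z) \<partial>Q) (\<lambda>a x. \<integral>z. G a (x + z) \<partial>Q) (\<lambda>a b x. \<integral>z. A a b (x + z) \<partial>Q)"
proof -
  interpret prob_space Q by (rule steinD[OF Q])
  note I = C3_integrable[OF Q h]
  have sh: "x + v + z = (x + z) + v" for x v z :: "real ^ 'd" by simp
  have P: "\<bar>G a (x + v + z) - G a (x + z)\<bar> \<le> M * norm v"
    "\<bar>G a (x + v + z) - G a (x + z) - (\<Sum>b\<in>UNIV. A a b (x + z) * v $ b)\<bar> \<le> M * (norm v)\<^sup>2"
    "\<bar>A a b (x + z)\<bar> \<le> M" "\<bar>A a b (x + v + z) - A a b (x + z)\<bar> \<le> M * norm v" for a b x v z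
    unfolding sh[of x v z] by (rule C11D[OF C3D(4)[OF h]])+
  have P': "\<bar>h (x + v + z) - h (x + z)\<bar> \<le> M * norm v"
    "\<bar>h (x + v + z) - h (x + z) - (\<Sum>a\<in>UNIV. G a (x + z) * v $ a) - (\<Sum>a\<in>UNIV. \<Sum>b\<in>UNIV. A a b (x + z) * (v $ a * v $ b)) / 2\<bar> \<le> M * norm v ^ 3" for x v z
    unfolding sh[of x v z] by (rule C3D[OF h])+
  have C: "C11 M (\<lambda>x. \<integral>z. G a (x + z) \<partial>Q) (\<lambda>b x. \<integral>z. A a b (x + z) \<partial>Q)" for a
    unfolding C11_def
  proof (intro conjI allI)
    show "0 \<le> M" by (rule C3D(1)[OF h])
    fix x v :: "real ^ 'd" and b
    have "(\<integral>z. G a (x + v + z) \<partial>Q) - (\<integral>z. G a (x + z) \<partial>Q) = (\<integral>z. G a (x + v + z) - G a (x + z) \<partial>Q)" using I by simp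
    also have "\<bar>\<dots>\<bar> \<le> M * norm v"
      by (rule abs_integral_le) (use I P in auto)
    finally show "\<bar>(\<integral>z. G a (x + v + z) \<partial>Q) - (\<integral>z. G a (x + z) \<partial>Q)\<bar> \<le> M * norm v" .
    have "(\<integral>z. G a (x + v + z) \<partial>Q) - (\<integral>z. G a (x + z) \<partial>Q) - (\<Sum>b\<in>UNIV. (\<integral>z. A a b (x + z) \<partial>Q) * v $ b)
      = (\<integral>z. G a (x + v + z) - G a (x + z) - (\<Sum>b\<in>UNIV. A a b (x + z) * v $ b) \<partial>Q)" using I by simp
    also have "\<bar>\<dots>\<bar> \<le> M * (norm v)\<^sup>2"
      by (rule abs_integral_le) (use I P in auto)
    finally show "\<bar>(\<integral>z. G a (x + v + z) \<partial>Q) - (\<integral>z. G a (x + z) \<partial>Q) - (\<Sum>b\<in>UNIV. (\<integral>z. A a b (x + z) \<partial>Q) * v $ b)\<bar> \<le> M * (norm v)\<^sup>2" .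
    show "\<bar>\<integral>z. A a b (x + z) \<partial>Q\<bar> \<le> M"
      by (rule abs_integral_le) (use I P in auto)
    have "(\<integral>z. A a b (x + v + z) \<partial>Q) - (\<integral>z. A a b (x + z) \<partial>Q) = (\<integral>z. A a b (x + v + z) - A a b (x + z) \<partial>Q)" using I by simp
    also have "\<bar>\<dots>\<bar> \<le> M * norm v"
      by (rule abs_integral_le) (use I P in auto)
    finally show "\<bar>(\<integral>z. A a b (x + v + z) \<partial>Q) - (\<integral>z. A a b (x + z) \<partial>Q)\<bar> \<le> M * norm v" .
  qed
  show ?thesis
    unfolding C3_def
  proof (intro conjI allI)
    show "0 \<le> M" by (rule C3D(1)[OF h])
    show "C11 M (\<lambda>x. \<integral>z. G a (x + z) \<partial>Q) (\<lambda>b x. \<integral>z. A a b (x + z) \<partial>Q)" for a by (rule C)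
    fix x v :: "real ^ 'd" and a b
    show "\<bar>\<integral>z. G a (x + z) \<partial>Q\<bar> \<le> M" by (rule abs_integral_le) (use I C3D(5)[OF h] in auto)
    show "(\<integral>z. A a b (x + z) \<partial>Q) = (\<integral>z. A b a (x + z) \<partial>Q)" using C3D(6)[OF h, of a b] by simp
    have "(\<integral>z. h (x + v + z) \<partial>Q) - (\<integral>z. h (x + z) \<partial>Q) = (\<integral>z. h (x + v + z) - h (x + z) \<partial>Q)" using I by simp
    also have "\<bar>\<dots>\<bar> \<le> M * norm v"
      by (rule abs_integral_le) (use I P' in auto)
    finally show "\<bar>(\<integral>z. h (x + v + z) \<partial>Q) - (\<integral>z. h (x + z) \<partial>Q)\<bar> \<le> M * norm v" .
    have "(\<integral>z. h (x + v + z) \<partial>Q) - (\<integral>z. h (x + z) \<partial>Q) - (\<Sum>a\<in>UNIV. (\<integral>z. G a (x + z) \<partial>Q) * v $ a)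
        - (\<Sum>a\<in>UNIV. \<Sum>b\<in>UNIV. (\<integral>z. A a b (x + z) \<partial>Q) * (v $ a * v $ b)) / 2
      = (\<integral>z. h (x + v + z) - h (x + z) - (\<Sum>a\<in>UNIV. G a (x + z) * v $ a) - (\<Sum>a\<in>UNIV. \<Sum>b\<in>UNIV. A a b (x + z) * (v $ a * v $ b)) / 2 \<partial>Q)"
      using I by simp
    also have "\<bar>\<dots>\<bar> \<le> M * norm v ^ 3"
      by (rule abs_integral_le) (use I P' in auto)
    finally show "\<bar>(\<integral>z. h (x + v + z) \<partial>Q) - (\<integral>z. h (x + z) \<partial>Q) - (\<Sum>a\<in>UNIV. (\<integral>z. G a (x + z) \<partial>Q) * v $ a)
        - (\<Sum>a\<in>UNIV. \<Sum>b\<in>UNIV. (\<integral>z. A a b (x + z) \<partial>Q) * (v $ a * v $ b)) / 2\<bar> \<le> M * norm v ^ 3" .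
  qed
qed

lemma convol_integral:
  fixes h :: "real ^ 'd \<Rightarrow> real"
  assumes Q1: "stein S1 Q1" and Q2: "stein S2 Q2" and hm [measurable]: "h \<in> borel_measurable borel"
    and i: "integrable (convol Q1 Q2) (\<lambda>w. h (x + w))"
  shows "(\<integral>w. h (x + w) \<partial>convol Q1 Q2) = (\<integral>z. (\<integral>y. h (x + z + y) \<partial>Q1) \<partial>Q2)"
proof -
  interpret Q1: prob_space Q1 by (rule steinD[OF Q1])
  interpret Q2: prob_space Q2 by (rule steinD[OF Q2])
  interpret P: pair_prob_space Q1 Q2 ..
  note [measurable_cong] = steinD(2)[OF Q1] steinD(2)[OF Q2]
  have m: "(\<lambda>p. fst p + snd p) \<in> Q1 \<Otimes>\<^sub>M Q2 \<rightarrow>\<^sub>M borel" by measurable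
  from i have i': "integrable (Q1 \<Otimes>\<^sub>M Q2) (\<lambda>(y, z). h (x + z + y))"
    unfolding convol_def by (subst (asm) integrable_distr_eq[OF m]) (auto simp: case_prod_unfold add_ac)
  have "(\<integral>w. h (x + w) \<partial>convol Q1 Q2) = (\<integral>p. h (x + (fst p + snd p)) \<partial>(Q1 \<Otimes>\<^sub>M Q2))"
    unfolding convol_def by (subst integral_distr[OF m]) auto
  also have "\<dots> = (\<integral>z. (\<integral>y. h (x + z + y) \<partial>Q1) \<partial>Q2)"
    using P.integral_snd[OF i'] by (simp add: case_prod_unfold add_ac)
  finally show ?thesis .
qed

lemma C3_partial_bound: 
  fixes h :: "real ^ 'd \<Rightarrow> real"
  assumes bd: "(MAX k\<in>{1,2,3}. D_norm k h) < \<infinity>"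
  shows "\<exists>M. \<forall>js x. length js \<in> {1,2,3} \<longrightarrow> \<bar>partials js h x\<bar> \<le> M"
proof -
  have each: "\<exists>n :: nat. \<forall>js x. length js = k \<longrightarrow> \<bar>partials js h x\<bar> \<le> real n" if k: "k \<in> {1,2,3}" for k
  proof -
    have "D_norm k h \<le> (MAX k\<in>{1,2,3}. D_norm k h)" using k by (intro Max_ge) auto
    then have "D_norm k h < \<infinity>" using bd by (rule le_less_trans)
    then obtain n :: nat where n: "D_norm k h < ereal (real n)" by (auto dest!: less_PInf_Ex_of_nat[THEN iffD1])
    have "\<bar>partials js h x\<bar> \<le> real n" if l: "length js = k" for js x
    proof -
      have "ereal \<bar>partials js h x\<bar> \<le> (SUP x. ereal \<bar>partials js h x\<bar>)" by (rule SUP_upper) simp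
      also have "\<dots> \<le> D_norm k h"
        unfolding D_norm_def using finite_lists_length_eq[of "UNIV :: 'd set" k] l by (intro Max_ge) auto
      finally have "ereal \<bar>partials js h x\<bar> < ereal (real n)" using n by (rule le_less_trans)
      then show ?thesis by simp
    qed
    then show ?thesis by blast
  qed
  obtain n1 :: nat where n1: "\<forall>js x. length js = 1 \<longrightarrow> \<bar>partials js h x\<bar> \<le> real n1" using each[of 1] by blast
  obtain n2 :: nat where n2: "\<forall>js x. length js = 2 \<longrightarrow> \<bar>partials js h x\<bar> \<le> real n2" using each[of 2] by blast
  obtain n3 :: nat where n3: "\<forall>js x. length js = 3 \<longrightarrow> \<bar>partials js h x\<bar> \<le> real n3" using each[of 3] by blast
  note n = n1[rule_format] n2[rule_format] n3[rule_format]
  have "\<bar>partials js h x\<bar> \<le> real n1 + real n2 + real n3" if len: "length js \<in> {1,2,3}" for js x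
  proof -
    consider "length js = 1" | "length js = 2" | "length js = 3" using len by auto
    then show ?thesis
    proof cases
      case 1 then show ?thesis using n(1)[of js x] by simp
    next
      case 2 then show ?thesis using n(2)[of js x] by simp
    next
      case 3 then show ?thesis using n(3)[of js x] by simp
    qed
  qed
  then show ?thesis by blast
qed

lemma partial_eq_derivative:
  fixes f :: "real ^ 'd \<Rightarrow> real"
  assumes "(f has_derivative f') (at x)"
  shows "partial i f x = f' (axis i 1)"
proof -
  have lin: "linear f'" using assms has_derivative_linear by blast
  have "((\<lambda>t. x + t *\<^sub>R axis i 1) has_derivative (\<lambda>t. t *\<^sub>R axis i 1)) (at 0)"
    by (auto intro!: derivative_eq_intros)
  moreover have "(f has_derivative f') (at (x + 0 *\<^sub>R axis i 1))" using assms by simp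
  ultimately have "((\<lambda>t. f (x + t *\<^sub>R axis i 1)) has_derivative (\<lambda>t. f' (t *\<^sub>R axis i 1))) (at 0)"
    by (rule has_derivative_compose)
  then have "((\<lambda>t. f (x + t *\<^sub>R axis i 1)) has_real_derivative f' (axis i 1)) (at 0)"
    by (rule has_derivative_imp_has_field_derivative) (simp add: linear_scale[OF lin] mult.commute)
  then show ?thesis unfolding partial_def by (rule DERIV_imp_deriv)
qed

lemma increment_bound:
  fixes f f' :: "real \<Rightarrow> real"
  assumes "\<And>t. 0 \<le> t \<Longrightarrow> t \<le> 1 \<Longrightarrow> (f has_real_derivative f' t) (at t)" "\<And>t. 0 \<le> t \<Longrightarrow> t \<le> 1 \<Longrightarrow> \<bar>f' t\<bar> \<le> K"
  shows "\<bar>f 1 - f 0\<bar> \<le> K"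
proof -
  have "norm (f 1 - f 0) \<le> K * norm (1 - 0 :: real)"
    by (rule field_differentiable_bound[where S="{0..1}"])
       (use assms in \<open>auto intro: has_field_derivative_at_within\<close>)
  then show ?thesis by simp
qed

lemma C3_symmetric_hessian:
  fixes h :: "real ^ 'd \<Rightarrow> real"
  assumes h: "\<And>x v. \<bar>h (x + v) - h x - (\<Sum>a\<in>UNIV. G a x * v $ a) - (\<Sum>a\<in>UNIV. \<Sum>b\<in>UNIV. A a b x * (v $ a * v $ b)) / 2\<bar> \<le> M * norm v ^ 3"
    and G: "\<And>a. C11 M (G a) (A a)"
  shows "A a b x = A b a x"
proof -
  have M: "0 \<le> M" by (rule C11D(1)[OF G])
  have Gt: "\<bar>G q (y + v) - G q y - (\<Sum>a\<in>UNIV. A q a y * v $ a)\<bar> \<le> M * (norm v)\<^sup>2" for q y v by (rule C11D(3)[OF G])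
  have Al: "\<bar>A q p (y + v) - A q p y\<bar> \<le> M * norm v" for q p y v by (rule C11D(5)[OF G])
  have ax: "(\<Sum>c\<in>UNIV. g c * (t *\<^sub>R axis p (1::real)) $ c) = t * g p" for g p t
    by (simp add: axis_def if_distrib cong: if_cong)
  have ax2: "(\<Sum>c\<in>UNIV. \<Sum>d\<in>UNIV. g c d * ((t *\<^sub>R axis p (1::real)) $ c * (t *\<^sub>R axis p 1) $ d)) = t\<^sup>2 * g p p" for g :: "'d \<Rightarrow> 'd \<Rightarrow> real" and p t
  proof -
    have "(\<Sum>c\<in>UNIV. \<Sum>d\<in>UNIV. g c d * ((t *\<^sub>R axis p (1::real)) $ c * (t *\<^sub>R axis p 1) $ d))
      = (\<Sum>c\<in>UNIV. (\<Sum>d\<in>UNIV. g c d * (t *\<^sub>R axis p 1) $ d) * (t *\<^sub>R axis p 1) $ c)"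
      by (simp add: sum_distrib_right sum_distrib_left ac_simps)
    also have "\<dots> = t * (t * g p p)" by (simp only: ax)
    finally show ?thesis by (simp add: power2_eq_square)
  qed
  have one: "\<bar>h (y + t *\<^sub>R axis p 1) - h y - t * G p y - t\<^sup>2 * A p p y / 2\<bar> \<le> M * t ^ 3" if "0 < t" for y p t
    using h[of y "t *\<^sub>R axis p 1"] that unfolding ax ax2 by simp
  have two: "\<bar>h (x + t *\<^sub>R axis p 1 + t *\<^sub>R axis q 1) - h x - t * G p x - t * G q x - t\<^sup>2 * A p p x / 2 - t\<^sup>2 * A q q x / 2 - t\<^sup>2 * A q p x\<bar> \<le> 4 * M * t ^ 3"
    if t: "0 < t" for p q t
  proof -
    let ?y = "x + t *\<^sub>R axis p 1"
    have 1: "\<bar>h ?y - h x - t * G p x - t\<^sup>2 * A p p x / 2\<bar> \<le> M * t ^ 3" by (rule one[OF t])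
    have 2: "\<bar>h (?y + t *\<^sub>R axis q 1) - h ?y - t * G q ?y - t\<^sup>2 * A q q ?y / 2\<bar> \<le> M * t ^ 3" by (rule one[OF t])
    have "\<bar>G q ?y - G q x - t * A q p x\<bar> \<le> M * t\<^sup>2"
      using Gt[of q x "t *\<^sub>R axis p 1"] t unfolding ax by simp
    then have "\<bar>t * (G q ?y - G q x - t * A q p x)\<bar> \<le> t * (M * t\<^sup>2)"
      unfolding abs_mult using t by (simp add: mult_left_mono)
    then have 3: "\<bar>t * G q ?y - t * G q x - t\<^sup>2 * A q p x\<bar> \<le> M * t ^ 3"
      by (simp add: algebra_simps power2_eq_square power3_eq_cube)
    have "\<bar>A q q ?y - A q q x\<bar> \<le> M * t" using Al[of q q x "t *\<^sub>R axis p 1"] t by simp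
    then have "t\<^sup>2 * \<bar>A q q ?y - A q q x\<bar> \<le> t\<^sup>2 * (M * t)" by (rule mult_left_mono) simp
    moreover have "\<bar>t\<^sup>2 * A q q ?y - t\<^sup>2 * A q q x\<bar> = t\<^sup>2 * \<bar>A q q ?y - A q q x\<bar>" by (simp add: abs_mult flip: right_diff_distrib)
    moreover have "t\<^sup>2 * (M * t) = M * t ^ 3" by (simp add: power2_eq_square power3_eq_cube)
    ultimately have 4: "\<bar>t\<^sup>2 * A q q ?y - t\<^sup>2 * A q q x\<bar> \<le> M * t ^ 3" by linarith
    have "0 \<le> M * t ^ 3" using M t by simp
    then show ?thesis using 1 2 3 4 by linarith
  qed
  have small: "\<bar>A a b x - A b a x\<bar> \<le> 8 * M * t" if t: "0 < t" for t
  proof -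
    have "\<bar>t\<^sup>2 * A a b x - t\<^sup>2 * A b a x\<bar> \<le> 8 * M * t ^ 3"
      using two[OF t, of a b] two[OF t, of b a] by (simp add: add.assoc add.commute[of "t *\<^sub>R axis a 1"])
    then have "t\<^sup>2 * \<bar>A a b x - A b a x\<bar> \<le> t\<^sup>2 * (8 * M * t)"
      by (simp add: abs_mult power2_eq_square power3_eq_cube ac_simps flip: right_diff_distrib)
    then show ?thesis using t by (simp add: mult_le_cancel_left)
  qed
  show ?thesis
  proof (rule ccontr)
    assume "A a b x \<noteq> A b a x"
    then have d: "0 < \<bar>A a b x - A b a x\<bar>" by simp
    define t where "t = \<bar>A a b x - A b a x\<bar> / (16 * (M + 1))"
    have t: "0 < t" using d M by (simp add: t_def)
    have "8 * M * t \<le> 8 * (M + 1) * t" using t by (intro mult_right_mono) auto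
    also have "\<dots> = \<bar>A a b x - A b a x\<bar> / 2" using M by (simp add: t_def field_simps)
    finally have "\<bar>A a b x - A b a x\<bar> \<le> \<bar>A a b x - A b a x\<bar> / 2" by (rule order_trans[OF small[OF t]])
    then show False using d by simp
  qed
qed

lemma three_times_differentiable_C3:
  fixes h :: "real ^ 'd \<Rightarrow> real"
  assumes diff: "three_times_differentiable h" and bd: "(MAX k\<in>{1,2,3}. D_norm k h) < \<infinity>"
  obtains M G A where "C3 M h G A"
proof -
  obtain h1 h2 h3 where d1: "\<And>x. (h has_derivative blinfun_apply (h1 x)) (at x)"
    and d2: "\<And>x. (h1 has_derivative blinfun_apply (h2 x)) (at x)"
    and d3: "\<And>x. (h2 has_derivative blinfun_apply (h3 x)) (at x)"
    using diff unfolding three_times_differentiable_def by blast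
  let ?e = "\<lambda>i. axis i (1::real) :: real ^ 'd"
  define G where "G a x = blinfun_apply (h1 x) (?e a)" for a x
  define A where "A a b x = blinfun_apply (blinfun_apply (h2 x) (?e b)) (?e a)" for a b x
  define T where "T a b c x = blinfun_apply (blinfun_apply (blinfun_apply (h3 x) (?e c)) (?e b)) (?e a)" for a b c x
  have dG: "(G a has_derivative (\<lambda>v. blinfun_apply (blinfun_apply (h2 x) v) (?e a))) (at x)" for a x
    unfolding G_def by (rule bounded_linear.has_derivative[OF blinfun.bounded_linear_left d2])
  have dA: "(A a b has_derivative (\<lambda>v. blinfun_apply (blinfun_apply (blinfun_apply (h3 x) v) (?e b)) (?e a))) (at x)" for a b x
    unfolding A_def
    by (rule bounded_linear.has_derivative[OF blinfun.bounded_linear_left bounded_linear.has_derivative[OF blinfun.bounded_linear_left d3]])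
  have p1: "partials [a] h = G a" for a
    by (rule ext) (simp add: partial_eq_derivative[OF d1] G_def)
  have p2: "partials [b, a] h = A a b" for a b
    using p1[of a] by (intro ext) (simp add: partial_eq_derivative[OF dG] A_def)
  have p3: "partials [c, b, a] h = T a b c" for a b c
    using p2[of b a] by (intro ext) (simp add: partial_eq_derivative[OF dA] T_def)
  obtain M0 where M0: "\<And>js x. length js \<in> {1,2,3} \<Longrightarrow> \<bar>partials js h x\<bar> \<le> M0"
    using C3_partial_bound[OF bd] by blast
  have bG: "\<bar>G a x\<bar> \<le> M0" and bA: "\<bar>A a b x\<bar> \<le> M0" and bT: "\<bar>T a b c x\<bar> \<le> M0" for a b c x
    using M0[of "[a]" x] M0[of "[b, a]" x] M0[of "[c, b, a]" x] unfolding p1 p2 p3 by auto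
  have M00: "0 \<le> M0" using bG[of undefined undefined] by linarith
  have ex: "(\<Sum>i\<in>UNIV. v $ i *\<^sub>R ?e i) = v" for v :: "real ^ 'd"
    using basis_expansion[of v] by (simp add: scalar_mult_eq_scaleR)
  have e1: "blinfun_apply (h1 x) v = (\<Sum>a\<in>UNIV. G a x * v $ a)" for x v
    by (subst ex[of v, symmetric], unfold blinfun.sum_right blinfun.scaleR_right) (simp add: G_def mult.commute)
  have e2: "blinfun_apply (blinfun_apply (h2 x) v) (?e a) = (\<Sum>b\<in>UNIV. A a b x * v $ b)" for x v a
    by (subst ex[of v, symmetric], unfold blinfun.sum_right blinfun.scaleR_right blinfun.sum_left blinfun.scaleR_left)
       (simp add: A_def mult.commute)
  have e3: "blinfun_apply (blinfun_apply (blinfun_apply (h3 x) v) (?e b)) (?e a) = (\<Sum>c\<in>UNIV. T a b c x * v $ c)" for x v a b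
    by (subst ex[of v, symmetric], unfold blinfun.sum_right blinfun.scaleR_right blinfun.sum_left blinfun.scaleR_left)
       (simp add: T_def mult.commute)
  have line: "((\<lambda>t. F (x + t *\<^sub>R v)) has_real_derivative F' (x + t *\<^sub>R v) v) (at t)"
    if F: "\<And>x. (F has_derivative F' x) (at x)" for F :: "real ^ 'd \<Rightarrow> real" and F' x v t
  proof -
    have lin: "linear (F' (x + t *\<^sub>R v))" using F has_derivative_linear by blast
    have "((\<lambda>t. x + t *\<^sub>R v) has_derivative (\<lambda>t. t *\<^sub>R v)) (at t)" by (auto intro!: derivative_eq_intros)
    then have "((\<lambda>t. F (x + t *\<^sub>R v)) has_derivative (\<lambda>s. F' (x + t *\<^sub>R v) (s *\<^sub>R v))) (at t)"
      by (rule has_derivative_compose) (rule F)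
    then show ?thesis
      by (rule has_derivative_imp_has_field_derivative) (simp add: linear_scale[OF lin] mult.commute)
  qed
  note lh = line[of h "\<lambda>x. blinfun_apply (h1 x)", OF d1, unfolded e1]
  note lG = line[of "G _", OF dG, unfolded e2]
  note lA = line[of "A _ _", OF dA, unfolded e3]
  let ?d = "real CARD('d)"
  have d1': "1 \<le> ?d" using zero_less_card_finite[where 'a='d] by linarith
  have sb: "\<bar>\<Sum>a\<in>UNIV. g a * v $ a\<bar> \<le> ?d * (c * norm v)" if "\<And>a. \<bar>g a\<bar> \<le> c" for g and v :: "real ^ 'd" and c
  proof -
    have "0 \<le> c" using that[of undefined] by linarith
    then have "\<bar>\<Sum>a\<in>UNIV. g a * v $ a\<bar> \<le> (\<Sum>a\<in>(UNIV :: 'd set). c * norm v)"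
      by (intro order_trans[OF sum_abs] sum_mono) (auto simp: abs_mult intro!: mult_mono that component_le_norm_cart)
    then show ?thesis by simp
  qed
  define M where "M = ?d ^ 3 * M0"
  have dp: "1 \<le> ?d ^ 3" "?d \<le> ?d ^ 3" "?d\<^sup>2 \<le> ?d ^ 3"
    using d1' power_increasing[of 1 3 ?d] power_increasing[of 2 3 ?d] by (auto simp: one_le_power)
  have up: "p \<le> M * t" if "p \<le> k * M0 * t" "k \<le> ?d ^ 3" "0 \<le> t" for p k t
    using that(1) mult_right_mono[OF mult_right_mono[OF that(2) M00] that(3)] unfolding M_def by linarith
  have Alip: "\<bar>A a b (x + v) - A a b x\<bar> \<le> ?d * M0 * norm v" for a b x v
    using increment_bound[of "\<lambda>t. A a b (x + t *\<^sub>R v)" _ "?d * (M0 * norm v)", OF lA sb[OF bT]] by (simp add: mult.assoc)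
  have Glip: "\<bar>G a (x + v) - G a x\<bar> \<le> ?d * M0 * norm v" for a x v
    using increment_bound[of "\<lambda>t. G a (x + t *\<^sub>R v)" _ "?d * (M0 * norm v)", OF lG sb[OF bA]] by (simp add: mult.assoc)
  have hlip: "\<bar>h (x + v) - h x\<bar> \<le> ?d * M0 * norm v" for x v
    using increment_bound[of "\<lambda>t. h (x + t *\<^sub>R v)" _ "?d * (M0 * norm v)", OF lh sb[OF bG]] by (simp add: mult.assoc)
  have Gtay: "\<bar>G a (x + v) - G a x - (\<Sum>b\<in>UNIV. A a b x * v $ b)\<bar> \<le> ?d\<^sup>2 * M0 * (norm v)\<^sup>2" for a x v
  proof -
    let ?f = "\<lambda>t. G a (x + t *\<^sub>R v) - t * (\<Sum>b\<in>UNIV. A a b x * v $ b)"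
    have "\<bar>?f 1 - ?f 0\<bar> \<le> ?d * (?d * M0 * norm v * norm v)"
    proof (rule increment_bound)
      fix t :: real assume t: "0 \<le> t" "t \<le> 1"
      show "(?f has_real_derivative (\<Sum>b\<in>UNIV. (A a b (x + t *\<^sub>R v) - A a b x) * v $ b)) (at t)"
      proof -
        have "(?f has_real_derivative (\<Sum>b\<in>UNIV. A a b (x + t *\<^sub>R v) * v $ b) - (\<Sum>b\<in>UNIV. A a b x * v $ b)) (at t)"
          by (rule derivative_eq_intros lG | simp)+
        then show ?thesis by (simp add: left_diff_distrib sum_subtractf)
      qed
      show "\<bar>\<Sum>b\<in>UNIV. (A a b (x + t *\<^sub>R v) - A a b x) * v $ b\<bar> \<le> ?d * (?d * M0 * norm v * norm v)"
      proof (rule sb)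
        fix b
        have "\<bar>A a b (x + t *\<^sub>R v) - A a b x\<bar> \<le> ?d * M0 * norm (t *\<^sub>R v)" by (rule Alip)
        also have "\<dots> \<le> ?d * M0 * norm v" using t M00 by (intro mult_left_mono) (auto simp: mult_left_le_one_le)
        finally show "\<bar>A a b (x + t *\<^sub>R v) - A a b x\<bar> \<le> ?d * M0 * norm v" .
      qed
    qed
    then show ?thesis by (simp add: power2_eq_square ac_simps diff_diff_eq add.commute)
  qed
  have htay: "\<bar>h (x + v) - h x - (\<Sum>a\<in>UNIV. G a x * v $ a) - (\<Sum>a\<in>UNIV. \<Sum>b\<in>UNIV. A a b x * (v $ a * v $ b)) / 2\<bar> \<le> ?d ^ 3 * M0 * norm v ^ 3" for x v
  proof -
    let ?L = "\<Sum>a\<in>UNIV. G a x * v $ a" and ?Q = "\<Sum>a\<in>UNIV. \<Sum>b\<in>UNIV. A a b x * (v $ a * v $ b)"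
    let ?f = "\<lambda>t. h (x + t *\<^sub>R v) - t * ?L - t\<^sup>2 * (?Q / 2)"
    have "\<bar>?f 1 - ?f 0\<bar> \<le> ?d * (?d\<^sup>2 * M0 * (norm v)\<^sup>2 * norm v)"
    proof (rule increment_bound)
      fix t :: real assume t: "0 \<le> t" "t \<le> 1"
      have "(?f has_real_derivative (\<Sum>a\<in>UNIV. G a (x + t *\<^sub>R v) * v $ a) - ?L - t * ?Q) (at t)"
        by (rule derivative_eq_intros lh | simp)+
      moreover have "(\<Sum>a\<in>UNIV. G a (x + t *\<^sub>R v) * v $ a) - ?L - t * ?Q
        = (\<Sum>a\<in>UNIV. (G a (x + t *\<^sub>R v) - G a x - (\<Sum>b\<in>UNIV. A a b x * (t *\<^sub>R v) $ b)) * v $ a)"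
      proof -
        have "(G a (x + t *\<^sub>R v) - G a x - (\<Sum>b\<in>UNIV. A a b x * (t *\<^sub>R v) $ b)) * v $ a
          = G a (x + t *\<^sub>R v) * v $ a - G a x * v $ a - t * (\<Sum>b\<in>UNIV. A a b x * (v $ a * v $ b))" for a
          by (simp add: right_diff_distrib left_diff_distrib sum_distrib_left sum_distrib_right ac_simps)
        then show ?thesis by (simp only: sum_subtractf sum_distrib_left)
      qed
      ultimately show "(?f has_real_derivative (\<Sum>a\<in>UNIV. (G a (x + t *\<^sub>R v) - G a x - (\<Sum>b\<in>UNIV. A a b x * (t *\<^sub>R v) $ b)) * v $ a)) (at t)"
        by simp
      show "\<bar>\<Sum>a\<in>UNIV. (G a (x + t *\<^sub>R v) - G a x - (\<Sum>b\<in>UNIV. A a b x * (t *\<^sub>R v) $ b)) * v $ a\<bar> \<le> ?d * (?d\<^sup>2 * M0 * (norm v)\<^sup>2 * norm v)"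
      proof (rule sb)
        fix a
        have "\<bar>G a (x + t *\<^sub>R v) - G a x - (\<Sum>b\<in>UNIV. A a b x * (t *\<^sub>R v) $ b)\<bar> \<le> ?d\<^sup>2 * M0 * (norm (t *\<^sub>R v))\<^sup>2" by (rule Gtay)
        also have "\<dots> \<le> ?d\<^sup>2 * M0 * (norm v)\<^sup>2"
          using t M00 by (intro mult_left_mono power_mono) (auto simp: mult_left_le_one_le)
        finally show "\<bar>G a (x + t *\<^sub>R v) - G a x - (\<Sum>b\<in>UNIV. A a b x * (t *\<^sub>R v) $ b)\<bar> \<le> ?d\<^sup>2 * M0 * (norm v)\<^sup>2" .
      qed
    qed
    then show ?thesis by (simp add: power2_eq_square power3_eq_cube ac_simps algebra_simps)
  qed
  have C: "C11 M (G a) (A a)" for a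
    unfolding C11_def
  proof (intro conjI allI)
    show "0 \<le> M" using M00 by (simp add: M_def)
    show "\<bar>G a (x + v) - G a x\<bar> \<le> M * norm v" for x v by (rule up[OF Glip dp(2)]) simp
    show "\<bar>G a (x + v) - G a x - (\<Sum>b\<in>UNIV. A a b x * v $ b)\<bar> \<le> M * (norm v)\<^sup>2" for x v by (rule up[OF Gtay dp(3)]) simp
    show "\<bar>A a b x\<bar> \<le> M" for b x using up[of "\<bar>A a b x\<bar>" 1 1] bA[of a b x] dp by simp
    show "\<bar>A a b (x + v) - A a b x\<bar> \<le> M * norm v" for b x v by (rule up[OF Alip dp(2)]) simp
  qed
  have htay': "\<bar>h (x + v) - h x - (\<Sum>a\<in>UNIV. G a x * v $ a) - (\<Sum>a\<in>UNIV. \<Sum>b\<in>UNIV. A a b x * (v $ a * v $ b)) / 2\<bar> \<le> M * norm v ^ 3" for x v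
    by (rule up[OF htay]) auto
  have "C3 M h G A"
    unfolding C3_def
  proof (intro conjI allI)
    show "0 \<le> M" using M00 by (simp add: M_def)
    show "\<bar>h (x + v) - h x\<bar> \<le> M * norm v" for x v by (rule up[OF hlip dp(2)]) simp
    show "\<bar>G a x\<bar> \<le> M" for a x using up[of "\<bar>G a x\<bar>" 1 1] bG[of a x] dp by simp
    show "A a b x = A b a x" for a b x by (rule C3_symmetric_hessian[OF htay' C])
  qed (fact htay' C)+
  then show ?thesis by (rule that)
qed

section \<open>Decorrelation from a decreasing filtration\<close>

lemma le_geometric_mean:
  fixes x :: real
  assumes "x \<le> c * u\<^sup>2" "x \<le> c * v\<^sup>2" "0 \<le> x" "0 \<le> c" "0 \<le> u" "0 \<le> v"
  shows "x \<le> c * (u * v)"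
proof (cases "u \<le> v")
  case True
  then have "u * u \<le> u * v" using assms by (intro mult_left_mono)
  then have "c * u\<^sup>2 \<le> c * (u * v)" using assms by (auto simp: power2_eq_square intro: mult_left_mono)
  then show ?thesis using assms by linarith
next
  case False
  then have "v * v \<le> u * v" using assms by (intro mult_right_mono) auto
  then have "c * v\<^sup>2 \<le> c * (u * v)" using assms by (auto simp: power2_eq_square intro: mult_left_mono)
  then show ?thesis using assms by linarith
qed

text \<open>\<open>F n\<close> contains the information about the orbit from time \<open>n\<close> on. The rate is a square because
  geometric means of two decorrelation bounds have to be summable.\<close>

locale reverse_mixing = prob_space M for M :: "'a measure" +
  fixes F :: "nat \<Rightarrow> 'a measure" and X :: "nat \<Rightarrow> 'a \<Rightarrow> real ^ 'd" and K :: real and w :: "nat \<Rightarrow> real"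
  assumes sub: "subalgebra M (F n)"
    and decr: "subalgebra (F n) (F (Suc n))"
    and X_meas: "X n \<in> borel_measurable (F n)"
    and X_bound: "norm (X n \<omega>) \<le> K"
    and X_mean: "(\<integral>\<omega>. X n \<omega> $ a \<partial>M) = 0"
    and mix1: "i < n \<Longrightarrow> E \<in> sets (F n) \<Longrightarrow> \<bar>\<integral>\<omega>. X i \<omega> $ a * indicator E \<omega> \<partial>M\<bar> \<le> (w (n - i))\<^sup>2"
    and mix2: "i \<le> j \<Longrightarrow> j < n \<Longrightarrow> E \<in> sets (F n) \<Longrightarrow>
      \<bar>\<integral>\<omega>. (X i \<omega> $ a * X j \<omega> $ b - (\<integral>\<omega>. X i \<omega> $ a * X j \<omega> $ b \<partial>M)) * indicator E \<omega> \<partial>M\<bar> \<le> (w (n - j))\<^sup>2"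
    and w_nonneg: "0 \<le> w l" and w_anti: "l \<le> m \<Longrightarrow> w m \<le> w l" and w_summable: "summable w"
begin

definition W1 :: real where "W1 = (\<Sum>l. w l)"

lemma K_nonneg: "0 \<le> K" using X_bound norm_ge_zero by (rule order_trans[rotated])

lemma w_le: "w l \<le> w 0" by (rule w_anti) simp

lemma W1_nonneg: "0 \<le> W1"
  unfolding W1_def using w_summable w_nonneg by (auto intro!: suminf_nonneg)

lemma sum_w_le: "finite I \<Longrightarrow> inj_on g I \<Longrightarrow> (\<Sum>k\<in>I. w (g k)) \<le> W1"
  unfolding W1_def using sum_le_suminf[OF w_summable, of "g ` I"] w_nonneg by (simp add: sum.reindex)

lemma w2_le: "real l * (w l)\<^sup>2 \<le> W1 * w l"
proof -
  have "real l * w l = (\<Sum>k\<in>{1..l}. w l)" by simp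
  also have "\<dots> \<le> (\<Sum>k\<in>{1..l}. w k)" by (intro sum_mono w_anti) auto
  also have "\<dots> \<le> W1" by (rule sum_w_le) auto
  finally have "real l * w l * w l \<le> W1 * w l" using w_nonneg by (rule mult_right_mono)
  then show ?thesis by (simp add: power2_eq_square mult.assoc)
qed

lemma subalgebra_le:
  assumes "i \<le> n" shows "subalgebra (F i) (F n)"
  using assms
proof (induction rule: dec_induct)
  case base show ?case by (simp add: subalgebra_def)
next
  case (step m) then show ?case using decr[of m] by (auto simp: subalgebra_def)
qed

lemma F_mono: "i \<le> n \<Longrightarrow> f \<in> borel_measurable (F n) \<Longrightarrow> f \<in> borel_measurable (F i)"
  using measurable_from_subalg[OF subalgebra_le] by blast

lemma F_M: "f \<in> borel_measurable (F n) \<Longrightarrow> f \<in> borel_measurable M"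
  using measurable_from_subalg[OF sub] by blast

lemma X_meas_le: "i \<le> n \<Longrightarrow> X n \<in> borel_measurable (F i)"
  by (rule F_mono[OF _ X_meas])

lemma X_comp_meas: "i \<le> n \<Longrightarrow> (\<lambda>\<omega>. X n \<omega> $ a) \<in> borel_measurable (F i)"
  by (rule measurable_compose[OF X_meas_le component_measurable])

lemma X_comp_M [measurable]: "(\<lambda>\<omega>. X n \<omega> $ a) \<in> borel_measurable M"
  by (rule F_M[OF X_comp_meas[OF order_refl]])

lemma X_comp_bound: "\<bar>X n \<omega> $ a\<bar> \<le> K"
  using component_le_norm_cart[of "X n \<omega>" a] X_bound[of n \<omega>] by linarith

lemma bounded_cond_exp:
  fixes Z :: "'a \<Rightarrow> real"
  assumes [measurable]: "Z \<in> borel_measurable M" and Z: "\<And>\<omega>. \<bar>Z \<omega>\<bar> \<le> C"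
  shows "\<exists>u\<in>borel_measurable (F n). (\<forall>\<omega>. \<bar>u \<omega>\<bar> \<le> C)
    \<and> (\<forall>\<phi>\<in>borel_measurable (F n). \<forall>B. (\<forall>\<omega>. \<bar>\<phi> \<omega>\<bar> \<le> B) \<longrightarrow> (\<integral>\<omega>. Z \<omega> * \<phi> \<omega> \<partial>M) = (\<integral>\<omega>. u \<omega> * \<phi> \<omega> \<partial>M))"
proof -
  interpret sigma_finite_subalgebra M "F n"
    by (rule finite_measure_subalgebra_is_sigma_finite[OF finite_measure_subalgebra.intro])
       (use sub in \<open>auto simp: finite_measure_subalgebra_axioms_def finite_measure_axioms\<close>)
  have Zi: "integrable M Z" by (rule integrable_const_bound[where B=C]) (use Z in auto)
  let ?e = "real_cond_exp M (F n) Z"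
  define u where "u \<omega> = max (- C) (min C (?e \<omega>))" for \<omega>
  have C0: "0 \<le> C" using Z[of undefined] by linarith
  have e [measurable]: "?e \<in> borel_measurable (F n)" by simp
  have uF: "u \<in> borel_measurable (F n)" unfolding u_def[abs_def] by measurable
  have "AE \<omega> in M. ?e \<omega> \<le> C" by (rule real_cond_exp_le_c[OF Zi]) (use Z in \<open>auto simp: abs_le_iff\<close>)
  moreover have "AE \<omega> in M. ?e \<omega> \<ge> - C"
    by (rule real_cond_exp_ge_c[OF Zi]) (use Z in \<open>auto simp: abs_le_iff intro: minus_le_iff[THEN iffD1]\<close>)
  ultimately have ae: "AE \<omega> in M. u \<omega> = ?e \<omega>" by eventually_elim (auto simp: u_def)
  show ?thesis
  proof (intro bexI[OF _ uF] conjI allI ballI impI)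
    show "\<bar>u \<omega>\<bar> \<le> C" for \<omega> using C0 by (auto simp: u_def)
    fix \<phi> :: "'a \<Rightarrow> real" and B assume phi: "\<phi> \<in> borel_measurable (F n)" and b: "\<forall>\<omega>. \<bar>\<phi> \<omega>\<bar> \<le> B"
    have [measurable]: "\<phi> \<in> borel_measurable M" "u \<in> borel_measurable M" using phi uF by (auto intro: F_M)
    have i: "integrable M (\<lambda>\<omega>. \<phi> \<omega> * Z \<omega>)"
    proof (rule integrable_const_bound[where B="B * C"])
      have B0: "0 \<le> B" using b[rule_format, of undefined] by linarith
      show "AE \<omega> in M. norm (\<phi> \<omega> * Z \<omega>) \<le> B * C"
        unfolding real_norm_def abs_mult using b by (intro AE_I2 mult_mono Z B0) auto
    qed measurable
    have "(\<integral>\<omega>. Z \<omega> * \<phi> \<omega> \<partial>M) = (\<integral>\<omega>. \<phi> \<omega> * ?e \<omega> \<partial>M)"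
      using real_cond_exp_intg(2)[OF i phi] by (simp add: mult.commute)
    also have "\<dots> = (\<integral>\<omega>. u \<omega> * \<phi> \<omega> \<partial>M)"
    proof (rule integral_cong_AE)
      have [measurable]: "?e \<in> borel_measurable M" by (rule F_M[OF e])
      show "(\<lambda>\<omega>. \<phi> \<omega> * ?e \<omega>) \<in> borel_measurable M" "(\<lambda>\<omega>. u \<omega> * \<phi> \<omega>) \<in> borel_measurable M" by measurable
      show "AE \<omega> in M. \<phi> \<omega> * ?e \<omega> = u \<omega> * \<phi> \<omega>" using ae by eventually_elim simp
    qed
    finally show "(\<integral>\<omega>. Z \<omega> * \<phi> \<omega> \<partial>M) = (\<integral>\<omega>. u \<omega> * \<phi> \<omega> \<partial>M)" .
  qed
qed

lemma integrable_bounded: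
  fixes Z :: "'a \<Rightarrow> real"
  shows "Z \<in> borel_measurable M \<Longrightarrow> (\<And>\<omega>. \<bar>Z \<omega>\<bar> \<le> C) \<Longrightarrow> integrable M Z"
  by (rule integrable_const_bound[where B=C]) auto

lemma mix_function:
  fixes Z \<phi> :: "'a \<Rightarrow> real"
  assumes Zm: "Z \<in> borel_measurable M" and Z: "\<And>\<omega>. \<bar>Z \<omega>\<bar> \<le> C"
    and mix: "\<And>E. E \<in> sets (F n) \<Longrightarrow> \<bar>\<integral>\<omega>. Z \<omega> * indicator E \<omega> \<partial>M\<bar> \<le> \<rho>"
    and phi: "\<phi> \<in> borel_measurable (F n)" and B: "\<And>\<omega>. \<bar>\<phi> \<omega>\<bar> \<le> B"
  shows "\<bar>\<integral>\<omega>. Z \<omega> * \<phi> \<omega> \<partial>M\<bar> \<le> 2 * B * \<rho>"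
proof -
  obtain u where u': "u \<in> borel_measurable (F n)" "\<forall>\<omega>. \<bar>u \<omega>\<bar> \<le> C"
    "\<forall>\<phi>\<in>borel_measurable (F n). \<forall>B. (\<forall>\<omega>. \<bar>\<phi> \<omega>\<bar> \<le> B) \<longrightarrow> (\<integral>\<omega>. Z \<omega> * \<phi> \<omega> \<partial>M) = (\<integral>\<omega>. u \<omega> * \<phi> \<omega> \<partial>M)"
    using bounded_cond_exp[OF Zm Z, of n] by (elim bexE conjE) (rule that)
  note u = u'(1) u'(2)[rule_format] u'(3)[rule_format]
  have B0: "0 \<le> B" using B[of undefined] by linarith
  have C0: "0 \<le> C" using Z[of undefined] by linarith
  have uM [measurable]: "u \<in> borel_measurable M" by (rule F_M[OF u(1)])
  have [measurable]: "\<phi> \<in> borel_measurable M" by (rule F_M[OF phi])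
  have ui: "integrable M u" by (rule integrable_bounded[OF uM u(2)])
  define P where "P = u -` {0..} \<inter> space (F n)"
  define N where "N = u -` {..<0} \<inter> space (F n)"
  have PN: "P \<in> sets (F n)" "N \<in> sets (F n)" unfolding P_def N_def by (rule measurable_sets[OF u(1)], simp)+
  have sp: "space (F n) = space M" using sub[of n] by (auto simp: subalgebra_def)
  have ind: "(\<integral>\<omega>. Z \<omega> * indicator E \<omega> \<partial>M) = (\<integral>\<omega>. u \<omega> * indicator E \<omega> \<partial>M)" if "E \<in> sets (F n)" for E
    by (rule u(3)[where B=1]) (use that in \<open>auto simp: indicator_def\<close>)
  have i: "integrable M (\<lambda>\<omega>. u \<omega> * indicator E \<omega>)" if "E \<in> sets (F n)" for E
  proof (rule integrable_bounded)
    have "E \<in> sets M" using that sub[of n] by (auto simp: subalgebra_def)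
    then show "(\<lambda>\<omega>. u \<omega> * indicator E \<omega>) \<in> borel_measurable M" by measurable
    show "\<bar>u \<omega> * indicator E \<omega>\<bar> \<le> C" for \<omega> using u(2)[of \<omega>] C0 by (auto simp: indicator_def)
  qed
  have "(\<integral>\<omega>. \<bar>u \<omega>\<bar> \<partial>M) = (\<integral>\<omega>. u \<omega> * indicator P \<omega> - u \<omega> * indicator N \<omega> \<partial>M)"
    by (rule Bochner_Integration.integral_cong) (auto simp: P_def N_def sp indicator_def)
  also have "\<dots> = (\<integral>\<omega>. Z \<omega> * indicator P \<omega> \<partial>M) - (\<integral>\<omega>. Z \<omega> * indicator N \<omega> \<partial>M)"
    using i PN ind by simp
  also have "\<dots> \<le> 2 * \<rho>" using mix[OF PN(1)] mix[OF PN(2)] by linarith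
  finally have L: "(\<integral>\<omega>. \<bar>u \<omega>\<bar> \<partial>M) \<le> 2 * \<rho>" .
  have "\<bar>\<integral>\<omega>. Z \<omega> * \<phi> \<omega> \<partial>M\<bar> = \<bar>\<integral>\<omega>. u \<omega> * \<phi> \<omega> \<partial>M\<bar>" using u(3)[OF phi B] by simp
  also have "\<dots> \<le> (\<integral>\<omega>. \<bar>u \<omega> * \<phi> \<omega>\<bar> \<partial>M)" by (rule integral_abs_bound)
  also have "\<dots> \<le> (\<integral>\<omega>. B * \<bar>u \<omega>\<bar> \<partial>M)"
  proof (rule integral_mono)
    show "integrable M (\<lambda>\<omega>. \<bar>u \<omega> * \<phi> \<omega>\<bar>)"
      by (rule integrable_bounded[where C="C * B"]) (use u(2) B C0 in \<open>auto simp: abs_mult intro!: mult_mono\<close>)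
    show "integrable M (\<lambda>\<omega>. B * \<bar>u \<omega>\<bar>)" using ui by auto
    show "\<bar>u \<omega> * \<phi> \<omega>\<bar> \<le> B * \<bar>u \<omega>\<bar>" for \<omega>
      unfolding abs_mult using B[of \<omega>] by (subst mult.commute) (rule mult_right_mono, auto)
  qed
  also have "\<dots> \<le> B * (2 * \<rho>)" using L B0 by (simp add: mult_left_mono)
  finally show ?thesis by simp
qed

definition cov :: "nat \<Rightarrow> nat \<Rightarrow> 'd \<Rightarrow> 'd \<Rightarrow> real" where
  "cov i j a b = (\<integral>\<omega>. X i \<omega> $ a * X j \<omega> $ b \<partial>M)"

lemma XX_bound: "\<bar>X i \<omega> $ a * X j \<omega> $ b\<bar> \<le> K\<^sup>2"
  unfolding abs_mult power2_eq_square using X_comp_bound K_nonneg by (intro mult_mono) auto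

lemma cov_bound0: "\<bar>cov i j a b\<bar> \<le> K\<^sup>2"
  unfolding cov_def by (rule abs_integral_le[OF integrable_bounded[OF _ XX_bound] XX_bound]) measurable

lemma mix_one:
  fixes \<phi> :: "'a \<Rightarrow> real"
  assumes "i < n" "\<phi> \<in> borel_measurable (F n)" "\<And>\<omega>. \<bar>\<phi> \<omega>\<bar> \<le> B"
  shows "\<bar>\<integral>\<omega>. X i \<omega> $ a * \<phi> \<omega> \<partial>M\<bar> \<le> 2 * B * (w (n - i))\<^sup>2"
  by (rule mix_function[OF X_comp_M X_comp_bound mix1[OF assms(1)] assms(2,3)])

lemma cov_bound: "i < j \<Longrightarrow> \<bar>cov i j a b\<bar> \<le> 2 * K * (w (j - i))\<^sup>2"
  unfolding cov_def by (rule mix_one[OF _ X_comp_meas X_comp_bound]) auto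

lemma mix_two:
  fixes \<phi> :: "'a \<Rightarrow> real"
  assumes ij: "i \<le> j" "j < n" and phi: "\<phi> \<in> borel_measurable (F n)" and B: "\<And>\<omega>. \<bar>\<phi> \<omega>\<bar> \<le> B"
  shows "\<bar>\<integral>\<omega>. (X i \<omega> $ a * X j \<omega> $ b - cov i j a b) * \<phi> \<omega> \<partial>M\<bar> \<le> 4 * B * (K + 1) * (w (j - i) * w (n - j))"
    (is "\<bar>?I\<bar> \<le> _")
proof -
  let ?L = "4 * B * (K + 1)"
  have B0: "0 \<le> B" using B[of undefined] by linarith
  have L0: "0 \<le> ?L" using B0 K_nonneg by simp
  have "2 * B * 1 \<le> 2 * B * (2 * (K + 1))" using B0 K_nonneg by (intro mult_left_mono) auto
  then have L2: "2 * B \<le> ?L" by (simp add: algebra_simps)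
  have [measurable]: "\<phi> \<in> borel_measurable M" by (rule F_M[OF phi])
  have "\<bar>?I\<bar> \<le> 2 * B * (w (n - j))\<^sup>2"
  proof (rule mix_function[OF _ _ _ phi B])
    show "(\<lambda>\<omega>. X i \<omega> $ a * X j \<omega> $ b - cov i j a b) \<in> borel_measurable M" by measurable
    show "\<bar>X i \<omega> $ a * X j \<omega> $ b - cov i j a b\<bar> \<le> K\<^sup>2 + K\<^sup>2" for \<omega>
      using XX_bound[of i \<omega> a j b] cov_bound0[of i j a b] by linarith
    show "\<bar>\<integral>\<omega>. (X i \<omega> $ a * X j \<omega> $ b - cov i j a b) * indicator E \<omega> \<partial>M\<bar> \<le> (w (n - j))\<^sup>2"
      if "E \<in> sets (F n)" for E unfolding cov_def by (rule mix2[OF ij that])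
  qed
  also have "\<dots> \<le> ?L * (w (n - j))\<^sup>2" using L2 by (rule mult_right_mono) simp
  finally have 1: "\<bar>?I\<bar> \<le> ?L * (w (n - j))\<^sup>2" .
  show ?thesis
  proof (cases "i = j")
    case True
    have "?L * (w (n - j))\<^sup>2 \<le> ?L * (w (j - i) * w (n - j))"
      using True w_le[of "n - j"] w_nonneg[of "n - j"] L0 by (intro mult_left_mono) (auto simp: power2_eq_square intro: mult_right_mono)
    then show ?thesis using 1 by linarith
  next
    case False
    then have ij': "i < j" using ij by simp
    have i1: "integrable M (\<lambda>\<omega>. X i \<omega> $ a * (X j \<omega> $ b * \<phi> \<omega>))"
      by (rule integrable_bounded[where C="K * (K * B)"])
         (use X_comp_bound B K_nonneg B0 in \<open>auto simp: abs_mult intro!: mult_mono\<close>)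
    have i2: "integrable M \<phi>" by (rule integrable_bounded[OF _ B]) measurable
    have "?I = (\<integral>\<omega>. X i \<omega> $ a * (X j \<omega> $ b * \<phi> \<omega>) - cov i j a b * \<phi> \<omega> \<partial>M)" by (simp add: algebra_simps)
    also have "\<dots> = (\<integral>\<omega>. X i \<omega> $ a * (X j \<omega> $ b * \<phi> \<omega>) \<partial>M) - cov i j a b * (\<integral>\<omega>. \<phi> \<omega> \<partial>M)" using i1 i2 by simp
    finally have "?I = \<dots>" .
    moreover have "\<bar>\<integral>\<omega>. X i \<omega> $ a * (X j \<omega> $ b * \<phi> \<omega>) \<partial>M\<bar> \<le> 2 * (K * B) * (w (j - i))\<^sup>2"
    proof (rule mix_one[OF ij'])
      have [measurable]: "(\<lambda>\<omega>. X j \<omega> $ b) \<in> borel_measurable (F j)" "\<phi> \<in> borel_measurable (F j)"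
        using X_comp_meas[of j j] F_mono[OF _ phi, of j] ij by auto
      show "(\<lambda>\<omega>. X j \<omega> $ b * \<phi> \<omega>) \<in> borel_measurable (F j)" by measurable
      show "\<bar>X j \<omega> $ b * \<phi> \<omega>\<bar> \<le> K * B" for \<omega>
        unfolding abs_mult using X_comp_bound B K_nonneg by (intro mult_mono) auto
    qed
    moreover have "\<bar>cov i j a b * (\<integral>\<omega>. \<phi> \<omega> \<partial>M)\<bar> \<le> 2 * K * (w (j - i))\<^sup>2 * B"
      unfolding abs_mult using cov_bound[OF ij', of a b] abs_integral_le[OF i2 B] K_nonneg by (intro mult_mono) auto
    ultimately have "\<bar>?I\<bar> \<le> 4 * B * K * (w (j - i))\<^sup>2" by (simp add: algebra_simps)
    also have "\<dots> \<le> ?L * (w (j - i))\<^sup>2" using B0 by (intro mult_right_mono) (auto simp: algebra_simps)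
    finally have 2: "\<bar>?I\<bar> \<le> ?L * (w (j - i))\<^sup>2" .
    have "\<bar>?I\<bar>\<^sup>2 \<le> (?L * (w (n - j))\<^sup>2) * (?L * (w (j - i))\<^sup>2)"
      unfolding power2_eq_square[of "\<bar>?I\<bar>"] using 1 2 L0 by (intro mult_mono) auto
    also have "\<dots> = (?L * (w (j - i) * w (n - j)))\<^sup>2" by (simp add: power2_eq_square ac_simps)
    finally show ?thesis by (rule power2_le_imp_le) (use L0 w_nonneg in \<open>auto intro!: mult_nonneg_nonneg\<close>)
  qed
qed

definition R :: "nat \<Rightarrow> real \<Rightarrow> nat \<Rightarrow> 'a \<Rightarrow> real ^ 'd" where
  "R N s i \<omega> = s *\<^sub>R (\<Sum>k\<in>{i..<N}. X k \<omega>)"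

lemma R_N: "R N s N \<omega> = 0" by (simp add: R_def)

lemma R_step: "i < N \<Longrightarrow> R N s i \<omega> = R N s (Suc i) \<omega> + s *\<^sub>R X i \<omega>"
  by (simp add: R_def sum.atLeast_Suc_lessThan scaleR_add_right add.commute)

lemma R_meas: "i \<le> j \<Longrightarrow> R N s j \<in> borel_measurable (F i)"
  unfolding R_def[abs_def] by (intro borel_measurable_scaleR borel_measurable_const borel_measurable_sum X_meas_le) auto

lemma R_diff: "i < N \<Longrightarrow> 0 \<le> s \<Longrightarrow> norm (s *\<^sub>R X i \<omega>) \<le> s * K"
  using X_bound[of i \<omega>] by (simp add: mult_left_mono)

lemma C11_R_meas:
  assumes "f \<in> borel_measurable borel" "i \<le> j"
  shows "(\<lambda>\<omega>. f (R N s j \<omega>)) \<in> borel_measurable (F i)"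
  by (rule measurable_compose[OF R_meas[OF assms(2)] assms(1)])

lemma pair_decorrelation:
  fixes A :: "real ^ 'd \<Rightarrow> real"
  assumes lip: "\<And>x v. \<bar>A (x + v) - A x\<bar> \<le> L * norm v" and bd: "\<And>x. \<bar>A x\<bar> \<le> L"
    and ij: "i \<le> j" "j < N" and s: "0 \<le> s"
  shows "\<bar>(\<integral>\<omega>. A (R N s (Suc j) \<omega>) * (X i \<omega> $ a * X j \<omega> $ b) \<partial>M) - (\<integral>\<omega>. A (R N s (Suc j) \<omega>) \<partial>M) * cov i j a b\<bar>
    \<le> 4 * (L * (s * K)) * (K + 1) * w (j - i) * W1"
proof -
  have L0: "0 \<le> L" using bd[of 0] by linarith
  have Am: "A \<in> borel_measurable borel"
    by (rule borel_measurable_continuous_onI[OF lipschitz_continuous_cart[OF lip L0]])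
  have AR: "(\<lambda>\<omega>. A (R N s k \<omega>)) \<in> borel_measurable (F m)" if "m \<le> k" for k m by (rule C11_R_meas[OF Am that])
  have [measurable]: "(\<lambda>\<omega>. A (R N s k \<omega>)) \<in> borel_measurable M" for k by (rule F_M[OF AR[OF order_refl]])
  define Z where "Z \<omega> = X i \<omega> $ a * X j \<omega> $ b - cov i j a b" for \<omega>
  have Zm [measurable]: "Z \<in> borel_measurable M" unfolding Z_def[abs_def] by measurable
  have Zb: "\<bar>Z \<omega>\<bar> \<le> 2 * K\<^sup>2" for \<omega> using XX_bound[of i \<omega> a j b] cov_bound0[of i j a b] by (simp add: Z_def)
  have iXX: "integrable M (\<lambda>\<omega>. X i \<omega> $ a * X j \<omega> $ b)" by (rule integrable_bounded[OF _ XX_bound]) measurable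
  have iA: "integrable M (\<lambda>\<omega>. A (R N s k \<omega>))" for k by (rule integrable_bounded[where C=L]) (use bd in auto)
  have iAX: "integrable M (\<lambda>\<omega>. A (R N s k \<omega>) * (X i \<omega> $ a * X j \<omega> $ b))" for k
    by (rule integrable_bounded[where C="L * K\<^sup>2"]) (use bd XX_bound L0 in \<open>auto simp: abs_mult[of "A _"] intro!: mult_mono\<close>)
  have iAZ: "integrable M (\<lambda>\<omega>. Z \<omega> * A (R N s k \<omega>))" for k
    by (rule integrable_bounded[where C="2 * K\<^sup>2 * L"]) (use bd Zb L0 in \<open>auto simp: abs_mult intro!: mult_mono\<close>)
  have Z0: "(\<integral>\<omega>. Z \<omega> \<partial>M) = 0" unfolding Z_def using iXX by (simp add: cov_def prob_space)
  define f where "f k = (\<integral>\<omega>. Z \<omega> * A (R N s k \<omega>) \<partial>M)" for k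
  have fN: "f N = 0" unfolding f_def R_N using Z0 by simp
  have step: "\<bar>f (Suc k) - f k\<bar> \<le> 4 * (L * (s * K)) * (K + 1) * (w (j - i) * w (k - j))" if k: "j < k" "k < N" for k
  proof -
    have "f (Suc k) - f k = - (\<integral>\<omega>. Z \<omega> * (A (R N s k \<omega>) - A (R N s (Suc k) \<omega>)) \<partial>M)"
      unfolding f_def using iAZ by (simp add: right_diff_distrib)
    also have "\<bar>\<dots>\<bar> \<le> 4 * (L * (s * K)) * (K + 1) * (w (j - i) * w (k - j))"
      unfolding Z_def abs_minus_cancel
    proof (rule mix_two[OF ij(1) k(1)])
      show "(\<lambda>\<omega>. A (R N s k \<omega>) - A (R N s (Suc k) \<omega>)) \<in> borel_measurable (F k)"
        by (intro borel_measurable_diff AR) auto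
      fix \<omega>
      have "\<bar>A (R N s k \<omega>) - A (R N s (Suc k) \<omega>)\<bar> \<le> L * norm (s *\<^sub>R X k \<omega>)" unfolding R_step[OF k(2)] by (rule lip)
      also have "\<dots> \<le> L * (s * K)" using R_diff[OF k(2) s] L0 by (intro mult_left_mono)
      finally show "\<bar>A (R N s k \<omega>) - A (R N s (Suc k) \<omega>)\<bar> \<le> L * (s * K)" .
    qed
    finally show ?thesis .
  qed
  have nn: "0 \<le> 4 * (L * (s * K)) * (K + 1)" using L0 s K_nonneg by simp
  have "f N - f (Suc j) = (\<Sum>k\<in>{Suc j..<N}. f (Suc k) - f k)" using ij by (simp add: sum_Suc_diff')
  also have "\<bar>\<dots>\<bar> \<le> (\<Sum>k\<in>{Suc j..<N}. 4 * (L * (s * K)) * (K + 1) * (w (j - i) * w (k - j)))"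
    by (rule order_trans[OF sum_abs]) (auto intro!: sum_mono step)
  also have "\<dots> = 4 * (L * (s * K)) * (K + 1) * w (j - i) * (\<Sum>k\<in>{Suc j..<N}. w (k - j))"
    by (simp add: sum_distrib_left mult.assoc)
  also have "\<dots> \<le> 4 * (L * (s * K)) * (K + 1) * w (j - i) * W1"
    by (intro mult_left_mono sum_w_le) (use nn w_nonneg in \<open>auto simp: inj_on_def intro!: mult_nonneg_nonneg\<close>)
  finally have "\<bar>f (Suc j)\<bar> \<le> 4 * (L * (s * K)) * (K + 1) * w (j - i) * W1" unfolding fN by simp
  moreover have "f (Suc j) = (\<integral>\<omega>. A (R N s (Suc j) \<omega>) * (X i \<omega> $ a * X j \<omega> $ b) \<partial>M) - (\<integral>\<omega>. A (R N s (Suc j) \<omega>) \<partial>M) * cov i j a b"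
  proof -
    have "f (Suc j) = (\<integral>\<omega>. A (R N s (Suc j) \<omega>) * (X i \<omega> $ a * X j \<omega> $ b) - A (R N s (Suc j) \<omega>) * cov i j a b \<partial>M)"
      unfolding f_def Z_def by (simp add: algebra_simps)
    also have "\<dots> = (\<integral>\<omega>. A (R N s (Suc j) \<omega>) * (X i \<omega> $ a * X j \<omega> $ b) \<partial>M) - (\<integral>\<omega>. A (R N s (Suc j) \<omega>) \<partial>M) * cov i j a b"
      by (subst Bochner_Integration.integral_diff[OF iAX]) (use iA in auto)
    finally show ?thesis .
  qed
  ultimately show ?thesis by simp
qed

definition step_const :: real where
  "step_const = real CARD('d) * (2 * K\<^sup>2 * w 0 * W1 + real CARD('d) * (4 * K * (K + 1) * W1\<^sup>2 + 2 * K\<^sup>2 * W1\<^sup>2))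
     + 2 * (real CARD('d))\<^sup>2 * K * (K + 1) * w 0 * W1 + K ^ 3"

lemma gradient_expansion:
  fixes H :: "real ^ 'd \<Rightarrow> real"
  assumes H: "C3 L H G A" and i: "i < N" and s: "0 \<le> s"
  shows "\<bar>(\<integral>\<omega>. X i \<omega> $ a * G a (R N s (Suc i) \<omega>) \<partial>M)
      - s * (\<Sum>b\<in>UNIV. (\<integral>\<omega>. A a b (R N s (Suc i) \<omega>) \<partial>M) * (\<Sum>k\<in>{Suc i..<N}. cov i k a b))\<bar>
    \<le> s\<^sup>2 * L * (2 * K\<^sup>2 * w 0 * W1 + real CARD('d) * (4 * K * (K + 1) * W1\<^sup>2 + 2 * K\<^sup>2 * W1\<^sup>2))"
proof -
  note GA = C3D(4)[OF H]
  have L0: "0 \<le> L" by (rule C3D(1)[OF H])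
  note Gm = C11_measurable(1)[OF GA] and Am = C11_measurable(2)[OF GA]
  have GR [measurable]: "(\<lambda>\<omega>. G a (R N s k \<omega>)) \<in> borel_measurable M" for k by (rule F_M[OF C11_R_meas[OF Gm order_refl]])
  have AR [measurable]: "(\<lambda>\<omega>. A a b (R N s k \<omega>)) \<in> borel_measurable M" for b k by (rule F_M[OF C11_R_meas[OF Am order_refl]])
  have iXG: "integrable M (\<lambda>\<omega>. X i \<omega> $ a * G a (R N s k \<omega>))" for k
    by (rule integrable_bounded[where C="K * L"])
       (use X_comp_bound C3D(5)[OF H] K_nonneg in \<open>auto simp: abs_mult intro!: mult_mono\<close>)
  have iA: "integrable M (\<lambda>\<omega>. A a b (R N s k \<omega>))" for b k
    by (rule integrable_bounded[where C=L]) (use C11D(4)[OF GA] in auto)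
  have iAX: "integrable M (\<lambda>\<omega>. A a b (R N s k \<omega>) * (X i \<omega> $ a * X l \<omega> $ b))" for b k l
    by (rule integrable_bounded[where C="L * K\<^sup>2"]) (use C11D(4)[OF GA] XX_bound L0 in \<open>auto simp: abs_mult[of "A _ _ _"] intro!: mult_mono\<close>)
  define f where "f k = (\<integral>\<omega>. X i \<omega> $ a * G a (R N s k \<omega>) \<partial>M)" for k
  define p where "p k b = (\<integral>\<omega>. A a b (R N s (Suc k) \<omega>) * (X i \<omega> $ a * X k \<omega> $ b) \<partial>M)" for k b
  define \<alpha> where "\<alpha> k b = (\<integral>\<omega>. A a b (R N s (Suc k) \<omega>) \<partial>M)" for k b
  have fN: "f N = 0" unfolding f_def R_N using X_mean[of i a] by simp
  have one: "\<bar>(f k - f (Suc k)) - s * (\<Sum>b\<in>UNIV. \<alpha> i b * cov i k a b)\<bar>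
    \<le> s\<^sup>2 * L * (2 * K\<^sup>2 * w 0 + real CARD('d) * (4 * K * (K + 1) * W1 + 2 * K\<^sup>2 * W1)) * w (k - i)"
    if k: "i < k" "k < N" for k
  proof -
    let ?l = "k - i"
    define \<phi> where "\<phi> \<omega> = G a (R N s k \<omega>) - G a (R N s (Suc k) \<omega>) - (\<Sum>b\<in>UNIV. A a b (R N s (Suc k) \<omega>) * (s *\<^sub>R X k \<omega>) $ b)" for \<omega>
    have phi_b: "\<bar>\<phi> \<omega>\<bar> \<le> L * (s * K)\<^sup>2" for \<omega>
    proof -
      have "\<bar>\<phi> \<omega>\<bar> \<le> L * (norm (s *\<^sub>R X k \<omega>))\<^sup>2" unfolding \<phi>_def R_step[OF k(2)] by (rule C11D(3)[OF GA])
      also have "\<dots> \<le> L * (s * K)\<^sup>2" using R_diff[OF k(2) s] L0 by (intro mult_left_mono power_mono) auto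
      finally show ?thesis .
    qed
    have phi_m: "\<phi> \<in> borel_measurable (F k)"
    proof -
      have "(\<lambda>\<omega>. (s *\<^sub>R X k \<omega>) $ b) \<in> borel_measurable (F k)" for b
        using borel_measurable_times[OF borel_measurable_const[of s] X_comp_meas[OF order_refl, of k b]] by simp
      then show ?thesis unfolding \<phi>_def[abs_def]
        by (intro borel_measurable_diff borel_measurable_sum borel_measurable_times C11_R_meas[OF Gm] C11_R_meas[OF Am]) auto
    qed
    have [measurable]: "\<phi> \<in> borel_measurable M" by (rule F_M[OF phi_m])
    have wl: "(w ?l)\<^sup>2 \<le> w 0 * w ?l" unfolding power2_eq_square using w_le w_nonneg by (rule mult_right_mono)
    have "\<bar>\<integral>\<omega>. X i \<omega> $ a * \<phi> \<omega> \<partial>M\<bar> \<le> 2 * (L * (s * K)\<^sup>2) * (w ?l)\<^sup>2"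
      by (rule mix_one[OF k(1) phi_m phi_b])
    also have "\<dots> \<le> 2 * (L * (s * K)\<^sup>2) * (w 0 * w ?l)" by (rule mult_left_mono[OF wl]) (use L0 in simp)
    also have "\<dots> = s\<^sup>2 * L * (2 * K\<^sup>2 * w 0) * w ?l" by (simp add: power_mult_distrib)
    finally have 1: "\<bar>\<integral>\<omega>. X i \<omega> $ a * \<phi> \<omega> \<partial>M\<bar> \<le> s\<^sup>2 * L * (2 * K\<^sup>2 * w 0) * w ?l" .
    have i\<phi>: "integrable M (\<lambda>\<omega>. X i \<omega> $ a * \<phi> \<omega>)"
      by (rule integrable_bounded[where C="K * (L * (s * K)\<^sup>2)"])
         (use X_comp_bound phi_b K_nonneg in \<open>auto simp: abs_mult intro!: mult_mono\<close>)
    have "f k - f (Suc k) = (\<integral>\<omega>. X i \<omega> $ a * \<phi> \<omega> + (\<Sum>b\<in>UNIV. s * (A a b (R N s (Suc k) \<omega>) * (X i \<omega> $ a * X k \<omega> $ b))) \<partial>M)"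
    proof -
      have "X i \<omega> $ a * G a (R N s k \<omega>) - X i \<omega> $ a * G a (R N s (Suc k) \<omega>)
        = X i \<omega> $ a * \<phi> \<omega> + (\<Sum>b\<in>UNIV. s * (A a b (R N s (Suc k) \<omega>) * (X i \<omega> $ a * X k \<omega> $ b)))" for \<omega>
        by (simp add: \<phi>_def right_diff_distrib sum_distrib_left ac_simps)
      then show ?thesis unfolding f_def using iXG by (subst Bochner_Integration.integral_diff[symmetric]) auto
    qed
    also have "\<dots> = (\<integral>\<omega>. X i \<omega> $ a * \<phi> \<omega> \<partial>M) + (\<Sum>b\<in>UNIV. s * p k b)"
      unfolding p_def using i\<phi> iAX by simp
    finally have 2: "f k - f (Suc k) = (\<integral>\<omega>. X i \<omega> $ a * \<phi> \<omega> \<partial>M) + (\<Sum>b\<in>UNIV. s * p k b)" .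
    have pk: "\<bar>p k b - \<alpha> i b * cov i k a b\<bar> \<le> s * L * (4 * K * (K + 1) * W1 + 2 * K\<^sup>2 * W1) * w ?l" for b
    proof -
      have m1: "\<bar>p k b - \<alpha> k b * cov i k a b\<bar> \<le> 4 * (L * (s * K)) * (K + 1) * w ?l * W1"
        unfolding p_def \<alpha>_def by (rule pair_decorrelation[OF C11D(5)[OF GA] C11D(4)[OF GA] _ k(2) s]) (use k in simp)
      have "\<bar>\<alpha> k b - \<alpha> i b\<bar> \<le> L * (s * K * real ?l)"
      proof -
        have "\<alpha> k b - \<alpha> i b = (\<integral>\<omega>. A a b (R N s (Suc k) \<omega>) - A a b (R N s (Suc i) \<omega>) \<partial>M)" unfolding \<alpha>_def using iA by simp
        also have "\<bar>\<dots>\<bar> \<le> L * (s * K * real ?l)"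
        proof (rule abs_integral_le)
          fix \<omega>
          have "{Suc i..<N} = {Suc i..<Suc k} \<union> {Suc k..<N}" using k by auto
          then have e: "R N s (Suc i) \<omega> = R N s (Suc k) \<omega> + s *\<^sub>R (\<Sum>j\<in>{Suc i..<Suc k}. X j \<omega>)"
            unfolding R_def by (simp add: sum.union_disjoint scaleR_add_right add.commute del: sum.op_ivl_Suc)
          have "norm (\<Sum>j\<in>{Suc i..<Suc k}. X j \<omega>) \<le> (\<Sum>j\<in>{Suc i..<Suc k}. K)"
            by (rule order_trans[OF norm_sum]) (intro sum_mono X_bound)
          also have "\<dots> = K * real ?l" using k by simp
          finally have "norm (s *\<^sub>R (\<Sum>j\<in>{Suc i..<Suc k}. X j \<omega>)) \<le> s * (K * real ?l)" using s by (simp add: mult_left_mono)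
          then have "L * norm (s *\<^sub>R (\<Sum>j\<in>{Suc i..<Suc k}. X j \<omega>)) \<le> L * (s * (K * real ?l))" using L0 by (rule mult_left_mono)
          moreover have "\<bar>A a b (R N s (Suc i) \<omega>) - A a b (R N s (Suc k) \<omega>)\<bar> \<le> L * norm (s *\<^sub>R (\<Sum>j\<in>{Suc i..<Suc k}. X j \<omega>))"
            unfolding e by (rule C11D(5)[OF GA])
          ultimately show "\<bar>A a b (R N s (Suc k) \<omega>) - A a b (R N s (Suc i) \<omega>)\<bar> \<le> L * (s * K * real ?l)"
            by (simp add: abs_minus_commute mult.assoc)
        qed (use iA in auto)
        finally show ?thesis .
      qed
      then have "\<bar>\<alpha> k b - \<alpha> i b\<bar> * \<bar>cov i k a b\<bar> \<le> L * (s * K * real ?l) * (2 * K * (w ?l)\<^sup>2)"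
        by (rule mult_mono[OF _ cov_bound[OF k(1)]]) (use L0 s K_nonneg in auto)
      then have "\<bar>\<alpha> k b * cov i k a b - \<alpha> i b * cov i k a b\<bar> \<le> L * (s * K * real ?l) * (2 * K * (w ?l)\<^sup>2)"
        by (simp only: left_diff_distrib[symmetric] abs_mult)
      also have "\<dots> = L * s * (2 * K\<^sup>2) * (real ?l * (w ?l)\<^sup>2)" by (simp add: power2_eq_square)
      also have "\<dots> \<le> L * s * (2 * K\<^sup>2) * (W1 * w ?l)"
        using L0 s by (intro mult_left_mono w2_le) auto
      finally have m2: "\<bar>\<alpha> k b * cov i k a b - \<alpha> i b * cov i k a b\<bar> \<le> L * s * (2 * K\<^sup>2) * (W1 * w ?l)" .
      have "s * L * (4 * K * (K + 1) * W1 + 2 * K\<^sup>2 * W1) * w ?l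
        = 4 * (L * (s * K)) * (K + 1) * w ?l * W1 + L * s * (2 * K\<^sup>2) * (W1 * w ?l)" by (simp add: algebra_simps)
      then show ?thesis using m1 m2 by linarith
    qed
    have "\<bar>(\<Sum>b\<in>UNIV. s * p k b) - s * (\<Sum>b\<in>UNIV. \<alpha> i b * cov i k a b)\<bar> = s * \<bar>\<Sum>b\<in>UNIV. p k b - \<alpha> i b * cov i k a b\<bar>"
      using s by (simp add: sum_distrib_left[symmetric] sum_subtractf abs_mult flip: right_diff_distrib)
    also have "\<dots> \<le> s * (\<Sum>b\<in>(UNIV :: 'd set). s * L * (4 * K * (K + 1) * W1 + 2 * K\<^sup>2 * W1) * w ?l)"
      using s by (intro mult_left_mono order_trans[OF sum_abs] sum_mono pk) auto
    also have "\<dots> = s\<^sup>2 * L * (real CARD('d) * (4 * K * (K + 1) * W1 + 2 * K\<^sup>2 * W1)) * w ?l"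
      by (simp add: power2_eq_square)
    finally have 3: "\<bar>(\<Sum>b\<in>UNIV. s * p k b) - s * (\<Sum>b\<in>UNIV. \<alpha> i b * cov i k a b)\<bar>
      \<le> s\<^sup>2 * L * (real CARD('d) * (4 * K * (K + 1) * W1 + 2 * K\<^sup>2 * W1)) * w ?l" .
    have "s\<^sup>2 * L * (2 * K\<^sup>2 * w 0 + real CARD('d) * (4 * K * (K + 1) * W1 + 2 * K\<^sup>2 * W1)) * w ?l
      = s\<^sup>2 * L * (2 * K\<^sup>2 * w 0) * w ?l + s\<^sup>2 * L * (real CARD('d) * (4 * K * (K + 1) * W1 + 2 * K\<^sup>2 * W1)) * w ?l"
      by (simp add: distrib_left distrib_right)
    then show ?thesis using 1 2 3 by linarith
  qed
  let ?C = "s\<^sup>2 * L * (2 * K\<^sup>2 * w 0 + real CARD('d) * (4 * K * (K + 1) * W1 + 2 * K\<^sup>2 * W1))"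
  have C0: "0 \<le> ?C" using L0 K_nonneg W1_nonneg w_nonneg[of 0] by (intro mult_nonneg_nonneg add_nonneg_nonneg) auto
  have tel: "f (Suc i) = (\<Sum>k\<in>{Suc i..<N}. f k - f (Suc k))"
  proof -
    have "f N - f (Suc i) = (\<Sum>k\<in>{Suc i..<N}. f (Suc k) - f k)" using i by (simp add: sum_Suc_diff')
    then show ?thesis unfolding fN by (simp add: sum_subtractf)
  qed
  have "s * (\<Sum>b\<in>UNIV. \<alpha> i b * (\<Sum>k\<in>{Suc i..<N}. cov i k a b)) = (\<Sum>k\<in>{Suc i..<N}. s * (\<Sum>b\<in>UNIV. \<alpha> i b * cov i k a b))"
    unfolding sum_distrib_left by (rule sum.swap)
  then have "\<bar>f (Suc i) - s * (\<Sum>b\<in>UNIV. \<alpha> i b * (\<Sum>k\<in>{Suc i..<N}. cov i k a b))\<bar>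
    = \<bar>\<Sum>k\<in>{Suc i..<N}. (f k - f (Suc k)) - s * (\<Sum>b\<in>UNIV. \<alpha> i b * cov i k a b)\<bar>"
    unfolding tel by (simp add: sum_subtractf)
  also have "\<dots> \<le> (\<Sum>k\<in>{Suc i..<N}. ?C * w (k - i))"
    by (rule order_trans[OF sum_abs]) (intro sum_mono one, auto)
  also have "\<dots> = ?C * (\<Sum>k\<in>{Suc i..<N}. w (k - i))" by (rule sum_distrib_left[symmetric])
  also have "\<dots> \<le> ?C * W1" by (intro mult_left_mono[OF _ C0] sum_w_le) (auto simp: inj_on_def)
  also have "\<dots> = s\<^sup>2 * L * (2 * K\<^sup>2 * w 0 * W1 + real CARD('d) * (4 * K * (K + 1) * W1\<^sup>2 + 2 * K\<^sup>2 * W1\<^sup>2))"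
    by (simp add: power2_eq_square algebra_simps)
  finally show ?thesis by (simp only: f_def \<alpha>_def)
qed

lemma step_expansion:
  fixes H :: "real ^ 'd \<Rightarrow> real"
  assumes H: "C3 L H G A" and i: "i < N" and s: "0 \<le> s"
  shows "\<bar>(\<integral>\<omega>. H (R N s i \<omega>) \<partial>M) - (\<integral>\<omega>. H (R N s (Suc i) \<omega>) \<partial>M)
      - s\<^sup>2 / 2 * (\<Sum>a\<in>UNIV. \<Sum>b\<in>UNIV. (\<integral>\<omega>. A a b (R N s (Suc i) \<omega>) \<partial>M) * (cov i i a b + 2 * (\<Sum>k\<in>{Suc i..<N}. cov i k a b)))\<bar>
    \<le> s ^ 3 * L * step_const"
proof -
  note GA = C3D(4)[OF H]
  have L0: "0 \<le> L" by (rule C3D(1)[OF H])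
  have Hm: "H \<in> borel_measurable borel" by (rule C11_measurable[OF C3_C11[OF H]])
  note Gm = C11_measurable(1)[OF GA] and Am = C11_measurable(2)[OF GA]
  have HR [measurable]: "(\<lambda>\<omega>. H (R N s k \<omega>)) \<in> borel_measurable M" for k by (rule F_M[OF C11_R_meas[OF Hm order_refl]])
  have GR [measurable]: "(\<lambda>\<omega>. G a (R N s k \<omega>)) \<in> borel_measurable M" for a k by (rule F_M[OF C11_R_meas[OF Gm order_refl]])
  have AR [measurable]: "(\<lambda>\<omega>. A a b (R N s k \<omega>)) \<in> borel_measurable M" for a b k by (rule F_M[OF C11_R_meas[OF Am order_refl]])
  have Rb: "norm (R N s k \<omega>) \<le> s * (K * real N)" for k \<omega>
  proof -
    have "norm (\<Sum>j\<in>{k..<N}. X j \<omega>) \<le> (\<Sum>j\<in>{k..<N}. K)" by (rule order_trans[OF norm_sum]) (intro sum_mono X_bound)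
    also have "\<dots> \<le> K * real N" using K_nonneg mult_left_mono[of "real (N - k)" "real N" K] by (simp add: mult.commute)
    finally show ?thesis using s by (simp add: R_def mult_left_mono)
  qed
  have iH: "integrable M (\<lambda>\<omega>. H (R N s k \<omega>))" for k
  proof (rule integrable_bounded[where C="\<bar>H 0\<bar> + L * (s * (K * real N))"])
    show "\<bar>H (R N s k \<omega>)\<bar> \<le> \<bar>H 0\<bar> + L * (s * (K * real N))" for \<omega>
      using C3D(2)[OF H, of 0 "R N s k \<omega>"] mult_left_mono[OF Rb[of k \<omega>] L0] by simp
  qed measurable
  have iXG: "integrable M (\<lambda>\<omega>. X i \<omega> $ a * G a (R N s k \<omega>))" for a k
    by (rule integrable_bounded[where C="K * L"])
       (use X_comp_bound C3D(5)[OF H] K_nonneg in \<open>auto simp: abs_mult intro!: mult_mono\<close>)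
  have iAX: "integrable M (\<lambda>\<omega>. A a b (R N s k \<omega>) * (X i \<omega> $ a * X i \<omega> $ b))" for a b k
    by (rule integrable_bounded[where C="L * K\<^sup>2"]) (use C11D(4)[OF GA] XX_bound L0 in \<open>auto simp: abs_mult[of "A _ _ _"] intro!: mult_mono\<close>)
  let ?R = "R N s (Suc i)" and ?d = "real CARD('d)"
  define g where "g a = (\<integral>\<omega>. X i \<omega> $ a * G a (?R \<omega>) \<partial>M)" for a
  define e where "e a b = (\<integral>\<omega>. A a b (?R \<omega>) * (X i \<omega> $ a * X i \<omega> $ b) \<partial>M)" for a b
  define \<alpha> where "\<alpha> a b = (\<integral>\<omega>. A a b (?R \<omega>) \<partial>M)" for a b
  define Cg where "Cg = 2 * K\<^sup>2 * w 0 * W1 + ?d * (4 * K * (K + 1) * W1\<^sup>2 + 2 * K\<^sup>2 * W1\<^sup>2)"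
  define Ce where "Ce = 4 * K * (K + 1) * w 0 * W1"
  have ae: "\<bar>e a b - \<alpha> a b * cov i i a b\<bar> \<le> s * L * Ce" for a b
  proof -
    have "\<bar>e a b - \<alpha> a b * cov i i a b\<bar> \<le> 4 * (L * (s * K)) * (K + 1) * w (i - i) * W1"
      unfolding e_def \<alpha>_def by (rule pair_decorrelation[OF C11D(5)[OF GA] C11D(4)[OF GA] order_refl i s])
    also have "\<dots> = s * L * Ce" by (simp add: Ce_def)
    finally show ?thesis .
  qed
  have ag: "\<bar>g a - s * (\<Sum>b\<in>UNIV. \<alpha> a b * (\<Sum>k\<in>{Suc i..<N}. cov i k a b))\<bar> \<le> s\<^sup>2 * L * Cg" for a
    unfolding g_def \<alpha>_def Cg_def by (rule gradient_expansion[OF H i s])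
  have main: "\<bar>(\<integral>\<omega>. H (R N s i \<omega>) \<partial>M) - (\<integral>\<omega>. H (?R \<omega>) \<partial>M) - s * (\<Sum>a\<in>UNIV. g a) - s\<^sup>2 / 2 * (\<Sum>a\<in>UNIV. \<Sum>b\<in>UNIV. e a b)\<bar> \<le> L * (s * K) ^ 3"
  proof -
    have "(\<integral>\<omega>. H (R N s i \<omega>) \<partial>M) - (\<integral>\<omega>. H (?R \<omega>) \<partial>M) - s * (\<Sum>a\<in>UNIV. g a) - s\<^sup>2 / 2 * (\<Sum>a\<in>UNIV. \<Sum>b\<in>UNIV. e a b)
      = (\<integral>\<omega>. H (R N s i \<omega>) - H (?R \<omega>) - s * (\<Sum>a\<in>UNIV. X i \<omega> $ a * G a (?R \<omega>)) - s\<^sup>2 / 2 * (\<Sum>a\<in>UNIV. \<Sum>b\<in>UNIV. A a b (?R \<omega>) * (X i \<omega> $ a * X i \<omega> $ b)) \<partial>M)"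
      unfolding g_def e_def using iH iXG iAX by simp
    also have "\<bar>\<dots>\<bar> \<le> L * (s * K) ^ 3"
    proof (rule abs_integral_le)
      fix \<omega>
      have "s * (\<Sum>a\<in>UNIV. X i \<omega> $ a * G a (?R \<omega>)) = (\<Sum>a\<in>UNIV. G a (?R \<omega>) * (s *\<^sub>R X i \<omega>) $ a)"
        by (simp add: sum_distrib_left ac_simps)
      moreover have "s\<^sup>2 / 2 * (\<Sum>a\<in>UNIV. \<Sum>b\<in>UNIV. A a b (?R \<omega>) * (X i \<omega> $ a * X i \<omega> $ b))
        = (\<Sum>a\<in>UNIV. \<Sum>b\<in>UNIV. A a b (?R \<omega>) * ((s *\<^sub>R X i \<omega>) $ a * (s *\<^sub>R X i \<omega>) $ b)) / 2"
        by (simp add: sum_distrib_left sum_divide_distrib power2_eq_square ac_simps)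
      moreover have "L * norm (s *\<^sub>R X i \<omega>) ^ 3 \<le> L * (s * K) ^ 3"
        using R_diff[OF i s] L0 by (intro mult_left_mono power_mono) auto
      ultimately show "\<bar>H (R N s i \<omega>) - H (?R \<omega>) - s * (\<Sum>a\<in>UNIV. X i \<omega> $ a * G a (?R \<omega>)) - s\<^sup>2 / 2 * (\<Sum>a\<in>UNIV. \<Sum>b\<in>UNIV. A a b (?R \<omega>) * (X i \<omega> $ a * X i \<omega> $ b))\<bar> \<le> L * (s * K) ^ 3"
        unfolding R_step[OF i] using C3D(3)[OF H, of "?R \<omega>" "s *\<^sub>R X i \<omega>"] by linarith
    qed (use iH iXG iAX in auto)
    finally show ?thesis .
  qed
  have 1: "\<bar>s * (\<Sum>a\<in>UNIV. g a) - s * (\<Sum>a\<in>UNIV. s * (\<Sum>b\<in>UNIV. \<alpha> a b * (\<Sum>k\<in>{Suc i..<N}. cov i k a b)))\<bar> \<le> s * (?d * (s\<^sup>2 * L * Cg))"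
  proof -
    have "\<bar>s * (\<Sum>a\<in>UNIV. g a) - s * (\<Sum>a\<in>UNIV. s * (\<Sum>b\<in>UNIV. \<alpha> a b * (\<Sum>k\<in>{Suc i..<N}. cov i k a b)))\<bar>
      = s * \<bar>\<Sum>a\<in>UNIV. g a - s * (\<Sum>b\<in>UNIV. \<alpha> a b * (\<Sum>k\<in>{Suc i..<N}. cov i k a b))\<bar>"
      unfolding right_diff_distrib[symmetric] sum_subtractf[symmetric] abs_mult using s by simp
    also have "\<dots> \<le> s * (\<Sum>a\<in>(UNIV :: 'd set). s\<^sup>2 * L * Cg)"
      using s by (intro mult_left_mono order_trans[OF sum_abs] sum_mono ag) auto
    finally show ?thesis by simp
  qed
  have 2: "\<bar>s\<^sup>2 / 2 * (\<Sum>a\<in>UNIV. \<Sum>b\<in>UNIV. e a b) - s\<^sup>2 / 2 * (\<Sum>a\<in>UNIV. \<Sum>b\<in>UNIV. \<alpha> a b * cov i i a b)\<bar> \<le> s\<^sup>2 / 2 * (?d\<^sup>2 * (s * L * Ce))"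
  proof -
    have "\<bar>s\<^sup>2 / 2 * (\<Sum>a\<in>UNIV. \<Sum>b\<in>UNIV. e a b) - s\<^sup>2 / 2 * (\<Sum>a\<in>UNIV. \<Sum>b\<in>UNIV. \<alpha> a b * cov i i a b)\<bar>
      = s\<^sup>2 / 2 * \<bar>\<Sum>a\<in>UNIV. \<Sum>b\<in>UNIV. e a b - \<alpha> a b * cov i i a b\<bar>"
      unfolding right_diff_distrib[symmetric] sum_subtractf[symmetric] abs_mult by simp
    also have "\<dots> \<le> s\<^sup>2 / 2 * (\<Sum>a\<in>(UNIV :: 'd set). \<Sum>b\<in>(UNIV :: 'd set). s * L * Ce)"
      by (intro mult_left_mono order_trans[OF sum_abs] sum_mono ae) auto
    finally show ?thesis by (simp add: power2_eq_square)
  qed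
  have split: "s\<^sup>2 / 2 * (\<Sum>a\<in>UNIV. \<Sum>b\<in>UNIV. \<alpha> a b * (cov i i a b + 2 * (\<Sum>k\<in>{Suc i..<N}. cov i k a b)))
    = s\<^sup>2 / 2 * (\<Sum>a\<in>UNIV. \<Sum>b\<in>UNIV. \<alpha> a b * cov i i a b) + s * (\<Sum>a\<in>UNIV. s * (\<Sum>b\<in>UNIV. \<alpha> a b * (\<Sum>k\<in>{Suc i..<N}. cov i k a b)))"
  proof -
    have "(\<Sum>a\<in>UNIV. \<Sum>b\<in>UNIV. \<alpha> a b * (cov i i a b + 2 * (\<Sum>k\<in>{Suc i..<N}. cov i k a b)))
      = (\<Sum>a\<in>UNIV. \<Sum>b\<in>UNIV. \<alpha> a b * cov i i a b) + 2 * (\<Sum>a\<in>UNIV. \<Sum>b\<in>UNIV. \<alpha> a b * (\<Sum>k\<in>{Suc i..<N}. cov i k a b))"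
      by (simp add: distrib_left sum.distrib mult.left_commute[of _ 2] flip: sum_distrib_left)
    moreover have "s * (\<Sum>a\<in>UNIV. s * (\<Sum>b\<in>UNIV. \<alpha> a b * (\<Sum>k\<in>{Suc i..<N}. cov i k a b)))
      = s\<^sup>2 * (\<Sum>a\<in>UNIV. \<Sum>b\<in>UNIV. \<alpha> a b * (\<Sum>k\<in>{Suc i..<N}. cov i k a b))"
      unfolding sum_distrib_left[of s, symmetric] by (simp add: power2_eq_square)
    ultimately show ?thesis by (simp add: distrib_left)
  qed
  have "s ^ 3 * L * step_const = s * (?d * (s\<^sup>2 * L * Cg)) + s\<^sup>2 / 2 * (?d\<^sup>2 * (s * L * Ce)) + L * (s * K) ^ 3"
    unfolding step_const_def Cg_def[symmetric] Ce_def
    by (simp add: power_mult_distrib distrib_left distrib_right power2_eq_square power3_eq_cube ac_simps)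
  then show ?thesis using main 1 2 split unfolding \<alpha>_def[symmetric] by linarith
qed

section \<open>Reverse martingale differences\<close>

definition cexp :: "nat \<Rightarrow> nat \<Rightarrow> 'd \<Rightarrow> 'a \<Rightarrow> real" where
  "cexp j n a = (SOME u. u \<in> borel_measurable (F n) \<and> (\<forall>\<omega>. \<bar>u \<omega>\<bar> \<le> K)
    \<and> (\<forall>\<phi>\<in>borel_measurable (F n). \<forall>B. (\<forall>\<omega>. \<bar>\<phi> \<omega>\<bar> \<le> B) \<longrightarrow> (\<integral>\<omega>. X j \<omega> $ a * \<phi> \<omega> \<partial>M) = (\<integral>\<omega>. u \<omega> * \<phi> \<omega> \<partial>M)))"

lemma cexp:
  shows cexp_meas: "cexp j n a \<in> borel_measurable (F n)"
    and cexp_bound: "\<bar>cexp j n a \<omega>\<bar> \<le> K"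
    and cexp_integral: "\<phi> \<in> borel_measurable (F n) \<Longrightarrow> (\<And>\<omega>. \<bar>\<phi> \<omega>\<bar> \<le> B) \<Longrightarrow>
      (\<integral>\<omega>. X j \<omega> $ a * \<phi> \<omega> \<partial>M) = (\<integral>\<omega>. cexp j n a \<omega> * \<phi> \<omega> \<partial>M)"
proof -
  have "\<exists>u. u \<in> borel_measurable (F n) \<and> (\<forall>\<omega>. \<bar>u \<omega>\<bar> \<le> K)
    \<and> (\<forall>\<phi>\<in>borel_measurable (F n). \<forall>B. (\<forall>\<omega>. \<bar>\<phi> \<omega>\<bar> \<le> B) \<longrightarrow> (\<integral>\<omega>. X j \<omega> $ a * \<phi> \<omega> \<partial>M) = (\<integral>\<omega>. u \<omega> * \<phi> \<omega> \<partial>M))"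
    by (rule bounded_cond_exp[OF X_comp_M X_comp_bound, unfolded Bex_def])
  from someI_ex[OF this, folded cexp_def]
  show "cexp j n a \<in> borel_measurable (F n)" "\<bar>cexp j n a \<omega>\<bar> \<le> K"
    "\<phi> \<in> borel_measurable (F n) \<Longrightarrow> (\<And>\<omega>. \<bar>\<phi> \<omega>\<bar> \<le> B) \<Longrightarrow>
      (\<integral>\<omega>. X j \<omega> $ a * \<phi> \<omega> \<partial>M) = (\<integral>\<omega>. cexp j n a \<omega> * \<phi> \<omega> \<partial>M)" by blast+
qed

lemma cexp_M [measurable]: "cexp j n a \<in> borel_measurable M" by (rule F_M[OF cexp_meas])

definition Y :: "nat \<Rightarrow> 'd \<Rightarrow> 'a \<Rightarrow> real" where
  "Y i a \<omega> = (\<Sum>j<i. cexp j i a \<omega>)"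

definition q :: "nat \<Rightarrow> 'd \<Rightarrow> 'd \<Rightarrow> real" where
  "q i a b = (\<integral>\<omega>. Y i a \<omega> * Y i b \<omega> \<partial>M)"

text \<open>\<open>D i\<close> has vanishing conditional expectation given \<open>F (Suc i)\<close>, so the \<open>V i\<close> add up to the covariance
  of the sum except for a boundary term \<open>q\<close>.\<close>

definition D :: "nat \<Rightarrow> 'd \<Rightarrow> 'a \<Rightarrow> real" where
  "D i a \<omega> = X i \<omega> $ a + Y i a \<omega> - Y (Suc i) a \<omega>"

definition V :: "nat \<Rightarrow> 'd \<Rightarrow> 'd \<Rightarrow> real" where
  "V i a b = (\<integral>\<omega>. D i a \<omega> * D i b \<omega> \<partial>M)"

lemma Y_meas: "Y i a \<in> borel_measurable (F i)"
  unfolding Y_def[abs_def] by (intro borel_measurable_sum cexp_meas)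

lemma Y_M [measurable]: "Y i a \<in> borel_measurable M" by (rule F_M[OF Y_meas])

lemma Y_bound: "\<bar>Y i a \<omega>\<bar> \<le> real i * K"
proof -
  have "\<bar>Y i a \<omega>\<bar> \<le> (\<Sum>j<i. K)" unfolding Y_def by (rule order_trans[OF sum_abs]) (intro sum_mono cexp_bound)
  then show ?thesis by simp
qed

lemma Y_integral:
  assumes phi: "\<phi> \<in> borel_measurable (F i)" and B: "\<And>\<omega>. \<bar>\<phi> \<omega>\<bar> \<le> B"
  shows "(\<integral>\<omega>. Y i a \<omega> * \<phi> \<omega> \<partial>M) = (\<Sum>j<i. \<integral>\<omega>. X j \<omega> $ a * \<phi> \<omega> \<partial>M)"
proof -
  have [measurable]: "\<phi> \<in> borel_measurable M" by (rule F_M[OF phi])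
  have i: "integrable M (\<lambda>\<omega>. cexp j i a \<omega> * \<phi> \<omega>)" for j
    by (rule integrable_bounded[where C="K * B"]) (use cexp_bound B K_nonneg in \<open>auto simp: abs_mult intro!: mult_mono\<close>)
  have "(\<integral>\<omega>. Y i a \<omega> * \<phi> \<omega> \<partial>M) = (\<Sum>j<i. \<integral>\<omega>. cexp j i a \<omega> * \<phi> \<omega> \<partial>M)"
    unfolding Y_def sum_distrib_right by (rule Bochner_Integration.integral_sum) (rule i)
  also have "\<dots> = (\<Sum>j<i. \<integral>\<omega>. X j \<omega> $ a * \<phi> \<omega> \<partial>M)"
    by (intro sum.cong refl cexp_integral[symmetric, OF phi B])
  finally show ?thesis .
qed

lemma XY_integral: "(\<integral>\<omega>. Y i a \<omega> * X i \<omega> $ b \<partial>M) = (\<Sum>j<i. cov j i a b)"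
  unfolding cov_def by (rule Y_integral[OF X_comp_meas[OF order_refl] X_comp_bound])

lemma Z_integral:
  assumes phi: "\<phi> \<in> borel_measurable (F (Suc i))" and B: "\<And>\<omega>. \<bar>\<phi> \<omega>\<bar> \<le> B"
  shows "(\<integral>\<omega>. (X i \<omega> $ a + Y i a \<omega>) * \<phi> \<omega> \<partial>M) = (\<integral>\<omega>. Y (Suc i) a \<omega> * \<phi> \<omega> \<partial>M)"
proof -
  have phi': "\<phi> \<in> borel_measurable (F i)" by (rule F_mono[OF _ phi]) simp
  have [measurable]: "\<phi> \<in> borel_measurable M" by (rule F_M[OF phi])
  have i1: "integrable M (\<lambda>\<omega>. X i \<omega> $ a * \<phi> \<omega>)"
    by (rule integrable_bounded[where C="K * B"]) (use X_comp_bound B K_nonneg in \<open>auto simp: abs_mult intro!: mult_mono\<close>)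
  have i2: "integrable M (\<lambda>\<omega>. Y i a \<omega> * \<phi> \<omega>)"
    by (rule integrable_bounded[where C="real i * K * B"]) (use Y_bound B K_nonneg in \<open>auto simp: abs_mult intro!: mult_mono\<close>)
  have "(\<integral>\<omega>. (X i \<omega> $ a + Y i a \<omega>) * \<phi> \<omega> \<partial>M) = (\<integral>\<omega>. X i \<omega> $ a * \<phi> \<omega> \<partial>M) + (\<integral>\<omega>. Y i a \<omega> * \<phi> \<omega> \<partial>M)"
    unfolding distrib_right by (rule Bochner_Integration.integral_add[OF i1 i2])
  then show ?thesis using Y_integral[OF phi' B, of a] Y_integral[OF phi B, of a] by simp
qed

lemma V_eq: "V i a b = cov i i a b + (\<Sum>j<i. cov j i a b + cov j i b a) + q i a b - q (Suc i) a b"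
proof -
  define Z where "Z a \<omega> = X i \<omega> $ a + Y i a \<omega>" for a \<omega>
  define y where "y = Y (Suc i)"
  have Zb: "\<bar>Z a \<omega>\<bar> \<le> K + real i * K" for a \<omega>
    unfolding Z_def using X_comp_bound[of i \<omega> a] Y_bound[of i a \<omega>] by linarith
  have yb: "\<bar>y a \<omega>\<bar> \<le> real (Suc i) * K" for a \<omega> unfolding y_def by (rule Y_bound)
  have [measurable]: "Z a \<in> borel_measurable M" "y a \<in> borel_measurable M" for a
    unfolding Z_def[abs_def] y_def by measurable
  have prod_int: "integrable M (\<lambda>\<omega>. u \<omega> * v \<omega>)"
    if "u \<in> borel_measurable M" "v \<in> borel_measurable M" "\<And>\<omega>. \<bar>u \<omega>\<bar> \<le> B" "\<And>\<omega>. \<bar>v \<omega>\<bar> \<le> C"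
    for u v :: "'a \<Rightarrow> real" and B C
  proof (rule integrable_bounded[where C="B * C"])
    have "0 \<le> B" using that(3)[of undefined] by linarith
    then show "\<bar>u \<omega> * v \<omega>\<bar> \<le> B * C" for \<omega> unfolding abs_mult using that(3,4) by (intro mult_mono) auto
  qed (use that in measurable)
  have iZZ: "integrable M (\<lambda>\<omega>. Z a \<omega> * Z b \<omega>)" and iZy: "integrable M (\<lambda>\<omega>. Z a \<omega> * y b \<omega>)"
    and iyZ: "integrable M (\<lambda>\<omega>. y a \<omega> * Z b \<omega>)" and iyy: "integrable M (\<lambda>\<omega>. y a \<omega> * y b \<omega>)" for a b
    by (rule prod_int[OF _ _ Zb Zb] prod_int[OF _ _ Zb yb] prod_int[OF _ _ yb Zb] prod_int[OF _ _ yb yb]; measurable)+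
  have Zy: "(\<integral>\<omega>. Z a \<omega> * y b \<omega> \<partial>M) = (\<integral>\<omega>. y a \<omega> * y b \<omega> \<partial>M)" for a b
    unfolding Z_def y_def by (rule Z_integral[OF Y_meas Y_bound])
  have yZ: "(\<integral>\<omega>. y a \<omega> * Z b \<omega> \<partial>M) = (\<integral>\<omega>. y a \<omega> * y b \<omega> \<partial>M)"
  proof -
    have "(\<integral>\<omega>. y a \<omega> * Z b \<omega> \<partial>M) = (\<integral>\<omega>. Z b \<omega> * y a \<omega> \<partial>M)" by (simp add: mult.commute)
    also have "\<dots> = (\<integral>\<omega>. y b \<omega> * y a \<omega> \<partial>M)" by (rule Zy)
    also have "\<dots> = (\<integral>\<omega>. y a \<omega> * y b \<omega> \<partial>M)" by (simp add: mult.commute)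
    finally show ?thesis .
  qed
  have "V i a b = (\<integral>\<omega>. Z a \<omega> * Z b \<omega> - Z a \<omega> * y b \<omega> - y a \<omega> * Z b \<omega> + y a \<omega> * y b \<omega> \<partial>M)"
    unfolding V_def D_def Z_def y_def by (simp add: algebra_simps)
  also have "\<dots> = (\<integral>\<omega>. Z a \<omega> * Z b \<omega> \<partial>M) - (\<integral>\<omega>. Z a \<omega> * y b \<omega> \<partial>M) - (\<integral>\<omega>. y a \<omega> * Z b \<omega> \<partial>M) + (\<integral>\<omega>. y a \<omega> * y b \<omega> \<partial>M)"
    by (simp add: iZZ iZy iyZ iyy)
  also have "\<dots> = (\<integral>\<omega>. Z a \<omega> * Z b \<omega> \<partial>M) - q (Suc i) a b"
    unfolding Zy yZ by (simp add: q_def y_def)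
  also have "(\<integral>\<omega>. Z a \<omega> * Z b \<omega> \<partial>M) = cov i i a b + (\<Sum>j<i. cov j i a b + cov j i b a) + q i a b"
  proof -
    have i1: "integrable M (\<lambda>\<omega>. X i \<omega> $ a * X i \<omega> $ b)" by (rule prod_int[OF _ _ X_comp_bound X_comp_bound]) measurable
    have i2: "integrable M (\<lambda>\<omega>. Y i a \<omega> * X i \<omega> $ b)" for a b by (rule prod_int[OF _ _ Y_bound X_comp_bound]) measurable
    have i3: "integrable M (\<lambda>\<omega>. Y i a \<omega> * Y i b \<omega>)" by (rule prod_int[OF _ _ Y_bound Y_bound]) measurable
    have "(\<integral>\<omega>. Z a \<omega> * Z b \<omega> \<partial>M)
      = (\<integral>\<omega>. X i \<omega> $ a * X i \<omega> $ b + Y i a \<omega> * X i \<omega> $ b + Y i b \<omega> * X i \<omega> $ a + Y i a \<omega> * Y i b \<omega> \<partial>M)"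
      unfolding Z_def by (simp add: algebra_simps)
    also have "\<dots> = cov i i a b + (\<integral>\<omega>. Y i a \<omega> * X i \<omega> $ b \<partial>M) + (\<integral>\<omega>. Y i b \<omega> * X i \<omega> $ a \<partial>M) + q i a b"
      by (simp add: cov_def q_def i1 i2 i3)
    finally show ?thesis unfolding XY_integral by (simp add: sum.distrib)
  qed
  finally show ?thesis .
qed

lemma V_symmetric: "V i a b = V i b a"
  unfolding V_def by (simp add: mult.commute)

lemma D_bound: "\<bar>D i a \<omega>\<bar> \<le> K + real i * K + real (Suc i) * K"
  unfolding D_def using X_comp_bound[of i \<omega> a] Y_bound[of i a \<omega>] Y_bound[of "Suc i" a \<omega>] by linarith

lemma V_psd: "0 \<le> (\<Sum>a\<in>UNIV. \<Sum>b\<in>UNIV. v a * v b * V i a b)"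
proof -
  have [measurable]: "D i a \<in> borel_measurable M" for a unfolding D_def[abs_def] by measurable
  have i: "integrable M (\<lambda>\<omega>. D i a \<omega> * D i b \<omega>)" for a b
    by (rule integrable_bounded[where C="(K + real i * K + real (Suc i) * K) * (K + real i * K + real (Suc i) * K)"])
       (measurable, unfold abs_mult, intro mult_mono D_bound, use K_nonneg in auto)
  have "(\<Sum>a\<in>UNIV. \<Sum>b\<in>UNIV. v a * v b * V i a b) = (\<integral>\<omega>. (\<Sum>a\<in>UNIV. \<Sum>b\<in>UNIV. v a * v b * (D i a \<omega> * D i b \<omega>)) \<partial>M)"
    unfolding V_def by (simp add: i)
  also have "\<dots> = (\<integral>\<omega>. (\<Sum>a\<in>UNIV. v a * D i a \<omega>)\<^sup>2 \<partial>M)"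
    by (simp add: power2_eq_square sum_product ac_simps)
  also have "0 \<le> \<dots>" by simp
  finally show ?thesis .
qed

lemma q_bound: "\<bar>q i a b\<bar> \<le> 2 * K * W1\<^sup>2"
proof -
  have one: "\<bar>\<integral>\<omega>. cexp j i a \<omega> * cexp k i b \<omega> \<partial>M\<bar> \<le> 2 * K * (w (i - j))\<^sup>2" if "j < i" for j k a b
    unfolding cexp_integral[OF cexp_meas cexp_bound, symmetric] by (rule mix_one[OF that cexp_meas cexp_bound])
  have two: "\<bar>\<integral>\<omega>. cexp j i a \<omega> * cexp k i b \<omega> \<partial>M\<bar> \<le> 2 * K * (w (i - j) * w (i - k))" if jk: "j < i" "k < i" for j k
  proof (rule le_geometric_mean[OF one[OF jk(1)]])
    have "(\<integral>\<omega>. cexp j i a \<omega> * cexp k i b \<omega> \<partial>M) = (\<integral>\<omega>. cexp k i b \<omega> * cexp j i a \<omega> \<partial>M)" by (simp add: mult.commute)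
    then show "\<bar>\<integral>\<omega>. cexp j i a \<omega> * cexp k i b \<omega> \<partial>M\<bar> \<le> 2 * K * (w (i - k))\<^sup>2"
      using one[OF jk(2), of b j a] by simp
  qed (use K_nonneg w_nonneg in auto)
  have i: "integrable M (\<lambda>\<omega>. cexp j i a \<omega> * cexp k i b \<omega>)" for j k
    by (rule integrable_bounded[where C="K * K"]) (use cexp_bound K_nonneg in \<open>auto simp: abs_mult intro!: mult_mono\<close>)
  have "q i a b = (\<Sum>j<i. \<Sum>k<i. \<integral>\<omega>. cexp j i a \<omega> * cexp k i b \<omega> \<partial>M)"
    unfolding q_def Y_def sum_product by (simp add: i)
  also have "\<bar>\<dots>\<bar> \<le> (\<Sum>j<i. \<Sum>k<i. 2 * K * (w (i - j) * w (i - k)))"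
    by (rule order_trans[OF sum_abs], rule sum_mono, rule order_trans[OF sum_abs], rule sum_mono, rule two) auto
  also have "\<dots> = 2 * K * ((\<Sum>j<i. w (i - j)) * (\<Sum>k<i. w (i - k)))"
    by (simp only: sum_product, simp only: sum_distrib_left)
  also have "\<dots> \<le> 2 * K * (W1 * W1)"
  proof -
    have "(\<Sum>j<i. w (i - j)) \<le> W1" by (rule sum_w_le) (auto simp: inj_on_def)
    then show ?thesis using K_nonneg w_nonneg by (intro mult_left_mono mult_mono) (auto intro!: sum_nonneg W1_nonneg)
  qed
  finally show ?thesis by (simp add: power2_eq_square)
qed

definition V_max :: real where
  "V_max = K\<^sup>2 + 4 * K * (w 0 * W1) + 4 * K * W1\<^sup>2"

lemma V_max_nonneg: "0 \<le> V_max"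
  unfolding V_max_def using K_nonneg W1_nonneg w_nonneg[of 0] by (intro add_nonneg_nonneg mult_nonneg_nonneg) auto

lemma V_bound: "\<bar>V i a b\<bar> \<le> V_max"
proof -
  have "\<bar>\<Sum>j<i. cov j i a b + cov j i b a\<bar> \<le> (\<Sum>j<i. 4 * K * (w 0 * w (i - j)))"
  proof (rule order_trans[OF sum_abs], rule sum_mono)
    fix j assume "j \<in> {..<i}"
    then have "\<bar>cov j i a b + cov j i b a\<bar> \<le> 4 * K * (w (i - j))\<^sup>2"
      using cov_bound[of j i a b] cov_bound[of j i b a] by simp
    also have "\<dots> \<le> 4 * K * (w 0 * w (i - j))"
      unfolding power2_eq_square using K_nonneg w_nonneg w_le by (intro mult_left_mono mult_right_mono) auto
    finally show "\<bar>cov j i a b + cov j i b a\<bar> \<le> 4 * K * (w 0 * w (i - j))" .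
  qed
  also have "\<dots> = 4 * K * (w 0 * (\<Sum>j<i. w (i - j)))" by (simp add: sum_distrib_left)
  also have "\<dots> \<le> 4 * K * (w 0 * W1)"
    using K_nonneg w_nonneg by (intro mult_left_mono sum_w_le) (auto simp: inj_on_def)
  finally show ?thesis unfolding V_eq V_max_def
    using cov_bound0[of i i a b] q_bound[of i a b] q_bound[of "Suc i" a b] by linarith
qed

lemma cov_swap: "cov i k a b = cov k i b a"
  unfolding cov_def by (simp add: mult.commute)

lemma q_0: "q 0 a b = 0" by (simp add: q_def Y_def)

lemma V_sum: "(\<Sum>i<n. V i a b) = (\<Sum>i<n. \<Sum>k<n. cov i k a b) - q n a b"
proof (induction n)
  case 0 then show ?case by (simp add: q_0)
next
  case (Suc n)
  have "(\<Sum>i<n. cov n i a b) = (\<Sum>i<n. cov i n b a)" by (rule sum.cong[OF refl cov_swap])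
  then have "(\<Sum>i<Suc n. \<Sum>k<Suc n. cov i k a b)
    = (\<Sum>i<n. \<Sum>k<n. cov i k a b) + (\<Sum>i<n. cov i n a b + cov i n b a) + cov n n a b"
    by (simp add: sum.distrib)
  then show ?case using Suc V_eq[of n a b] by simp
qed

text \<open>Its increments are the difference between the covariances that arise in Taylor's formula and
  \<open>V\<close>.\<close>

definition \<tau> :: "nat \<Rightarrow> nat \<Rightarrow> 'd \<Rightarrow> 'd \<Rightarrow> real" where
  "\<tau> N i a b = (\<Sum>j<i. \<Sum>k\<in>{i..<N}. cov j k a b + cov j k b a) + q i a b"

lemma tau_0: "\<tau> N 0 a b = 0" by (simp add: \<tau>_def q_0)

lemma tau_diff:
  assumes "i < N"
  shows "\<tau> N (Suc i) a b - \<tau> N i a b = cov i i a b + (\<Sum>k\<in>{Suc i..<N}. cov i k a b + cov i k b a) - V i a b"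
proof -
  have "{i..<N} = insert i {Suc i..<N}" using assms by auto
  then have "(\<Sum>j<i. \<Sum>k\<in>{i..<N}. cov j k a b + cov j k b a)
    = (\<Sum>j<i. cov j i a b + cov j i b a) + (\<Sum>j<i. \<Sum>k\<in>{Suc i..<N}. cov j k a b + cov j k b a)"
    by (simp add: sum.distrib)
  then show ?thesis unfolding \<tau>_def V_eq by simp
qed

lemma tau_bound: "\<bar>\<tau> N i a b\<bar> \<le> 6 * K * W1\<^sup>2"
proof -
  have "\<bar>\<Sum>j<i. \<Sum>k\<in>{i..<N}. cov j k a b + cov j k b a\<bar> \<le> (\<Sum>j<i. \<Sum>k\<in>{i..<N}. 4 * K * (w (i - j) * w (k - i)))"
  proof (rule order_trans[OF sum_abs], rule sum_mono, rule order_trans[OF sum_abs], rule sum_mono)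
    fix j k assume "j \<in> {..<i}" "k \<in> {i..<N}"
    then have jk: "j < k" "i - j \<le> k - j" "k - i \<le> k - j" by auto
    have "\<bar>cov j k a b + cov j k b a\<bar> \<le> 4 * K * (w (k - j) * w (k - j))"
      using cov_bound[OF jk(1), of a b] cov_bound[OF jk(1), of b a] by (simp add: power2_eq_square)
    also have "\<dots> \<le> 4 * K * (w (i - j) * w (k - i))"
      using K_nonneg w_nonneg jk by (intro mult_left_mono mult_mono w_anti) auto
    finally show "\<bar>cov j k a b + cov j k b a\<bar> \<le> 4 * K * (w (i - j) * w (k - i))" .
  qed
  also have "\<dots> = 4 * K * ((\<Sum>j<i. w (i - j)) * (\<Sum>k\<in>{i..<N}. w (k - i)))"
    by (simp only: sum_product, simp only: sum_distrib_left)
  also have "\<dots> \<le> 4 * K * (W1 * W1)"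
  proof -
    have "(\<Sum>j<i. w (i - j)) \<le> W1" "(\<Sum>k\<in>{i..<N}. w (k - i)) \<le> W1" by (rule sum_w_le; auto simp: inj_on_def)+
    then show ?thesis using K_nonneg w_nonneg by (intro mult_left_mono mult_mono) (auto intro!: sum_nonneg W1_nonneg)
  qed
  finally show ?thesis unfolding \<tau>_def using q_bound[of i a b] by (simp add: power2_eq_square)
qed

end

section \<open>Replacement by Gaussian vectors\<close>

lemma stein_moments:
  fixes S :: "real ^ 'd ^ 'd"
  assumes P: "stein S P"
  shows "(\<integral>z. z $ a \<partial>P) = 0" "(\<integral>z. z $ a * z $ b \<partial>P) = S $ a $ b"
    "integrable P (\<lambda>z. z $ a)" "integrable P (\<lambda>z. z $ a * z $ b)" "integrable P (\<lambda>z. norm z)"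
proof -
  interpret prob_space P by (rule steinD[OF P])
  note [measurable_cong] = steinD(2)[OF P]
  have "C11 1 (\<lambda>x. 1) (\<lambda>b (x :: real ^ 'd). 0)" by (simp add: C11_def)
  from steinD(4)[OF P this, of a] show "(\<integral>z. z $ a \<partial>P) = 0" by simp
  have ax: "(\<Sum>c\<in>UNIV. (if c = b then 1 else 0) * v $ c) = v $ b" for v :: "real ^ 'd"
  proof -
    have "(\<Sum>c\<in>UNIV. (if c = b then 1 else 0) * v $ c) = (\<Sum>c\<in>UNIV. if c = b then v $ c else 0)" by (rule sum.cong) auto
    then show ?thesis by simp
  qed
  have "C11 1 (\<lambda>x. x $ b) (\<lambda>c (x :: real ^ 'd). if c = b then 1 else 0)"
    unfolding C11_def ax by (auto simp: component_le_norm_cart)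
  from steinD(4)[OF P this, of a] have "(\<integral>z. z $ a * z $ b \<partial>P) = (\<Sum>c\<in>UNIV. S $ a $ c * (if c = b then 1 else 0))"
    by (simp add: prob_space if_distrib[of "\<lambda>c. _ * c"] cong: if_cong)
  also have "\<dots> = (\<Sum>c\<in>UNIV. if c = b then S $ a $ c else 0)" by (rule sum.cong) auto
  finally show "(\<integral>z. z $ a * z $ b \<partial>P) = S $ a $ b" by simp
  have n: "norm z \<le> 1 + norm z ^ 3" "(norm z)\<^sup>2 \<le> 1 + norm z ^ 3" for z :: "real ^ 'd"
    using power_le_1_plus_power3[of "norm z" 1] power_le_1_plus_power3[of "norm z" 2] by auto
  show "integrable P (\<lambda>z. z $ a)"
  proof (rule integrable_cubic_growth[OF finite_measure_axioms steinD(2,3)[OF P], where C=1])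
    show "\<bar>z $ a\<bar> \<le> 1 * (1 + norm z ^ 3)" for z using component_le_norm_cart[of z a] n(1)[of z] by simp
  qed measurable
  show "integrable P (\<lambda>z. norm z)"
  proof (rule integrable_cubic_growth[OF finite_measure_axioms steinD(2,3)[OF P], where C=1])
    show "\<bar>norm z\<bar> \<le> 1 * (1 + norm z ^ 3)" for z :: "real ^ 'd" using n(1)[of z] by simp
  qed measurable
  show "integrable P (\<lambda>z. z $ a * z $ b)"
  proof (rule integrable_cubic_growth[OF finite_measure_axioms steinD(2,3)[OF P], where C=1])
    fix z :: "real ^ 'd"
    have "\<bar>z $ a * z $ b\<bar> \<le> norm z * norm z" unfolding abs_mult by (intro mult_mono component_le_norm_cart) auto
    then show "\<bar>z $ a * z $ b\<bar> \<le> 1 * (1 + norm z ^ 3)" using n(2)[of z] by (simp add: power2_eq_square)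
  qed measurable
qed

lemma stein_increment:
  fixes H :: "real ^ 'd \<Rightarrow> real"
  assumes P: "stein S P" and H: "C3 M H G A"
  shows "\<bar>(\<integral>z. H (x + z) \<partial>P) - H x - (\<Sum>a\<in>UNIV. \<Sum>b\<in>UNIV. A a b x * S $ a $ b) / 2\<bar> \<le> M * (\<integral>z. norm z ^ 3 \<partial>P)"
proof -
  interpret prob_space P by (rule steinD[OF P])
  note I = C3_integrable(1)[OF P H] stein_moments(3,4)[OF P] steinD(3)[OF P]
  have "(\<integral>z. H (x + z) - H x - (\<Sum>a\<in>UNIV. G a x * z $ a) - (\<Sum>a\<in>UNIV. \<Sum>b\<in>UNIV. A a b x * (z $ a * z $ b)) / 2 \<partial>P)
    = (\<integral>z. H (x + z) \<partial>P) - H x - (\<Sum>a\<in>UNIV. \<Sum>b\<in>UNIV. A a b x * S $ a $ b) / 2"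
    using I by (simp add: stein_moments(1,2)[OF P] prob_space)
  moreover have "\<bar>\<integral>z. H (x + z) - H x - (\<Sum>a\<in>UNIV. G a x * z $ a) - (\<Sum>a\<in>UNIV. \<Sum>b\<in>UNIV. A a b x * (z $ a * z $ b)) / 2 \<partial>P\<bar>
    \<le> (\<integral>z. M * norm z ^ 3 \<partial>P)"
  proof (rule order_trans[OF integral_abs_bound integral_mono])
    show "\<bar>H (x + z) - H x - (\<Sum>a\<in>UNIV. G a x * z $ a) - (\<Sum>a\<in>UNIV. \<Sum>b\<in>UNIV. A a b x * (z $ a * z $ b)) / 2\<bar> \<le> M * norm z ^ 3" for z
      by (rule C3D(3)[OF H])
  qed (use I in auto)
  ultimately show ?thesis by simp
qed

lemma stein_first_moment:
  fixes S :: "real ^ 'd ^ 'd"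
  assumes P: "stein S P" and s: "0 < s" and c: "(\<integral>z. norm z ^ 3 \<partial>P) \<le> c * s ^ 3"
  shows "(\<integral>z. norm z \<partial>P) \<le> s * (1 + c)"
proof -
  interpret prob_space P by (rule steinD[OF P])
  have "(\<integral>z. norm z \<partial>P) \<le> (\<integral>z. s + norm z ^ 3 / s\<^sup>2 \<partial>P)"
  proof (rule integral_mono)
    show "integrable P (\<lambda>z. norm z)" by (rule stein_moments(5)[OF P])
    show "integrable P (\<lambda>z. s + norm z ^ 3 / s\<^sup>2)" using steinD(3)[OF P] by auto
    fix z :: "real ^ 'd"
    have "s * (norm z / s) ^ 1 \<le> s * (1 + (norm z / s) ^ 3)" using s by (intro mult_left_mono power_le_1_plus_power3) auto
    then show "norm z \<le> s + norm z ^ 3 / s\<^sup>2"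
      using s by (simp add: distrib_left power_divide power2_eq_square power3_eq_cube)
  qed
  also have "\<dots> = s + (\<integral>z. norm z ^ 3 \<partial>P) / s\<^sup>2" using steinD(3)[OF P] by (simp add: prob_space)
  also have "\<dots> \<le> s + c * s ^ 3 / s\<^sup>2" using c s by (intro add_left_mono divide_right_mono) auto
  also have "\<dots> = s * (1 + c)" using s by (simp add: power2_eq_square power3_eq_cube distrib_left)
  finally show ?thesis .
qed

lemma abel_bound:
  fixes \<alpha> \<tau> :: "nat \<Rightarrow> real"
  assumes t0: "\<tau> 0 = 0" and t: "\<And>i. \<bar>\<tau> i\<bar> \<le> T" and a: "\<And>i. \<bar>\<alpha> i\<bar> \<le> m"
    and d: "\<And>i. Suc i < N \<Longrightarrow> \<bar>\<alpha> (Suc i) - \<alpha> i\<bar> \<le> D" and D0: "0 \<le> D"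
  shows "\<bar>\<Sum>i<N. \<alpha> i * (\<tau> (Suc i) - \<tau> i)\<bar> \<le> T * (m + real N * D)"
proof -
  have T0: "0 \<le> T" using t[of 0] by linarith
  have m0: "0 \<le> m" using a[of 0] by linarith
  show ?thesis
  proof (cases N)
    case 0 then show ?thesis using T0 m0 by simp
  next
    case (Suc n)
    have eq: "(\<Sum>i<Suc k. \<alpha> i * (\<tau> (Suc i) - \<tau> i)) = \<alpha> k * \<tau> (Suc k) - (\<Sum>i<k. (\<alpha> (Suc i) - \<alpha> i) * \<tau> (Suc i))" for k
      by (induction k) (simp_all add: t0 algebra_simps)
    have "\<bar>\<alpha> n * \<tau> (Suc n)\<bar> \<le> m * T" unfolding abs_mult using a t m0 by (intro mult_mono) auto
    moreover have "\<bar>\<Sum>i<n. (\<alpha> (Suc i) - \<alpha> i) * \<tau> (Suc i)\<bar> \<le> (\<Sum>i<n. D * T)"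
      unfolding abs_mult using d t D0 Suc by (intro order_trans[OF sum_abs] sum_mono) (auto simp: abs_mult intro!: mult_mono)
    moreover have "(\<Sum>i<n. D * T) \<le> real N * D * T" using Suc D0 T0 by (simp add: mult_right_mono algebra_simps)
    ultimately show ?thesis unfolding Suc eq by (simp add: algebra_simps)
  qed
qed

lemma symmetric_contraction:
  fixes \<alpha> u :: "'d::finite \<Rightarrow> 'd \<Rightarrow> real"
  assumes "\<And>a b. \<alpha> a b = \<alpha> b a"
  shows "(\<Sum>a\<in>UNIV. \<Sum>b\<in>UNIV. \<alpha> a b * u b a) = (\<Sum>a\<in>UNIV. \<Sum>b\<in>UNIV. \<alpha> a b * u a b)"
proof -
  have "(\<Sum>a\<in>UNIV. \<Sum>b\<in>UNIV. \<alpha> a b * u b a) = (\<Sum>b\<in>UNIV. \<Sum>a\<in>UNIV. \<alpha> a b * u b a)" by (rule sum.swap)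
  also have "\<dots> = (\<Sum>b\<in>UNIV. \<Sum>a\<in>UNIV. \<alpha> b a * u b a)"
    by (intro sum.cong refl arg_cong2[where f="(*)"] assms)
  finally show ?thesis .
qed

context reverse_mixing
begin

text \<open>\<open>V i\<close> may be singular; a positive \<open>\<epsilon>\<close> allows the matrix to be factored.\<close>

definition increment_cov :: "real \<Rightarrow> real \<Rightarrow> nat \<Rightarrow> real ^ 'd ^ 'd" where
  "increment_cov s \<epsilon> i = (\<chi> a b. s\<^sup>2 * (V i a b + (if a = b then \<epsilon> else 0)))"

lemma increment_cov_positive_definite:
  assumes s: "0 < s" and e: "0 < \<epsilon>"
  shows "positive_definite (increment_cov s \<epsilon> i)"
  unfolding positive_definite_def
proof (intro conjI allI impI)
  show "transpose (increment_cov s \<epsilon> i) = increment_cov s \<epsilon> i"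
    using V_symmetric[of i] by (auto simp: vec_eq_iff transpose_def increment_cov_def)
  fix v :: "real ^ 'd" assume v: "v \<noteq> 0"
  have "v \<bullet> (increment_cov s \<epsilon> i *v v)
    = (\<Sum>a\<in>UNIV. \<Sum>b\<in>UNIV. s\<^sup>2 * (v $ a * v $ b * V i a b) + (if a = b then s\<^sup>2 * \<epsilon> * (v $ a * v $ b) else 0))"
    unfolding inner_vec_def matrix_vector_mult_def increment_cov_def by (auto simp: sum_distrib_left algebra_simps intro!: sum.cong)
  also have "\<dots> = s\<^sup>2 * (\<Sum>a\<in>UNIV. \<Sum>b\<in>UNIV. v $ a * v $ b * V i a b) + s\<^sup>2 * \<epsilon> * (v \<bullet> v)"
    by (simp add: sum.distrib inner_vec_def sum_distrib_left)
  also have "0 < \<dots>"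
  proof -
    have "0 < s\<^sup>2 * \<epsilon> * (v \<bullet> v)" using s e v by simp
    moreover have "0 \<le> s\<^sup>2 * (\<Sum>a\<in>UNIV. \<Sum>b\<in>UNIV. v $ a * v $ b * V i a b)" by (intro mult_nonneg_nonneg V_psd) simp
    ultimately show ?thesis by linarith
  qed
  finally show "0 < v \<bullet> (increment_cov s \<epsilon> i *v v)" .
qed

definition cube_const :: real where
  "cube_const = sqrt (real CARD('d) * (V_max + 1)) ^ 3 * gauss_third_moment TYPE('d)"

lemma cube_const_nonneg: "0 \<le> cube_const"
  unfolding cube_const_def gauss_third_moment_def using V_max_nonneg by (intro mult_nonneg_nonneg zero_le_power) auto

lemma gaussian_increment_exists:
  assumes s: "0 < s" and e: "0 < \<epsilon>" "\<epsilon> \<le> 1"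
  shows "\<exists>P. stein (increment_cov s \<epsilon> i) P \<and> (\<integral>z. norm z ^ 3 \<partial>P) \<le> cube_const * s ^ 3"
proof -
  obtain P where P: "stein (increment_cov s \<epsilon> i) P"
    "(\<integral>z. norm z ^ 3 \<partial>P) \<le> sqrt (\<Sum>j\<in>UNIV. increment_cov s \<epsilon> i $ j $ j) ^ 3 * gauss_third_moment TYPE('d)"
    by (rule positive_definite_stein_exists[OF increment_cov_positive_definite[OF s e(1), of i]])
  have g: "0 \<le> gauss_third_moment TYPE('d)" unfolding gauss_third_moment_def by simp
  have "(\<Sum>j\<in>UNIV. increment_cov s \<epsilon> i $ j $ j) \<le> (\<Sum>j\<in>(UNIV :: 'd set). s\<^sup>2 * (V_max + 1))"
  proof (rule sum_mono)
    fix j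
    have "V i j j + \<epsilon> \<le> V_max + 1" using V_bound[of i j j] e by linarith
    then show "increment_cov s \<epsilon> i $ j $ j \<le> s\<^sup>2 * (V_max + 1)" by (simp add: increment_cov_def mult_left_mono)
  qed
  also have "\<dots> = s\<^sup>2 * (real CARD('d) * (V_max + 1))" by simp
  finally have t: "sqrt (\<Sum>j\<in>UNIV. increment_cov s \<epsilon> i $ j $ j) \<le> s * sqrt (real CARD('d) * (V_max + 1))"
    using s real_sqrt_le_mono by (fastforce simp: real_sqrt_mult)
  have nn: "0 \<le> (\<Sum>j\<in>UNIV. increment_cov s \<epsilon> i $ j $ j)"
  proof (rule sum_nonneg)
    fix j
    have "0 < axis j 1 \<bullet> (increment_cov s \<epsilon> i *v axis j 1)"
      using increment_cov_positive_definite[OF s e(1), of i] by (auto simp: positive_definite_def)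
    then show "0 \<le> increment_cov s \<epsilon> i $ j $ j" by (simp add: matrix_vector_mul_component inner_axis inner_axis' )
  qed
  have "sqrt (\<Sum>j\<in>UNIV. increment_cov s \<epsilon> i $ j $ j) ^ 3 \<le> (s * sqrt (real CARD('d) * (V_max + 1))) ^ 3"
    using t nn by (intro power_mono) auto
  then have "sqrt (\<Sum>j\<in>UNIV. increment_cov s \<epsilon> i $ j $ j) ^ 3 * gauss_third_moment TYPE('d) \<le> cube_const * s ^ 3"
    unfolding cube_const_def using g mult_right_mono by (fastforce simp: power_mult_distrib ac_simps)
  then show ?thesis using P by (intro exI[of _ P]) linarith
qed

lemma lindeberg_step:
  fixes H :: "real ^ 'd \<Rightarrow> real"
  assumes H: "C3 L H G A" and P: "stein (increment_cov s \<epsilon> i) P" and P3: "(\<integral>z. norm z ^ 3 \<partial>P) \<le> cube_const * s ^ 3"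
    and i: "i < N" and s: "0 < s" and e: "0 < \<epsilon>" "\<epsilon> \<le> s"
  shows "\<bar>(\<integral>\<omega>. H (R N s i \<omega>) \<partial>M) - (\<integral>\<omega>. (\<integral>z. H (R N s (Suc i) \<omega> + z) \<partial>P) \<partial>M)
      - s\<^sup>2 / 2 * (\<Sum>a\<in>UNIV. \<Sum>b\<in>UNIV. (\<integral>\<omega>. A a b (R N s (Suc i) \<omega>) \<partial>M) * (\<tau> N (Suc i) a b - \<tau> N i a b))\<bar>
    \<le> s ^ 3 * L * (step_const + cube_const + real CARD('d))"
proof -
  have L0: "0 \<le> L" by (rule C3D(1)[OF H])
  let ?R = "R N s (Suc i)" and ?d = "real CARD('d)"
  have HP: "C3 L (\<lambda>x. \<integral>z. H (x + z) \<partial>P) (\<lambda>a x. \<integral>z. G a (x + z) \<partial>P) (\<lambda>a b x. \<integral>z. A a b (x + z) \<partial>P)" by (rule C3_average[OF P H])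
  have Rm [measurable]: "(\<lambda>\<omega>. f (?R \<omega>)) \<in> borel_measurable M" if "f \<in> borel_measurable borel" for f :: "real ^ 'd \<Rightarrow> real"
    by (rule F_M[OF C11_R_meas[OF that order_refl]])
  have Rb: "norm (?R \<omega>) \<le> s * (K * real N)" for \<omega>
  proof -
    have "norm (\<Sum>j\<in>{Suc i..<N}. X j \<omega>) \<le> (\<Sum>j\<in>{Suc i..<N}. K)" by (rule order_trans[OF norm_sum]) (intro sum_mono X_bound)
    also have "\<dots> \<le> K * real N" using K_nonneg mult_left_mono[of "real (N - Suc i)" "real N" K] by (simp add: mult.commute)
    finally show ?thesis using s by (simp add: R_def mult_left_mono)
  qed
  have int: "integrable M (\<lambda>\<omega>. f (?R \<omega>))" if f: "C3 L f G' A'" for f :: "real ^ 'd \<Rightarrow> real" and G' A'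
  proof (rule integrable_bounded[where C="\<bar>f 0\<bar> + L * (s * (K * real N))"])
    show "(\<lambda>\<omega>. f (?R \<omega>)) \<in> borel_measurable M" by (rule Rm[OF C11_measurable(1)[OF C3_C11[OF f]]])
    show "\<bar>f (?R \<omega>)\<bar> \<le> \<bar>f 0\<bar> + L * (s * (K * real N))" for \<omega>
      using C3D(2)[OF f, of 0 "?R \<omega>"] mult_left_mono[OF Rb[of \<omega>] L0] by simp
  qed
  have iA: "integrable M (\<lambda>\<omega>. A a b (?R \<omega>))" for a b
    by (rule integrable_bounded[OF Rm[OF C11_measurable(2)[OF C3D(4)[OF H]]] C11D(4)[OF C3D(4)[OF H]]])
  define \<alpha> where "\<alpha> a b = (\<integral>\<omega>. A a b (?R \<omega>) \<partial>M)" for a b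
  have asym: "\<alpha> a b = \<alpha> b a" for a b unfolding \<alpha>_def C3D(6)[OF H, of a b] ..
  have abd: "\<bar>\<alpha> a b\<bar> \<le> L" for a b unfolding \<alpha>_def by (rule abs_integral_le[OF iA C11D(4)[OF C3D(4)[OF H]]])
  define u where "u a b = (\<Sum>k\<in>{Suc i..<N}. cov i k a b)" for a b
  define T where "T = (\<Sum>a\<in>UNIV. \<Sum>b\<in>UNIV. \<alpha> a b * (\<tau> N (Suc i) a b - \<tau> N i a b))"
  define U where "U = (\<Sum>a\<in>UNIV. \<Sum>b\<in>UNIV. \<alpha> a b * V i a b)"
  have td: "\<tau> N (Suc i) a b - \<tau> N i a b = cov i i a b + (u a b + u b a) - V i a b" for a b
    unfolding tau_diff[OF i] u_def by (simp add: sum.distrib)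
  have tr: "(\<Sum>a\<in>UNIV. \<Sum>b\<in>UNIV. \<alpha> a b * (cov i i a b + 2 * u a b)) = T + U"
  proof -
    have "T + U = (\<Sum>a\<in>UNIV. \<Sum>b\<in>UNIV. \<alpha> a b * cov i i a b + \<alpha> a b * u a b + \<alpha> a b * u b a)"
      unfolding T_def U_def td sum.distrib[symmetric] by (simp add: distrib_left right_diff_distrib add.assoc)
    also have "\<dots> = (\<Sum>a\<in>UNIV. \<Sum>b\<in>UNIV. \<alpha> a b * cov i i a b) + (\<Sum>a\<in>UNIV. \<Sum>b\<in>UNIV. \<alpha> a b * u a b)
       + (\<Sum>a\<in>UNIV. \<Sum>b\<in>UNIV. \<alpha> a b * u b a)" by (simp add: sum.distrib)
    also have "(\<Sum>a\<in>UNIV. \<Sum>b\<in>UNIV. \<alpha> a b * u b a) = (\<Sum>a\<in>UNIV. \<Sum>b\<in>UNIV. \<alpha> a b * u a b)"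
      by (rule symmetric_contraction[OF asym])
    finally show ?thesis by (simp add: distrib_left sum.distrib mult.left_commute[of _ 2] flip: sum_distrib_left)
  qed
  have 1: "\<bar>(\<integral>\<omega>. H (R N s i \<omega>) \<partial>M) - (\<integral>\<omega>. H (?R \<omega>) \<partial>M) - s\<^sup>2 / 2 * (T + U)\<bar> \<le> s ^ 3 * L * step_const"
    using step_expansion[OF H i, of s] s unfolding \<alpha>_def[symmetric] u_def[symmetric] tr by simp
  have 2: "\<bar>(\<integral>\<omega>. (\<integral>z. H (?R \<omega> + z) \<partial>P) \<partial>M) - (\<integral>\<omega>. H (?R \<omega>) \<partial>M) - (\<Sum>a\<in>UNIV. \<Sum>b\<in>UNIV. \<alpha> a b * increment_cov s \<epsilon> i $ a $ b) / 2\<bar>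
    \<le> L * (cube_const * s ^ 3)"
  proof -
    have "(\<integral>\<omega>. (\<integral>z. H (?R \<omega> + z) \<partial>P) \<partial>M) - (\<integral>\<omega>. H (?R \<omega>) \<partial>M) - (\<Sum>a\<in>UNIV. \<Sum>b\<in>UNIV. \<alpha> a b * increment_cov s \<epsilon> i $ a $ b) / 2
      = (\<integral>\<omega>. (\<integral>z. H (?R \<omega> + z) \<partial>P) - H (?R \<omega>) - (\<Sum>a\<in>UNIV. \<Sum>b\<in>UNIV. A a b (?R \<omega>) * increment_cov s \<epsilon> i $ a $ b) / 2 \<partial>M)"
      unfolding \<alpha>_def using int[OF H] int[OF HP] iA by simp
    also have "\<bar>\<dots>\<bar> \<le> L * (cube_const * s ^ 3)"
    proof (rule abs_integral_le)
      show "integrable M (\<lambda>\<omega>. (\<integral>z. H (?R \<omega> + z) \<partial>P) - H (?R \<omega>) - (\<Sum>a\<in>UNIV. \<Sum>b\<in>UNIV. A a b (?R \<omega>) * increment_cov s \<epsilon> i $ a $ b) / 2)"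
        using int[OF H] int[OF HP] iA by simp
      show "\<bar>(\<integral>z. H (?R \<omega> + z) \<partial>P) - H (?R \<omega>) - (\<Sum>a\<in>UNIV. \<Sum>b\<in>UNIV. A a b (?R \<omega>) * increment_cov s \<epsilon> i $ a $ b) / 2\<bar> \<le> L * (cube_const * s ^ 3)" for \<omega>
        by (rule order_trans[OF stein_increment[OF P H] mult_left_mono[OF P3 L0]])
    qed
    finally show ?thesis .
  qed
  have S: "(\<Sum>a\<in>UNIV. \<Sum>b\<in>UNIV. \<alpha> a b * increment_cov s \<epsilon> i $ a $ b) = s\<^sup>2 * U + s\<^sup>2 * \<epsilon> * (\<Sum>a\<in>UNIV. \<alpha> a a)"
  proof -
    have "(\<Sum>a\<in>UNIV. \<Sum>b\<in>UNIV. \<alpha> a b * increment_cov s \<epsilon> i $ a $ b)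
      = (\<Sum>a\<in>UNIV. \<Sum>b\<in>UNIV. s\<^sup>2 * (\<alpha> a b * V i a b) + (if a = b then s\<^sup>2 * \<epsilon> * \<alpha> a b else 0))"
      unfolding increment_cov_def by (intro sum.cong refl) (simp add: algebra_simps)
    then show ?thesis by (simp add: U_def sum.distrib sum_distrib_left)
  qed
  have 3: "\<bar>s\<^sup>2 * \<epsilon> * (\<Sum>a\<in>UNIV. \<alpha> a a)\<bar> \<le> s ^ 3 * L * ?d"
  proof -
    have "\<bar>\<Sum>a\<in>UNIV. \<alpha> a a\<bar> \<le> (\<Sum>a\<in>(UNIV :: 'd set). L)" by (rule order_trans[OF sum_abs]) (intro sum_mono abd)
    then have "\<bar>\<Sum>a\<in>UNIV. \<alpha> a a\<bar> \<le> ?d * L" by simp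
    then have "s\<^sup>2 * \<epsilon> * \<bar>\<Sum>a\<in>UNIV. \<alpha> a a\<bar> \<le> s\<^sup>2 * s * (?d * L)" using s e by (intro mult_mono) auto
    then show ?thesis using e by (simp add: abs_mult power2_eq_square power3_eq_cube ac_simps)
  qed
  have "s ^ 3 * L * (step_const + cube_const + ?d) = s ^ 3 * L * step_const + L * (cube_const * s ^ 3) + s ^ 3 * L * ?d"
    by (simp add: algebra_simps)
  moreover have "s\<^sup>2 / 2 * (T + U) = s\<^sup>2 / 2 * T + s\<^sup>2 * U / 2" by (simp add: distrib_left)
  ultimately show ?thesis unfolding \<alpha>_def[symmetric] T_def[symmetric] using 1 2 3 S by linarith
qed

theorem lindeberg:
  fixes h :: "real ^ 'd \<Rightarrow> real"
  assumes h: "C3 L h G A"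
  shows "\<exists>C. \<forall>N\<ge>1. \<forall>S. (\<forall>a b. S $ a $ b = (\<integral>\<omega>. R N (1 / sqrt (real N)) 0 \<omega> $ a * R N (1 / sqrt (real N)) 0 \<omega> $ b \<partial>M))
    \<longrightarrow> positive_definite S \<longrightarrow>
    \<bar>(\<integral>\<omega>. h (R N (1 / sqrt (real N)) 0 \<omega>) \<partial>M) - (\<integral>x. h x \<partial>centered_normal S)\<bar> \<le> C / sqrt (real N)"
proof (intro exI allI impI)
  fix N :: nat and S :: "real ^ 'd ^ 'd"
  assume N: "1 \<le> N" and S: "\<forall>a b. S $ a $ b = (\<integral>\<omega>. R N (1 / sqrt (real N)) 0 \<omega> $ a * R N (1 / sqrt (real N)) 0 \<omega> $ b \<partial>M)"
    and pd: "positive_definite S"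
  define s where "s = 1 / sqrt (real N)"
  define \<epsilon> where "\<epsilon> = 1 / real N"
  let ?d = "real CARD('d)"
  have s: "0 < s" "s \<le> 1" and s2: "s\<^sup>2 = \<epsilon>" and Ns: "real N * s\<^sup>2 = 1"
    using N by (auto simp: s_def \<epsilon>_def power_divide)
  have ss: "s\<^sup>2 \<le> s" using s mult_left_le[of s s] by (simp add: power2_eq_square)
  have e: "0 < \<epsilon>" "\<epsilon> \<le> s" "\<epsilon> \<le> 1" using s ss s2 zero_less_power[OF s(1), of 2] by auto
  have L0: "0 \<le> L" by (rule C3D(1)[OF h])
  have "\<forall>i. \<exists>P. stein (increment_cov s \<epsilon> i) P \<and> (\<integral>z. norm z ^ 3 \<partial>P) \<le> cube_const * s ^ 3"
    using gaussian_increment_exists[OF s(1) e(1,3)] by (rule allI)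
  from choice[OF this] obtain P where P': "\<forall>i. stein (increment_cov s \<epsilon> i) (P i) \<and> (\<integral>z. norm z ^ 3 \<partial>P i) \<le> cube_const * s ^ 3" ..
  then have P: "stein (increment_cov s \<epsilon> i) (P i)" "(\<integral>z. norm z ^ 3 \<partial>P i) \<le> cube_const * s ^ 3" for i by auto
  define Q where "Q = rec_nat (return borel 0) (\<lambda>i q. convol q (P i))"
  have Q0: "Q 0 = return borel 0" and QS: "Q (Suc i) = convol (Q i) (P i)" for i by (simp_all add: Q_def)
  have Q: "stein (\<Sum>j<i. increment_cov s \<epsilon> j) (Q i)" for i
    by (induction i) (simp_all add: Q0 QS stein_return_0 stein_convol P)
  define H where "H i x = (\<integral>z. h (x + z) \<partial>Q i)" for i x
  define B where "B i a b x = (\<integral>z. A a b (x + z) \<partial>Q i)" for i a b x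
  define G' where "G' i a x = (\<integral>z. G a (x + z) \<partial>Q i)" for i a x
  have HC: "C3 L (H i) (G' i) (B i)" for i
    unfolding H_def[abs_def] B_def[abs_def] G'_def[abs_def] by (rule C3_average[OF Q h])
  have H_Suc: "H (Suc i) x = (\<integral>z. H i (x + z) \<partial>P i)" for i x
    unfolding H_def QS
    by (rule convol_integral[OF Q P(1) C11_measurable(1)[OF C3_C11[OF h]] C3_integrable(1)[OF stein_convol[OF Q P(1)] h]])
  have B_Suc: "B (Suc i) a b x = (\<integral>z. B i a b (x + z) \<partial>P i)" for i a b x
    unfolding B_def QS
    by (rule convol_integral[OF Q P(1) C11_measurable(2)[OF C3D(4)[OF h]] C3_integrable(3)[OF stein_convol[OF Q P(1)] h]])
  note BC = C11D[OF C3D(4)[OF HC]]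
  have RM: "(\<lambda>\<omega>. f (R N s k \<omega>)) \<in> borel_measurable M" if "f \<in> borel_measurable borel" for f :: "real ^ 'd \<Rightarrow> real" and k
    by (rule F_M[OF C11_R_meas[OF that order_refl]])
  have iB: "integrable M (\<lambda>\<omega>. B i a b (R N s k \<omega>))" for i a b k
    by (rule integrable_bounded[OF RM[OF C11_measurable(2)[OF C3D(4)[OF HC]]] BC(4)])
  define \<alpha> where "\<alpha> a b i = (\<integral>\<omega>. B i a b (R N s (Suc i) \<omega>) \<partial>M)" for a b i
  define f where "f i = (\<integral>\<omega>. H i (R N s i \<omega>) \<partial>M)" for i
  let ?E = "s ^ 3 * L * (step_const + cube_const + ?d)"
  have step: "\<bar>f i - f (Suc i) - s\<^sup>2 / 2 * (\<Sum>a\<in>UNIV. \<Sum>b\<in>UNIV. \<alpha> a b i * (\<tau> N (Suc i) a b - \<tau> N i a b))\<bar> \<le> ?E" if "i < N" for i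
    unfolding f_def \<alpha>_def H_Suc by (rule lindeberg_step[OF HC P that s(1) e(1,2)])
  have f0: "f 0 = (\<integral>\<omega>. h (R N s 0 \<omega>) \<partial>M)"
  proof -
    have "H 0 x = h x" for x
    proof -
      have [measurable]: "h \<in> borel_measurable borel" by (rule C11_measurable(1)[OF C3_C11[OF h]])
      show ?thesis unfolding H_def Q0 by (subst integral_return) auto
    qed
    then show ?thesis by (simp add: f_def)
  qed
  have fN: "f N = (\<integral>x. h x \<partial>Q N)" by (simp add: f_def R_N H_def prob_space)
  define T where "T = 6 * K * W1\<^sup>2"
  define D' where "D' = L * (s * (K + 1 + cube_const))"
  have T0: "0 \<le> T" unfolding T_def using K_nonneg by simp
  have D0: "0 \<le> D'" unfolding D'_def using L0 s K_nonneg cube_const_nonneg by simp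
  have ab: "\<bar>\<alpha> a b i\<bar> \<le> L" for a b i unfolding \<alpha>_def by (rule abs_integral_le[OF iB BC(4)])
  have ad: "\<bar>\<alpha> a b (Suc i) - \<alpha> a b i\<bar> \<le> D'" if i: "Suc i < N" for a b i
  proof -
    have "\<alpha> a b (Suc i) - \<alpha> a b i = (\<integral>\<omega>. B (Suc i) a b (R N s (Suc (Suc i)) \<omega>) - B i a b (R N s (Suc i) \<omega>) \<partial>M)"
      unfolding \<alpha>_def by (rule Bochner_Integration.integral_diff[OF iB iB, symmetric])
    also have "\<bar>\<dots>\<bar> \<le> D'"
    proof (rule abs_integral_le)
      show "integrable M (\<lambda>\<omega>. B (Suc i) a b (R N s (Suc (Suc i)) \<omega>) - B i a b (R N s (Suc i) \<omega>))"
        by (rule Bochner_Integration.integrable_diff[OF iB iB])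
      fix \<omega>
      let ?x = "R N s (Suc (Suc i)) \<omega>"
      interpret P: prob_space "P i" by (rule steinD[OF P(1)])
      have iP: "integrable (P i) (\<lambda>z. B i a b (?x + z))" by (rule C3_integrable(3)[OF P(1) HC])
      have "B (Suc i) a b ?x - B i a b ?x = (\<integral>z. B i a b (?x + z) - B i a b ?x \<partial>P i)"
        unfolding B_Suc using iP by (simp add: P.prob_space)
      also have "\<bar>\<dots>\<bar> \<le> (\<integral>z. L * norm z \<partial>P i)"
      proof (rule order_trans[OF integral_abs_bound integral_mono])
        show "integrable (P i) (\<lambda>z. \<bar>B i a b (?x + z) - B i a b ?x\<bar>)" using iP by auto
        show "integrable (P i) (\<lambda>z. L * norm z)" using stein_moments(5)[OF P(1)] by auto
        show "\<bar>B i a b (?x + z) - B i a b ?x\<bar> \<le> L * norm z" for z by (rule BC(5))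
      qed
      also have "\<dots> \<le> L * (s * (1 + cube_const))"
        using stein_first_moment[OF P(1) s(1) P(2)] L0 by (simp add: mult_left_mono)
      finally have 1: "\<bar>B (Suc i) a b ?x - B i a b ?x\<bar> \<le> L * (s * (1 + cube_const))" .
      have "\<bar>B i a b (R N s (Suc i) \<omega>) - B i a b ?x\<bar> \<le> L * norm (s *\<^sub>R X (Suc i) \<omega>)"
        unfolding R_step[OF i] by (rule BC(5))
      also have "\<dots> \<le> L * (s * K)" using R_diff[OF i, of s] s L0 by (intro mult_left_mono) auto
      finally have "\<bar>B i a b (R N s (Suc i) \<omega>) - B i a b ?x\<bar> \<le> L * (s * K)" .
      moreover have "D' = L * (s * (1 + cube_const)) + L * (s * K)" by (simp add: D'_def algebra_simps)
      ultimately show "\<bar>B (Suc i) a b ?x - B i a b (R N s (Suc i) \<omega>)\<bar> \<le> D'" using 1 by linarith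
    qed
    finally show ?thesis .
  qed
  have abel: "\<bar>\<Sum>i<N. \<alpha> a b i * (\<tau> N (Suc i) a b - \<tau> N i a b)\<bar> \<le> T * (L + real N * D')" for a b
    by (rule abel_bound[where \<alpha>="\<alpha> a b" and \<tau>="\<lambda>i. \<tau> N i a b"]) (use tau_0 tau_bound ab ad D0 in \<open>auto simp: T_def\<close>)
  define Z where "Z = (\<Sum>a\<in>UNIV. \<Sum>b\<in>UNIV. \<Sum>i<N. \<alpha> a b i * (\<tau> N (Suc i) a b - \<tau> N i a b))"
  have "\<bar>Z\<bar> \<le> (\<Sum>a\<in>(UNIV :: 'd set). \<Sum>b\<in>(UNIV :: 'd set). T * (L + real N * D'))"
    unfolding Z_def by (rule order_trans[OF sum_abs], rule sum_mono, rule order_trans[OF sum_abs], rule sum_mono, rule abel)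
  then have Zb: "\<bar>Z\<bar> \<le> ?d\<^sup>2 * (T * (L + real N * D'))" by (simp add: power2_eq_square mult.assoc)
  have "\<bar>f 0 - f N - s\<^sup>2 / 2 * Z\<bar> \<le> (\<Sum>i<N. ?E)"
  proof -
    have "(\<Sum>i<N. \<Sum>a\<in>UNIV. \<Sum>b\<in>UNIV. \<alpha> a b i * (\<tau> N (Suc i) a b - \<tau> N i a b)) = Z"
      unfolding Z_def by (subst sum.swap, rule sum.cong[OF refl], rule sum.swap)
    moreover have "f 0 - f N = (\<Sum>i<N. f i - f (Suc i))" by (rule sum_lessThan_telescope'[symmetric])
    ultimately have "f 0 - f N - s\<^sup>2 / 2 * Z
      = (\<Sum>i<N. f i - f (Suc i) - s\<^sup>2 / 2 * (\<Sum>a\<in>UNIV. \<Sum>b\<in>UNIV. \<alpha> a b i * (\<tau> N (Suc i) a b - \<tau> N i a b)))"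
      by (simp only: sum_subtractf sum_distrib_left[symmetric])
    also have "\<bar>\<dots>\<bar> \<le> (\<Sum>i<N. ?E)" by (rule order_trans[OF sum_abs], rule sum_mono, rule step) simp
    finally show ?thesis .
  qed
  also have "(\<Sum>i<N. ?E) = s * (L * (step_const + cube_const + ?d))"
  proof -
    have "(\<Sum>i<N. ?E) = (real N * s\<^sup>2) * (s * (L * (step_const + cube_const + ?d)))"
      by (simp add: power2_eq_square power3_eq_cube ac_simps)
    then show ?thesis unfolding Ns by simp
  qed
  finally have A1: "\<bar>f 0 - f N - s\<^sup>2 / 2 * Z\<bar> \<le> s * (L * (step_const + cube_const + ?d))" .
  have A2: "\<bar>s\<^sup>2 / 2 * Z\<bar> \<le> s * (?d\<^sup>2 * (T * (L * (K + 2 + cube_const))))"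
  proof -
    have "\<bar>s\<^sup>2 / 2 * Z\<bar> \<le> s\<^sup>2 * \<bar>Z\<bar>" by (simp add: abs_mult)
    also have "\<dots> \<le> s\<^sup>2 * (?d\<^sup>2 * (T * (L + real N * D')))" using Zb by (rule mult_left_mono) simp
    also have "\<dots> = ?d\<^sup>2 * (T * (s\<^sup>2 * L + (real N * s\<^sup>2) * D'))" by (simp add: algebra_simps)
    also have "\<dots> = ?d\<^sup>2 * (T * (s\<^sup>2 * L + D'))" unfolding Ns by simp
    also have "\<dots> \<le> ?d\<^sup>2 * (T * (s * L + D'))"
      using T0 L0 ss by (intro mult_left_mono add_right_mono mult_right_mono) auto
    also have "\<dots> = s * (?d\<^sup>2 * (T * (L * (K + 2 + cube_const))))" by (simp add: D'_def algebra_simps)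
    finally show ?thesis .
  qed
  have A3: "\<bar>f N - (\<integral>x. h x \<partial>centered_normal S)\<bar> \<le> s * (2 * L * (?d\<^sup>2 * (2 * K * W1\<^sup>2 + 1)))"
  proof -
    have en: "\<bar>(\<Sum>j<N. increment_cov s \<epsilon> j) $ a $ b - S $ a $ b\<bar> \<le> s * (2 * K * W1\<^sup>2 + 1)" for a b
    proof -
      have "S $ a $ b = (\<integral>\<omega>. s\<^sup>2 * (\<Sum>i<N. \<Sum>k<N. X i \<omega> $ a * X k \<omega> $ b) \<partial>M)"
        unfolding S[rule_format] s_def[symmetric] R_def
        by (simp add: power2_eq_square sum_product ac_simps lessThan_atLeast0)
      also have "\<dots> = s\<^sup>2 * (\<Sum>i<N. \<Sum>k<N. cov i k a b)"
      proof -
        have "integrable M (\<lambda>\<omega>. X i \<omega> $ a * X k \<omega> $ b)" for i k by (rule integrable_bounded[OF _ XX_bound]) measurable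
        then show ?thesis by (simp add: cov_def)
      qed
      finally have Sab: "S $ a $ b = s\<^sup>2 * (\<Sum>i<N. \<Sum>k<N. cov i k a b)" .
      have "(\<Sum>j<N. increment_cov s \<epsilon> j) $ a $ b = s\<^sup>2 * ((\<Sum>j<N. V j a b) + real N * (if a = b then \<epsilon> else 0))"
        by (simp add: increment_cov_def sum.distrib sum_distrib_left[symmetric])
      also have "\<dots> = s\<^sup>2 * (\<Sum>j<N. V j a b) + s\<^sup>2 * (if a = b then 1 else 0)"
        using N by (simp add: \<epsilon>_def distrib_left)
      finally have "(\<Sum>j<N. increment_cov s \<epsilon> j) $ a $ b - S $ a $ b = s\<^sup>2 * ((if a = b then 1 else 0) - q N a b)"
        unfolding Sab V_sum by (simp add: algebra_simps)
      then have "\<bar>(\<Sum>j<N. increment_cov s \<epsilon> j) $ a $ b - S $ a $ b\<bar> = s\<^sup>2 * \<bar>(if a = b then 1 else 0) - q N a b\<bar>"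
        by (simp add: abs_mult)
      also have "\<dots> \<le> s * (2 * K * W1\<^sup>2 + 1)"
        using q_bound[of N a b] ss s by (intro mult_mono) auto
      finally show ?thesis .
    qed
    have "\<bar>f N - (\<integral>x. h x \<partial>centered_normal S)\<bar>
      \<le> 2 * L * (\<Sum>a\<in>UNIV. \<Sum>b\<in>UNIV. \<bar>(\<Sum>j<N. increment_cov s \<epsilon> j) $ a $ b - S $ a $ b\<bar>)"
      unfolding fN by (rule stein_comparison[OF Q stein_centered_normal[OF pd] h])
    also have "\<dots> \<le> 2 * L * (\<Sum>a\<in>(UNIV :: 'd set). \<Sum>b\<in>(UNIV :: 'd set). s * (2 * K * W1\<^sup>2 + 1))"
      using L0 by (intro mult_left_mono sum_mono en) auto
    also have "\<dots> = s * (2 * L * (?d\<^sup>2 * (2 * K * W1\<^sup>2 + 1)))" by (simp add: power2_eq_square ac_simps)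
    finally show ?thesis .
  qed
  have "\<bar>f 0 - (\<integral>x. h x \<partial>centered_normal S)\<bar>
    \<le> s * (L * (step_const + cube_const + ?d)) + s * (?d\<^sup>2 * (T * (L * (K + 2 + cube_const)))) + s * (2 * L * (?d\<^sup>2 * (2 * K * W1\<^sup>2 + 1)))"
    using A1 A2 A3 by linarith
  also have "\<dots> = (L * (step_const + cube_const + ?d) + ?d\<^sup>2 * (6 * K * W1\<^sup>2 * (L * (K + 2 + cube_const)))
    + 2 * L * (?d\<^sup>2 * (2 * K * W1\<^sup>2 + 1))) / sqrt (real N)"
    by (simp only: T_def s_def distrib_left[symmetric]) simp
  finally show "\<bar>(\<integral>\<omega>. h (R N (1 / sqrt (real N)) 0 \<omega>) \<partial>M) - (\<integral>x. h x \<partial>centered_normal S)\<bar>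
    \<le> (L * (step_const + cube_const + ?d) + ?d\<^sup>2 * (6 * K * W1\<^sup>2 * (L * (K + 2 + cube_const)))
    + 2 * L * (?d\<^sup>2 * (2 * K * W1\<^sup>2 + 1))) / sqrt (real N)"
    unfolding f0 s_def .
qed

end

section \<open>Application to intermittent maps\<close>

lemma leb01_density:
  fixes g :: "real \<Rightarrow> real"
  assumes \<mu>: "\<mu> = density leb01 (\<lambda>x. ennreal (g x))" and i: "integrable leb01 g" and nn: "\<forall>x\<in>{0<..1}. 0 \<le> g x"
  defines "g' \<equiv> \<lambda>x. indicator {0<..1} x * g x"
  shows "g' \<in> borel_measurable borel" "integrable lborel g'" "0 \<le> g' x"
    and "\<And>(u :: real \<Rightarrow> 'e::euclidean_space) u'. u' \<in> borel_measurable borel \<Longrightarrow> (\<And>x. x \<in> {0..1} \<Longrightarrow> u x = u' x) \<Longrightarrow>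
      (\<integral>x. u x \<partial>\<mu>) = (\<integral>x. u' x \<partial>density lborel (\<lambda>x. ennreal (g' x)))"
proof -
  have iI: "integrable lborel (\<lambda>x. indicator {0..1} x *\<^sub>R g x)"
    using i unfolding leb01_def by (subst (asm) integrable_restrict_space) auto
  then have [measurable]: "(\<lambda>x. indicator {0..1} x *\<^sub>R g x) \<in> borel_measurable borel" by auto
  have g': "g' = (\<lambda>x. indicator {0<..1} x * (indicator {0..1} x *\<^sub>R g x))" by (auto simp: g'_def indicator_def)
  show gm [measurable]: "g' \<in> borel_measurable borel" unfolding g' by measurable
  show "integrable lborel g'"
  proof (rule Bochner_Integration.integrable_bound[OF iI])
    show "g' \<in> borel_measurable lborel" using gm by simp
    show "AE x in lborel. norm (g' x) \<le> norm (indicator {0..1} x *\<^sub>R g x)" by (auto simp: g'_def indicator_def)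
  qed
  show g0: "0 \<le> g' x" for x using nn by (auto simp: g'_def indicator_def)
  fix u u' :: "real \<Rightarrow> 'e"
  assume [measurable]: "u' \<in> borel_measurable borel" and eq: "\<And>x. x \<in> {0..1} \<Longrightarrow> u x = u' x"
  have sp: "space leb01 = {0..1}" by (simp add: leb01_def)
  have null: "AE x in lborel. x \<noteq> (0::real)" by (rule AE_lborel_singleton)
  have gl [measurable]: "g \<in> borel_measurable leb01" using i by auto
  have ul: "u' \<in> borel_measurable leb01" unfolding leb01_def by (intro measurable_restrict_space1) simp
  have "(\<integral>x. u x \<partial>\<mu>) = (\<integral>x. u' x \<partial>\<mu>)"
    by (rule Bochner_Integration.integral_cong) (auto simp: \<mu> sp eq)
  also have "\<dots> = (\<integral>x. g x *\<^sub>R u' x \<partial>leb01)"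
    unfolding \<mu>
  proof (rule integral_density[OF ul gl])
    have "AE x in lborel. x \<in> {0..1} \<longrightarrow> 0 \<le> g x" using null by eventually_elim (use nn in auto)
    then show "AE x in leb01. 0 \<le> g x" unfolding leb01_def by (subst AE_restrict_space_iff) auto
  qed
  also have "\<dots> = (\<integral>x. indicator {0..1} x *\<^sub>R (g x *\<^sub>R u' x) \<partial>lborel)"
    unfolding leb01_def by (subst integral_restrict_space) auto
  also have "\<dots> = (\<integral>x. g' x *\<^sub>R u' x \<partial>lborel)"
  proof (rule integral_cong_AE)
    have e: "indicator {0..1} x *\<^sub>R (g x *\<^sub>R u' x) = (indicator {0..1} x *\<^sub>R g x) *\<^sub>R u' x" for x by simp
    show "(\<lambda>x. indicator {0..1} x *\<^sub>R (g x *\<^sub>R u' x)) \<in> borel_measurable lborel" unfolding e by measurable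
    show "(\<lambda>x. g' x *\<^sub>R u' x) \<in> borel_measurable lborel" by simp
    show "AE x in lborel. indicator {0..1} x *\<^sub>R (g x *\<^sub>R u' x) = g' x *\<^sub>R u' x"
      using null by eventually_elim (auto simp: g'_def indicator_def)
  qed
  also have "\<dots> = (\<integral>x. u' x \<partial>density lborel (\<lambda>x. ennreal (g' x)))"
    by (rule integral_density[symmetric]) (use g0 in auto)
  finally show "(\<integral>x. u x \<partial>\<mu>) = (\<integral>x. u' x \<partial>density lborel (\<lambda>x. ennreal (g' x)))" .
qed

lemma composed_map_unit_interval:
  assumes "admissible \<beta> \<alpha>" "x \<in> {0..1}"
  shows "composed_map \<alpha> n x \<in> {0..1}"
proof (induction n)
  case (Suc n)
  have step: "intermittent_map a y \<in> {0..1}" if a: "0 \<le> a" and y: "y \<in> {0..1}" for a y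
  proof (cases "y < 1/2")
    case True
    have "2 powr a * y powr a = (2 * y) powr a" using y by (simp add: powr_mult)
    also have "\<dots> \<le> 1" using True y a by (intro powr_le1) auto
    finally have "1 + 2 powr a * y powr a \<le> 2" by simp
    then have "y * (1 + 2 powr a * y powr a) \<le> y * 2" using y by (intro mult_left_mono) auto
    moreover have "0 \<le> y * (1 + 2 powr a * y powr a)" using y by simp
    ultimately show ?thesis using True by (simp add: intermittent_map_def)
  qed (use y in \<open>auto simp: intermittent_map_def\<close>)
  have "0 \<le> \<alpha> (Suc n)" using assms(1) by (auto simp: admissible_def)
  then show ?case using step[OF _ Suc.IH] by simp
qed (use assms in simp)

context neutral_exponent
begin

lemma mixing_system:
  fixes f :: "real \<Rightarrow> real ^ 'd"
  assumes beta: "\<beta> < 1/3" and adm: "admissible \<beta> \<alpha>" and r: "r \<in> cone A" and r1: "(\<integral>x. r x \<partial>lborel) = 1"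
    and f: "\<And>x y. norm (f x - f y) \<le> L * \<bar>x - y\<bar>" "\<And>x. norm (f x) \<le> K" and L0: "0 \<le> L"
  defines "\<nu> \<equiv> density lborel (\<lambda>x. ennreal (r x))"
  shows "\<exists>w. reverse_mixing \<nu> (\<lambda>n. vimage_algebra UNIV (composed_map \<alpha> n) borel)
     (\<lambda>i x. f (composed_map \<alpha> i x) - (\<integral>y. f (composed_map \<alpha> i y) \<partial>\<nu>)) (2 * K) w"
proof -
  have fm [measurable]: "f \<in> borel_measurable borel"
  proof (rule borel_measurable_continuous_onI, rule lipschitz_on_continuous_on)
    show "L-lipschitz_on UNIV f" using f L0 by (auto simp: dist_norm intro!: lipschitz_onI)
  qed
  note [measurable] = coneD(1)[OF r]
  have r0: "0 \<le> r x" for x by (rule coneD(2)[OF r])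
  interpret N: prob_space \<nu>
  proof
    have "emeasure \<nu> (space \<nu>) = (\<integral>\<^sup>+x. ennreal (r x) \<partial>lborel)" by (simp add: \<nu>_def emeasure_density)
    also have "\<dots> = ennreal 1" using nn_integral_eq_integral[OF coneD(7)[OF r]] r0 r1 by simp
    finally show "emeasure \<nu> (space \<nu>) = 1" by simp
  qed
  have sp: "space \<nu> = UNIV" and st: "sets \<nu> = sets borel" by (simp_all add: \<nu>_def)
  note [measurable_cong] = st
  have nu: "(\<integral>x. u x \<partial>\<nu>) = (\<integral>x. u x * r x \<partial>lborel)" if "u \<in> borel_measurable borel" for u :: "real \<Rightarrow> real"
    unfolding \<nu>_def using that r0 by (subst integral_real_density) (auto simp: mult.commute)
  have K0: "0 \<le> K" by (rule order_trans[OF norm_ge_zero f(2)])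
  define m where "m i = (\<integral>y. f (composed_map \<alpha> i y) \<partial>\<nu>)" for i
  have fi: "integrable \<nu> (\<lambda>y. f (composed_map \<alpha> i y))" for i
    by (rule N.integrable_const_bound[where B=K]) (use f(2) in auto)
  have mb: "norm (m i) \<le> K" for i
  proof -
    have "norm (m i) \<le> (\<integral>y. norm (f (composed_map \<alpha> i y)) \<partial>\<nu>)" unfolding m_def by (rule integral_norm_bound)
    also have "\<dots> \<le> K" by (rule N.integral_le_const) (use fi f(2) in auto)
    finally show ?thesis .
  qed
  define u where "u i a y = f y $ a - m i $ a" for i a y
  have u_eq: "u i a y = (f y - m i) $ a" for i a y by (simp add: u_def)
  have ub: "\<bar>u i a y\<bar> \<le> 2 * K" for i a y
  proof -
    have "\<bar>(f y - m i) $ a\<bar> \<le> norm (f y - m i)" by (rule component_le_norm_cart)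
    also have "\<dots> \<le> 2 * K" using norm_triangle_ineq4[of "f y" "m i"] f(2)[of y] mb[of i] by linarith
    finally show ?thesis unfolding u_eq .
  qed
  have um [measurable]: "u i a \<in> borel_measurable borel" for i a unfolding u_def[abs_def] by measurable
  have uo: "observable (2 * K) L (u i a)" for i a
    unfolding observable_def
  proof (intro conjI ballI allI um ub L0)
    fix x y :: real
    have "\<bar>u i a x - u i a y\<bar> = \<bar>(f x - f y) $ a\<bar>" by (simp add: u_def)
    also have "\<dots> \<le> L * \<bar>x - y\<bar>" by (rule order_trans[OF component_le_norm_cart f(1)])
    finally show "\<bar>u i a x - u i a y\<bar> \<le> L * \<bar>x - y\<bar>" .
  qed
  let ?T = "composed_map \<alpha>"
  have mean: "(\<integral>x. u i a (?T i x) \<partial>\<nu>) = 0" for i a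
  proof -
    have "(\<integral>x. f (?T i x) $ a \<partial>\<nu>) = m i $ a"
      unfolding m_def using integral_bounded_linear[OF bounded_linear_vec_nth fi] .
    moreover have "integrable \<nu> (\<lambda>x. f (?T i x) $ a)"
      by (rule integrable_bounded_linear[OF bounded_linear_vec_nth fi])
    ultimately show ?thesis unfolding u_def by (simp add: N.prob_space)
  qed
  define \<alpha>s where "\<alpha>s i = (\<lambda>k. \<alpha> (i + k))" for i
  define s where "s i = transfer_iter \<alpha> i r" for i
  have adms: "admissible \<beta> (\<alpha>s i)" for i unfolding \<alpha>s_def by (rule admissible_shift[OF adm])
  have sc: "s i \<in> cone A" for i unfolding s_def by (rule transfer_iter_cone[OF adm r])
  have s1: "(\<integral>x. s i x \<partial>lborel) = 1" for i
    unfolding s_def using integrable_transfer_iter[OF adm coneD(7)[OF r] coneD(3)[OF r], where n=i] r1 by simp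
  have push: "(\<integral>x. v (?T i x) \<partial>\<nu>) = (\<integral>y. v y * s i y \<partial>lborel)" if "v \<in> borel_measurable borel" "\<And>y. \<bar>v y\<bar> \<le> c" for v i c
  proof -
    note [measurable] = that(1)
    have "(\<integral>x. v (?T i x) \<partial>\<nu>) = (\<integral>x. v (?T i x) * r x \<partial>lborel)" by (rule nu) measurable
    then show ?thesis unfolding s_def using integral_transfer_iter[OF adm that(1) coneD(7)[OF r] that(2) coneD(3)[OF r], of i] by simp
  qed
  have T_add: "?T j x = composed_map (\<alpha>s i) (j - i) (?T i x)" if "i \<le> j" for i j x
    using composed_map_add[of \<alpha> i "j - i" x] that by (simp add: \<alpha>s_def)
  have us: "(\<integral>y. u i a y * s i y \<partial>lborel) = 0" for i a using push[OF um ub, of i a i] mean[of i a] by simp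
  define C where "C = max (loss_const * (mult_const (2 * K) L * A)) (loss_const * ((2 * (mult_const (2 * K) L)\<^sup>2 + (2 * K)\<^sup>2) * A))"
  have C2: "loss_const * ((2 * (mult_const (2 * K) L)\<^sup>2 + (2 * K)\<^sup>2) * A) \<le> C" "loss_const * (mult_const (2 * K) L * A) \<le> C"
    by (simp_all add: C_def)
  have C0: "0 \<le> C"
  proof -
    have "0 \<le> s 0 1" by (rule coneD(2)[OF sc])
    also have "s 0 1 \<le> A" using coneD(6)[OF sc, of 1 0] by simp
    finally have "0 \<le> A" .
    then have "0 \<le> loss_const * ((2 * (mult_const (2 * K) L)\<^sup>2 + (2 * K)\<^sup>2) * A)"
      using loss_const_pos by (intro mult_nonneg_nonneg) auto
    then show ?thesis using C2(1) by linarith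
  qed
  define w where "w l = sqrt C * (max 1 (real l)) powr (- rate / 2)" for l :: nat
  have w2: "(w l)\<^sup>2 = C * real l powr (- rate)" if "0 < l" for l
  proof -
    have "max 1 (real l) = real l" using that by simp
    moreover have "(real l powr (- rate / 2))\<^sup>2 = real l powr (- rate)"
      by (simp add: power2_eq_square flip: powr_add)
    ultimately show ?thesis using C0 by (simp add: w_def power_mult_distrib)
  qed
  have rate2: "2 < rate" using beta beta_pos by (simp add: rate_def field_simps)
  let ?F = "\<lambda>n. vimage_algebra UNIV (?T n) borel" and ?X = "\<lambda>i x. f (?T i x) - m i"
  have "reverse_mixing \<nu> ?F ?X (2 * K) w"
  proof (rule reverse_mixing.intro[OF N.prob_space_axioms], rule reverse_mixing_axioms.intro)
    have pre: "?T n -` Bs \<in> sets borel" if "Bs \<in> sets borel" for n Bs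
      using measurable_sets[OF composed_map_measurable that, of \<alpha> n] by simp
    show "subalgebra \<nu> (?F n)" for n
      unfolding subalgebra_def sp st using pre by (auto simp: sets_vimage_algebra2)
    show "subalgebra (?F n) (?F (Suc n))" for n
    proof -
      have "?T (Suc n) -` Bs \<in> sets (?F n)" if "Bs \<in> sets borel" for Bs
      proof -
        have "?T (Suc n) -` Bs = ?T n -` (intermittent_map (\<alpha> (Suc n)) -` Bs)" by auto
        moreover have "intermittent_map (\<alpha> (Suc n)) -` Bs \<in> sets borel"
          using measurable_sets[OF intermittent_measurable that] by simp
        ultimately show ?thesis by (auto simp: sets_vimage_algebra2)
      qed
      then show ?thesis unfolding subalgebra_def by (auto simp: sets_vimage_algebra2 simp del: composed_map.simps)
    qed
    show "?X n \<in> borel_measurable (?F n)" for n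
    proof -
      have "?T n \<in> measurable (?F n) borel" by (rule measurable_vimage_algebra1) simp
      then show ?thesis by measurable
    qed
    show "norm (?X n x) \<le> 2 * K" for n x
      using norm_triangle_ineq4[of "f (?T n x)" "m n"] f(2)[of "?T n x"] mb[of n] by linarith
    show "(\<integral>x. ?X n x $ a \<partial>\<nu>) = 0" for n a using mean[of n a] by (simp only: u_eq)
    fix n and E assume "E \<in> sets (?F n)"
    then obtain Bs where Bs: "Bs \<in> sets borel" "E = ?T n -` Bs" by (auto simp: sets_vimage_algebra2)
    note [measurable] = Bs(1)
    have ind: "indicator E x = (indicator Bs (?T n x) :: real)" for x by (simp add: Bs(2) indicator_def)
    show "\<bar>\<integral>x. ?X i x $ a * indicator E x \<partial>\<nu>\<bar> \<le> (w (n - i))\<^sup>2" if "i < n" for i a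
    proof -
      define v where "v y = u i a y * indicator Bs (composed_map (\<alpha>s i) (n - i) y)" for y
      have "(\<integral>x. ?X i x $ a * indicator E x \<partial>\<nu>) = (\<integral>x. v (?T i x) \<partial>\<nu>)"
        unfolding v_def ind using T_add[of i n] that by (simp add: u_eq)
      also have "\<dots> = (\<integral>y. v y * s i y \<partial>lborel)"
      proof (rule push)
        show "v \<in> borel_measurable borel" unfolding v_def[abs_def] by measurable
        show "\<bar>v y\<bar> \<le> 2 * K" for y using ub[of i a y] K0 by (auto simp: v_def indicator_def)
      qed
      also have "\<dots> = (\<integral>y. indicator Bs (composed_map (\<alpha>s i) (n - i) y) * (u i a y * s i y) \<partial>lborel)"
        by (simp add: v_def ac_simps)
      also have "\<bar>\<dots>\<bar> \<le> loss_const * (mult_const (2 * K) L * A) * real (n - i) powr (- rate)"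
        by (rule decorrelation_one[OF adms sc uo us]) (use that in \<open>auto simp: indicator_def\<close>)
      also have "\<dots> \<le> C * real (n - i) powr (- rate)" using C2 by (intro mult_right_mono) auto
      also have "\<dots> = (w (n - i))\<^sup>2" using that by (simp add: w2)
      finally show ?thesis .
    qed
    show "\<bar>\<integral>x. (?X i x $ a * ?X j x $ b - (\<integral>x. ?X i x $ a * ?X j x $ b \<partial>\<nu>)) * indicator E x \<partial>\<nu>\<bar> \<le> (w (n - j))\<^sup>2"
      if "i \<le> j" "j < n" for i j a b
    proof -
      define c where "c = (\<integral>x. ?X i x $ a * ?X j x $ b \<partial>\<nu>)"
      define p where "p y = u i a y * u j b (composed_map (\<alpha>s i) (j - i) y)" for y
      have pm [measurable]: "p \<in> borel_measurable borel" unfolding p_def[abs_def] by measurable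
      have pb: "\<bar>p y\<bar> \<le> 2 * K * (2 * K)" for y unfolding p_def abs_mult using ub K0 by (intro mult_mono) auto
      have pX: "?X i x $ a * ?X j x $ b = p (?T i x)" for x
        unfolding p_def u_eq T_add[OF that(1), of x] ..
      have c: "c = (\<integral>y. u i a y * u j b (composed_map (\<alpha>s i) (j - i) y) * s i y \<partial>lborel)"
        unfolding c_def pX push[OF pm pb] unfolding p_def ..
      have cb: "\<bar>c\<bar> \<le> 2 * K * (2 * K)"
        unfolding c_def pX by (rule N.abs_integral_le[OF N.integrable_const_bound[where B="2 * K * (2 * K)"]]) (use pb in auto)
      define v where "v y = (p y - c) * indicator Bs (composed_map (\<alpha>s i) ((j - i) + (n - j)) y)" for y
      have nji: "(j - i) + (n - j) = n - i" using that by simp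
      have "(\<integral>x. (?X i x $ a * ?X j x $ b - c) * indicator E x \<partial>\<nu>) = (\<integral>x. v (?T i x) \<partial>\<nu>)"
        unfolding v_def ind pX nji using T_add[of i n] that by simp
      also have "\<dots> = (\<integral>y. v y * s i y \<partial>lborel)"
      proof (rule push)
        show "v \<in> borel_measurable borel" unfolding v_def[abs_def] by measurable
        show "\<bar>v y\<bar> \<le> 2 * (2 * K * (2 * K))" for y
          using pb[of y] cb K0 by (auto simp: v_def indicator_def)
      qed
      also have "\<dots> = (\<integral>y. indicator Bs (composed_map (\<alpha>s i) ((j - i) + (n - j)) y)
          * ((u i a y * u j b (composed_map (\<alpha>s i) (j - i) y) - c) * s i y) \<partial>lborel)"
        by (simp add: v_def p_def ac_simps)
      also have "\<bar>\<dots>\<bar> \<le> loss_const * ((2 * (mult_const (2 * K) L)\<^sup>2 + (2 * K)\<^sup>2) * A) * real (n - j) powr (- rate)"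
        by (rule decorrelation_two[OF adms sc s1 uo uo _ _ _ c]) (use that in \<open>auto simp: indicator_def\<close>)
      also have "\<dots> \<le> C * real (n - j) powr (- rate)" using C2 by (intro mult_right_mono) auto
      also have "\<dots> = (w (n - j))\<^sup>2" using that by (simp add: w2)
      finally show ?thesis unfolding c_def .
    qed
  next
    show "0 \<le> w l" for l using C0 by (simp add: w_def)
    show "w k \<le> w l" if "l \<le> k" for l k
      unfolding w_def using C0 that rate2 by (intro mult_left_mono powr_mono2') auto
    have "summable (\<lambda>l. sqrt C * real l powr (- rate / 2))"
      by (rule summable_mult, subst summable_real_powr_iff) (use rate2 in simp)
    then show "summable w"
    proof (rule summable_cong[THEN iffD1, rotated])
      show "\<forall>\<^sub>F l in sequentially. sqrt C * real l powr (- rate / 2) = w l"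
        using eventually_gt_at_top[of 0] by eventually_elim (simp add: w_def)
    qed
  qed
  then show ?thesis unfolding m_def by blast
qed

end

theorem theorem2p1:
  fixes \<beta> :: real and \<alpha> :: "nat \<Rightarrow> real" and \<mu> :: "real measure"
    and g :: "real \<Rightarrow> real" and f :: "real \<Rightarrow> real ^ 'd" and h :: "real ^ 'd \<Rightarrow> real"
  assumes "0 < \<beta>" and "\<beta> < 1/3"
    and "admissible \<beta> \<alpha>"
    and "prob_space \<mu>" and "g \<in> C_star \<beta>" and "\<mu> = density leb01 (\<lambda>x. ennreal (g x))"
    and "\<exists>L. L-lipschitz_on {0..1} f"
    and "three_times_differentiable h"
    and "(MAX k\<in>{1,2,3}. D_norm k h) < \<infinity>"
  shows "\<exists>C>0. \<forall>N\<ge>2. positive_definite (Sigma_mat \<alpha> \<mu> f N) \<longrightarrow>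
     \<bar>(LINT x|\<mu>. h (W_sum \<alpha> \<mu> f N x)) - Phi (Sigma_mat \<alpha> \<mu> f N) h\<bar>
       \<le> C * real N powr (\<beta> - 1/2) * ln (real N) powr (1 / \<beta>)"
proof -
  interpret neutral_exponent \<beta> using assms(1,2) by unfold_locales auto
  obtain L where L: "L-lipschitz_on {0..1} f" using assms(7) by blast
  have L0: "0 \<le> L" by (rule lipschitz_on_nonneg[OF L])
  define f' where "f' x = f (max 0 (min 1 x))" for x
  have f'_eq: "f' x = f x" if "x \<in> {0..1}" for x using that by (simp add: f'_def)
  have f'_lip: "norm (f' x - f' y) \<le> L * \<bar>x - y\<bar>" for x y
  proof -
    have "norm (f' x - f' y) \<le> L * dist (max 0 (min 1 x)) (max 0 (min 1 y))"
      unfolding f'_def dist_norm[symmetric] by (rule lipschitz_onD[OF L]) auto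
    also have "\<dots> \<le> L * \<bar>x - y\<bar>" using L0 by (intro mult_left_mono) (auto simp: dist_real_def)
    finally show ?thesis .
  qed
  have f'_bound: "norm (f' x) \<le> norm (f 0) + L" for x
  proof -
    have "norm (f' x - f 0) \<le> L * dist (max 0 (min 1 x)) 0"
      unfolding f'_def dist_norm[symmetric] by (rule lipschitz_onD[OF L]) auto
    also have "\<dots> \<le> L * 1" using L0 by (intro mult_left_mono) (auto simp: dist_real_def)
    finally show ?thesis using norm_triangle_sub[of "f' x" "f 0"] by simp
  qed
  have f'm [measurable]: "f' \<in> borel_measurable borel"
  proof (rule borel_measurable_continuous_onI, rule lipschitz_on_continuous_on)
    show "L-lipschitz_on UNIV f'" using f'_lip L0 by (auto simp: dist_norm intro!: lipschitz_onI)
  qed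
  define r where "r x = indicator {0<..1} x * g x" for x
  define \<nu> where "\<nu> = density lborel (\<lambda>x. ennreal (r x))"
  have gi: "integrable leb01 g" and g0: "\<forall>x\<in>{0<..1}. 0 \<le> g x" using assms(5) by (auto simp: C_star_def)
  note dens = leb01_density[OF assms(6) gi g0, folded r_def]
  note int_eq = dens(4)[folded \<nu>_def]
  have "\<exists>A. r \<in> cone A"
    by (rule C_star_cone[OF assms(5) dens(1) _ _ dens(2)]) (simp_all add: r_def)
  then obtain A where A: "r \<in> cone A" ..
  have r1: "(\<integral>x. r x \<partial>lborel) = 1"
  proof -
    interpret P: prob_space \<mu> by (rule assms(4))
    have "(1 :: real) = (\<integral>x. 1 \<partial>\<mu>)" by (simp add: P.prob_space)
    also have "\<dots> = (\<integral>x. 1 \<partial>\<nu>)" by (rule int_eq) auto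
    also have "\<dots> = (\<integral>x. r x *\<^sub>R 1 \<partial>lborel)" unfolding \<nu>_def by (rule integral_density) (use dens(1,3) in auto)
    finally show ?thesis by simp
  qed
  obtain w where "reverse_mixing \<nu> (\<lambda>n. vimage_algebra UNIV (composed_map \<alpha> n) borel)
     (\<lambda>i x. f' (composed_map \<alpha> i x) - (\<integral>y. f' (composed_map \<alpha> i y) \<partial>\<nu>)) (2 * (norm (f 0) + L)) w"
    using mixing_system[OF assms(2,3) A r1 f'_lip f'_bound L0] unfolding \<nu>_def by blast
  then interpret RM: reverse_mixing \<nu> "\<lambda>n. vimage_algebra UNIV (composed_map \<alpha> n) borel"
     "\<lambda>i x. f' (composed_map \<alpha> i x) - (\<integral>y. f' (composed_map \<alpha> i y) \<partial>\<nu>)" "2 * (norm (f 0) + L)" w .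
  define Rs where "Rs N = RM.R N (1 / sqrt (real N)) 0" for N
  obtain M G H where h: "C3 M h G H" using three_times_differentiable_C3[OF assms(8,9)] by blast
  obtain C where C: "\<And>N S. 1 \<le> N \<Longrightarrow> (\<And>a b. S $ a $ b = (\<integral>x. Rs N x $ a * Rs N x $ b \<partial>\<nu>)) \<Longrightarrow> positive_definite S \<Longrightarrow>
      \<bar>(\<integral>x. h (Rs N x) \<partial>\<nu>) - (\<integral>x. h x \<partial>centered_normal S)\<bar> \<le> C / sqrt (real N)"
    using RM.lindeberg[OF h] unfolding Rs_def by blast
  have unit: "composed_map \<alpha> i x \<in> {0..1}" if "x \<in> {0..1}" for i x
    by (rule composed_map_unit_interval[OF assms(3) that])
  have Rs_meas [measurable]: "Rs N \<in> borel_measurable borel" for N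
  proof -
    have "Rs N \<in> borel_measurable \<nu>" unfolding Rs_def by (rule measurable_from_subalg[OF RM.sub RM.R_meas[OF order_refl]])
    then show ?thesis by (simp add: \<nu>_def)
  qed
  have W: "W_sum \<alpha> \<mu> f N x = Rs N x" if "x \<in> {0..1}" for N x
  proof -
    have "(\<integral>y. f (composed_map \<alpha> i y) \<partial>\<mu>) = (\<integral>y. f' (composed_map \<alpha> i y) \<partial>\<nu>)" for i
      by (rule int_eq) (use unit f'_eq in \<open>simp_all\<close>)
    then show ?thesis unfolding W_sum_def Rs_def RM.R_def using unit[OF that] f'_eq by (simp add: lessThan_atLeast0)
  qed
  have hW: "(\<integral>x. h (W_sum \<alpha> \<mu> f N x) \<partial>\<mu>) = (\<integral>x. h (Rs N x) \<partial>\<nu>)" for N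
    using C11_measurable(1)[OF C3_C11[OF h]] W by (intro int_eq) auto
  have Sig: "Sigma_mat \<alpha> \<mu> f N $ a $ b = (\<integral>x. Rs N x $ a * Rs N x $ b \<partial>\<nu>)" for N a b
  proof -
    have cont: "continuous_on UNIV (\<lambda>v :: real ^ 'd. outer v v)" unfolding outer_def by (intro continuous_intros)
    have om: "(\<lambda>x. outer (Rs N x) (Rs N x)) \<in> borel_measurable borel"
      by (rule measurable_compose[OF Rs_meas borel_measurable_continuous_onI[OF cont]])
    have S: "Sigma_mat \<alpha> \<mu> f N = (\<integral>x. outer (Rs N x) (Rs N x) \<partial>\<nu>)"
      unfolding Sigma_mat_def by (rule int_eq[OF om]) (simp add: W)
    obtain c where c: "norm (Rs N x) \<le> c" for x
    proof
      fix x
      have "norm (\<Sum>k\<in>{0..<N}. f' (composed_map \<alpha> k x) - (\<integral>y. f' (composed_map \<alpha> k y) \<partial>\<nu>)) \<le> (\<Sum>k\<in>{0..<N}. 2 * (norm (f 0) + L))"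
        by (rule order_trans[OF norm_sum sum_mono[OF RM.X_bound]])
      then show "norm (Rs N x) \<le> 1 / sqrt (real N) * (\<Sum>k\<in>{0..<N}. 2 * (norm (f 0) + L))"
        unfolding Rs_def RM.R_def by (simp add: divide_right_mono)
    qed
    have i: "integrable \<nu> (\<lambda>x. outer (Rs N x) (Rs N x))"
    proof (rule RM.integrable_const_bound[where B="\<Sum>a\<in>(UNIV :: 'd set). \<Sum>b\<in>(UNIV :: 'd set). c * c"])
      have "norm (outer v v) \<le> (\<Sum>a\<in>(UNIV :: 'd set). \<Sum>b\<in>(UNIV :: 'd set). c * c)" if "norm v \<le> c" for v :: "real ^ 'd"
      proof -
        have "norm (outer v v) \<le> (\<Sum>a\<in>UNIV. norm (outer v v $ a))" unfolding norm_vec_def by (rule L2_set_le_sum) simp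
        also have "\<dots> \<le> (\<Sum>a\<in>UNIV. \<Sum>b\<in>UNIV. norm (outer v v $ a $ b))"
          unfolding norm_vec_def[of "outer v v $ _"] by (intro sum_mono L2_set_le_sum) simp
        also have "\<dots> \<le> (\<Sum>a\<in>(UNIV :: 'd set). \<Sum>b\<in>(UNIV :: 'd set). c * c)"
        proof (intro sum_mono)
          fix a b
          have "\<bar>v $ k\<bar> \<le> c" for k using component_le_norm_cart[of v k] that by linarith
          moreover from this have "0 \<le> c" by (rule order_trans[OF abs_ge_zero])
          ultimately show "norm (outer v v $ a $ b) \<le> c * c" unfolding outer_def by (auto simp: abs_mult intro!: mult_mono)
        qed
        finally show ?thesis .
      qed
      then show "AE x in \<nu>. norm (outer (Rs N x) (Rs N x)) \<le> (\<Sum>a\<in>(UNIV :: 'd set). \<Sum>b\<in>(UNIV :: 'd set). c * c)" using c by simp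
      show "(\<lambda>x. outer (Rs N x) (Rs N x)) \<in> borel_measurable \<nu>" using om by (simp add: \<nu>_def)
    qed
    have i2: "integrable \<nu> (\<lambda>x. outer (Rs N x) (Rs N x) $ a)" by (rule integrable_bounded_linear[OF bounded_linear_vec_nth i])
    have "Sigma_mat \<alpha> \<mu> f N $ a = (\<integral>x. outer (Rs N x) (Rs N x) $ a \<partial>\<nu>)"
      unfolding S by (rule integral_bounded_linear[OF bounded_linear_vec_nth i, symmetric])
    then have "Sigma_mat \<alpha> \<mu> f N $ a $ b = (\<integral>x. outer (Rs N x) (Rs N x) $ a $ b \<partial>\<nu>)"
      using integral_bounded_linear[OF bounded_linear_vec_nth i2, of b] by simp
    then show ?thesis by (simp add: outer_def)
  qed
  define c where "c = ln 2 powr (1 / \<beta>)"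
  have c0: "0 < c" by (simp add: c_def)
  show ?thesis
  proof (intro exI[of _ "(\<bar>C\<bar> + 1) / c"] conjI allI impI)
    show "0 < (\<bar>C\<bar> + 1) / c" using c0 by (intro divide_pos_pos) auto
    fix N :: nat assume N: "2 \<le> N" and pd: "positive_definite (Sigma_mat \<alpha> \<mu> f N)"
    have "\<bar>(\<integral>x. h (W_sum \<alpha> \<mu> f N x) \<partial>\<mu>) - Phi (Sigma_mat \<alpha> \<mu> f N) h\<bar> \<le> C / sqrt (real N)"
      unfolding hW Phi_def by (rule C[OF _ Sig pd]) (use N in simp)
    also have "\<dots> \<le> (\<bar>C\<bar> + 1) / sqrt (real N)" by (intro divide_right_mono) auto
    also have "\<dots> = (\<bar>C\<bar> + 1) * real N powr (- 1/2)"
      using N by (simp add: powr_minus_divide powr_half_sqrt)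
    also have "\<dots> \<le> (\<bar>C\<bar> + 1) * real N powr (\<beta> - 1/2)"
      using N assms(1) by (intro mult_left_mono powr_mono) auto
    also have "\<dots> = (\<bar>C\<bar> + 1) / c * real N powr (\<beta> - 1/2) * c" using c0 by simp
    also have "\<dots> \<le> (\<bar>C\<bar> + 1) / c * real N powr (\<beta> - 1/2) * ln (real N) powr (1 / \<beta>)"
    proof (rule mult_left_mono)
      have "ln 2 \<le> ln (real N)" using N by (subst ln_le_cancel_iff) auto
      then show "c \<le> ln (real N) powr (1 / \<beta>)" unfolding c_def using assms(1) by (intro powr_mono2) auto
      show "0 \<le> (\<bar>C\<bar> + 1) / c * real N powr (\<beta> - 1/2)" using c0 by simp
    qed
    finally show "\<bar>(\<integral>x. h (W_sum \<alpha> \<mu> f N x) \<partial>\<mu>) - Phi (Sigma_mat \<alpha> \<mu> f N) h\<bar>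
      \<le> (\<bar>C\<bar> + 1) / c * real N powr (\<beta> - 1/2) * ln (real N) powr (1 / \<beta>)" .
  qed
qed

end
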